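(* Let $k$ be a field and $P$ a finite connected poset. For all $S,C\in\mathrm{Int}(P)$, there is an isomorphism $$\bigl(\mathsf K^\bullet(S,C),d^{\mathsf K}\bigr)\cong\mathbf R\mathrm{Hom}_{\Lambda_P}(\mathsf L(S),\mathsf L(C))$$ in the derived category of cochain complexes of $k$-vector spaces.
   Context: A subset $S\subseteq P$ is connected if any $x,y\in S$ are joined by a sequence $x=x_0,\dots,x_r=y$ in $S$ with $x_{i-1},x_i$ comparable for all $i$; convex if $x,y\in S$ and $x\le z\le y$ imply $z\in S$; an interval if it is nonempty, connected and convex. $\mathrm{Int}(P)$ is the set of intervals of $P$. Representations of $P$ are functors from $P$ to finite-dimensional $k$-vector spaces, with morphism spaces $\mathrm{Hom}_P$. For $S\in\mathrm{Int}(P)$, $\mathbb I_S$ is the representation with $\mathbb I_S(x)=k$ for $x\in S$ and $0$ otherwise, and $\mathbb I_S(x\le y)=\mathrm{id}$ if $x,y\in S$ and $0$ otherwise. Put $G_P=\bigoplus_{S\in\mathrm{Int}(P)}\mathbb I_S$ and $\Lambda_P=\mathrm{End}_P(G_P)^{\mathrm{op}}$; $e_S\in\Lambda_P$ is the idempotent of the summand $\mathbb I_S$, so $e_R\Lambda_Pe_S=\mathrm{Hom}_P(\mathbb I_R,\mathbb I_S)$. All modules are finitely generated left modules; $\mathsf L(S)$ is the simple top of $\Lambda_Pe_S$. For an interval $T$, a subset $C\subseteq T$ is a relative upset (resp. relative downset) in $T$ if $c\in C$, $x\in T$ and $c\le x$ (resp. $x\le c$) imply $x\in C$. $\mathrm{Min}(X)$,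 $\mathrm{Max}(X)$ are the sets of minimal and maximal elements of $X$, and $\lessdot_T$ is the covering relation in $T$. For an interval $C$ that is a relative upset in $T$, $\partial_T^-C=\{x\in T\setminus C\mid x\lessdot_Tc\text{ for some }c\in C\}$; for an interval $S$ that is a relative downset in $T$, $\partial_T^+S=\{x\in T\setminus S\mid s\lessdot_Tx\text{ for some }s\in S\}$. $\mathcal W(S,C)$ is the set of $T\in\mathrm{Int}(P)$ such that $S$ is a relative downset in $T$ with $\partial_T^+S=\mathrm{Max}(T\setminus S)$ and $C$ is a relative upset in $T$ with $\partial_T^-C=\mathrm{Min}(T\setminus C)$; it is ordered by inclusion. For $T\in\mathcal W(S,C)$ put $\omega(S,T,C)=|\partial_T^+S|+|\partial_T^-C|$. For a finite set $X$, $\det(X)=\bigwedge^{|X|}k^X$ (top exterior power of the free $k$-vector space on $X$, one-dimensional). The graded vector space $\mathsf K^\bullet(S,C)$ is $$\mathsf K^p(S,C)=\bigoplus_{T\in\mathcal W(S,C),\ \omega(S,T,C)=p}\det(\partial_T^+S)\otimes_k\det(\partial_T^-C).$$ For a cover $T\lessdot R$ in $\mathcal W(S,C)$ exactly one of the following holds: (i) $\partial_R^+S=\partial_T^+S\sqcup\{a\}$ and $\partial_R^-C=\partial_T^-C$ for a unique $a$; (ii) $\partial_R^+S=\partial_T^+S$ and $\partial_R^-C=\partial_T^-C\sqcup\{b\}$ for a unique $b$. The component of the differential from the $T$-summand to the $R$-summand is $d^{\mathsf K}_{R,T}(\alpha\otimes\beta)=(a\wedge\alpha)\otimes\beta$ in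 case (i) and $(-1)^{|\partial_T^+S|}\alpha\otimes(b\wedge\beta)$ in case (ii); all other components are zero. This defines a differential $d^{\mathsf K}$ on $\mathsf K^\bullet(S,C)$. *)

theory Defs
  imports "HOL-Algebra.Algebraic_Closure_Type"
begin

section \<open>Left modules over a possibly noncommutative ring\<close>

text \<open>The library's locale \<open>module\<close> requires a commutative ring of scalars. The same record type is
  used here; its unused multiplicative fields are left \<open>undefined\<close>.\<close>

locale left_module = R?: ring R + M?: abelian_group M
  for R :: "('r, 's) ring_scheme" (structure) and M :: "('r, 'm, 't) module_scheme" (structure) +
  assumes smult_closed:
      "\<lbrakk>a \<in> carrier R; x \<in> carrier M\<rbrakk> \<Longrightarrow> a \<odot>\<^bsub>M\<^esub> x \<in> carrier M"
    and smult_l_distr: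
      "\<lbrakk>a \<in> carrier R; b \<in> carrier R; x \<in> carrier M\<rbrakk> \<Longrightarrow>
      (a \<oplus> b) \<odot>\<^bsub>M\<^esub> x = a \<odot>\<^bsub>M\<^esub> x \<oplus>\<^bsub>M\<^esub> b \<odot>\<^bsub>M\<^esub> x"
    and smult_r_distr:
      "\<lbrakk>a \<in> carrier R; x \<in> carrier M; y \<in> carrier M\<rbrakk> \<Longrightarrow>
      a \<odot>\<^bsub>M\<^esub> (x \<oplus>\<^bsub>M\<^esub> y) = a \<odot>\<^bsub>M\<^esub> x \<oplus>\<^bsub>M\<^esub> a \<odot>\<^bsub>M\<^esub> y"
    and smult_assoc:
      "\<lbrakk>a \<in> carrier R; b \<in> carrier R; x \<in> carrier M\<rbrakk> \<Longrightarrow>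
      (a \<otimes> b) \<odot>\<^bsub>M\<^esub> x = a \<odot>\<^bsub>M\<^esub> (b \<odot>\<^bsub>M\<^esub> x)"
    and smult_one:
      "x \<in> carrier M \<Longrightarrow> \<one> \<odot>\<^bsub>M\<^esub> x = x"

definition lin_hom :: "'r ring \<Rightarrow> ('r, 'm) module \<Rightarrow> ('r, 'n) module \<Rightarrow> ('m \<Rightarrow> 'n) set" where
  "lin_hom R M N = {f \<in> carrier M \<rightarrow>\<^sub>E carrier N.
     (\<forall>x\<in>carrier M. \<forall>y\<in>carrier M. f (x \<oplus>\<^bsub>M\<^esub> y) = f x \<oplus>\<^bsub>N\<^esub> f y) \<and>
     (\<forall>r\<in>carrier R. \<forall>x\<in>carrier M. f (r \<odot>\<^bsub>M\<^esub> x) = r \<odot>\<^bsub>N\<^esub> f x)}"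

definition zero_part :: "('r, 'm) module \<Rightarrow> ('r, 'm) module" where
  "zero_part M = M\<lparr>carrier := {\<zero>\<^bsub>M\<^esub>}\<rparr>"

definition quotient_module :: "('r, 'm) module \<Rightarrow> 'm set \<Rightarrow> ('r, 'm set) module" where
  "quotient_module M N = \<lparr>carrier = {N +>\<^bsub>M\<^esub> x | x. x \<in> carrier M},
     monoid.mult = undefined, one = undefined, zero = N,
     add = (\<lambda>A B. A <+>\<^bsub>M\<^esub> B), module.smult = (\<lambda>r A. \<Union>x\<in>A. N +>\<^bsub>M\<^esub> (r \<odot>\<^bsub>M\<^esub> x))\<rparr>"

definition generated_submodule :: "'r ring \<Rightarrow> ('r, 'm) module \<Rightarrow> 'm set \<Rightarrow> 'm set" where
  "generated_submodule R M A = carrier M \<inter> \<Inter> {N. submodule N R M \<and> A \<subseteq> N}"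

text \<open>Used for finite index sets only.\<close>

definition direct_sum :: "'i set \<Rightarrow> ('i \<Rightarrow> ('r, 'm) module) \<Rightarrow> ('r, 'i \<Rightarrow> 'm) module" where
  "direct_sum I M = \<lparr>carrier = (\<Pi>\<^sub>E i\<in>I. carrier (M i)),
     monoid.mult = undefined, one = undefined, zero = (\<lambda>i\<in>I. \<zero>\<^bsub>M i\<^esub>),
     add = (\<lambda>f g. \<lambda>i\<in>I. f i \<oplus>\<^bsub>M i\<^esub> g i), module.smult = (\<lambda>r f. \<lambda>i\<in>I. r \<odot>\<^bsub>M i\<^esub> f i)\<rparr>"

definition maximal_submodule :: "'m set \<Rightarrow> 'r ring \<Rightarrow> ('r, 'm) module \<Rightarrow> bool" where
  "maximal_submodule N R M \<longleftrightarrow> submodule N R M \<and> N \<noteq> carrier M \<and>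
     (\<forall>N'. submodule N' R M \<and> N \<subseteq> N' \<longrightarrow> N' = N \<or> N' = carrier M)"

definition radical :: "'r ring \<Rightarrow> ('r, 'm) module \<Rightarrow> 'm set" where
  "radical R M = carrier M \<inter> \<Inter> {N. maximal_submodule N R M}"

definition top_module :: "'r ring \<Rightarrow> ('r, 'm) module \<Rightarrow> ('r, 'm set) module" where
  "top_module R M = quotient_module M (radical R M)"

definition left_ideal_module :: "'r ring \<Rightarrow> 'r \<Rightarrow> ('r, 'r) module" where
  "left_ideal_module R e = \<lparr>carrier = {r \<otimes>\<^bsub>R\<^esub> e | r. r \<in> carrier R},
     monoid.mult = undefined, one = undefined, zero = \<zero>\<^bsub>R\<^esub>, add = add R, module.smult = monoid.mult R\<rparr>"

definition regular_module :: "'r ring \<Rightarrow> ('r, 'r) module" where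
  "regular_module R = left_ideal_module R \<one>\<^bsub>R\<^esub>"

text \<open>Finitely generated projective modules, as direct summands of free modules of finite rank.\<close>

definition fg_projective :: "'r ring \<Rightarrow> ('r, 'm) module \<Rightarrow> bool" where
  "fg_projective R M \<longleftrightarrow> left_module R M \<and>
     (\<exists>n::nat. \<exists>i \<in> lin_hom R M (direct_sum {..<n} (\<lambda>_. regular_module R)).
        \<exists>p \<in> lin_hom R (direct_sum {..<n} (\<lambda>_. regular_module R)) M. \<forall>x\<in>carrier M. p (i x) = x)"


section \<open>Vector spaces over a field\<close>

abbreviation kk :: "'k::field ring" where
  "kk \<equiv> ring_of_type_algebra"

text \<open>The free vector space on \<open>A\<close>: finitely supported functions vanishing outside \<open>A\<close>. In particular
  \<open>free_space A\<close> is literally a subspace of \<open>free_space B\<close> when \<open>A \<subseteq> B\<close>.\<close>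

definition free_space :: "'x set \<Rightarrow> ('k::field, 'x \<Rightarrow> 'k) module" where
  "free_space A = \<lparr>carrier = {f. finite {x. f x \<noteq> 0} \<and> (\<forall>x. x \<notin> A \<longrightarrow> f x = 0)},
     monoid.mult = undefined, one = undefined, zero = (\<lambda>_. 0),
     add = (\<lambda>f g x. f x + g x), module.smult = (\<lambda>a f x. a * f x)\<rparr>"

definition basis_vec :: "'x \<Rightarrow> 'x \<Rightarrow> 'k::field" where
  "basis_vec x = (\<lambda>y. if y = x then 1 else 0)"

type_synonym ('k, 'v) ext = "('v list \<Rightarrow> 'k) set"

definition words :: "nat \<Rightarrow> ('k::field, 'v) module \<Rightarrow> 'v list set" where
  "words n V = {xs. length xs = n \<and> set xs \<subseteq> carrier V}"

text \<open>Multilinearity in each entry, and vanishing on words with a repeated entry.\<close>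

definition ext_relations :: "nat \<Rightarrow> ('k::field, 'v) module \<Rightarrow> ('v list \<Rightarrow> 'k) set" where
  "ext_relations n V =
     {\<lambda>w. basis_vec (us @ (x \<oplus>\<^bsub>V\<^esub> y) # vs) w - basis_vec (us @ x # vs) w - basis_vec (us @ y # vs) w
        | us x y vs. us @ x # vs \<in> words n V \<and> y \<in> carrier V} \<union>
     {\<lambda>w. basis_vec (us @ (a \<odot>\<^bsub>V\<^esub> x) # vs) w - a * basis_vec (us @ x # vs) w
        | us a x vs. us @ x # vs \<in> words n V} \<union>
     {basis_vec xs | xs. xs \<in> words n V \<and> \<not> distinct xs}"

definition ext_kernel :: "nat \<Rightarrow> ('k::field, 'v) module \<Rightarrow> ('v list \<Rightarrow> 'k) set" where
  "ext_kernel n V = generated_submodule kk (free_space (words n V)) (ext_relations n V)"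

definition ext_power :: "nat \<Rightarrow> ('k::field, 'v) module \<Rightarrow> ('k, ('k, 'v) ext) module" where
  "ext_power n V = quotient_module (free_space (words n V)) (ext_kernel n V)"

text \<open>The class of \<open>x\<^sub>1 \<and> \<dots> \<and> x\<^sub>n\<close>.\<close>

definition wedge_word :: "nat \<Rightarrow> ('k::field, 'v) module \<Rightarrow> 'v list \<Rightarrow> ('k, 'v) ext" where
  "wedge_word n V xs = ext_kernel n V +>\<^bsub>free_space (words n V)\<^esub> basis_vec xs"

type_synonym ('k, 'v, 'w) tens = "('v \<times> 'w \<Rightarrow> 'k) set"

definition tensor_relations ::
    "('k::field, 'v) module \<Rightarrow> ('k, 'w) module \<Rightarrow> ('v \<times> 'w \<Rightarrow> 'k) set" where
  "tensor_relations V W =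
     {\<lambda>z. basis_vec (x \<oplus>\<^bsub>V\<^esub> x', y) z - basis_vec (x, y) z - basis_vec (x', y) z
        | x x' y. x \<in> carrier V \<and> x' \<in> carrier V \<and> y \<in> carrier W} \<union>
     {\<lambda>z. basis_vec (x, y \<oplus>\<^bsub>W\<^esub> y') z - basis_vec (x, y) z - basis_vec (x, y') z
        | x y y'. x \<in> carrier V \<and> y \<in> carrier W \<and> y' \<in> carrier W} \<union>
     {\<lambda>z. basis_vec (a \<odot>\<^bsub>V\<^esub> x, y) z - a * basis_vec (x, y) z
        | a x y. x \<in> carrier V \<and> y \<in> carrier W} \<union>
     {\<lambda>z. basis_vec (x, a \<odot>\<^bsub>W\<^esub> y) z - a * basis_vec (x, y) z
        | a x y. x \<in> carrier V \<and> y \<in> carrier W}"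

definition tensor_kernel ::
    "('k::field, 'v) module \<Rightarrow> ('k, 'w) module \<Rightarrow> ('v \<times> 'w \<Rightarrow> 'k) set" where
  "tensor_kernel V W =
     generated_submodule kk (free_space (carrier V \<times> carrier W)) (tensor_relations V W)"

definition tensor_space ::
    "('k::field, 'v) module \<Rightarrow> ('k, 'w) module \<Rightarrow> ('k, ('k, 'v, 'w) tens) module" where
  "tensor_space V W = quotient_module (free_space (carrier V \<times> carrier W)) (tensor_kernel V W)"

definition pure_tensor ::
    "('k::field, 'v) module \<Rightarrow> ('k, 'w) module \<Rightarrow> 'v \<Rightarrow> 'w \<Rightarrow> ('k, 'v, 'w) tens" where
  "pure_tensor V W v w =
     tensor_kernel V W +>\<^bsub>free_space (carrier V \<times> carrier W)\<^esub> basis_vec (v, w)"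

type_synonym ('x, 'k) det_elt = "('k, 'x \<Rightarrow> 'k) ext"

definition det_space :: "'x set \<Rightarrow> ('k::field, ('x, 'k) det_elt) module" where
  "det_space A = ext_power (card A) (free_space A)"

text \<open>For \<open>a \<notin> A\<close>, the linear map \<open>\<alpha> \<mapsto> a \<and> \<alpha>\<close> from \<open>det A\<close> to \<open>det (A \<union> {a})\<close>, determined by
  its values on the spanning decomposable elements.\<close>

definition det_wedge :: "'x set \<Rightarrow> 'x \<Rightarrow> ('x, 'k::field) det_elt \<Rightarrow> ('x, 'k) det_elt" where
  "det_wedge A a = (THE h. h \<in> lin_hom kk (det_space A) (det_space (insert a A)) \<and>
     (\<forall>xs \<in> words (card A) (free_space A).
        h (wedge_word (card A) (free_space A) xs) =
        wedge_word (card (insert a A)) (free_space (insert a A)) (basis_vec a # xs)))"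


section \<open>Cochain complexes and the derived category of vector spaces\<close>

record ('k, 'v) cochain =
  obj :: "int \<Rightarrow> ('k, 'v) module"
  diff :: "int \<Rightarrow> 'v \<Rightarrow> 'v"

definition cochain_complex :: "('k::field, 'v) cochain \<Rightarrow> bool" where
  "cochain_complex A \<longleftrightarrow> (\<forall>p. left_module kk (obj A p) \<and>
     diff A p \<in> lin_hom kk (obj A p) (obj A (p + 1)) \<and>
     (\<forall>x\<in>carrier (obj A p). diff A (p + 1) (diff A p x) = \<zero>\<^bsub>obj A (p + 1 + 1)\<^esub>))"

definition cocycles :: "('k::field, 'v) cochain \<Rightarrow> int \<Rightarrow> 'v set" where
  "cocycles A p = {x \<in> carrier (obj A p). diff A p x = \<zero>\<^bsub>obj A (p + 1)\<^esub>}"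

definition coboundaries :: "('k::field, 'v) cochain \<Rightarrow> int \<Rightarrow> 'v set" where
  "coboundaries A p = diff A (p - 1) ` carrier (obj A (p - 1))"

definition cohomology :: "('k::field, 'v) cochain \<Rightarrow> int \<Rightarrow> ('k, 'v set) module" where
  "cohomology A p = quotient_module ((obj A p)\<lparr>carrier := cocycles A p\<rparr>) (coboundaries A p)"

definition chain_map ::
    "('k::field, 'v) cochain \<Rightarrow> ('k, 'w) cochain \<Rightarrow> (int \<Rightarrow> 'v \<Rightarrow> 'w) \<Rightarrow> bool" where
  "chain_map A B f \<longleftrightarrow> (\<forall>p. f p \<in> lin_hom kk (obj A p) (obj B p) \<and>
     (\<forall>x\<in>carrier (obj A p). f (p + 1) (diff A p x) = diff B p (f p x)))"

definition cohomology_map ::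
    "('k::field, 'w) cochain \<Rightarrow> (int \<Rightarrow> 'v \<Rightarrow> 'w) \<Rightarrow> int \<Rightarrow> 'v set \<Rightarrow> 'w set" where
  "cohomology_map B f p A = (\<Union>x\<in>A. coboundaries B p +>\<^bsub>obj B p\<^esub> f p x)"

definition quasi_iso ::
    "('k::field, 'v) cochain \<Rightarrow> ('k, 'w) cochain \<Rightarrow> (int \<Rightarrow> 'v \<Rightarrow> 'w) \<Rightarrow> bool" where
  "quasi_iso A B f \<longleftrightarrow> chain_map A B f \<and>
     (\<forall>p. bij_betw (cohomology_map B f p) (carrier (cohomology A p)) (carrier (cohomology B p)))"

text \<open>Isomorphism in the derived category: two complexes joined by a roof of quasi-isomorphisms. The
  apex is drawn from the element type of \<open>A\<close>; no isomorphism is lost by this, since over a field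
  every isomorphism in the derived category is represented by a roof with apex \<open>A\<close> itself.\<close>

definition derived_iso :: "('k::field, 'v) cochain \<Rightarrow> ('k, 'w) cochain \<Rightarrow> bool" where
  "derived_iso A B \<longleftrightarrow> cochain_complex A \<and> cochain_complex B \<and>
     (\<exists>Z :: ('k, 'v) cochain. cochain_complex Z \<and> (\<exists>f. quasi_iso Z A f) \<and> (\<exists>g. quasi_iso Z B g))"


section \<open>Derived Hom over a finite-dimensional algebra\<close>

record ('r, 'q, 'm) resolution =
  res_obj :: "nat \<Rightarrow> ('r, 'q) module"
  res_diff :: "nat \<Rightarrow> 'q \<Rightarrow> 'q"
  res_aug :: "'q \<Rightarrow> 'm"

text \<open>\<open>res_diff Q n\<close> is the map from degree \<open>n + 1\<close> to degree \<open>n\<close>.\<close>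

definition projective_resolution ::
    "'r ring \<Rightarrow> ('r, 'm) module \<Rightarrow> ('r, 'q, 'm) resolution \<Rightarrow> bool" where
  "projective_resolution R M Q \<longleftrightarrow>
     (\<forall>n. fg_projective R (res_obj Q n)) \<and>
     (\<forall>n. res_diff Q n \<in> lin_hom R (res_obj Q (Suc n)) (res_obj Q n)) \<and>
     res_aug Q \<in> lin_hom R (res_obj Q 0) M \<and>
     res_aug Q ` carrier (res_obj Q 0) = carrier M \<and>
     {x \<in> carrier (res_obj Q 0). res_aug Q x = \<zero>\<^bsub>M\<^esub>} = res_diff Q 0 ` carrier (res_obj Q 1) \<and>
     (\<forall>n. {x \<in> carrier (res_obj Q (Suc n)). res_diff Q n x = \<zero>\<^bsub>res_obj Q n\<^esub>} =
          res_diff Q (Suc n) ` carrier (res_obj Q (Suc (Suc n))))"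

text \<open>A \<open>k\<close>-algebra is a ring \<open>R\<close> with a structure map \<open>\<iota>\<close> from \<open>k\<close> to the centre of \<open>R\<close>; it makes
  the group of \<open>R\<close>-linear maps a \<open>k\<close>-vector space.\<close>

definition hom_space ::
    "('k::field \<Rightarrow> 'r) \<Rightarrow> 'r ring \<Rightarrow> ('r, 'm) module \<Rightarrow> ('r, 'n) module \<Rightarrow> ('k, 'm \<Rightarrow> 'n) module" where
  "hom_space \<iota> R M N = \<lparr>carrier = lin_hom R M N,
     monoid.mult = undefined, one = undefined, zero = (\<lambda>x\<in>carrier M. \<zero>\<^bsub>N\<^esub>),
     add = (\<lambda>f g. \<lambda>x\<in>carrier M. f x \<oplus>\<^bsub>N\<^esub> g x), module.smult = (\<lambda>a f. \<lambda>x\<in>carrier M. \<iota> a \<odot>\<^bsub>N\<^esub> f x)\<rparr>"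

definition hom_cochain_obj ::
    "('k::field \<Rightarrow> 'r) \<Rightarrow> 'r ring \<Rightarrow> ('r, 'q, 'm) resolution \<Rightarrow> ('r, 'n) module \<Rightarrow>
     int \<Rightarrow> ('k, 'q \<Rightarrow> 'n) module" where
  "hom_cochain_obj \<iota> R Q N p =
     (if 0 \<le> p then hom_space \<iota> R (res_obj Q (nat p)) N
      else zero_part (hom_space \<iota> R (res_obj Q 0) N))"

definition hom_cochain ::
    "('k::field \<Rightarrow> 'r) \<Rightarrow> 'r ring \<Rightarrow> ('r, 'q, 'm) resolution \<Rightarrow> ('r, 'n) module \<Rightarrow>
     ('k, 'q \<Rightarrow> 'n) cochain" where
  "hom_cochain \<iota> R Q N = \<lparr>obj = hom_cochain_obj \<iota> R Q N,
     diff = (\<lambda>p. \<lambda>f\<in>carrier (hom_cochain_obj \<iota> R Q N p).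
       if 0 \<le> p then compose (carrier (res_obj Q (Suc (nat p)))) f (res_diff Q (nat p))
       else \<zero>\<^bsub>hom_cochain_obj \<iota> R Q N (p + 1)\<^esub>)\<rparr>"

text \<open>\<open>RHom\<^sub>R(M, N)\<close> is computed from a projective resolution of \<open>M\<close>, and is independent of it up to
  isomorphism in the derived category. The element type \<open>nat \<Rightarrow> 'r\<close> of the chosen resolution is no
  restriction: it contains the elements of all free modules of finite rank, and every finitely
  generated projective module is isomorphic to a submodule of one of these. For \<open>R\<close>
  finite-dimensional over \<open>k\<close>, hence Noetherian, and \<open>M\<close> finitely generated such a resolution exists.\<close>

definition RHom ::
    "('k::field \<Rightarrow> 'r) \<Rightarrow> 'r ring \<Rightarrow> ('r, 'm) module \<Rightarrow> ('r, 'n) module \<Rightarrow>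
     ('k, (nat \<Rightarrow> 'r) \<Rightarrow> 'n) cochain" where
  "RHom \<iota> R M N =
     hom_cochain \<iota> R (SOME Q :: ('r, nat \<Rightarrow> 'r, 'm) resolution. projective_resolution R M Q) N"


section \<open>Intervals in a poset\<close>

definition poset_connected :: "'p::order set \<Rightarrow> bool" where
  "poset_connected S \<longleftrightarrow>
     (\<forall>x\<in>S. \<forall>y\<in>S. (x, y) \<in> {(a, b). a \<in> S \<and> b \<in> S \<and> (a \<le> b \<or> b \<le> a)}\<^sup>*)"

definition poset_convex :: "'p::order set \<Rightarrow> bool" where
  "poset_convex S \<longleftrightarrow> (\<forall>x\<in>S. \<forall>y\<in>S. \<forall>z. x \<le> z \<and> z \<le> y \<longrightarrow> z \<in> S)"

definition intervals :: "'p::order set set" where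
  "intervals = {S. S \<noteq> {} \<and> poset_connected S \<and> poset_convex S}"

definition rel_upset :: "'p::order set \<Rightarrow> 'p set \<Rightarrow> bool" where
  "rel_upset C T \<longleftrightarrow> C \<subseteq> T \<and> (\<forall>c\<in>C. \<forall>x\<in>T. c \<le> x \<longrightarrow> x \<in> C)"

definition rel_downset :: "'p::order set \<Rightarrow> 'p set \<Rightarrow> bool" where
  "rel_downset C T \<longleftrightarrow> C \<subseteq> T \<and> (\<forall>c\<in>C. \<forall>x\<in>T. x \<le> c \<longrightarrow> x \<in> C)"

definition min_elems :: "'p::order set \<Rightarrow> 'p set" where
  "min_elems A = {x \<in> A. \<not> (\<exists>y\<in>A. y < x)}"

definition max_elems :: "'p::order set \<Rightarrow> 'p set" where
  "max_elems A = {x \<in> A. \<not> (\<exists>y\<in>A. x < y)}"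

definition covers_in :: "'a::order set \<Rightarrow> 'a \<Rightarrow> 'a \<Rightarrow> bool" where
  "covers_in T x y \<longleftrightarrow> x \<in> T \<and> y \<in> T \<and> x < y \<and> \<not> (\<exists>z\<in>T. x < z \<and> z < y)"

definition lower_boundary :: "'p::order set \<Rightarrow> 'p set \<Rightarrow> 'p set" where
  "lower_boundary T C = {x \<in> T - C. \<exists>c\<in>C. covers_in T x c}"

definition upper_boundary :: "'p::order set \<Rightarrow> 'p set \<Rightarrow> 'p set" where
  "upper_boundary T S = {x \<in> T - S. \<exists>s\<in>S. covers_in T s x}"


section \<open>Representations and the endomorphism algebra of the sum of all interval modules\<close>

record ('p, 'k, 'v) rep =
  rep_space :: "'p \<Rightarrow> ('k, 'v) module"
  rep_map :: "'p \<Rightarrow> 'p \<Rightarrow> 'v \<Rightarrow> 'v"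

definition rep_hom ::
    "('p::order, 'k::field, 'v) rep \<Rightarrow> ('p, 'k, 'w) rep \<Rightarrow> ('p \<Rightarrow> 'v \<Rightarrow> 'w) set" where
  "rep_hom V W = {\<eta>. (\<forall>x. \<eta> x \<in> lin_hom kk (rep_space V x) (rep_space W x)) \<and>
     (\<forall>x y. x \<le> y \<longrightarrow> (\<forall>v\<in>carrier (rep_space V x).
        \<eta> y (rep_map V x y v) = rep_map W x y (\<eta> x v)))}"

definition interval_rep :: "'p::order set \<Rightarrow> ('p, 'k::field, 'k) rep" where
  "interval_rep S = \<lparr>
     rep_space = (\<lambda>x. \<lparr>carrier = (if x \<in> S then UNIV else {0}),
       monoid.mult = undefined, one = undefined, zero = 0, add = (+), module.smult = (*)\<rparr>),
     rep_map = (\<lambda>x y v. if x \<in> S \<and> y \<in> S then v else 0)\<rparr>"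

definition rep_direct_sum ::
    "'i set \<Rightarrow> ('i \<Rightarrow> ('p, 'k::field, 'v) rep) \<Rightarrow> ('p, 'k, 'i \<Rightarrow> 'v) rep" where
  "rep_direct_sum I V = \<lparr>
     rep_space = (\<lambda>x. direct_sum I (\<lambda>i. rep_space (V i) x)),
     rep_map = (\<lambda>x y f. \<lambda>i\<in>I. rep_map (V i) x y (f i))\<rparr>"

text \<open>The opposite of the endomorphism ring: \<open>f \<otimes> g\<close> is first \<open>f\<close>, then \<open>g\<close>.\<close>

definition rep_End_op :: "('p::order, 'k::field, 'v) rep \<Rightarrow> ('p \<Rightarrow> 'v \<Rightarrow> 'v) ring" where
  "rep_End_op V = \<lparr>carrier = rep_hom V V,
     monoid.mult = (\<lambda>f g x. compose (carrier (rep_space V x)) (g x) (f x)),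
     one = (\<lambda>x. \<lambda>v\<in>carrier (rep_space V x). v),
     zero = (\<lambda>x. \<lambda>v\<in>carrier (rep_space V x). \<zero>\<^bsub>rep_space V x\<^esub>),
     add = (\<lambda>f g x. \<lambda>v\<in>carrier (rep_space V x). f x v \<oplus>\<^bsub>rep_space V x\<^esub> g x v)\<rparr>"

definition interval_sum :: "('p::{finite,order}, 'k::field, 'p set \<Rightarrow> 'k) rep" where
  "interval_sum = rep_direct_sum intervals interval_rep"

type_synonym ('p, 'k) lam = "'p \<Rightarrow> ('p set \<Rightarrow> 'k) \<Rightarrow> ('p set \<Rightarrow> 'k)"

definition Lambda :: "('p::{finite,order}, 'k::field) lam ring" where
  "Lambda = rep_End_op interval_sum"

definition Lambda_scalar :: "'k \<Rightarrow> ('p::{finite,order}, 'k::field) lam" where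
  "Lambda_scalar a =
     (\<lambda>x. \<lambda>v\<in>carrier (rep_space interval_sum x). a \<odot>\<^bsub>rep_space interval_sum x\<^esub> v)"

definition Lambda_idem :: "'p set \<Rightarrow> ('p::{finite,order}, 'k::field) lam" where
  "Lambda_idem S =
     (\<lambda>x. \<lambda>v\<in>carrier (rep_space interval_sum x). \<lambda>S'\<in>intervals. if S' = S then v S' else 0)"

definition simple_L ::
    "'p::{finite,order} set \<Rightarrow> (('p, 'k::field) lam, ('p, 'k) lam set) module" where
  "simple_L S = top_module Lambda (left_ideal_module Lambda (Lambda_idem S))"


section \<open>The complex \<open>K\<close>\<close>

definition W_set :: "'p::{finite,order} set \<Rightarrow> 'p set \<Rightarrow> 'p set set" where
  "W_set S C = {T \<in> intervals.
     rel_downset S T \<and> upper_boundary T S = max_elems (T - S) \<and>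
     rel_upset C T \<and> lower_boundary T C = min_elems (T - C)}"

definition omega :: "'p::{finite,order} set \<Rightarrow> 'p set \<Rightarrow> 'p set \<Rightarrow> nat" where
  "omega S T C = card (upper_boundary T S) + card (lower_boundary T C)"

type_synonym ('p, 'k) Kterm = "('k, ('p, 'k) det_elt, ('p, 'k) det_elt) tens"

definition K_summand ::
    "'p::{finite,order} set \<Rightarrow> 'p set \<Rightarrow> 'p set \<Rightarrow> ('k::field, ('p, 'k) Kterm) module" where
  "K_summand S C T =
     tensor_space (det_space (upper_boundary T S)) (det_space (lower_boundary T C))"

definition K_tensor ::
    "'p::{finite,order} set \<Rightarrow> 'p set \<Rightarrow> 'p set \<Rightarrow> ('p, 'k::field) det_elt \<Rightarrow> ('p, 'k) det_elt \<Rightarrow>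
     ('p, 'k) Kterm" where
  "K_tensor S C T =
     pure_tensor (det_space (upper_boundary T S)) (det_space (lower_boundary T C))"

text \<open>The component from the \<open>T\<close>-summand to the \<open>R\<close>-summand, for a cover of \<open>T\<close> by \<open>R\<close> in \<open>W_set S C\<close>:
  the unique linear map with the prescribed values on pure tensors. Exactly one of the two clauses
  applies, for exactly one new boundary element.\<close>

definition K_component ::
    "'p::{finite,order} set \<Rightarrow> 'p set \<Rightarrow> 'p set \<Rightarrow> 'p set \<Rightarrow> ('p, 'k::field) Kterm \<Rightarrow> ('p, 'k) Kterm" where
  "K_component S C T R = (THE h. h \<in> lin_hom kk (K_summand S C T) (K_summand S C R) \<and>
     (\<forall>\<alpha>\<in>carrier (det_space (upper_boundary T S)). \<forall>\<beta>\<in>carrier (det_space (lower_boundary T C)).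
        (\<forall>a. a \<notin> upper_boundary T S \<and> upper_boundary R S = insert a (upper_boundary T S) \<and>
             lower_boundary R C = lower_boundary T C \<longrightarrow>
             h (K_tensor S C T \<alpha> \<beta>) = K_tensor S C R (det_wedge (upper_boundary T S) a \<alpha>) \<beta>) \<and>
        (\<forall>b. b \<notin> lower_boundary T C \<and> lower_boundary R C = insert b (lower_boundary T C) \<and>
             upper_boundary R S = upper_boundary T S \<longrightarrow>
             h (K_tensor S C T \<alpha> \<beta>) = (-1) ^ card (upper_boundary T S) \<odot>\<^bsub>K_summand S C R\<^esub>
               K_tensor S C R \<alpha> (det_wedge (lower_boundary T C) b \<beta>))))"

definition K_index :: "'p::{finite,order} set \<Rightarrow> 'p set \<Rightarrow> int \<Rightarrow> 'p set set" where
  "K_index S C p = {T \<in> W_set S C. int (omega S T C) = p}"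

definition K_obj ::
    "'p::{finite,order} set \<Rightarrow> 'p set \<Rightarrow> int \<Rightarrow> ('k::field, 'p set \<Rightarrow> ('p, 'k) Kterm) module" where
  "K_obj S C p = direct_sum (K_index S C p) (K_summand S C)"

definition K_complex ::
    "'p::{finite,order} set \<Rightarrow> 'p set \<Rightarrow> ('k::field, 'p set \<Rightarrow> ('p, 'k) Kterm) cochain" where
  "K_complex S C = \<lparr>obj = K_obj S C,
     diff = (\<lambda>p. \<lambda>\<xi>\<in>carrier (K_obj S C p). \<lambda>R\<in>K_index S C (p + 1).
       \<Oplus>\<^bsub>K_summand S C R\<^esub> T\<in>{T \<in> K_index S C p. covers_in (W_set S C) T R}. K_component S C T R (\<xi> T))\<rparr>"

end

theory Submission
  imports Defs "HOL-Library.Function_Algebras"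
begin

text \<open>Let \<open>cube S\<close> be the disjoint union of \<open>up_frontier S\<close>, the minimal elements among those strictly above
  \<open>S\<close>, and of \<open>min_elems S\<close>. The simple module \<open>L(S)\<close> has a cubical projective resolution whose summand at
  \<open>F \<subseteq> cube S\<close> belongs to a convex set \<open>cell S F\<close>: the elements of the first kind in \<open>F\<close> are added to \<open>S\<close>,
  together with all elements below them that are incomparable to \<open>S\<close>, and those of the second kind are
  removed; the summand is the direct sum of the projectives of its connected components. Applying
  \<open>Hom(-, L(C))\<close> keeps exactly those \<open>F\<close> for which \<open>C\<close> is a component of \<open>cell S F\<close>; these form \<open>phi S C\<close>.
  On the other side \<open>T \<mapsto> boundary S C T\<close> identifies \<open>\<W>(S, C)\<close> with an order convex family \<open>psi S C\<close> of
  subsets, and in coordinates on the determinant lines \<open>K(S, C)\<close> becomes the cube complex of \<open>psi S C\<close>.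
  The two families differ by acyclic pieces, which are contracted by toggling single elements.\<close>

section \<open>Intervals and connected components\<close>

text \<open>The two kinds of cube elements are the two ways in which a non-zero morphism from the
  representation of an interval \<open>R\<close> to that of \<open>S\<close> can fail to be
  invertible. Its support is an upset of \<open>S\<close> and a downset of \<open>R\<close>. If it
  is not all of \<open>S\<close>, it misses a minimal element of \<open>S\<close>; if it is
  \<open>S\<close> but \<open>R\<close> is larger, then \<open>R\<close> contains an element of
  \<open>up_frontier S\<close>. The obstacle to exactness is that no single element can be toggled
  for all \<open>R\<close> and all points: the choice must be natural in the point and must survive
  a change of \<open>F\<close>. It is therefore read off from a component of
  \<open>R \<inter> stage S (lefts F)\<close>, and an induction on the size of
  \<open>lefts F\<close> absorbs the remaining change. The comparison of \<open>psi\<close> with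
  \<open>phi\<close> meets the same difficulty and has the same cure. Two further points have to be
  settled. \<open>RHom\<close> is computed from an unspecified resolution, so the comparison theorem
  for projective resolutions is needed. The determinant lines are given by generators and relations;
  Laplace expansion supplies their coordinate, and ordering the left half of the cube before the
  right half produces the sign in the second clause of \<open>K_component\<close>.\<close>

lemma poset_connected_const:
 assumes "poset_connected D" and "!!a b. a \<in> D ==> b \<in> D ==> a \<le> b ==> f a = f b"
  and "x \<in> D" and "y \<in> D"
 shows "f x = f y"
proof -
 have "(x, y) \<in> {(a, b). a \<in> D & b \<in> D & (a \<le> b \<or> b \<le> a)}\<^sup>*"
  using assms(1,3,4) unfolding poset_connected_def by blast
 then show ?thesis
 proof (induction rule: rtrancl_induct)
  case (step y z)
  then have "y \<in> D" "z \<in> D" "y \<le> z \<or> z \<le> y" by auto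
  then have "f y = f z" using assms(2)[of y z] assms(2)[of z y] by metis
  then show ?case using step(3) by simp
 qed simp
qed

lemma poset_connected_subset_closed:
 assumes "poset_connected D" and "x \<in> D" and "x \<in> E"
  and "!!a b. a \<in> D ==> b \<in> D ==> a \<in> E ==> a \<le> b \<or> b \<le> a ==> b \<in> E"
 shows "D \<subseteq> E"
 using poset_connected_const[of D "%a. a \<in> E" x] assms by blast

definition comparability :: "'p::order set => ('p \<times> 'p) set" where
 "comparability T = {(a, b). a \<in> T & b \<in> T & (a \<le> b \<or> b \<le> a)}"

definition component_of :: "'p::order set => 'p => 'p set" where
 "component_of T x = {y. (x, y) \<in> (comparability T)\<^sup>*}"

definition components :: "'p::order set => 'p set set" where
 "components T = component_of T ` T"

lemma sym_comparability_rtrancl: "(x, y) \<in> (comparability T)\<^sup>* ==> (y, x) \<in> (comparability T)\<^sup>*"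
proof -
 have "sym (comparability T)" unfolding comparability_def sym_def by blast
 then show "(x, y) \<in> (comparability T)\<^sup>* ==> (y, x) \<in> (comparability T)\<^sup>*"
  by (meson sym_rtrancl symD)
qed

lemma component_of_self [simp]: "x \<in> component_of T x"
 unfolding component_of_def by simp

lemma component_of_subset: "x \<in> T ==> component_of T x \<subseteq> T"
proof
 fix y assume "x \<in> T" "y \<in> component_of T x"
 then have "(x, y) \<in> (comparability T)\<^sup>*" unfolding component_of_def by simp
 then show "y \<in> T" using \<open>x \<in> T\<close>
  by (induction rule: rtrancl_induct) (auto simp: comparability_def)
qed

lemma component_of_closed:
 assumes "x \<in> T" "y \<in> component_of T x" "z \<in> T" "y \<le> z \<or> z \<le> y"
 shows "z \<in> component_of T x"
proof -
 have "y \<in> T" using component_of_subset assms by blast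
 then have "(y, z) \<in> comparability T" using assms unfolding comparability_def by auto
 then show ?thesis using assms(2) unfolding component_of_def by (auto intro: rtrancl_into_rtrancl)
qed

lemma component_of_eq: "y \<in> component_of T x ==> component_of T y = component_of T x"
 unfolding component_of_def using sym_comparability_rtrancl by (auto intro: rtrancl_trans)

lemma poset_connected_component_of:
 assumes "x \<in> T" shows "poset_connected (component_of T x)"
proof -
 let ?D = "component_of T x"
 have *: "(y, z) \<in> (comparability ?D)\<^sup>*" if "y \<in> ?D" "(y, z) \<in> (comparability T)\<^sup>*" for y z
  using that(2)
 proof (induction rule: rtrancl_induct)
  case (step z w)
  have "z \<in> ?D" using that(1) step(1) unfolding component_of_def by (auto intro: rtrancl_trans)
  moreover have "w \<in> ?D" using calculation step(2) unfolding component_of_def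
   by (auto intro: rtrancl_into_rtrancl)
  ultimately have "(z, w) \<in> comparability ?D" using step(2) unfolding comparability_def by auto
  then show ?case using step(3) by (auto intro: rtrancl_into_rtrancl)
 qed simp
 show ?thesis unfolding poset_connected_def
 proof (intro ballI)
  fix y z assume "y \<in> ?D" "z \<in> ?D"
  then have "(y, z) \<in> (comparability T)\<^sup>*"
   unfolding component_of_def using sym_comparability_rtrancl by (auto intro: rtrancl_trans)
  then show "(y, z) \<in> {(a, b). a \<in> ?D & b \<in> ?D & (a \<le> b \<or> b \<le> a)}\<^sup>*"
   using * \<open>y \<in> ?D\<close> unfolding comparability_def by blast
 qed
qed

lemma components_subset: "D \<in> components T ==> D \<subseteq> T"
 unfolding components_def using component_of_subset by blast

lemma components_closed:
 "D \<in> components T ==> x \<in> D ==> y \<in> T ==> x \<le> y \<or> y \<le> x ==> y \<in> D"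
 unfolding components_def using component_of_closed by blast

lemma components_disjoint: "D \<in> components T ==> D' \<in> components T ==> x \<in> D ==> x \<in> D' ==> D = D'"
 unfolding components_def using component_of_eq by blast

lemma components_cover: "x \<in> T ==> \<exists>D\<in>components T. x \<in> D"
 unfolding components_def using component_of_self by blast

lemma components_connected: "D \<in> components T ==> poset_connected D"
 unfolding components_def using poset_connected_component_of by blast

lemma componentsI:
 assumes "C \<subseteq> T" "C ~= {}" "poset_connected C"
  and "!!c x. c \<in> C ==> x \<in> T ==> x \<le> c \<or> c \<le> x ==> x \<in> C"
 shows "C \<in> components T"
proof -
 obtain c where c: "c \<in> C" using assms(2) by blast
 then have cT: "c \<in> T" using assms(1) by blast
 have "C \<subseteq> component_of T c"
  using poset_connected_subset_closed[OF assms(3) c, of "component_of T c"]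
   component_of_closed[OF cT] assms(1) by auto
 moreover have "component_of T c \<subseteq> C"
  using poset_connected_subset_closed[OF poset_connected_component_of[OF cT] component_of_self c]
   assms(4) component_of_subset[OF cT] by blast
 ultimately show ?thesis unfolding components_def using cT by blast
qed

lemma components_intervals:
 assumes "poset_convex T" "D \<in> components T" shows "D \<in> intervals"
proof -
 have "D ~= {}" using assms(2) component_of_self unfolding components_def by blast
 moreover have "poset_convex D"
  unfolding poset_convex_def
 proof (intro ballI allI impI)
  fix x y z assume "x \<in> D" "y \<in> D" and xz: "x \<le> z & z \<le> y"
  then have "z \<in> T" using components_subset[OF assms(2)] assms(1) unfolding poset_convex_def by blast
  then show "z \<in> D" using components_closed[OF assms(2) \<open>x \<in> D\<close>] xz by blast
 qed
 ultimately show ?thesis using components_connected[OF assms(2)] unfolding intervals_def by blast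
qed

lemma interval_is_component: "C \<in> intervals ==> C \<in> components C"
 unfolding intervals_def by (auto intro: componentsI)

lemma intervalsD:
 assumes "S \<in> intervals" shows "S ~= {}" "poset_connected S" "poset_convex S"
 using assms unfolding intervals_def by auto

lemma poset_convexD: "poset_convex S ==> x \<in> S ==> y \<in> S ==> x \<le> z ==> z \<le> y ==> z \<in> S"
 unfolding poset_convex_def by blast

section \<open>Homomorphisms between interval representations\<close>

text \<open>\<open>ivl_hom R T c\<close>: multiplication by \<open>c\<close> is a morphism from the indicator representation of
 \<open>R\<close> to that of \<open>T\<close>. The second clause combines the naturality condition with the support condition.\<close>

definition ivl_hom :: "'p::order set => 'p set => ('p => 'k::zero) => bool" where
 "ivl_hom R T c \<longleftrightarrow> (ALL x. x \<notin> R \<or> x \<notin> T --> c x = 0) & (\<forall>x\<in>R. \<forall>y\<in>T. x \<le> y --> c x = c y)"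

lemma ivl_hom_outside: "ivl_hom R T c ==> x \<notin> R \<or> x \<notin> T ==> c x = 0"
 unfolding ivl_hom_def by blast

lemma ivl_hom_support: "ivl_hom R T c ==> c x ~= 0 ==> x \<in> R & x \<in> T"
 unfolding ivl_hom_def by blast

lemma ivl_hom_eq: "ivl_hom R T c ==> x \<in> R ==> y \<in> T ==> x \<le> y ==> c x = c y"
 unfolding ivl_hom_def by blast

lemma ivl_hom_zero [simp]: "ivl_hom R T (%x. 0)"
 unfolding ivl_hom_def by simp

lemma ivl_hom_add: "ivl_hom R T c ==> ivl_hom R T d ==> ivl_hom R T (%x. c x + d x :: 'k::field)"
 unfolding ivl_hom_def by auto

lemma ivl_hom_scale: "ivl_hom R T c ==> ivl_hom R T (%x. a * c x :: 'k::field)"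
 unfolding ivl_hom_def by auto

lemma ivl_hom_sum: "(!!i. i \<in> I ==> ivl_hom R T (c i)) ==> ivl_hom R T (%x. \<Sum>i\<in>I. c i x :: 'k::field)"
 by (induction I rule: infinite_finite_induct) (auto intro: ivl_hom_add)

text \<open>Pointwise multiplication is composition of morphisms. If exactly one of
  \<open>x \<le> y\<close> lies in \<open>R'\<close>, the factor that is natural for this pair
  vanishes at the point outside \<open>R'\<close> and hence at both. If neither lies in
  \<open>R'\<close>, both products contain a vanishing factor.\<close>

lemma ivl_hom_mult:
 assumes "ivl_hom R R' c" "ivl_hom R' T d" shows "ivl_hom R T (%x. c x * d x :: 'k::field)"
 unfolding ivl_hom_def
proof (intro conjI allI ballI impI)
 fix x assume "x \<notin> R \<or> x \<notin> T" then show "c x * d x = 0" using assms unfolding ivl_hom_def by auto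
next
 fix x y assume *: "x \<in> R" "y \<in> T" "x \<le> y"
 show "c x * d x = c y * d y"
 proof (cases "x \<in> R'")
  case True
  then have d: "d x = d y" using ivl_hom_eq[OF assms(2) _ *(2,3)] by blast
  show ?thesis
  proof (cases "y \<in> R'")
   case True
   then have "c x = c y" using ivl_hom_eq[OF assms(1) *(1) _ *(3)] by blast
   then show ?thesis using d by simp
  next
   case False
   then have "d y = 0" using ivl_hom_outside[OF assms(2), of y] by blast
   then show ?thesis using d by simp
  qed
 next
  case False
  then have cx: "c x = 0" using ivl_hom_outside[OF assms(1)] by blast
  have "c y = 0 \<or> d y = 0"
  proof (cases "y \<in> R'")
   case True
   then show ?thesis using ivl_hom_eq[OF assms(1) *(1) _ *(3)] cx by simp
  next
   case False then show ?thesis using ivl_hom_outside[OF assms(2), of y] by blast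
  qed
  then show ?thesis using cx by auto
 qed
qed

text \<open>The canonical maps used later all have this form: those between cells, the inclusions
  and projections of components, and the morphisms that realise the last toggle in the exactness
  proof.\<close>

lemma ivl_hom_indicator:
 assumes "!!x y. x \<in> R ==> y \<in> T ==> x \<le> y ==> x \<in> T & y \<in> R"
 shows "ivl_hom R T (%x. if x \<in> R & x \<in> T then 1 else 0 :: 'k::field)"
 unfolding ivl_hom_def
proof (intro conjI allI ballI impI)
 fix x y assume "x \<in> R" "y \<in> T" "x \<le> y"
 then show "(if x \<in> R & x \<in> T then 1 else 0 :: 'k) = (if y \<in> R & y \<in> T then 1 else 0)"
  using assms[of x y] by simp
qed simp

lemma ivl_hom_component_const:
 assumes "C \<in> components T" "ivl_hom C T c" "x \<in> C" "y \<in> C" shows "c x = c y"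
proof -
 have "c a = c b" if "a \<in> C" "b \<in> C" "a \<le> b" for a b
  using ivl_hom_eq[OF assms(2)] that components_subset[OF assms(1)] by blast
 then show ?thesis
  using poset_connected_const[OF components_connected[OF assms(1)]] assms(3,4) by blast
qed

text \<open>The composite \<open>C \<rightarrow> R \<rightarrow> T\<close> is a scalar on the
  component \<open>C\<close>, so if it is non-zero anywhere then both factors are non-zero on all of
  \<open>C\<close>, and \<open>C \<subseteq> R\<close>. Non-vanishing then prevents \<open>R\<close>
  from leaving \<open>C\<close>: naturality of \<open>c\<close> handles a step upwards, naturality
  of \<open>d\<close> together with closedness of the component a step downwards. Every later
  collapse of a matrix product to a single term rests on this.\<close>

lemma component_factor:
 fixes c d :: "'p::order => 'k::field"
 assumes C: "C \<in> components T" and R: "poset_connected R"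
  and c: "ivl_hom C R c" and d: "ivl_hom R T d" and x: "x \<in> C" and nz: "c x * d x ~= 0"
 shows "R = C"
proof -
 have nz': "c y ~= 0 & d y ~= 0" if "y \<in> C" for y
  using ivl_hom_component_const[OF C ivl_hom_mult[OF c d] x that] nz by auto
 then have CR: "C \<subseteq> R" using ivl_hom_support[OF c] by blast
 have "b \<in> C" if "a \<in> C" "b \<in> R" "a \<le> b \<or> b \<le> a" for a b
  using that(3)
 proof
  assume "a \<le> b"
  then have "c b ~= 0" using ivl_hom_eq[OF c that(1,2)] nz' that(1) by auto
  then show ?thesis using ivl_hom_support[OF c] by blast
 next
  assume "b \<le> a"
  moreover have "a \<in> T" using components_subset[OF C] that(1) by blast
  ultimately have "d b ~= 0" using ivl_hom_eq[OF d that(2)] nz' that(1) by auto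
  then have "b \<in> T" using ivl_hom_support[OF d] by blast
  then show ?thesis using components_closed[OF C that(1)] \<open>b \<le> a\<close> by blast
 qed
 then have "R \<subseteq> C" using poset_connected_subset_closed[OF R, of x C] x CR by blast
 then show ?thesis using CR by blast
qed

section \<open>The cube attached to an interval\<close>

definition up_frontier :: "'p::order set => 'p set" where
 "up_frontier S = min_elems {x. x \<notin> S & (\<exists>s\<in>S. s < x)}"

definition down_frontier :: "'p::order set => 'p set" where
 "down_frontier C = max_elems {x. x \<notin> C & (\<exists>c\<in>C. x < c)}"

text \<open>The incomparable elements are added all at once so that the set is as large as possible.
  If a convex \<open>R\<close> contains \<open>S\<close> as a downset and also \<open>a\<close>,
  then every element of \<open>R\<close> below \<open>a\<close> is in \<open>S\<close>, equal to
  \<open>a\<close>, or incomparable to \<open>S\<close>. The stage thus contains all of them, and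
  the map from \<open>R\<close> to \<open>S\<close> lifts to it.\<close>

definition stage :: "'p::order set => 'p set => 'p set" where
 "stage S A = S \<union> A \<union> {z. (\<exists>a\<in>A. z < a) & (\<forall>s\<in>S. \<not> z \<le> s & \<not> s \<le> z)}"

lemma stage_empty [simp]: "stage S {} = S"
 unfolding stage_def by simp

lemma stage_mono: "A \<subseteq> A' ==> stage S A \<subseteq> stage S A'"
 unfolding stage_def by blast

lemma up_frontier_above: "a \<in> up_frontier S ==> a \<notin> S & (\<exists>s\<in>S. s < a)"
 unfolding up_frontier_def min_elems_def by blast

lemma up_frontier_not_below:
 assumes "poset_convex S" "a \<in> up_frontier S" "s \<in> S" shows "\<not> a \<le> s"
 using up_frontier_above[OF assms(2)] assms(1,3) unfolding poset_convex_def by (meson less_imp_le)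

lemma up_frontier_antichain:
 assumes "a \<in> up_frontier S" "b \<in> up_frontier S" "a \<le> b" shows "a = b"
 using assms unfolding up_frontier_def min_elems_def by auto

lemma up_frontier_min:
 assumes "a \<in> up_frontier S" "z < a" "s \<in> S" "s \<le> z" shows "z \<in> S"
 using assms unfolding up_frontier_def min_elems_def by (metis (mono_tags, lifting) mem_Collect_eq order.not_eq_order_implies_strict)

lemma down_frontier_antichain:
 assumes "a \<in> down_frontier S" "b \<in> down_frontier S" "a \<le> b" shows "a = b"
 using assms unfolding down_frontier_def max_elems_def by auto

context
 fixes S :: "'p::order set"
 assumes S: "poset_convex S"
begin

lemma stage_not_below:
 assumes "A \<subseteq> up_frontier S" "x \<in> stage S A" "x \<notin> S" "s \<in> S" shows "\<not> x \<le> s"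
 using assms up_frontier_not_below[OF S] unfolding stage_def by blast

lemma stage_above:
 assumes "A \<subseteq> up_frontier S" "x \<in> stage S A" "x \<notin> S" "s \<in> S" "s \<le> x" shows "x \<in> A"
 using assms unfolding stage_def by blast

lemma stage_below:
 assumes "x \<in> stage S A" "x \<notin> S" shows "\<exists>a\<in>A. x \<le> a"
 using assms unfolding stage_def by (auto intro: less_imp_le)

text \<open>An element under some \<open>a\<close> in \<open>A\<close> is \<open>a\<close> itself,
  or in \<open>S\<close>, or, by minimality of \<open>a\<close> above \<open>S\<close>, not above
  any element of \<open>S\<close>. That it is not below \<open>S\<close> either is inherited from
  the lower end \<open>x\<close>.\<close>

lemma stage_convex:
 assumes A: "A \<subseteq> up_frontier S" shows "poset_convex (stage S A)"
 unfolding poset_convex_def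
proof (intro ballI allI impI)
 fix x y z assume x: "x \<in> stage S A" and y: "y \<in> stage S A" and z: "x \<le> z & z \<le> y"
 show "z \<in> stage S A"
 proof (cases "y \<in> S")
  case True
  then have "x \<in> S" using stage_not_below[OF A x] z by (meson order_trans)
  then show ?thesis using True z S unfolding poset_convex_def stage_def by blast
 next
  case False
  then obtain a where a: "a \<in> A" "y \<le> a" using stage_below[OF y] by blast
  show ?thesis
  proof (cases "z = a \<or> z \<in> S")
   case True then show ?thesis using a unfolding stage_def by blast
  next
   case F: False
   then have za: "z < a" using a z by auto
   have n1: "\<not> s \<le> z" if "s \<in> S" for s using up_frontier_min[of a S z s] a(1) A za that F by blast
   then have "x \<notin> S" using z by blast
   then have "\<not> z \<le> s" if "s \<in> S" for s using stage_not_below[OF A x _ that] z by (meson order_trans)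
   then show ?thesis using n1 za a(1) unfolding stage_def by blast
  qed
 qed
qed

text \<open>The only danger is an element of \<open>A'\<close> below an element of \<open>A\<close>;
  the two are equal because the frontier is an antichain. Adding left elements therefore gives
  surjections of representations.\<close>

lemma stage_downset:
 assumes A': "A' \<subseteq> up_frontier S" and "A \<subseteq> A'" and x: "x \<in> stage S A'" and t: "t \<in> stage S A" and "x \<le> t"
 shows "x \<in> stage S A"
proof (cases "x \<in> S")
 case True then show ?thesis unfolding stage_def by blast
next
 case False
 have tS: "t \<notin> S" using stage_not_below[OF A' x False] \<open>x \<le> t\<close> by blast
 then obtain a where a: "a \<in> A" "t \<le> a" using stage_below[OF t] by blast
 show ?thesis
 proof (cases "x \<in> A'")
  case True
  moreover have "x \<le> a" using a(2) \<open>x \<le> t\<close> by (rule order_trans[rotated])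
  ultimately have "x = a" using up_frontier_antichain[of x S a] a(1) assms(1,2) by blast
  then show ?thesis using a unfolding stage_def by blast
 next
  case F: False
  then have "\<not> s \<le> x" "\<not> x \<le> s" if "s \<in> S" for s
   using stage_above[OF A' x False that] stage_not_below[OF A' x False that] by auto
  moreover have "x < a" using a \<open>x \<le> t\<close> F assms(2) by (metis order_trans order.not_eq_order_implies_strict subsetD)
  ultimately show ?thesis using a(1) unfolding stage_def by blast
 qed
qed

text \<open>Nothing that is added lies below \<open>S\<close>. This keeps the two halves of the cube
  independent: deleting minimal elements of \<open>S\<close> preserves convexity at every
  stage.\<close>

lemma min_elems_stage:
 assumes A: "A \<subseteq> up_frontier S" and v: "v \<in> min_elems S" and x: "x \<in> stage S A" and "x \<le> v" shows "x = v"
proof -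
 have "v \<in> S" using v unfolding min_elems_def by blast
 then have "x \<in> S" using stage_not_below[OF A x] \<open>x \<le> v\<close> by blast
 then show ?thesis using v \<open>x \<le> v\<close> unfolding min_elems_def by (metis (mono_tags, lifting) mem_Collect_eq order.not_eq_order_implies_strict)
qed

end

section \<open>The cells of the cube\<close>

definition cube :: "'p::order set => ('p + 'p) set" where
 "cube S = up_frontier S <+> min_elems S"

definition lefts :: "('a + 'b) set => 'a set" where "lefts F = {a. Inl a \<in> F}"

definition rights :: "('a + 'b) set => 'b set" where "rights F = {b. Inr b \<in> F}"

definition cell :: "'p::order set => ('p + 'p) set => 'p set" where
 "cell S F = stage S (lefts F) - rights F"

lemma cube_subset: "F \<subseteq> cube S ==> lefts F \<subseteq> up_frontier S & rights F \<subseteq> min_elems S"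
 unfolding cube_def lefts_def rights_def by auto

lemma lefts_rights_mono: "F' \<subseteq> F ==> lefts F' \<subseteq> lefts F & rights F' \<subseteq> rights F"
 unfolding lefts_def rights_def by auto

lemma cell_empty [simp]: "cell S {} = S"
 unfolding cell_def lefts_def rights_def by simp

lemma cell_convex:
 assumes S: "poset_convex S" and F: "F \<subseteq> cube S" shows "poset_convex (cell S F)"
proof -
 note A = cube_subset[OF F]
 have "poset_convex (stage S (lefts F))" using stage_convex[OF S] A by blast
 then show ?thesis unfolding poset_convex_def cell_def
  using min_elems_stage[OF S] A by (smt (verit, best) Diff_iff subsetD)
qed

text \<open>This is the hypothesis of \<open>ivl_hom_indicator\<close>: for
  \<open>F' \<subseteq> F\<close> the overlap carries a canonical morphism from
  \<open>cell S F\<close> to \<open>cell S F'\<close>, the structure map of the cube. Left elements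
  contribute a passage to a quotient and right elements an inclusion.\<close>

lemma cell_restrict:
 assumes S: "poset_convex S" and F: "F \<subseteq> cube S" and "F' \<subseteq> F" and x: "x \<in> cell S F" and y: "y \<in> cell S F'" and "x \<le> y"
 shows "x \<in> cell S F' & y \<in> cell S F"
proof -
 note A = cube_subset[OF F] and B = lefts_rights_mono[OF \<open>F' \<subseteq> F\<close>]
 have "x \<in> stage S (lefts F')"
  using stage_downset[OF S, of "lefts F" "lefts F'" x y] A B x y \<open>x \<le> y\<close> unfolding cell_def by blast
 moreover have y1: "y \<in> stage S (lefts F)"
  using stage_mono[of "lefts F'" "lefts F" S] B y unfolding cell_def by blast
 moreover have "y \<notin> rights F"
 proof
  assume "y \<in> rights F"
  then have "x = y" using min_elems_stage[OF S, of "lefts F" y x] A x \<open>x \<le> y\<close> unfolding cell_def by blast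
  then show False using x \<open>y \<in> rights F\<close> unfolding cell_def by blast
 qed
 ultimately show ?thesis using x B unfolding cell_def by blast
qed

section \<open>Boundaries and extremal elements\<close>

lemma upper_boundary_below:
 fixes T :: "'p::{finite,order} set"
 assumes "S \<subseteq> T" "x \<in> T - S" "s \<in> S" "s < x"
 shows "\<exists>z\<in>upper_boundary T S. s < z & z \<le> x"
proof -
 \<comment> \<open>\<open>z\<close> is minimal outside \<open>S\<close> and \<open>t\<close> is then
   maximal inside \<open>S\<close>, so an element strictly between them would undercut one of the
   two choices. Hence \<open>z\<close> covers \<open>t\<close>.\<close>
 obtain z where z: "z \<in> {y \<in> T - S. s < y & y \<le> x}"
  and zmin: "!!y. y \<in> {y \<in> T - S. s < y & y \<le> x} ==> y \<le> z ==> z = y"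
  using finite_has_minimal[of "{y \<in> T - S. s < y & y \<le> x}"] assms by auto
 obtain t where t: "t \<in> {t \<in> S. s \<le> t & t < z}"
  and tmax: "!!y. y \<in> {t \<in> S. s \<le> t & t < z} ==> t \<le> y ==> t = y"
  using finite_has_maximal[of "{t \<in> S. s \<le> t & t < z}"] assms z by auto
 have "\<not> (t < y & y < z)" if "y \<in> T" for y
 proof
  assume y: "t < y & y < z"
  show False
  proof (cases "y \<in> S")
   case True
   then have "t = y" using tmax[of y] t y by (auto simp: less_imp_le intro: order_trans)
   then show False using y by simp
  next
   case False
   have "s < y" using t y by (auto intro: le_less_trans)
   moreover have "y \<le> x" using z y by (auto intro: order_trans[OF less_imp_le])
   ultimately have "z = y" using zmin[of y] False that y by (simp add: less_imp_le)
   then show False using y by simp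
  qed
 qed
 then have "z \<in> upper_boundary T S"
  using t z assms(1) unfolding upper_boundary_def covers_in_def by blast
 then show ?thesis using z by blast
qed

lemma lower_boundary_above:
 fixes T :: "'p::{finite,order} set"
 assumes "C \<subseteq> T" "x \<in> T - C" "c \<in> C" "x < c"
 shows "\<exists>z\<in>lower_boundary T C. z < c & x \<le> z"
proof -
 obtain z where z: "z \<in> {y \<in> T - C. y < c & x \<le> y}"
  and zmax: "!!y. y \<in> {y \<in> T - C. y < c & x \<le> y} ==> z \<le> y ==> z = y"
  using finite_has_maximal[of "{y \<in> T - C. y < c & x \<le> y}"] assms by auto
 obtain t where t: "t \<in> {t \<in> C. t \<le> c & z < t}"
  and tmin: "!!y. y \<in> {t \<in> C. t \<le> c & z < t} ==> y \<le> t ==> t = y"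
  using finite_has_minimal[of "{t \<in> C. t \<le> c & z < t}"] assms z by auto
 have "\<not> (z < y & y < t)" if "y \<in> T" for y
 proof
  assume y: "z < y & y < t"
  show False
  proof (cases "y \<in> C")
   case True
   then have "t = y" using tmin[of y] t y by (auto simp: less_imp_le intro: order_trans)
   then show False using y by simp
  next
   case False
   have "y < c" using t y by (auto intro: less_le_trans)
   moreover have "x \<le> y" using z y by (auto intro: order_trans[OF _ less_imp_le])
   ultimately have "z = y" using zmax[of y] False that y by (simp add: less_imp_le)
   then show False using y by simp
  qed
 qed
 then have "z \<in> lower_boundary T C"
  using t z assms(1) unfolding lower_boundary_def covers_in_def by blast
 then show ?thesis using z by blast
qed

lemma max_elems_above:
 fixes Y :: "'p::{finite,order} set" assumes "x \<in> Y" shows "\<exists>m\<in>max_elems Y. x \<le> m"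
proof -
 obtain m where "m \<in> {y \<in> Y. x \<le> y}" "!!y. y \<in> {y \<in> Y. x \<le> y} ==> m \<le> y ==> m = y"
  using finite_has_maximal[of "{y \<in> Y. x \<le> y}"] assms by auto
 then have "m \<in> max_elems Y" "x \<le> m" unfolding max_elems_def by (auto simp: less_le intro: order_trans)
 then show ?thesis by blast
qed

lemma min_elems_below:
 fixes Y :: "'p::{finite,order} set" assumes "x \<in> Y" shows "\<exists>m\<in>min_elems Y. m \<le> x"
proof -
 obtain m where "m \<in> {y \<in> Y. y \<le> x}" "!!y. y \<in> {y \<in> Y. y \<le> x} ==> y \<le> m ==> m = y"
  using finite_has_minimal[of "{y \<in> Y. y \<le> x}"] assms by auto
 then have "m \<in> min_elems Y" "m \<le> x" unfolding min_elems_def by (auto simp: less_le intro: order_trans)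
 then show ?thesis by blast
qed

lemma max_elems_sub: "max_elems Y \<subseteq> Y" and min_elems_sub: "min_elems Y \<subseteq> Y"
 unfolding max_elems_def min_elems_def by auto

text \<open>Put \<open>N = down_frontier C \<inter> stage S (lefts F)\<close> and
  \<open>B = min_elems S - C\<close>. The two families impose the same conditions on
  \<open>lefts F\<close> and opposite ones on \<open>rights F\<close>: it lies between
  \<open>N\<close> and \<open>B\<close> in \<open>phi\<close>, and between \<open>B\<close> and
  \<open>N\<close> in \<open>psi\<close>. Over a fixed left part each is a Boolean interval, and
  both can be non-empty only if \<open>N = B\<close>.\<close>

definition phi :: "'p::{finite,order} set => 'p set => ('p + 'p) set set" where
 "phi S C = {F. lefts F \<subseteq> up_frontier S & rel_upset C (stage S (lefts F)) &
   down_frontier C \<inter> stage S (lefts F) \<subseteq> rights F & rights F \<subseteq> min_elems S - C}"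

definition psi :: "'p::{finite,order} set => 'p set => ('p + 'p) set set" where
 "psi S C = {F. lefts F \<subseteq> up_frontier S & rel_upset C (stage S (lefts F)) &
   min_elems S - C \<subseteq> rights F & rights F \<subseteq> down_frontier C \<inter> stage S (lefts F)}"

lemma down_frontier_below: "b \<in> down_frontier C ==> b \<notin> C & (\<exists>c\<in>C. b < c)"
 unfolding down_frontier_def max_elems_def by blast

lemma below_down_frontier:
 fixes C :: "'p::{finite,order} set" assumes "x \<notin> C" "c \<in> C" "x < c"
 shows "\<exists>b\<in>down_frontier C. x \<le> b"
 using max_elems_above[of x "{x. x \<notin> C & (\<exists>c\<in>C. x < c)}"] assms unfolding down_frontier_def by blast

text \<open>Since \<open>rights F\<close> consists of minimal elements, closedness of
  \<open>C\<close> upwards means the same in the cell and in the stage. For closedness downwards, an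
  element outside \<open>C\<close> but below it lies under some \<open>b\<close> in
  \<open>down_frontier C\<close>. Convexity puts \<open>b\<close> into the stage, so
  \<open>b\<close> has been deleted; being minimal, it has nothing of the cell below it.\<close>

lemma phi_components:
 fixes S :: "'p::{finite,order} set"
 assumes S: "S \<in> intervals" and C: "C \<in> intervals"
 shows "F \<in> phi S C \<longleftrightarrow> F \<subseteq> cube S & C \<in> components (cell S F)"
proof
 note Sc = intervalsD(3)[OF S]
 assume "F \<in> phi S C"
 then have A: "lefts F \<subseteq> up_frontier S" and up: "rel_upset C (stage S (lefts F))"
  and N: "down_frontier C \<inter> stage S (lefts F) \<subseteq> rights F" and B: "rights F \<subseteq> min_elems S - C"
  unfolding phi_def by auto
 have "F \<subseteq> cube S"
 proof
  fix w assume "w \<in> F"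
  then show "w \<in> cube S" using A B unfolding cube_def lefts_def rights_def by (cases w) auto
 qed
 moreover have "C \<in> components (cell S F)"
 proof (rule componentsI)
  show "C \<subseteq> cell S F" using up B unfolding rel_upset_def cell_def by blast
  show "C ~= {}" "poset_connected C" using intervalsD[OF C] by auto
  fix c x assume c: "c \<in> C" and x: "x \<in> cell S F" and "x \<le> c \<or> c \<le> x"
  then show "x \<in> C"
  proof (elim disjE)
   assume "c \<le> x" then show ?thesis using up c x unfolding rel_upset_def cell_def by blast
  next
   assume "x \<le> c"
   show ?thesis
   proof (rule ccontr)
    assume "x \<notin> C"
    then obtain b where b: "b \<in> down_frontier C" "x \<le> b"
     using below_down_frontier[of x C c] c \<open>x \<le> c\<close> by (metis order.not_eq_order_implies_strict)
    then obtain c' where c': "c' \<in> C" "b < c'" using down_frontier_below by blast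
    have "b \<in> stage S (lefts F)"
    proof (rule poset_convexD[OF stage_convex[OF Sc A]])
     show "x \<in> stage S (lefts F)" using x unfolding cell_def by blast
     show "c' \<in> stage S (lefts F)" using up c' unfolding rel_upset_def by blast
    qed (use b c' in auto)
    then have "b \<in> rights F" using N b by blast
    then have "x = b" using min_elems_stage[OF Sc A, of b x] B x b(2) unfolding cell_def by blast
    then show False using x \<open>b \<in> rights F\<close> unfolding cell_def by blast
   qed
  qed
 qed
 ultimately show "F \<subseteq> cube S & C \<in> components (cell S F)" by blast
next
 note Sc = intervalsD(3)[OF S]
 assume *: "F \<subseteq> cube S & C \<in> components (cell S F)"
 then have A: "lefts F \<subseteq> up_frontier S" "rights F \<subseteq> min_elems S" using cube_subset by auto
 have CT: "C \<subseteq> cell S F" using * components_subset by blast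
 have "rel_upset C (stage S (lefts F))"
  unfolding rel_upset_def
 proof (intro conjI ballI impI)
  show "C \<subseteq> stage S (lefts F)" using CT unfolding cell_def by blast
  fix c x assume c: "c \<in> C" and x: "x \<in> stage S (lefts F)" "c \<le> x"
  have "x \<notin> rights F"
  proof
   assume "x \<in> rights F"
   then have "c = x" using min_elems_stage[OF Sc A(1), of x c] A c CT x unfolding cell_def by blast
   then show False using c CT \<open>x \<in> rights F\<close> unfolding cell_def by blast
  qed
  then show "x \<in> C" using components_closed[of C "cell S F" c x] * c x unfolding cell_def by blast
 qed
 moreover have "b \<in> rights F" if "b \<in> down_frontier C" "b \<in> stage S (lefts F)" for b
 proof (rule ccontr)
  assume "b \<notin> rights F"
  moreover from down_frontier_below[OF that(1)] obtain c where "c \<in> C" "b < c" "b \<notin> C" by blast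
  ultimately show False
   using components_closed[of C "cell S F" c b] * that(2) unfolding cell_def by (auto simp: less_imp_le)
 qed
 moreover have "rights F \<subseteq> min_elems S - C" using A CT unfolding cell_def by blast
 ultimately show "F \<in> phi S C" using A unfolding phi_def by blast
qed

text \<open>The candidate for the inverse of \<open>boundary\<close>: outside \<open>S\<close> and
  \<open>C\<close>, every element of an interval \<open>T\<close> in \<open>W_set S C\<close> lies
  above a minimal element of \<open>T - C\<close> and below a maximal element of
  \<open>T - S\<close>.\<close>

definition span_hull :: "'p::order set => 'p set => 'p set => 'p set => 'p set" where
 "span_hull S C A B = S \<union> C \<union> {x. \<exists>b\<in>B. \<exists>a\<in>A. b \<le> x & x \<le> a}"

definition boundary :: "'p::order set => 'p set => 'p set => ('p + 'p) set" where
 "boundary S C T = upper_boundary T S <+> lower_boundary T C"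

lemma lefts_Plus [simp]: "lefts (A <+> B) = A" and rights_Plus [simp]: "rights (A <+> B) = B"
 unfolding lefts_def rights_def by auto

lemma Plus_lefts_rights [simp]: "lefts F <+> rights F = F"
proof -
 have "w \<in> lefts F <+> rights F \<longleftrightarrow> w \<in> F" for w unfolding lefts_def rights_def by (cases w) auto
 then show ?thesis by blast
qed

lemma card_boundary: "card (boundary S C T) = omega S T C" for S :: "'p::{finite,order} set"
 unfolding boundary_def omega_def by (simp add: card_Plus)

text \<open>The first four claims are the conditions of \<open>psi\<close> for the boundary, the
  last says that \<open>span_hull\<close> is a left inverse. Boundary elements belong to the
  frontiers because anything between \<open>S\<close> and a boundary element is in \<open>T\<close>
  by convexity and then has another boundary element below it. This contradicts the description of
  the boundary as a set of maximal elements; the lower side is dual.\<close>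

lemma W_set_properties:
 fixes S :: "'p::{finite,order} set"
 assumes S: "S \<in> intervals" and C: "C \<in> intervals" and T: "T \<in> W_set S C"
 defines "A \<equiv> upper_boundary T S" and "B \<equiv> lower_boundary T C"
 shows "A \<subseteq> up_frontier S" and "rel_upset C (stage S A)" and "min_elems S - C \<subseteq> B"
  and "B \<subseteq> down_frontier C \<inter> stage S A" and "span_hull S C A B = T"
proof -
 have Tc: "poset_convex T" using T intervalsD(3) unfolding W_set_def by blast
 have SD: "rel_downset S T" and A: "A = max_elems (T - S)" and CU: "rel_upset C T" and B: "B = min_elems (T - C)"
  using T unfolding W_set_def A_def B_def by auto
 have Tcs: "x \<in> T ==> y \<in> T ==> x < z ==> z < y ==> z \<in> T" for x y z
  using poset_convexD[OF Tc] less_imp_le by metis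
 have ST: "S \<subseteq> T" "C \<subseteq> T" using SD CU unfolding rel_downset_def rel_upset_def by auto
 have AT: "A \<subseteq> T - S" "B \<subseteq> T - C" using A B max_elems_sub min_elems_sub by auto
 show AU: "A \<subseteq> up_frontier S"
 proof
  fix a assume a: "a \<in> A"
  then obtain s where s: "s \<in> S" "s < a" unfolding A_def upper_boundary_def covers_in_def by blast
  have "\<not> z < a" if z: "z \<notin> S" "t \<in> S" "t < z" for z t
  proof
   assume za: "z < a"
   then have "z \<in> T" using Tcs[of t a z] z ST AT a by blast
   then obtain y where "y \<in> A" "y \<le> z" using upper_boundary_below[OF ST(1), of z t] z unfolding A_def by blast
   moreover have "y < a" using calculation za by simp
   ultimately show False using a unfolding A max_elems_def by blast
  qed
  then show "a \<in> up_frontier S" using a s AT unfolding up_frontier_def min_elems_def by blast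
 qed
 have "B \<subseteq> down_frontier C"
 proof
  fix b assume b: "b \<in> B"
  then obtain c where c: "c \<in> C" "b < c" unfolding B_def lower_boundary_def covers_in_def by blast
  have "\<not> b < z" if z: "z \<notin> C" "t \<in> C" "z < t" for z t
  proof
   assume bz: "b < z"
   then have "z \<in> T" using Tcs[of b t z] z ST AT b by blast
   then obtain y where "y \<in> B" "z \<le> y" using lower_boundary_above[OF ST(2), of z t] z unfolding B_def by blast
   moreover have "b < y" using calculation bz by simp
   ultimately show False using b AT unfolding B min_elems_def by blast
  qed
  then show "b \<in> down_frontier C" using b c AT unfolding down_frontier_def max_elems_def by blast
 qed
 moreover have TS: "T \<subseteq> stage S A"
 proof
  fix x assume x: "x \<in> T"
  show "x \<in> stage S A"
  proof (cases "x \<in> S \<or> x \<in> A")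
   case True then show ?thesis unfolding stage_def by blast
  next
   case False
   then obtain a where a: "a \<in> A" "x \<le> a" using max_elems_above[of x "T - S"] x A by blast
   then have "x < a" using False by (metis order.not_eq_order_implies_strict)
   moreover have "\<not> x \<le> s" if "s \<in> S" for s using that False x SD unfolding rel_downset_def by blast
   moreover have "\<not> s \<le> x" if s: "s \<in> S" for s
   proof
    assume "s \<le> x"
    then have "s < x" using s False by (metis order.not_eq_order_implies_strict)
    then have "x \<in> S" using up_frontier_min[of a S x s] a AU \<open>x < a\<close> s by auto
    then show False using False by blast
   qed
   ultimately show ?thesis using a unfolding stage_def by blast
  qed
 qed
 ultimately show "B \<subseteq> down_frontier C \<inter> stage S A" using AT by blast
 show "rel_upset C (stage S A)"
  unfolding rel_upset_def
 proof (intro conjI ballI impI)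
  show "C \<subseteq> stage S A" using ST TS by blast
  fix c x assume c: "c \<in> C" "x \<in> stage S A" "c \<le> x"
  have "x \<in> T"
  proof (cases "x \<in> S")
   case True then show ?thesis using ST by blast
  next
   case False
   then obtain a where "a \<in> A" "x \<le> a" using stage_below c(2) intervalsD(3)[OF S] by blast
   then show ?thesis using poset_convexD[OF Tc, of c a x] c ST AT by blast
  qed
  then show "x \<in> C" using CU c unfolding rel_upset_def by blast
 qed
 show "min_elems S - C \<subseteq> B"
 proof
  fix v assume v: "v \<in> min_elems S - C"
  then have vS: "v \<in> S" using min_elems_sub by blast
  have "\<not> y < v" if "y \<in> T" for y
  proof
   assume "y < v"
   then have "y \<in> S" using SD vS that unfolding rel_downset_def by (simp add: less_imp_le)
   then show False using \<open>y < v\<close> v unfolding min_elems_def by blast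
  qed
  then show "v \<in> B" using v vS ST unfolding B min_elems_def by blast
 qed
 show "span_hull S C A B = T"
 proof
  show "span_hull S C A B \<subseteq> T" using ST AT poset_convexD[OF Tc] unfolding span_hull_def by blast
  show "T \<subseteq> span_hull S C A B"
  proof
   fix x assume x: "x \<in> T"
   show "x \<in> span_hull S C A B"
   proof (cases "x \<in> S \<or> x \<in> C")
    case True then show ?thesis unfolding span_hull_def by blast
   next
    case False
    then show ?thesis using max_elems_above[of x "T - S"] min_elems_below[of x "T - C"] x
     unfolding A B span_hull_def by blast
   qed
  qed
 qed
qed

lemma span_hull_W_set:
 fixes S :: "'p::{finite,order} set"
 assumes S: "S \<in> intervals" and C: "C \<in> intervals"
  and A: "A \<subseteq> up_frontier S" and up: "rel_upset C (stage S A)" and V: "min_elems S - C \<subseteq> B"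
  and B: "B \<subseteq> down_frontier C \<inter> stage S A"
 defines "T \<equiv> span_hull S C A B"
 shows "T \<in> W_set S C" and "upper_boundary T S = A" and "lower_boundary T C = B"
proof -
 note Sc = intervalsD(3)[OF S] and Sn = intervalsD(1)[OF S]
 note stc = stage_convex[OF Sc A]
 have AS: "A \<subseteq> stage S A" "S \<subseteq> stage S A" unfolding stage_def by auto
 have CS: "C \<subseteq> stage S A" using up unfolding rel_upset_def by blast
 have TS: "T \<subseteq> stage S A" unfolding T_def span_hull_def using AS CS B poset_convexD[OF stc] by blast
 have ST: "S \<subseteq> T" "C \<subseteq> T" unfolding T_def span_hull_def by auto
 have SD: "rel_downset S T"
  unfolding rel_downset_def using ST TS stage_not_below[OF Sc A] by blast
 have CU: "rel_upset C T" using up ST TS unfolding rel_upset_def by blast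
 \<comment> \<open>A minimal element of \<open>S\<close> below \<open>s\<close> is either in
   \<open>C\<close> or, by \<open>V\<close>, in \<open>B\<close>.\<close>
 have low: "\<exists>v\<in>C \<union> B. v \<le> s" if "s \<in> S" for s
  using min_elems_below[OF that] V by blast
 have AT: "A \<subseteq> T"
 proof
  fix a assume a: "a \<in> A"
  then obtain s where s: "s \<in> S" "s < a" using up_frontier_above A by blast
  then obtain v where v: "v \<in> C \<union> B" "v \<le> a" using low[OF s(1)] by (meson less_imp_le order_trans)
  then show "a \<in> T" using up a AS unfolding rel_upset_def T_def span_hull_def by blast
 qed
 have BT: "B \<subseteq> T"
 proof
  fix b assume b: "b \<in> B"
  show "b \<in> T"
  proof (cases "b \<in> S")
   case True then show ?thesis using ST by blast
  next
   case False
   then obtain a where "a \<in> A" "b \<le> a" using stage_below[OF Sc, of b A] b B by blast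
   then show ?thesis using b unfolding T_def span_hull_def by blast
  qed
 qed
 have bel: "\<exists>b\<in>B. b \<le> x" if x: "x \<in> T" "x \<notin> C" for x
 proof (cases "x \<in> S")
  case True
  then obtain v where v: "v \<in> C \<union> B" "v \<le> x" using low by blast
  then have "v \<notin> C" using CU x unfolding rel_upset_def by blast
  then show ?thesis using v by blast
 next
  case False then show ?thesis using x unfolding T_def span_hull_def by blast
 qed
 have Tc: "poset_convex T"
  unfolding poset_convex_def
 proof (intro ballI allI impI)
  fix x y z assume x: "x \<in> T" and y: "y \<in> T" and z: "x \<le> z & z \<le> y"
  have zs: "z \<in> stage S A" using poset_convexD[OF stc, of x y z] x y z TS by blast
  show "z \<in> T"
  proof (cases "z \<in> S \<or> z \<in> C")
   case True then show ?thesis using ST by blast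
  next
   case F: False
   then obtain a where a: "a \<in> A" "z \<le> a" using stage_below[OF Sc zs] by blast
   have "x \<notin> C" using F z zs up unfolding rel_upset_def by blast
   then obtain b where "b \<in> B" "b \<le> x" using bel[OF x] by blast
   then show ?thesis using a z unfolding T_def span_hull_def by (blast intro: order_trans)
  qed
 qed
 have maxA: "max_elems (T - S) = A"
 proof
  show "max_elems (T - S) \<subseteq> A"
  proof
   fix x assume x: "x \<in> max_elems (T - S)"
   then have "x \<in> T" "x \<notin> S" using max_elems_sub by auto
   then obtain a where a: "a \<in> A" "x \<le> a" using stage_below[OF Sc, of x A] TS by blast
   then have "\<not> x < a" using x AT A up_frontier_above unfolding max_elems_def by blast
   then show "x \<in> A" using a by (metis order.not_eq_order_implies_strict)
  qed
  show "A \<subseteq> max_elems (T - S)"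
  proof
   fix a assume a: "a \<in> A"
   have "\<not> a < y" if y: "y \<in> T - S" for y
   proof
    assume "a < y"
    moreover obtain a' where "a' \<in> A" "y \<le> a'" using stage_below[OF Sc, of y A] TS y by blast
    ultimately show False using up_frontier_antichain[of a S a'] a A by (metis leD less_imp_le order_trans subsetD)
   qed
   then show "a \<in> max_elems (T - S)" using a AT A up_frontier_above unfolding max_elems_def by blast
  qed
 qed
 show ubA: "upper_boundary T S = A"
 proof
  show "upper_boundary T S \<subseteq> A"
  proof
   fix x assume "x \<in> upper_boundary T S"
   then obtain s where "x \<in> T" "x \<notin> S" "s \<in> S" "s < x" unfolding upper_boundary_def covers_in_def by blast
   then show "x \<in> A" using stage_above[OF Sc A, of x s] TS by (auto simp: less_imp_le)
  qed
  show "A \<subseteq> upper_boundary T S"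
  proof
   fix a assume a: "a \<in> A"
   then obtain s where s: "s \<in> S" "s < a" "a \<notin> S" using up_frontier_above A by blast
   then obtain z where z: "z \<in> upper_boundary T S" "s < z" "z \<le> a"
    using upper_boundary_below[OF ST(1), of a s] a AT by blast
   then have "z \<in> T" "z \<notin> S" unfolding upper_boundary_def by auto
   then have "z \<in> A" using stage_above[OF Sc A, of z s] TS s z(2) by (auto simp: less_imp_le)
   then have "z = a" using up_frontier_antichain[of z S a] z A a by blast
   then show "a \<in> upper_boundary T S" using z by simp
  qed
 qed
 have minB: "min_elems (T - C) = B"
 proof
  show "min_elems (T - C) \<subseteq> B"
  proof
   fix x assume x: "x \<in> min_elems (T - C)"
   then have xT: "x \<in> T" "x \<notin> C" using min_elems_sub by auto
   then obtain b where b: "b \<in> B" "b \<le> x" using bel by blast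
   then have "\<not> b < x" using x BT B down_frontier_below unfolding min_elems_def by blast
   then have "b = x" using b by (metis order.not_eq_order_implies_strict)
   then show "x \<in> B" using b by blast
  qed
  show "B \<subseteq> min_elems (T - C)"
  proof
   fix b assume b: "b \<in> B"
   have "\<not> y < b" if y: "y \<in> T - C" for y
   proof
    assume "y < b"
    moreover obtain b' where "b' \<in> B" "b' \<le> y" using bel y by blast
    ultimately show False using down_frontier_antichain[of b' C b] b B by (metis leD less_imp_le order_trans subsetD Int_iff)
   qed
   then show "b \<in> min_elems (T - C)" using b BT B down_frontier_below unfolding min_elems_def by blast
  qed
 qed
 show lbB: "lower_boundary T C = B"
 proof
  show "lower_boundary T C \<subseteq> B"
  proof
   fix x assume "x \<in> lower_boundary T C"
   then obtain c where x: "x \<in> T" "x \<notin> C" "c \<in> C" "x < c" unfolding lower_boundary_def covers_in_def by blast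
   then obtain b where b: "b \<in> B" "b \<le> x" using bel by blast
   have "\<not> b < x" using x b B unfolding down_frontier_def max_elems_def by blast
   then have "b = x" using b by (metis order.not_eq_order_implies_strict)
   then show "x \<in> B" using b by blast
  qed
  show "B \<subseteq> lower_boundary T C"
  proof
   fix b assume b: "b \<in> B"
   then obtain c where c: "c \<in> C" "b < c" "b \<notin> C" using down_frontier_below B by blast
   then obtain z where z: "z \<in> lower_boundary T C" "z < c" "b \<le> z"
    using lower_boundary_above[OF ST(2), of b c] b BT by blast
   then have "z \<notin> C" unfolding lower_boundary_def by auto
   then have "\<not> b < z" using z c b B unfolding down_frontier_def max_elems_def by blast
   then have "b = z" using z by (metis order.not_eq_order_implies_strict)
   then show "b \<in> lower_boundary T C" using z by simp
  qed
 qed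
 \<comment> \<open>Everything is joined to the connected set \<open>S\<close>: an element outside it
   lies below some \<open>a\<close> in \<open>A\<close>, and every such \<open>a\<close> lies above
   an element of \<open>S\<close>.\<close>
 have "poset_connected T"
 proof -
  obtain s0 where s0: "s0 \<in> S" using Sn by blast
  let ?r = "{(a, b). a \<in> T & b \<in> T & (a \<le> b \<or> b \<le> a)}"
  have "sym ?r" unfolding sym_def by blast
  then have symr: "(x, y) \<in> ?r\<^sup>* ==> (y, x) \<in> ?r\<^sup>*" for x y by (meson sym_rtrancl symD)
  have S0: "(s0, s) \<in> ?r\<^sup>*" if "s \<in> S" for s
  proof -
   have "(s0, s) \<in> {(a, b). a \<in> S & b \<in> S & (a \<le> b \<or> b \<le> a)}\<^sup>*"
    using intervalsD(2)[OF S] s0 that unfolding poset_connected_def by blast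
   moreover have "{(a, b). a \<in> S & b \<in> S & (a \<le> b \<or> b \<le> a)} \<subseteq> ?r" using ST by blast
   ultimately show ?thesis using rtrancl_mono by blast
  qed
  have A0: "(s0, a) \<in> ?r\<^sup>*" if a: "a \<in> A" for a
  proof -
   obtain s where s: "s \<in> S" "s < a" using up_frontier_above A a by blast
   then have "(s, a) \<in> ?r" using ST AT a by (auto simp: less_imp_le)
   then show ?thesis using S0[OF s(1)] by (rule rtrancl_into_rtrancl[rotated])
  qed
  have "(s0, x) \<in> ?r\<^sup>*" if x: "x \<in> T" for x
  proof (cases "x \<in> S")
   case True then show ?thesis using S0 by blast
  next
   case False
   then obtain a where a: "a \<in> A" "x \<le> a" using stage_below[OF Sc, of x A] TS x by blast
   then have "(a, x) \<in> ?r" using x AT by auto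
   then show ?thesis using A0[OF a(1)] by (rule rtrancl_into_rtrancl[rotated])
  qed
  then show ?thesis unfolding poset_connected_def using symr by (blast intro: rtrancl_trans)
 qed
 then have "T \<in> intervals" using Tc ST Sn unfolding intervals_def by blast
 then show "T \<in> W_set S C" unfolding W_set_def using SD CU ubA lbB maxA minB by simp
qed

lemma boundary_bij:
 fixes S :: "'p::{finite,order} set"
 assumes S: "S \<in> intervals" and C: "C \<in> intervals"
 shows "bij_betw (boundary S C) (W_set S C) (psi S C)"
  and "!!F. F \<in> psi S C ==> span_hull S C (lefts F) (rights F) \<in> W_set S C"
  and "!!F. F \<in> psi S C ==> boundary S C (span_hull S C (lefts F) (rights F)) = F"
  and "!!T. T \<in> W_set S C ==> boundary S C T \<in> psi S C"
  and "!!T. T \<in> W_set S C ==> span_hull S C (lefts (boundary S C T)) (rights (boundary S C T)) = T"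
proof -
 show 1: "!!F. F \<in> psi S C ==> span_hull S C (lefts F) (rights F) \<in> W_set S C"
  unfolding psi_def using span_hull_W_set(1)[OF S C] by blast
 show 2: "!!F. F \<in> psi S C ==> boundary S C (span_hull S C (lefts F) (rights F)) = F"
  unfolding psi_def boundary_def using span_hull_W_set(2,3)[OF S C] by simp
 show 3: "!!T. T \<in> W_set S C ==> boundary S C T \<in> psi S C"
  unfolding psi_def boundary_def using W_set_properties[OF S C] by simp
 show 4: "!!T. T \<in> W_set S C ==> span_hull S C (lefts (boundary S C T)) (rights (boundary S C T)) = T"
  unfolding boundary_def using W_set_properties(5)[OF S C] by simp
 show "bij_betw (boundary S C) (W_set S C) (psi S C)"
  by (rule bij_betwI[where g = "%F. span_hull S C (lefts F) (rights F)"]) (use 1 2 3 4 in auto)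
qed

text \<open>This makes covers in \<open>psi\<close> one-element enlargements. If the right parts
  agree, a left element may be added at the bottom, because being an upset of the stage is inherited
  between two stages. If they differ, a right element of \<open>G\<close> missing from
  \<open>F\<close> may be removed at the top, since it cannot be in
  \<open>min_elems S - C\<close>.\<close>

lemma psi_between:
 fixes S :: "'p::{finite,order} set"
 assumes F: "F \<in> psi S C" and G: "G \<in> psi S C" and sub: "F \<subset> G"
 shows "\<exists>w\<in>G - F. insert w F \<in> psi S C \<or> G - {w} \<in> psi S C"
proof (cases "rights F = rights G")
 case True
 then obtain a where a: "a \<in> lefts G - lefts F"
  using sub lefts_rights_mono[of F G] by (metis Diff_iff Plus_lefts_rights psubsetE subsetI subset_antisym)
 have l: "lefts (insert (Inl a) F) = insert a (lefts F)" "rights (insert (Inl a) F) = rights F"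
  unfolding lefts_def rights_def by auto
 have "lefts F \<subseteq> insert a (lefts F)" "insert a (lefts F) \<subseteq> lefts G"
  using a sub lefts_rights_mono[of F G] by auto
 then have "stage S (lefts F) \<subseteq> stage S (insert a (lefts F))" "stage S (insert a (lefts F)) \<subseteq> stage S (lefts G)"
  using stage_mono by blast+
 note st = this
 have up: "rel_upset C (stage S (lefts F))" "rel_upset C (stage S (lefts G))" using F G unfolding psi_def by auto
 have "rel_upset C (stage S (insert a (lefts F)))"
  using up st unfolding rel_upset_def by (meson subsetD subset_trans)
 moreover have "insert a (lefts F) \<subseteq> up_frontier S" using a F G unfolding psi_def by blast
 moreover have "min_elems S - C \<subseteq> rights F" "rights F \<subseteq> down_frontier C \<inter> stage S (insert a (lefts F))"
  using F st(1) unfolding psi_def by auto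
 ultimately have "insert (Inl a) F \<in> psi S C" unfolding psi_def mem_Collect_eq l by blast
 moreover have "Inl a \<in> G - F" using a unfolding lefts_def by auto
 ultimately show ?thesis by blast
next
 case False
 then obtain b where b: "b \<in> rights G" "b \<notin> rights F" using lefts_rights_mono[of F G] sub by blast
 have l: "lefts (G - {Inr b}) = lefts G" "rights (G - {Inr b}) = rights G - {b}"
  unfolding lefts_def rights_def by auto
 have "min_elems S - C \<subseteq> rights G - {b}" using F b lefts_rights_mono[of F G] sub unfolding psi_def by blast
 then have "G - {Inr b} \<in> psi S C" using G unfolding psi_def mem_Collect_eq l by blast
 moreover have "Inr b \<in> G - F" using b unfolding rights_def by auto
 ultimately show ?thesis by blast
qed

text \<open>\<open>boundary\<close> is an isomorphism of ordered sets onto \<open>psi S C\<close>: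
  its inverse \<open>span_hull\<close> is visibly monotone, and it is monotone itself because covers
  of a convex set remain covers in a larger one. The claim then follows from
  \<open>psi_between\<close>.\<close>

lemma covers_in_W_set:
 fixes S :: "'p::{finite,order} set"
 assumes S: "S \<in> intervals" and C: "C \<in> intervals" and T: "T \<in> W_set S C" and R: "R \<in> W_set S C"
 shows "covers_in (W_set S C) T R \<longleftrightarrow> (EX w. w \<notin> boundary S C T & boundary S C R = insert w (boundary S C T))"
proof -
 note bb = boundary_bij[OF S C]
 let ?b = "boundary S C" and ?h = "%F. span_hull S C (lefts F) (rights F)"
 have mono: "?b T1 \<subseteq> ?b T2 \<longleftrightarrow> T1 \<subseteq> T2" if T1: "T1 \<in> W_set S C" and T2: "T2 \<in> W_set S C" for T1 T2
 proof
  assume "?b T1 \<subseteq> ?b T2"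
  then have "lefts (?b T1) \<subseteq> lefts (?b T2)" "rights (?b T1) \<subseteq> rights (?b T2)" using lefts_rights_mono by blast+
  then have "?h (?b T1) \<subseteq> ?h (?b T2)" unfolding span_hull_def by blast
  then show "T1 \<subseteq> T2" using bb(5) T1 T2 by simp
 next
  assume sub: "T1 \<subseteq> T2"
  have cx: "poset_convex T1" using T1 intervalsD(3) unfolding W_set_def by blast
  have d: "rel_downset S T2" "rel_upset C T2" "rel_downset S T1" "rel_upset C T1" using T1 T2 unfolding W_set_def by auto
  \<comment> \<open>Convexity puts everything strictly between \<open>x\<close> and \<open>y\<close>
    into \<open>T1\<close>, so no new element of \<open>T2\<close> can separate them.\<close>
  have cov: "covers_in T2 x y" if "covers_in T1 x y" for x y
  proof -
   have xy: "x \<in> T1" "y \<in> T1" "x < y" and no: "!!z. z \<in> T1 ==> \<not> (x < z & z < y)"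
    using that unfolding covers_in_def by auto
   have "\<not> (x < z & z < y)" for z
    using no[of z] poset_convexD[OF cx xy(1,2), of z] less_imp_le by metis
   then show ?thesis using xy sub unfolding covers_in_def by blast
  qed
  have "upper_boundary T1 S \<subseteq> upper_boundary T2 S" "lower_boundary T1 C \<subseteq> lower_boundary T2 C"
   unfolding upper_boundary_def lower_boundary_def using cov sub by auto
  then show "?b T1 \<subseteq> ?b T2" unfolding boundary_def by auto
 qed
 have mono': "?b T1 \<subset> ?b T2 \<longleftrightarrow> T1 \<subset> T2" if "T1 \<in> W_set S C" and "T2 \<in> W_set S C" for T1 T2
  using mono[OF that] mono[OF that(2,1)] by blast
 show ?thesis
 proof
  assume cov: "covers_in (W_set S C) T R"
  then have "?b T \<subset> ?b R" using mono'[OF T R] unfolding covers_in_def by blast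
  then obtain w where w: "w \<in> ?b R - ?b T" "insert w (?b T) \<in> psi S C \<or> ?b R - {w} \<in> psi S C"
   using psi_between[OF bb(4)[OF T] bb(4)[OF R]] by blast
  have no: "\<not> (?b T \<subset> F & F \<subset> ?b R)" if F: "F \<in> psi S C" for F
  proof -
   have "\<not> (T \<subset> ?h F & ?h F \<subset> R)" using cov bb(2)[OF F] unfolding covers_in_def by blast
   then show ?thesis using mono'[OF T bb(2)[OF F]] mono'[OF bb(2)[OF F] R] bb(3)[OF F] by metis
  qed
  from w(2) show "EX w. w \<notin> ?b T & ?b R = insert w (?b T)"
  proof
   assume "insert w (?b T) \<in> psi S C"
   then have "insert w (?b T) = ?b R" using no \<open>?b T \<subset> ?b R\<close> w(1) by blast
   then show ?thesis using w(1) by blast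
  next
   assume "?b R - {w} \<in> psi S C"
   then have "?b R - {w} = ?b T" using no \<open>?b T \<subset> ?b R\<close> w(1) by blast
   then show ?thesis using w(1) by blast
  qed
 next
  assume "EX w. w \<notin> ?b T & ?b R = insert w (?b T)"
  then obtain w where w: "w \<notin> ?b T" "?b R = insert w (?b T)" by blast
  have "\<not> (T \<subset> Z & Z \<subset> R)" if "Z \<in> W_set S C" for Z
   using mono'[OF T that] mono'[OF that R] w by auto
  moreover have "T \<subset> R" using mono'[OF T R] w by auto
  ultimately show "covers_in (W_set S C) T R" unfolding covers_in_def using T R by blast
 qed
qed

section \<open>Left modules\<close>

lemma kk_simps [simp]:
 "carrier (kk :: 'k::field ring) = UNIV" "monoid.mult (kk :: 'k ring) = (*)" "one (kk :: 'k ring) = 1"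
 "zero (kk :: 'k ring) = 0" "add (kk :: 'k ring) = (+)"
 unfolding ring_of_type_algebra_def by auto

lemma ring_kk: "ring (kk :: 'k::field ring)" by (rule ring_from_type_algebra)

lemma kk_a_inv [simp]: "\<ominus>\<^bsub>kk\<^esub> (a :: 'k::field) = - a"
proof -
 interpret ring "kk :: 'k ring" by (rule ring_kk)
 show ?thesis by (rule minus_equality) auto
qed

text \<open>All identities are checked after applying the injective map \<open>l\<close>. Negatives
  come from the scalar \<open>\<ominus> \<one>\<close>, so closure under addition and scalars
  suffices.\<close>

lemma left_module_inj:
 assumes M: "left_module R M" and l: "!!x. x \<in> carrier N ==> l x \<in> carrier M"
  and inj: "inj_on l (carrier N)"
  and zc: "\<zero>\<^bsub>N\<^esub> \<in> carrier N" and z: "l \<zero>\<^bsub>N\<^esub> = \<zero>\<^bsub>M\<^esub>"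
  and ac: "!!x y. x \<in> carrier N ==> y \<in> carrier N ==> x \<oplus>\<^bsub>N\<^esub> y \<in> carrier N"
  and a: "!!x y. x \<in> carrier N ==> y \<in> carrier N ==> l (x \<oplus>\<^bsub>N\<^esub> y) = l x \<oplus>\<^bsub>M\<^esub> l y"
  and sc: "!!r x. r \<in> carrier R ==> x \<in> carrier N ==> r \<odot>\<^bsub>N\<^esub> x \<in> carrier N"
  and s: "!!r x. r \<in> carrier R ==> x \<in> carrier N ==> l (r \<odot>\<^bsub>N\<^esub> x) = r \<odot>\<^bsub>M\<^esub> l x"
 shows "left_module R N"
proof -
 interpret M: left_module R M by fact
 have eq: "x = y" if "x \<in> carrier N" "y \<in> carrier N" "l x = l y" for x y
  using inj that unfolding inj_on_def by blast
 have neg: "l ((\<ominus>\<^bsub>R\<^esub> \<one>\<^bsub>R\<^esub>) \<odot>\<^bsub>N\<^esub> x) \<oplus>\<^bsub>M\<^esub> l x = \<zero>\<^bsub>M\<^esub>" if x: "x \<in> carrier N" for x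
 proof -
  have "l ((\<ominus>\<^bsub>R\<^esub> \<one>\<^bsub>R\<^esub>) \<odot>\<^bsub>N\<^esub> x) \<oplus>\<^bsub>M\<^esub> l x = (\<ominus>\<^bsub>R\<^esub> \<one>\<^bsub>R\<^esub>) \<odot>\<^bsub>M\<^esub> l x \<oplus>\<^bsub>M\<^esub> \<one>\<^bsub>R\<^esub> \<odot>\<^bsub>M\<^esub> l x"
   using x s l M.smult_one by simp
  also have "\<dots> = \<zero>\<^bsub>R\<^esub> \<odot>\<^bsub>M\<^esub> l x"
   using M.smult_l_distr[of "\<ominus>\<^bsub>R\<^esub> \<one>\<^bsub>R\<^esub>" "\<one>\<^bsub>R\<^esub>" "l x"] l x M.R.l_neg by simp
  also have "\<zero>\<^bsub>R\<^esub> \<odot>\<^bsub>M\<^esub> l x = \<zero>\<^bsub>M\<^esub>"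
  proof -
   have "\<zero>\<^bsub>R\<^esub> \<odot>\<^bsub>M\<^esub> l x \<oplus>\<^bsub>M\<^esub> \<zero>\<^bsub>R\<^esub> \<odot>\<^bsub>M\<^esub> l x = \<zero>\<^bsub>R\<^esub> \<odot>\<^bsub>M\<^esub> l x"
    using M.smult_l_distr[of "\<zero>\<^bsub>R\<^esub>" "\<zero>\<^bsub>R\<^esub>" "l x"] l x by simp
   then show ?thesis using M.M.add.l_cancel_one M.smult_closed l x M.R.zero_closed by metis
  qed
  finally show ?thesis .
 qed
 show ?thesis
 proof (intro left_module.intro M.R.ring_axioms abelian_groupI left_module_axioms.intro)
  fix x assume x: "x \<in> carrier N"
  show "\<exists>y\<in>carrier N. y \<oplus>\<^bsub>N\<^esub> x = \<zero>\<^bsub>N\<^esub>"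
  proof (rule bexI[of _ "(\<ominus>\<^bsub>R\<^esub> \<one>\<^bsub>R\<^esub>) \<odot>\<^bsub>N\<^esub> x"])
   show c: "(\<ominus>\<^bsub>R\<^esub> \<one>\<^bsub>R\<^esub>) \<odot>\<^bsub>N\<^esub> x \<in> carrier N" using sc x by simp
   show "(\<ominus>\<^bsub>R\<^esub> \<one>\<^bsub>R\<^esub>) \<odot>\<^bsub>N\<^esub> x \<oplus>\<^bsub>N\<^esub> x = \<zero>\<^bsub>N\<^esub>"
    by (rule eq) (use c x zc ac a z neg in auto)
  qed
 next
  fix x y assume x: "x \<in> carrier N" and y: "y \<in> carrier N"
  show "x \<oplus>\<^bsub>N\<^esub> y = y \<oplus>\<^bsub>N\<^esub> x" by (rule eq) (use x y ac a l M.M.add.m_comm in auto)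
 next
  fix x y w assume x: "x \<in> carrier N" and y: "y \<in> carrier N" and w: "w \<in> carrier N"
  show "(x \<oplus>\<^bsub>N\<^esub> y) \<oplus>\<^bsub>N\<^esub> w = x \<oplus>\<^bsub>N\<^esub> (y \<oplus>\<^bsub>N\<^esub> w)"
   by (rule eq) (use x y w ac a l M.M.add.m_assoc in auto)
 next
  fix x assume x: "x \<in> carrier N"
  show "\<zero>\<^bsub>N\<^esub> \<oplus>\<^bsub>N\<^esub> x = x" by (rule eq) (use x zc ac a z l in auto)
  show "\<one>\<^bsub>R\<^esub> \<odot>\<^bsub>N\<^esub> x = x" by (rule eq) (use x sc s l M.smult_one in auto)
 next
  fix r t x assume r: "r \<in> carrier R" "t \<in> carrier R" and x: "x \<in> carrier N"
  show "(r \<oplus>\<^bsub>R\<^esub> t) \<odot>\<^bsub>N\<^esub> x = r \<odot>\<^bsub>N\<^esub> x \<oplus>\<^bsub>N\<^esub> t \<odot>\<^bsub>N\<^esub> x"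
   by (rule eq) (use r x sc s ac a l M.smult_l_distr in auto)
  show "(r \<otimes>\<^bsub>R\<^esub> t) \<odot>\<^bsub>N\<^esub> x = r \<odot>\<^bsub>N\<^esub> (t \<odot>\<^bsub>N\<^esub> x)"
   by (rule eq) (use r x sc s l M.smult_assoc in auto)
 next
  fix r x y assume r: "r \<in> carrier R" and x: "x \<in> carrier N" and y: "y \<in> carrier N"
  show "r \<odot>\<^bsub>N\<^esub> (x \<oplus>\<^bsub>N\<^esub> y) = r \<odot>\<^bsub>N\<^esub> x \<oplus>\<^bsub>N\<^esub> r \<odot>\<^bsub>N\<^esub> y"
   by (rule eq) (use r x y sc s ac a l M.smult_r_distr in auto)
 qed (use zc ac sc in auto)
qed

context left_module
begin

lemma smult_zero_left: "x \<in> carrier M ==> \<zero> \<odot>\<^bsub>M\<^esub> x = \<zero>\<^bsub>M\<^esub>"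
 using smult_l_distr[of \<zero> \<zero> x] M.add.l_cancel_one smult_closed R.zero_closed by (metis R.l_zero)

lemma smult_zero_right: "r \<in> carrier R ==> r \<odot>\<^bsub>M\<^esub> \<zero>\<^bsub>M\<^esub> = \<zero>\<^bsub>M\<^esub>"
 using smult_r_distr[of r "\<zero>\<^bsub>M\<^esub>" "\<zero>\<^bsub>M\<^esub>"] M.add.l_cancel_one smult_closed M.zero_closed by (metis M.l_zero)

lemma smult_minus_one: "x \<in> carrier M ==> (\<ominus> \<one>) \<odot>\<^bsub>M\<^esub> x = \<ominus>\<^bsub>M\<^esub> x"
proof -
 assume x: "x \<in> carrier M"
 have "(\<ominus> \<one>) \<odot>\<^bsub>M\<^esub> x \<oplus>\<^bsub>M\<^esub> x = \<zero>\<^bsub>M\<^esub>"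
  using smult_l_distr[of "\<ominus> \<one>" "\<one>" x] x R.l_neg smult_zero_left smult_one by simp
 then show ?thesis using M.minus_equality[of "(\<ominus> \<one>) \<odot>\<^bsub>M\<^esub> x" x] x smult_closed by simp
qed

lemma submoduleI:
 assumes "H \<subseteq> carrier M" "\<zero>\<^bsub>M\<^esub> \<in> H" "!!x y. x \<in> H ==> y \<in> H ==> x \<oplus>\<^bsub>M\<^esub> y \<in> H"
  "!!r x. r \<in> carrier R ==> x \<in> H ==> r \<odot>\<^bsub>M\<^esub> x \<in> H"
 shows "submodule H R M"
proof (intro submodule.intro subgroup.intro submodule_axioms.intro)
 fix x assume x: "x \<in> H"
 then have "\<ominus>\<^bsub>M\<^esub> x = (\<ominus> \<one>) \<odot>\<^bsub>M\<^esub> x" using smult_minus_one assms(1) by auto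
 also have "\<dots> \<in> H" using assms(4) x by simp
 finally show "inv\<^bsub>add_monoid M\<^esub> x \<in> H" unfolding a_inv_def .
qed (use assms in auto)

lemma submoduleD:
 assumes "submodule H R M"
 shows "H \<subseteq> carrier M" "\<zero>\<^bsub>M\<^esub> \<in> H" "!!x y. x \<in> H ==> y \<in> H ==> x \<oplus>\<^bsub>M\<^esub> y \<in> H"
  "!!r x. r \<in> carrier R ==> x \<in> H ==> r \<odot>\<^bsub>M\<^esub> x \<in> H" "!!x. x \<in> H ==> \<ominus>\<^bsub>M\<^esub> x \<in> H"
proof -
 interpret H: submodule H R M by fact
 show "H \<subseteq> carrier M" using H.subset by simp
 show "\<zero>\<^bsub>M\<^esub> \<in> H" using H.one_closed by simp
 show "!!x y. x \<in> H ==> y \<in> H ==> x \<oplus>\<^bsub>M\<^esub> y \<in> H" using H.m_closed by simp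
 show "!!r x. r \<in> carrier R ==> x \<in> H ==> r \<odot>\<^bsub>M\<^esub> x \<in> H" by simp
 show "!!x. x \<in> H ==> \<ominus>\<^bsub>M\<^esub> x \<in> H" using H.m_inv_closed unfolding a_inv_def by simp
qed

end

lemma generated_submodule:
 assumes M: "left_module R M" and A: "A \<subseteq> carrier M"
 shows "submodule (generated_submodule R M A) R M" and "A \<subseteq> generated_submodule R M A"
  and "!!N. submodule N R M ==> A \<subseteq> N ==> generated_submodule R M A \<subseteq> N"
proof -
 interpret left_module R M by fact
 show "submodule (generated_submodule R M A) R M"
  unfolding generated_submodule_def
 proof (rule submoduleI)
  fix r x assume "r \<in> carrier R" "x \<in> carrier M \<inter> \<Inter> {N. submodule N R M & A \<subseteq> N}"
  then show "r \<odot>\<^bsub>M\<^esub> x \<in> carrier M \<inter> \<Inter> {N. submodule N R M & A \<subseteq> N}"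
   using submoduleD(4) by (auto simp: smult_closed)
 next
  fix x y assume "x \<in> carrier M \<inter> \<Inter> {N. submodule N R M & A \<subseteq> N}" "y \<in> carrier M \<inter> \<Inter> {N. submodule N R M & A \<subseteq> N}"
  then show "x \<oplus>\<^bsub>M\<^esub> y \<in> carrier M \<inter> \<Inter> {N. submodule N R M & A \<subseteq> N}"
   using submoduleD(3) by auto
 qed (use submoduleD(2) in auto)
qed (use A in \<open>auto simp: generated_submodule_def\<close>)

subsection \<open>Quotients\<close>

lemma
 assumes M: "left_module R M" and N: "submodule N R M"
 shows quotient_eq_iff: "!!x y. x \<in> carrier M ==> y \<in> carrier M ==> N +>\<^bsub>M\<^esub> x = N +>\<^bsub>M\<^esub> y \<longleftrightarrow> x \<ominus>\<^bsub>M\<^esub> y \<in> N"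
  and quotient_add: "!!x y. x \<in> carrier M ==> y \<in> carrier M ==>
   (N +>\<^bsub>M\<^esub> x) \<oplus>\<^bsub>quotient_module M N\<^esub> (N +>\<^bsub>M\<^esub> y) = N +>\<^bsub>M\<^esub> (x \<oplus>\<^bsub>M\<^esub> y)"
  and quotient_smult: "!!r x. r \<in> carrier R ==> x \<in> carrier M ==>
   r \<odot>\<^bsub>quotient_module M N\<^esub> (N +>\<^bsub>M\<^esub> x) = N +>\<^bsub>M\<^esub> (r \<odot>\<^bsub>M\<^esub> x)"
  and left_module_quotient: "left_module R (quotient_module M N)"
  and quotient_carrier: "carrier (quotient_module M N) = (%x. N +>\<^bsub>M\<^esub> x) ` carrier M"
  and quotient_zero: "\<zero>\<^bsub>quotient_module M N\<^esub> = N +>\<^bsub>M\<^esub> \<zero>\<^bsub>M\<^esub>"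
proof -
 interpret M: left_module R M by fact
 interpret N: submodule N R M by fact
 note Nd = M.submoduleD[OF N]
 interpret A: abelian_subgroup N M
  by (intro abelian_subgroupI3 additive_subgroup.intro N.subgroup_axioms M.M.abelian_group_axioms)
 show eq: "!!x y. x \<in> carrier M ==> y \<in> carrier M ==> N +>\<^bsub>M\<^esub> x = N +>\<^bsub>M\<^esub> y \<longleftrightarrow> x \<ominus>\<^bsub>M\<^esub> y \<in> N"
 proof -
  fix x y assume x: "x \<in> carrier M" and y: "y \<in> carrier M"
  have "x \<ominus>\<^bsub>M\<^esub> y \<in> N \<longleftrightarrow> x \<in> N +>\<^bsub>M\<^esub> y"
   using A.a_rcos_module[OF y x] by (simp add: a_minus_def)
  also have "\<dots> \<longleftrightarrow> N +>\<^bsub>M\<^esub> x = N +>\<^bsub>M\<^esub> y"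
   using A.a_repr_independence'[of x y] A.a_rcos_self[OF x] x y by metis
  finally show "N +>\<^bsub>M\<^esub> x = N +>\<^bsub>M\<^esub> y \<longleftrightarrow> x \<ominus>\<^bsub>M\<^esub> y \<in> N" by simp
 qed
 show add: "!!x y. x \<in> carrier M ==> y \<in> carrier M ==>
   (N +>\<^bsub>M\<^esub> x) \<oplus>\<^bsub>quotient_module M N\<^esub> (N +>\<^bsub>M\<^esub> y) = N +>\<^bsub>M\<^esub> (x \<oplus>\<^bsub>M\<^esub> y)"
  unfolding quotient_module_def using A.a_rcos_sum by simp
 show smult: "!!r x. r \<in> carrier R ==> x \<in> carrier M ==>
   r \<odot>\<^bsub>quotient_module M N\<^esub> (N +>\<^bsub>M\<^esub> x) = N +>\<^bsub>M\<^esub> (r \<odot>\<^bsub>M\<^esub> x)"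
 proof -
  fix r x assume r: "r \<in> carrier R" and x: "x \<in> carrier M"
  have "N +>\<^bsub>M\<^esub> (r \<odot>\<^bsub>M\<^esub> y) = N +>\<^bsub>M\<^esub> (r \<odot>\<^bsub>M\<^esub> x)" if y: "y \<in> N +>\<^bsub>M\<^esub> x" for y
  proof -
   obtain n where n: "n \<in> N" "y = n \<oplus>\<^bsub>M\<^esub> x" using y unfolding a_r_coset_def r_coset_def by auto
   have nc: "n \<in> carrier M" using n Nd(1) by blast
   have "r \<odot>\<^bsub>M\<^esub> y = r \<odot>\<^bsub>M\<^esub> n \<oplus>\<^bsub>M\<^esub> r \<odot>\<^bsub>M\<^esub> x" using n r x nc M.smult_r_distr by simp
   then have "r \<odot>\<^bsub>M\<^esub> y \<ominus>\<^bsub>M\<^esub> r \<odot>\<^bsub>M\<^esub> x = r \<odot>\<^bsub>M\<^esub> n"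
    using M.smult_closed r x nc by (simp add: M.M.minus_eq M.M.a_assoc M.M.r_neg)
   also have "\<dots> \<in> N" using Nd(4) r n by blast
   finally show ?thesis using eq M.smult_closed r x nc n by auto
  qed
  moreover have "x \<in> N +>\<^bsub>M\<^esub> x" using A.a_rcos_self x by blast
  ultimately have "(\<Union>y\<in>N +>\<^bsub>M\<^esub> x. N +>\<^bsub>M\<^esub> (r \<odot>\<^bsub>M\<^esub> y)) = N +>\<^bsub>M\<^esub> (r \<odot>\<^bsub>M\<^esub> x)" by blast
  then show "r \<odot>\<^bsub>quotient_module M N\<^esub> (N +>\<^bsub>M\<^esub> x) = N +>\<^bsub>M\<^esub> (r \<odot>\<^bsub>M\<^esub> x)"
   unfolding quotient_module_def by simp
 qed
 show carr: "carrier (quotient_module M N) = (%x. N +>\<^bsub>M\<^esub> x) ` carrier M"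
  unfolding quotient_module_def by auto
 show zero: "\<zero>\<^bsub>quotient_module M N\<^esub> = N +>\<^bsub>M\<^esub> \<zero>\<^bsub>M\<^esub>"
  unfolding quotient_module_def using Nd(1) by simp
 show "left_module R (quotient_module M N)"
 proof (intro left_module.intro M.R.ring_axioms abelian_groupI left_module_axioms.intro)
  fix z assume "z \<in> carrier (quotient_module M N)"
  then obtain x where x: "z = N +>\<^bsub>M\<^esub> x" "x \<in> carrier M" unfolding carr by blast
  have "(N +>\<^bsub>M\<^esub> (\<ominus>\<^bsub>M\<^esub> x)) \<oplus>\<^bsub>quotient_module M N\<^esub> z = \<zero>\<^bsub>quotient_module M N\<^esub>"
   using x by (simp add: add zero M.M.l_neg)
  then show "\<exists>y\<in>carrier (quotient_module M N). y \<oplus>\<^bsub>quotient_module M N\<^esub> z = \<zero>\<^bsub>quotient_module M N\<^esub>"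
   using x unfolding carr by blast
 qed (auto simp: carr add zero smult M.smult_closed M.smult_one M.smult_l_distr M.smult_r_distr M.smult_assoc
   M.M.a_ac)
qed

subsection \<open>Modules with a coordinate\<close>

text \<open>A module isomorphic to the one-dimensional space \<open>'k\<close>, on which scalars act through \<open>\<chi>\<close>.\<close>

definition coordinate :: "'r ring => ('r => 'k::field) => ('r, 'm) module => ('m => 'k) => bool" where
 "coordinate R \<chi> M l \<longleftrightarrow> left_module R M & bij_betw l (carrier M) UNIV &
   (\<forall>x\<in>carrier M. \<forall>y\<in>carrier M. l (x \<oplus>\<^bsub>M\<^esub> y) = l x + l y) &
   (\<forall>r\<in>carrier R. \<forall>x\<in>carrier M. l (r \<odot>\<^bsub>M\<^esub> x) = \<chi> r * l x)"

lemma coordinateD: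
 assumes "coordinate R \<chi> M l"
 shows "left_module R M" "bij_betw l (carrier M) UNIV"
  "!!x y. x \<in> carrier M ==> y \<in> carrier M ==> l (x \<oplus>\<^bsub>M\<^esub> y) = l x + l y"
  "!!r x. r \<in> carrier R ==> x \<in> carrier M ==> l (r \<odot>\<^bsub>M\<^esub> x) = \<chi> r * l x"
  "!!x y. x \<in> carrier M ==> y \<in> carrier M ==> l x = l y ==> x = y"
  "!!a. inv_into (carrier M) l a \<in> carrier M" "!!a. l (inv_into (carrier M) l a) = a"
  "l \<zero>\<^bsub>M\<^esub> = 0"
proof -
 show 1: "left_module R M" and 2: "bij_betw l (carrier M) UNIV"
  and 3: "!!x y. x \<in> carrier M ==> y \<in> carrier M ==> l (x \<oplus>\<^bsub>M\<^esub> y) = l x + l y"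
  and "!!r x. r \<in> carrier R ==> x \<in> carrier M ==> l (r \<odot>\<^bsub>M\<^esub> x) = \<chi> r * l x"
  using assms unfolding coordinate_def by auto
 show "!!x y. x \<in> carrier M ==> y \<in> carrier M ==> l x = l y ==> x = y"
  using 2 unfolding bij_betw_def inj_on_def by blast
 have im: "l ` carrier M = UNIV" using 2 unfolding bij_betw_def by blast
 show "!!a. inv_into (carrier M) l a \<in> carrier M" using im by (metis UNIV_I inv_into_into)
 show "!!a. l (inv_into (carrier M) l a) = a" using im by (metis UNIV_I f_inv_into_f)
 interpret left_module R M by fact
 show "l \<zero>\<^bsub>M\<^esub> = 0" using 3[of "\<zero>\<^bsub>M\<^esub>" "\<zero>\<^bsub>M\<^esub>"] by (metis M.l_zero M.zero_closed add_cancel_right_right)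
qed

lemma quotient_coordinate:
 fixes h :: "'m => 'k::field"
 assumes M: "left_module R M" and N: "submodule N R M"
  and add: "!!x y. x \<in> carrier M ==> y \<in> carrier M ==> h (x \<oplus>\<^bsub>M\<^esub> y) = h x + h y"
  and smult: "!!r x. r \<in> carrier R ==> x \<in> carrier M ==> h (r \<odot>\<^bsub>M\<^esub> x) = \<chi> r * h x"
  and surj: "h ` carrier M = UNIV" and ker: "!!x. x \<in> carrier M ==> h x = 0 \<longleftrightarrow> x \<in> N"
 shows "EX l. coordinate R \<chi> (quotient_module M N) l & (\<forall>x\<in>carrier M. l (N +>\<^bsub>M\<^esub> x) = h x)"
proof -
 interpret M: left_module R M by fact
 have zero: "h \<zero>\<^bsub>M\<^esub> = 0" using add[of "\<zero>\<^bsub>M\<^esub>" "\<zero>\<^bsub>M\<^esub>"] by (metis M.M.l_zero M.M.zero_closed add_cancel_right_right)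
 have neg: "h (\<ominus>\<^bsub>M\<^esub> x) = - h x" if "x \<in> carrier M" for x
  using add[of x "\<ominus>\<^bsub>M\<^esub> x"] that zero by (simp add: M.M.r_neg eq_neg_iff_add_eq_0 add.commute)
 have eq: "N +>\<^bsub>M\<^esub> x = N +>\<^bsub>M\<^esub> y \<longleftrightarrow> h x = h y" if "x \<in> carrier M" "y \<in> carrier M" for x y
  using quotient_eq_iff[OF M N that] ker[of "x \<ominus>\<^bsub>M\<^esub> y"] add[of x "\<ominus>\<^bsub>M\<^esub> y"] neg that
  by (simp add: M.M.minus_eq)
 define l where "l z = h (SOME x. x \<in> carrier M & z = N +>\<^bsub>M\<^esub> x)" for z
 have l: "l (N +>\<^bsub>M\<^esub> x) = h x" if x: "x \<in> carrier M" for x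
 proof -
  have "(SOME y. y \<in> carrier M & N +>\<^bsub>M\<^esub> x = N +>\<^bsub>M\<^esub> y) \<in> carrier M &
    N +>\<^bsub>M\<^esub> x = N +>\<^bsub>M\<^esub> (SOME y. y \<in> carrier M & N +>\<^bsub>M\<^esub> x = N +>\<^bsub>M\<^esub> y)"
   by (rule someI[of _ x]) (use x in auto)
  then show ?thesis unfolding l_def using eq[OF x] by auto
 qed
 note carr = quotient_carrier[OF M N]
 have "bij_betw l (carrier (quotient_module M N)) UNIV"
  unfolding bij_betw_def inj_on_def
 proof (intro conjI ballI impI)
  show "l ` carrier (quotient_module M N) = UNIV" unfolding carr image_image using surj l by auto
  fix x y assume "x \<in> carrier (quotient_module M N)" "y \<in> carrier (quotient_module M N)" "l x = l y"
  then show "x = y" unfolding carr using l eq by (elim imageE) metis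
 qed
 then have "coordinate R \<chi> (quotient_module M N) l"
  unfolding coordinate_def using left_module_quotient[OF M N]
  by (auto simp: carr l quotient_add[OF M N] quotient_smult[OF M N] add smult M.smult_closed)
 then show ?thesis using l by blast
qed

subsection \<open>Linear maps\<close>

lemma lin_homI:
 assumes "!!x. x \<in> carrier M ==> f x \<in> carrier N" "!!x. x \<notin> carrier M ==> f x = undefined"
  "!!x y. x \<in> carrier M ==> y \<in> carrier M ==> f (x \<oplus>\<^bsub>M\<^esub> y) = f x \<oplus>\<^bsub>N\<^esub> f y"
  "!!r x. r \<in> carrier R ==> x \<in> carrier M ==> f (r \<odot>\<^bsub>M\<^esub> x) = r \<odot>\<^bsub>N\<^esub> f x"
 shows "f \<in> lin_hom R M N"
 using assms unfolding lin_hom_def by (auto simp: PiE_def Pi_def extensional_def)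

lemma lin_homD:
 assumes "f \<in> lin_hom R M N"
 shows "!!x. x \<in> carrier M ==> f x \<in> carrier N" "!!x. x \<notin> carrier M ==> f x = undefined"
  "!!x y. x \<in> carrier M ==> y \<in> carrier M ==> f (x \<oplus>\<^bsub>M\<^esub> y) = f x \<oplus>\<^bsub>N\<^esub> f y"
  "!!r x. r \<in> carrier R ==> x \<in> carrier M ==> f (r \<odot>\<^bsub>M\<^esub> x) = r \<odot>\<^bsub>N\<^esub> f x"
 using assms unfolding lin_hom_def by (auto simp: PiE_def Pi_def extensional_def)

lemma lin_hom_eqI:
 assumes "f \<in> lin_hom R M N" "g \<in> lin_hom R M N" "!!x. x \<in> carrier M ==> f x = g x" shows "f = g"
proof
 fix x show "f x = g x" using assms(3) lin_homD(2)[OF assms(1)] lin_homD(2)[OF assms(2)] by (cases "x \<in> carrier M") auto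
qed

lemma lin_hom_zero:
 assumes "f \<in> lin_hom R M N" "left_module R M" "left_module R N" shows "f \<zero>\<^bsub>M\<^esub> = \<zero>\<^bsub>N\<^esub>"
proof -
 interpret M: left_module R M by fact
 interpret N: left_module R N by fact
 have c: "f \<zero>\<^bsub>M\<^esub> \<in> carrier N" using lin_homD(1)[OF assms(1)] by simp
 have "f \<zero>\<^bsub>M\<^esub> \<oplus>\<^bsub>N\<^esub> f \<zero>\<^bsub>M\<^esub> = f \<zero>\<^bsub>M\<^esub>" using lin_homD(3)[OF assms(1), of "\<zero>\<^bsub>M\<^esub>" "\<zero>\<^bsub>M\<^esub>"] by simp
 then show ?thesis using N.M.add.l_cancel_one c by metis
qed

lemma lin_hom_minus:
 assumes "f \<in> lin_hom R M N" "left_module R M" "left_module R N" "x \<in> carrier M"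
 shows "f (\<ominus>\<^bsub>M\<^esub> x) = \<ominus>\<^bsub>N\<^esub> f x"
proof -
 interpret M: left_module R M by fact
 interpret N: left_module R N by fact
 show ?thesis
  using lin_homD(4)[OF assms(1), of "\<ominus>\<^bsub>R\<^esub> \<one>\<^bsub>R\<^esub>" x] M.smult_minus_one[OF assms(4)]
   N.smult_minus_one[of "f x"] lin_homD(1)[OF assms(1,4)] assms(4) by simp
qed

lemma lin_hom_compose:
 assumes "f \<in> lin_hom R L M" "g \<in> lin_hom R M N" "left_module R L"
 shows "compose (carrier L) g f \<in> lin_hom R L N"
proof -
 interpret L: left_module R L by fact
 show ?thesis
  by (rule lin_homI) (use lin_homD[OF assms(1)] lin_homD[OF assms(2)] in \<open>auto simp: compose_def L.smult_closed\<close>)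
qed

lemma lin_hom_finsum:
 assumes "f \<in> lin_hom R M N" "left_module R M" "left_module R N" "finite I" "!!i. i \<in> I ==> g i \<in> carrier M"
 shows "f (\<Oplus>\<^bsub>M\<^esub>i\<in>I. g i) = (\<Oplus>\<^bsub>N\<^esub>i\<in>I. f (g i))"
 using assms(4,5)
proof (induction I)
 interpret M: left_module R M by fact
 interpret N: left_module R N by fact
 case empty then show ?case using lin_hom_zero[OF assms(1-3)] by simp
next
 interpret M: left_module R M by fact
 interpret N: left_module R N by fact
 note D = lin_homD[OF assms(1)]
 case (insert i I)
 have g: "g \<in> I \<rightarrow> carrier M" "g i \<in> carrier M" using insert by auto
 moreover have "(%i. f (g i)) \<in> I \<rightarrow> carrier N" "f (g i) \<in> carrier N" using insert D(1) by auto
 ultimately show ?case using insert D(3)[of "g i" "\<Oplus>\<^bsub>M\<^esub>i\<in>I. g i"]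
  by (simp add: M.M.finsum_insert N.M.finsum_insert)
qed

lemma left_module_direct_sum:
 assumes R: "ring R" and M: "!!i. i \<in> I ==> left_module R (M i)" shows "left_module R (direct_sum I M)"
proof (intro left_module.intro R abelian_groupI left_module_axioms.intro)
 have Mg: "!!i. i \<in> I ==> abelian_group (M i)" using M unfolding left_module_def by blast
 have Mm: "!!i. i \<in> I ==> abelian_monoid (M i)" using Mg unfolding abelian_group_def by blast
 note d = direct_sum_def
 show "\<zero>\<^bsub>direct_sum I M\<^esub> \<in> carrier (direct_sum I M)"
  unfolding d using abelian_monoid.zero_closed[OF Mm] by auto
 fix x assume x: "x \<in> carrier (direct_sum I M)"
 then have xi: "!!i. i \<in> I ==> x i \<in> carrier (M i)" and xe: "!!i. i \<notin> I ==> x i = undefined"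
  unfolding d by (auto simp: PiE_def extensional_def)
 show "\<one>\<^bsub>R\<^esub> \<odot>\<^bsub>direct_sum I M\<^esub> x = x"
  unfolding d using xi xe left_module.smult_one[OF M] by fastforce
 show "\<zero>\<^bsub>direct_sum I M\<^esub> \<oplus>\<^bsub>direct_sum I M\<^esub> x = x"
  unfolding d using xi xe abelian_monoid.l_zero[OF Mm] by fastforce
 show "\<exists>y\<in>carrier (direct_sum I M). y \<oplus>\<^bsub>direct_sum I M\<^esub> x = \<zero>\<^bsub>direct_sum I M\<^esub>"
  by (rule bexI[of _ "\<lambda>i\<in>I. \<ominus>\<^bsub>M i\<^esub> x i"])
   (use xi abelian_group.l_neg[OF Mg] abelian_group.a_inv_closed[OF Mg] in \<open>auto simp: d\<close>)
 {
  fix r assume r: "r \<in> carrier R"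
  show "r \<odot>\<^bsub>direct_sum I M\<^esub> x \<in> carrier (direct_sum I M)"
   unfolding d using xi r left_module.smult_closed[OF M] by auto
 }
 {
  fix r t assume r: "r \<in> carrier R" "t \<in> carrier R"
  show "(r \<oplus>\<^bsub>R\<^esub> t) \<odot>\<^bsub>direct_sum I M\<^esub> x = r \<odot>\<^bsub>direct_sum I M\<^esub> x \<oplus>\<^bsub>direct_sum I M\<^esub> t \<odot>\<^bsub>direct_sum I M\<^esub> x"
   unfolding d using xi r left_module.smult_l_distr[OF M] by fastforce
  show "(r \<otimes>\<^bsub>R\<^esub> t) \<odot>\<^bsub>direct_sum I M\<^esub> x = r \<odot>\<^bsub>direct_sum I M\<^esub> (t \<odot>\<^bsub>direct_sum I M\<^esub> x)"
   unfolding d using xi r left_module.smult_assoc[OF M] by fastforce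
 }
 fix y assume y: "y \<in> carrier (direct_sum I M)"
 then have yi: "!!i. i \<in> I ==> y i \<in> carrier (M i)" unfolding d by auto
 show "x \<oplus>\<^bsub>direct_sum I M\<^esub> y \<in> carrier (direct_sum I M)"
  unfolding d using xi yi abelian_monoid.a_closed[OF Mm] by auto
 show "x \<oplus>\<^bsub>direct_sum I M\<^esub> y = y \<oplus>\<^bsub>direct_sum I M\<^esub> x"
  unfolding d using xi yi abelian_monoid.a_comm[OF Mm] by fastforce
 {
  fix z assume z: "z \<in> carrier (direct_sum I M)"
  then have zi: "!!i. i \<in> I ==> z i \<in> carrier (M i)" unfolding d by auto
  show "x \<oplus>\<^bsub>direct_sum I M\<^esub> y \<oplus>\<^bsub>direct_sum I M\<^esub> z = x \<oplus>\<^bsub>direct_sum I M\<^esub> (y \<oplus>\<^bsub>direct_sum I M\<^esub> z)"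
   unfolding d using xi yi zi abelian_monoid.a_assoc[OF Mm] by fastforce
 }
 fix r assume r: "r \<in> carrier R"
 show "r \<odot>\<^bsub>direct_sum I M\<^esub> (x \<oplus>\<^bsub>direct_sum I M\<^esub> y) = r \<odot>\<^bsub>direct_sum I M\<^esub> x \<oplus>\<^bsub>direct_sum I M\<^esub> r \<odot>\<^bsub>direct_sum I M\<^esub> y"
  unfolding d using xi yi r left_module.smult_r_distr[OF M] by fastforce
qed

lemma left_module_regular:
 assumes "ring R" shows "left_module R (regular_module R)" and "carrier (regular_module R) = carrier R"
proof -
 interpret ring R by fact
 show c: "carrier (regular_module R) = carrier R"
  unfolding regular_module_def left_ideal_module_def by force
 show "left_module R (regular_module R)"
 proof (intro left_module.intro ring_axioms abelian_groupI left_module_axioms.intro; (unfold c)?)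
  fix x assume "x \<in> carrier R"
  then show "\<exists>y\<in>carrier R. y \<oplus>\<^bsub>regular_module R\<^esub> x = \<zero>\<^bsub>regular_module R\<^esub>"
   by (intro bexI[of _ "\<ominus>\<^bsub>R\<^esub> x"]) (auto simp: regular_module_def left_ideal_module_def l_neg)
 qed (auto simp: regular_module_def left_ideal_module_def a_ac l_distr r_distr m_assoc)
qed

section \<open>Quasi-isomorphisms\<close>

lemma submodule_image:
 assumes f: "f \<in> lin_hom R M N" and M: "left_module R M" and N: "left_module R N"
 shows "submodule (f ` carrier M) R N"
proof -
 interpret M: left_module R M by fact
 interpret N: left_module R N by fact
 note D = lin_homD[OF f]
 show ?thesis
 proof (rule N.submoduleI)
  show "\<zero>\<^bsub>N\<^esub> \<in> f ` carrier M" using lin_hom_zero[OF f M N] M.M.zero_closed by (metis imageI)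
  fix x y assume "x \<in> f ` carrier M" "y \<in> f ` carrier M"
  then show "x \<oplus>\<^bsub>N\<^esub> y \<in> f ` carrier M" using D(3) M.M.a_closed by (metis (no_types, lifting) imageE imageI)
 next
  fix r x assume "r \<in> carrier R" "x \<in> f ` carrier M"
  then show "r \<odot>\<^bsub>N\<^esub> x \<in> f ` carrier M" using D(4) M.smult_closed by (metis (no_types, lifting) imageE imageI)
 qed (use D(1) in auto)
qed

text \<open>An elementwise form of \<open>quasi_iso\<close>, without cohomology classes.\<close>

definition qiso :: "('k::field, 'v) cochain => ('k, 'w) cochain => (int => 'v => 'w) => bool" where
 "qiso A B f \<longleftrightarrow> cochain_complex A & cochain_complex B & chain_map A B f &
   (ALL p. \<forall>x\<in>cocycles A p. f p x \<in> coboundaries B p --> x \<in> coboundaries A p) &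
   (ALL p. \<forall>y\<in>cocycles B p. \<exists>x\<in>cocycles A p. \<exists>b\<in>coboundaries B p. y = f p x \<oplus>\<^bsub>obj B p\<^esub> b)"

lemma cochain_complexD:
 assumes "cochain_complex A"
 shows "left_module kk (obj A p)" "diff A p \<in> lin_hom kk (obj A p) (obj A (p + 1))"
  "diff A (p - 1) \<in> lin_hom kk (obj A (p - 1)) (obj A p)"
  "!!x. x \<in> carrier (obj A (p - 1)) ==> diff A p (diff A (p - 1) x) = \<zero>\<^bsub>obj A (p + 1)\<^esub>"
proof -
 have a: "left_module kk (obj A p)" "diff A p \<in> lin_hom kk (obj A p) (obj A (p + 1))"
  "\<forall>x\<in>carrier (obj A p). diff A (p + 1) (diff A p x) = \<zero>\<^bsub>obj A (p + 1 + 1)\<^esub>" for p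
  using assms unfolding cochain_complex_def by auto
 show "left_module kk (obj A p)" "diff A p \<in> lin_hom kk (obj A p) (obj A (p + 1))" by (fact a)+
 show "diff A (p - 1) \<in> lin_hom kk (obj A (p - 1)) (obj A p)" using a(2)[of "p - 1"] by simp
 show "!!x. x \<in> carrier (obj A (p - 1)) ==> diff A p (diff A (p - 1) x) = \<zero>\<^bsub>obj A (p + 1)\<^esub>"
  using a(3)[of "p - 1"] by simp
qed

lemma submodule_coboundaries:
 assumes "cochain_complex A" shows "submodule (coboundaries A p) kk (obj A p)"
 unfolding coboundaries_def
 by (rule submodule_image) (use cochain_complexD[OF assms] in auto)

lemma submodule_cocycles:
 assumes A: "cochain_complex A" shows "submodule (cocycles A p) kk (obj A p)"
proof -
 interpret M: left_module kk "obj A p" using cochain_complexD(1)[OF A] .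
 interpret N: left_module kk "obj A (p + 1)" using cochain_complexD(1)[OF A] .
 note D = lin_homD[OF cochain_complexD(2)[OF A]] and z = lin_hom_zero[OF cochain_complexD(2)[OF A] cochain_complexD(1)[OF A] cochain_complexD(1)[OF A]]
 show ?thesis
  by (rule M.submoduleI) (use D z N.smult_zero_right M.smult_closed in \<open>auto simp: cocycles_def\<close>)
qed

lemma chain_mapD:
 assumes "chain_map A B f"
 shows "f p \<in> lin_hom kk (obj A p) (obj B p)"
  "!!x. x \<in> carrier (obj A p) ==> f (p + 1) (diff A p x) = diff B p (f p x)"
  "!!x. x \<in> carrier (obj A (p - 1)) ==> f p (diff A (p - 1) x) = diff B (p - 1) (f (p - 1) x)"
proof -
 have a: "f p \<in> lin_hom kk (obj A p) (obj B p)"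
  "\<forall>x\<in>carrier (obj A p). f (p + 1) (diff A p x) = diff B p (f p x)" for p
  using assms unfolding chain_map_def by auto
 show "f p \<in> lin_hom kk (obj A p) (obj B p)" by (fact a)
 show "!!x. x \<in> carrier (obj A p) ==> f (p + 1) (diff A p x) = diff B p (f p x)" using a(2) by blast
 show "!!x. x \<in> carrier (obj A (p - 1)) ==> f p (diff A (p - 1) x) = diff B (p - 1) (f (p - 1) x)"
  using a(2)[of "p - 1"] by simp
qed

lemma chain_map_cocycles:
 assumes A: "cochain_complex A" and B: "cochain_complex B" and f: "chain_map A B f" and x: "x \<in> cocycles A p"
 shows "f p x \<in> cocycles B p"
proof -
 have "diff B p (f p x) = f (p + 1) (\<zero>\<^bsub>obj A (p + 1)\<^esub>)"
  using chain_mapD(2)[OF f, of x p] x unfolding cocycles_def by simp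
 also have "\<dots> = \<zero>\<^bsub>obj B (p + 1)\<^esub>"
  using lin_hom_zero[OF chain_mapD(1)[OF f]] cochain_complexD(1)[OF A] cochain_complexD(1)[OF B] by blast
 finally show ?thesis using x lin_homD(1)[OF chain_mapD(1)[OF f]] unfolding cocycles_def by simp
qed

lemma chain_map_coboundaries:
 assumes f: "chain_map A B f" and x: "x \<in> coboundaries A p" shows "f p x \<in> coboundaries B p"
proof -
 obtain w where w: "w \<in> carrier (obj A (p - 1))" "x = diff A (p - 1) w" using x unfolding coboundaries_def by blast
 then have "f p x = diff B (p - 1) (f (p - 1) w)" using chain_mapD(3)[OF f] by simp
 then show ?thesis unfolding coboundaries_def using lin_homD(1)[OF chain_mapD(1)[OF f] w(1)] by blast
qed

lemma quasi_iso_qiso: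
 assumes "qiso A B f" shows "quasi_iso A B f"
proof -
 have A: "cochain_complex A" and B: "cochain_complex B" and f: "chain_map A B f"
  and inj: "!!p x. x \<in> cocycles A p ==> f p x \<in> coboundaries B p ==> x \<in> coboundaries A p"
  and surj: "!!p y. y \<in> cocycles B p ==> \<exists>x\<in>cocycles A p. \<exists>b\<in>coboundaries B p. y = f p x \<oplus>\<^bsub>obj B p\<^esub> b"
  using assms unfolding qiso_def by auto
 \<comment> \<open>Cosets involve only the addition, so shrinking the carrier to the cocycles does
   not affect them; the fact is recorded for both element types.\<close>
 have coset: "N +>\<^bsub>M\<lparr>carrier := Z\<rparr>\<^esub> x = N +>\<^bsub>M\<^esub> x" for N Z x and M :: "('a, 'b) module"
  unfolding a_r_coset_def r_coset_def by simp
 have coset': "N +>\<^bsub>M\<lparr>carrier := Z\<rparr>\<^esub> x = N +>\<^bsub>M\<^esub> x" for N Z x and M :: "('a, 'c) module"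
  unfolding a_r_coset_def r_coset_def by simp
 have "bij_betw (cohomology_map B f p) (carrier (cohomology A p)) (carrier (cohomology B p))" for p
 proof -
  let ?M = "obj A p" and ?N = "obj B p" and ?a = "coboundaries A p" and ?b = "coboundaries B p"
  have M: "left_module kk ?M" and N: "left_module kk ?N" using cochain_complexD(1) A B by auto
  interpret M: left_module kk ?M by fact
  interpret N: left_module kk ?N by fact
  note D = lin_homD[OF chain_mapD(1)[OF f, of p]]
  note sa = submodule_coboundaries[OF A, of p] and sb = submodule_coboundaries[OF B, of p]
  note za = submodule_cocycles[OF A, of p] and zb = submodule_cocycles[OF B, of p]
  note zac = M.submoduleD[OF za] and zbc = N.submoduleD[OF zb]
  have ca: "carrier (cohomology A p) = (%x. ?a +>\<^bsub>?M\<^esub> x) ` cocycles A p"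
   unfolding cohomology_def quotient_module_def coset by auto
  have cb: "carrier (cohomology B p) = (%x. ?b +>\<^bsub>?N\<^esub> x) ` cocycles B p"
   unfolding cohomology_def quotient_module_def coset' by auto
  \<comment> \<open>\<open>cohomology_map\<close> is a union over all representatives of a class;
    they differ by coboundaries, so each contributes the same coset.\<close>
  have map: "cohomology_map B f p (?a +>\<^bsub>?M\<^esub> x) = ?b +>\<^bsub>?N\<^esub> f p x" if x: "x \<in> cocycles A p" for x
  proof -
   have xc: "x \<in> carrier ?M" using x zac(1) by blast
   have "?b +>\<^bsub>?N\<^esub> f p y = ?b +>\<^bsub>?N\<^esub> f p x" if y: "y \<in> ?a +>\<^bsub>?M\<^esub> x" for y
   proof -
    obtain a where a: "a \<in> ?a" "y = a \<oplus>\<^bsub>?M\<^esub> x" using y unfolding a_r_coset_def r_coset_def by auto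
    have ac: "a \<in> carrier ?M" using a M.submoduleD(1)[OF sa] by blast
    have "f p y \<ominus>\<^bsub>?N\<^esub> f p x = f p a"
     using a ac xc D(1,3) by (simp add: N.M.minus_eq N.M.a_assoc N.M.r_neg)
    also have "\<dots> \<in> ?b" using chain_map_coboundaries[OF f a(1)] .
    finally show ?thesis using quotient_eq_iff[OF N sb] D(1) a ac xc by auto
   qed
   moreover have "x \<in> ?a +>\<^bsub>?M\<^esub> x" 
    using M.submoduleD(2)[OF sa] xc unfolding a_r_coset_def r_coset_def by force
   ultimately show ?thesis unfolding cohomology_map_def by blast
  qed
  show ?thesis unfolding bij_betw_def
  proof
   show "inj_on (cohomology_map B f p) (carrier (cohomology A p))"
   proof (rule inj_onI)
    fix X' Y' assume "X' \<in> carrier (cohomology A p)" "Y' \<in> carrier (cohomology A p)"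
     and eq: "cohomology_map B f p X' = cohomology_map B f p Y'"
    then obtain x y where x: "x \<in> cocycles A p" "X' = ?a +>\<^bsub>?M\<^esub> x" and y: "y \<in> cocycles A p" "Y' = ?a +>\<^bsub>?M\<^esub> y"
     unfolding ca by blast
    have xc: "x \<in> carrier ?M" "y \<in> carrier ?M" using x y zac(1) by auto
    have "?b +>\<^bsub>?N\<^esub> f p x = ?b +>\<^bsub>?N\<^esub> f p y" using eq map x y by simp
    then have "f p x \<ominus>\<^bsub>?N\<^esub> f p y \<in> ?b" using quotient_eq_iff[OF N sb] D(1) xc by blast
    moreover have "f p x \<ominus>\<^bsub>?N\<^esub> f p y = f p (x \<ominus>\<^bsub>?M\<^esub> y)"
     using D(3) lin_hom_minus[OF chain_mapD(1)[OF f] M N] xc by (simp add: M.M.minus_eq N.M.minus_eq)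
    moreover have "x \<ominus>\<^bsub>?M\<^esub> y \<in> cocycles A p"
     using zac(3)[OF x(1) zac(5)[OF y(1)]] by (simp add: M.M.minus_eq)
    ultimately have "x \<ominus>\<^bsub>?M\<^esub> y \<in> ?a" using inj by simp
    then show "X' = Y'" using quotient_eq_iff[OF M sa xc] x y by simp
   qed
   show "cohomology_map B f p ` carrier (cohomology A p) = carrier (cohomology B p)"
   proof
    show "cohomology_map B f p ` carrier (cohomology A p) \<subseteq> carrier (cohomology B p)"
     unfolding ca cb using map chain_map_cocycles[OF A B f] by auto
    show "carrier (cohomology B p) \<subseteq> cohomology_map B f p ` carrier (cohomology A p)"
    proof
     fix z assume "z \<in> carrier (cohomology B p)"
     then obtain y where y: "y \<in> cocycles B p" "z = ?b +>\<^bsub>?N\<^esub> y" unfolding cb by blast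
     obtain x b where x: "x \<in> cocycles A p" and b: "b \<in> ?b" and e: "y = f p x \<oplus>\<^bsub>?N\<^esub> b" using surj[OF y(1)] by blast
     have c: "f p x \<in> carrier ?N" "b \<in> carrier ?N" "y \<in> carrier ?N"
      using D(1) x zac(1) b N.submoduleD(1)[OF sb] y zbc(1) by auto
     have "y \<ominus>\<^bsub>?N\<^esub> f p x = b" unfolding e using c by (simp add: N.M.minus_eq N.M.a_ac N.M.r_neg)
     then have "?b +>\<^bsub>?N\<^esub> y = ?b +>\<^bsub>?N\<^esub> f p x" using quotient_eq_iff[OF N sb c(3,1)] b by simp
     then show "z \<in> cohomology_map B f p ` carrier (cohomology A p)" unfolding ca using y map[OF x] x by force
    qed
   qed
  qed
 qed
 then show ?thesis unfolding quasi_iso_def using f by blast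
qed

lemma qisoI_bij:
 assumes A: "cochain_complex A" and B: "cochain_complex B" and f: "chain_map A B f"
  and bij: "!!p. bij_betw (f p) (carrier (obj A p)) (carrier (obj B p))"
 shows "qiso A B f"
 unfolding qiso_def
proof (intro conjI A B f allI ballI impI)
 have inj: "x = y" if "f p x = f p y" "x \<in> carrier (obj A p)" "y \<in> carrier (obj A p)" for p x y
  using bij that unfolding bij_betw_def inj_on_def by blast
 have sur: "\<exists>x\<in>carrier (obj A p). f p x = y" if "y \<in> carrier (obj B p)" for p y
  using bij[of p] that unfolding bij_betw_def by (metis imageE)
 {
  fix p x assume x: "x \<in> cocycles A p" and "f p x \<in> coboundaries B p"
  then obtain w where w: "w \<in> carrier (obj B (p - 1))" "f p x = diff B (p - 1) w" unfolding coboundaries_def by blast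
  obtain v where v: "v \<in> carrier (obj A (p - 1))" "f (p - 1) v = w" using sur[OF w(1)] by blast
  have "f p x = f p (diff A (p - 1) v)" using chain_mapD(3)[OF f v(1)] v w by simp
  then have "x = diff A (p - 1) v" using inj x lin_homD(1)[OF cochain_complexD(3)[OF A] v(1)] unfolding cocycles_def by simp
  then show "x \<in> coboundaries A p" using v unfolding coboundaries_def by blast
 }
 fix p y assume y: "y \<in> cocycles B p"
 interpret N: left_module kk "obj B p" using cochain_complexD(1)[OF B] .
 obtain x where x: "x \<in> carrier (obj A p)" "f p x = y" using sur y unfolding cocycles_def by blast
 have M1: "left_module kk (obj A (p + 1))" using cochain_complexD(1)[OF A] .
 have "f (p + 1) (diff A p x) = f (p + 1) \<zero>\<^bsub>obj A (p + 1)\<^esub>"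
  using chain_mapD(2)[OF f x(1)] y x lin_hom_zero[OF chain_mapD(1)[OF f, of "p + 1"] M1 cochain_complexD(1)[OF B]]
  unfolding cocycles_def by simp
 moreover have "\<zero>\<^bsub>obj A (p + 1)\<^esub> \<in> carrier (obj A (p + 1))"
  using M1 abelian_monoid.zero_closed unfolding left_module_def abelian_group_def by blast
 ultimately have "diff A p x = \<zero>\<^bsub>obj A (p + 1)\<^esub>"
  using inj lin_homD(1)[OF cochain_complexD(2)[OF A] x(1)] by blast
 then have "x \<in> cocycles A p" using x unfolding cocycles_def by simp
 moreover have "\<zero>\<^bsub>obj B p\<^esub> \<in> coboundaries B p" using N.submoduleD(2)[OF submodule_coboundaries[OF B]] .
 moreover have "y = f p x \<oplus>\<^bsub>obj B p\<^esub> \<zero>\<^bsub>obj B p\<^esub>" using x y unfolding cocycles_def by simp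
 ultimately show "\<exists>x\<in>cocycles A p. \<exists>b\<in>coboundaries B p. y = f p x \<oplus>\<^bsub>obj B p\<^esub> b" by blast
qed

lemma qiso_compose:
 assumes f: "qiso A B f" and g: "qiso B D g"
 shows "qiso A D (%p. compose (carrier (obj A p)) (g p) (f p))"
 unfolding qiso_def
proof (intro conjI allI ballI impI)
 have A: "cochain_complex A" and B: "cochain_complex B" and D: "cochain_complex D"
  and fc: "chain_map A B f" and gc: "chain_map B D g" using f g unfolding qiso_def by auto
 then show "cochain_complex A" "cochain_complex D" by auto
 let ?h = "%p. compose (carrier (obj A p)) (g p) (f p)"
 show "chain_map A D ?h"
  unfolding chain_map_def
 proof (intro allI conjI ballI)
  fix p
  show "?h p \<in> lin_hom kk (obj A p) (obj D p)"
   using lin_hom_compose[OF chain_mapD(1)[OF fc] chain_mapD(1)[OF gc]] cochain_complexD(1)[OF A] by blast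
  fix x assume x: "x \<in> carrier (obj A p)"
  then have "diff A p x \<in> carrier (obj A (p + 1))" using lin_homD(1)[OF cochain_complexD(2)[OF A]] by blast
  then show "?h (p + 1) (diff A p x) = diff D p (?h p x)"
   using x chain_mapD(2)[OF fc x] chain_mapD(2)[OF gc] lin_homD(1)[OF chain_mapD(1)[OF fc] x] by (simp add: compose_def)
 qed
 have finj: "!!p x. x \<in> cocycles A p ==> f p x \<in> coboundaries B p ==> x \<in> coboundaries A p"
  and fsurj: "!!p y. y \<in> cocycles B p ==> \<exists>x\<in>cocycles A p. \<exists>b\<in>coboundaries B p. y = f p x \<oplus>\<^bsub>obj B p\<^esub> b"
  using f unfolding qiso_def by auto
 have ginj: "!!p x. x \<in> cocycles B p ==> g p x \<in> coboundaries D p ==> x \<in> coboundaries B p"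
  and gsurj: "!!p y. y \<in> cocycles D p ==> \<exists>x\<in>cocycles B p. \<exists>b\<in>coboundaries D p. y = g p x \<oplus>\<^bsub>obj D p\<^esub> b"
  using g unfolding qiso_def by auto
 have cyc: "x \<in> cocycles A p ==> x \<in> carrier (obj A p)" for x p unfolding cocycles_def by simp
 {
  fix p x assume "x \<in> cocycles A p" "?h p x \<in> coboundaries D p"
  then show "x \<in> coboundaries A p"
   using finj ginj chain_map_cocycles[OF A B fc] cyc by (simp add: compose_def)
 }
 fix p y assume "y \<in> cocycles D p"
 then obtain x b where x: "x \<in> cocycles B p" "b \<in> coboundaries D p" "y = g p x \<oplus>\<^bsub>obj D p\<^esub> b" using gsurj by blast
 then obtain u c where u: "u \<in> cocycles A p" "c \<in> coboundaries B p" "x = f p u \<oplus>\<^bsub>obj B p\<^esub> c" using fsurj by blast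
 interpret B: left_module kk "obj B p" using cochain_complexD(1)[OF B] .
 interpret D: left_module kk "obj D p" using cochain_complexD(1)[OF D] .
 have sub: "coboundaries D p \<subseteq> carrier (obj D p)" "coboundaries B p \<subseteq> carrier (obj B p)"
  using D.submoduleD(1)[OF submodule_coboundaries[OF D]] B.submoduleD(1)[OF submodule_coboundaries[OF B]] by auto
 have fu: "f p u \<in> carrier (obj B p)" "c \<in> carrier (obj B p)" "b \<in> carrier (obj D p)"
  using lin_homD(1)[OF chain_mapD(1)[OF fc]] cyc u x sub by auto
 note gD = lin_homD[OF chain_mapD(1)[OF gc, of p]]
 have gcb: "g p c \<in> coboundaries D p" using chain_map_coboundaries[OF gc u(2)] .
 have "y = ?h p u \<oplus>\<^bsub>obj D p\<^esub> (g p c \<oplus>\<^bsub>obj D p\<^esub> b)"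
  using x(3) u(3) fu gD(1,3) cyc[OF u(1)] by (simp add: compose_def D.M.a_assoc)
 moreover have "g p c \<oplus>\<^bsub>obj D p\<^esub> b \<in> coboundaries D p"
  using D.submoduleD(3)[OF submodule_coboundaries[OF D] gcb x(2)] .
 ultimately show "\<exists>x\<in>cocycles A p. \<exists>b\<in>coboundaries D p. y = ?h p x \<oplus>\<^bsub>obj D p\<^esub> b" using u(1) by blast
qed

text \<open>The roof has apex \<open>A\<close> with the identity as one leg. It is therefore enough
  to produce a chain of quasi-isomorphisms all pointing away from \<open>A\<close>.\<close>

lemma derived_iso_qiso:
 assumes "qiso A B f" shows "derived_iso A B"
proof -
 have A: "cochain_complex A" and B: "cochain_complex B" using assms unfolding qiso_def by auto
 have "chain_map A A (%p. \<lambda>x\<in>carrier (obj A p). x)"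
  unfolding chain_map_def
 proof (intro allI conjI ballI)
  fix p
  interpret M: left_module kk "obj A p" using cochain_complexD(1)[OF A] .
  show "(\<lambda>x\<in>carrier (obj A p). x) \<in> lin_hom kk (obj A p) (obj A p)"
   by (rule lin_homI) (auto simp: M.smult_closed)
  fix x assume "x \<in> carrier (obj A p)"
  then show "(\<lambda>x\<in>carrier (obj A (p + 1)). x) (diff A p x) = diff A p ((\<lambda>x\<in>carrier (obj A p). x) x)"
   using lin_homD(1)[OF cochain_complexD(2)[OF A]] by simp
 qed
 then have "qiso A A (%p. \<lambda>x\<in>carrier (obj A p). x)"
  by (rule qisoI_bij[OF A A]) (auto simp: bij_betw_def inj_on_def)
 from quasi_iso_qiso[OF this] quasi_iso_qiso[OF assms] show ?thesis unfolding derived_iso_def using A B by blast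
qed

section \<open>Projective resolutions\<close>

lemma direct_sum_finsum:
 assumes R: "ring R" and M: "!!i. i \<in> I ==> left_module R (M i)" and J: "finite J"
  and g: "!!j. j \<in> J ==> g j \<in> carrier (direct_sum I M)" and i: "i \<in> I"
 shows "(\<Oplus>\<^bsub>direct_sum I M\<^esub>j\<in>J. g j) i = (\<Oplus>\<^bsub>M i\<^esub>j\<in>J. g j i)"
 using J g
proof (induction J)
 interpret D: left_module R "direct_sum I M" using left_module_direct_sum[OF R M] .
 interpret N: left_module R "M i" using M[OF i] .
 case empty
 then show ?case unfolding D.M.finsum_empty N.M.finsum_empty using i by (simp add: direct_sum_def)
next
 interpret D: left_module R "direct_sum I M" using left_module_direct_sum[OF R M] .
 interpret N: left_module R "M i" using M[OF i] .
 case (insert j J)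
 have c: "g \<in> J \<rightarrow> carrier (direct_sum I M)" "g j \<in> carrier (direct_sum I M)" using insert by auto
 moreover have "(%j. g j i) \<in> J \<rightarrow> carrier (M i)" "g j i \<in> carrier (M i)"
  using insert.prems i unfolding direct_sum_def by auto
 ultimately show ?case using insert i
  by (simp add: D.M.finsum_insert N.M.finsum_insert) (simp add: direct_sum_def)
qed

lemma (in left_module) smult_finsum:
 assumes "finite I" "!!i. i \<in> I ==> f i \<in> carrier M" "r \<in> carrier R"
 shows "r \<odot>\<^bsub>M\<^esub> (\<Oplus>\<^bsub>M\<^esub>i\<in>I. f i) = (\<Oplus>\<^bsub>M\<^esub>i\<in>I. r \<odot>\<^bsub>M\<^esub> f i)"
 using assms(1,2)
proof (induction I)
 case empty then show ?case using smult_zero_right assms(3) by simp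
next
 case (insert i I)
 then have c: "f \<in> I \<rightarrow> carrier M" "f i \<in> carrier M" by auto
 moreover have "(%i. r \<odot>\<^bsub>M\<^esub> f i) \<in> I \<rightarrow> carrier M" using c smult_closed assms(3) by auto
 ultimately show ?case using insert assms(3) smult_closed
  by (simp add: M.finsum_insert smult_r_distr)
qed

text \<open>A direct summand of a free module lifts by lifting basis vectors. The condition
  \<open>im\<close> takes the place of surjectivity of \<open>e\<close>, so that \<open>e\<close>
  may be a differential of a resolution, whose image is only a kernel.\<close>

lemma projective_lift:
 fixes P :: "('r, 'p) module"
 assumes P: "fg_projective R P" and L: "left_module R L" and N: "left_module R N"
  and e: "e \<in> lin_hom R L N" and h: "h \<in> lin_hom R P N" and im: "!!x. x \<in> carrier P ==> h x \<in> e ` carrier L"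
 shows "\<exists>g\<in>lin_hom R P L. \<forall>x\<in>carrier P. e (g x) = h x"
proof -
 have Pm: "left_module R P" using P unfolding fg_projective_def by blast
 interpret P: left_module R P by fact
 interpret L: left_module R L by fact
 interpret N: left_module R N by fact
 let ?G = "regular_module R"
 note reg = left_module_regular[OF P.R.ring_axioms]
 interpret G: left_module R ?G using reg(1) .
 obtain n :: nat and i p where i: "i \<in> lin_hom R P (direct_sum {..<n} (%_. ?G))"
  and p: "p \<in> lin_hom R (direct_sum {..<n} (%_. ?G)) P" and pi: "!!x. x \<in> carrier P ==> p (i x) = x"
  using P unfolding fg_projective_def by blast
 let ?F = "direct_sum {..<n} (%_. ?G)"
 have Fm: "left_module R ?F" using left_module_direct_sum[OF P.R.ring_axioms] reg(1) .
 interpret F: left_module R ?F by fact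
 define b where "b j = (\<lambda>k\<in>{..<n}. if k = j then \<one>\<^bsub>R\<^esub> else \<zero>\<^bsub>R\<^esub>)" for j
 have bc: "b j \<in> carrier ?F" for j unfolding b_def direct_sum_def using reg(2) by auto
 have Fc: "f \<in> carrier ?F ==> j < n ==> f j \<in> carrier R" for f j
  unfolding direct_sum_def using reg(2) by auto
 have expand: "f = (\<Oplus>\<^bsub>?F\<^esub>j\<in>{..<n}. f j \<odot>\<^bsub>?F\<^esub> b j)" if f: "f \<in> carrier ?F" for f
 proof
  fix k show "f k = (\<Oplus>\<^bsub>?F\<^esub>j\<in>{..<n}. f j \<odot>\<^bsub>?F\<^esub> b j) k"
  proof (cases "k < n")
   case True
   have c: "f j \<odot>\<^bsub>?F\<^esub> b j \<in> carrier ?F" if "j \<in> {..<n}" for j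
    using F.smult_closed Fc[OF f] bc that by auto
   have "(\<Oplus>\<^bsub>?F\<^esub>j\<in>{..<n}. f j \<odot>\<^bsub>?F\<^esub> b j) k = (\<Oplus>\<^bsub>?G\<^esub>j\<in>{..<n}. (f j \<odot>\<^bsub>?F\<^esub> b j) k)"
    by (rule direct_sum_finsum[OF P.R.ring_axioms]) (use c reg True in auto)
   also have "\<dots> = (\<Oplus>\<^bsub>?G\<^esub>j\<in>{..<n}. if k = j then f j else \<zero>\<^bsub>?G\<^esub>)"
   proof (rule G.M.finsum_cong')
    show "(%j. if k = j then f j else \<zero>\<^bsub>?G\<^esub>) \<in> {..<n} \<rightarrow> carrier ?G" using Fc[OF f] reg(2) G.M.zero_closed by auto
    fix j assume "j \<in> {..<n}"
    then show "(f j \<odot>\<^bsub>?F\<^esub> b j) k = (if k = j then f j else \<zero>\<^bsub>?G\<^esub>)"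
     using True Fc[OF f, of j] unfolding direct_sum_def b_def regular_module_def left_ideal_module_def by auto
   qed simp
   also have "\<dots> = f k" by (rule G.M.add.finprod_singleton) (use True Fc[OF f] reg in auto)
   finally show ?thesis by simp
  next
   case False
   have "(\<Oplus>\<^bsub>?F\<^esub>j\<in>{..<n}. f j \<odot>\<^bsub>?F\<^esub> b j) \<in> carrier ?F"
    by (rule F.M.finsum_closed) (use F.smult_closed Fc[OF f] bc in auto)
   then show ?thesis using f False unfolding direct_sum_def by (auto simp: PiE_def extensional_def)
  qed
 qed
 \<comment> \<open>Preimages under \<open>e\<close> of the images of the basis vectors;
   \<open>g\<close> combines them with the coordinates of \<open>i x\<close>.\<close>
 have "EX y. y \<in> carrier L & e y = h (p (b j))" for j
  using im[OF lin_homD(1)[OF p bc]] by (metis imageE)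
 then obtain y where y: "!!j. y j \<in> carrier L" "!!j. e (y j) = h (p (b j))" by metis
 define g where "g = (\<lambda>x\<in>carrier P. \<Oplus>\<^bsub>L\<^esub>j\<in>{..<n}. i x j \<odot>\<^bsub>L\<^esub> y j)"
 have ic: "i x j \<in> carrier R" if "x \<in> carrier P" "j < n" for x j using Fc lin_homD(1)[OF i] that by blast
 have gm: "g \<in> lin_hom R P L"
 proof (rule lin_homI)
  fix x assume x: "x \<in> carrier P"
  have xc: "(%j. i x j \<odot>\<^bsub>L\<^esub> y j) \<in> {..<n} \<rightarrow> carrier L" using ic x y L.smult_closed by auto
  then show "g x \<in> carrier L" unfolding g_def using x by simp
  {
   fix z assume z: "z \<in> carrier P"
   have zc: "(%j. i z j \<odot>\<^bsub>L\<^esub> y j) \<in> {..<n} \<rightarrow> carrier L" using ic z y L.smult_closed by auto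
   have "(\<Oplus>\<^bsub>L\<^esub>j\<in>{..<n}. i (x \<oplus>\<^bsub>P\<^esub> z) j \<odot>\<^bsub>L\<^esub> y j) = (\<Oplus>\<^bsub>L\<^esub>j\<in>{..<n}. i x j \<odot>\<^bsub>L\<^esub> y j \<oplus>\<^bsub>L\<^esub> i z j \<odot>\<^bsub>L\<^esub> y j)"
   proof (rule L.M.finsum_cong')
    fix j assume "j \<in> {..<n}"
    moreover have "i (x \<oplus>\<^bsub>P\<^esub> z) j = i x j \<oplus>\<^bsub>R\<^esub> i z j" if "j < n"
     using lin_homD(3)[OF i x z] that by (simp add: direct_sum_def regular_module_def left_ideal_module_def)
    ultimately show "i (x \<oplus>\<^bsub>P\<^esub> z) j \<odot>\<^bsub>L\<^esub> y j = i x j \<odot>\<^bsub>L\<^esub> y j \<oplus>\<^bsub>L\<^esub> i z j \<odot>\<^bsub>L\<^esub> y j"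
     using ic x z y L.smult_l_distr by simp
   qed (use xc zc in auto)
   then show "g (x \<oplus>\<^bsub>P\<^esub> z) = g x \<oplus>\<^bsub>L\<^esub> g z"
    unfolding g_def using x z L.M.finsum_addf[OF xc zc] by simp
  }
  fix r assume r: "r \<in> carrier R"
  have "(\<Oplus>\<^bsub>L\<^esub>j\<in>{..<n}. i (r \<odot>\<^bsub>P\<^esub> x) j \<odot>\<^bsub>L\<^esub> y j) = (\<Oplus>\<^bsub>L\<^esub>j\<in>{..<n}. r \<odot>\<^bsub>L\<^esub> (i x j \<odot>\<^bsub>L\<^esub> y j))"
  proof (rule L.M.finsum_cong')
   fix j assume "j \<in> {..<n}"
   moreover have "i (r \<odot>\<^bsub>P\<^esub> x) j = r \<otimes>\<^bsub>R\<^esub> i x j" if "j < n"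
    using lin_homD(4)[OF i r x] that by (simp add: direct_sum_def regular_module_def left_ideal_module_def)
   ultimately show "i (r \<odot>\<^bsub>P\<^esub> x) j \<odot>\<^bsub>L\<^esub> y j = r \<odot>\<^bsub>L\<^esub> (i x j \<odot>\<^bsub>L\<^esub> y j)"
    using ic x r y L.smult_assoc by simp
  qed (use xc r L.smult_closed in auto)
  also have "\<dots> = r \<odot>\<^bsub>L\<^esub> (\<Oplus>\<^bsub>L\<^esub>j\<in>{..<n}. i x j \<odot>\<^bsub>L\<^esub> y j)"
   by (rule L.smult_finsum[symmetric]) (use xc r in auto)
  finally show "g (r \<odot>\<^bsub>P\<^esub> x) = r \<odot>\<^bsub>L\<^esub> g x" unfolding g_def using x r P.smult_closed by simp
 qed (simp add: g_def)
 have "e (g x) = h x" if x: "x \<in> carrier P" for x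
 proof -
  have ix: "i x \<in> carrier ?F" using lin_homD(1)[OF i x] .
  have "e (g x) = (\<Oplus>\<^bsub>N\<^esub>j\<in>{..<n}. e (i x j \<odot>\<^bsub>L\<^esub> y j))"
  proof -
   have "e (\<Oplus>\<^bsub>L\<^esub>j\<in>{..<n}. i x j \<odot>\<^bsub>L\<^esub> y j) = (\<Oplus>\<^bsub>N\<^esub>j\<in>{..<n}. e (i x j \<odot>\<^bsub>L\<^esub> y j))"
    by (rule lin_hom_finsum[OF e L N]) (use ic x y L.smult_closed in auto)
   then show ?thesis unfolding g_def using x by simp
  qed
  also have "\<dots> = (\<Oplus>\<^bsub>N\<^esub>j\<in>{..<n}. h (p (i x j \<odot>\<^bsub>?F\<^esub> b j)))"
  proof (rule N.M.finsum_cong')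
   fix j assume "j \<in> {..<n}"
   then show "e (i x j \<odot>\<^bsub>L\<^esub> y j) = h (p (i x j \<odot>\<^bsub>?F\<^esub> b j))"
    using ic[OF x, of j] y lin_homD(4)[OF e] lin_homD(4)[OF p _ bc] lin_homD(4)[OF h _ lin_homD(1)[OF p bc]] by simp
  next
   show "(%j. h (p (i x j \<odot>\<^bsub>?F\<^esub> b j))) \<in> {..<n} \<rightarrow> carrier N"
    using ic[OF x] bc F.smult_closed lin_homD(1)[OF p] lin_homD(1)[OF h] by auto
  qed simp
  also have "\<dots> = h (\<Oplus>\<^bsub>P\<^esub>j\<in>{..<n}. p (i x j \<odot>\<^bsub>?F\<^esub> b j))"
   by (rule lin_hom_finsum[OF h Pm N, symmetric]) (use ic[OF x] bc F.smult_closed lin_homD(1)[OF p] in auto)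
  also have "(\<Oplus>\<^bsub>P\<^esub>j\<in>{..<n}. p (i x j \<odot>\<^bsub>?F\<^esub> b j)) = p (\<Oplus>\<^bsub>?F\<^esub>j\<in>{..<n}. i x j \<odot>\<^bsub>?F\<^esub> b j)"
   by (rule lin_hom_finsum[OF p Fm Pm, symmetric]) (use ic[OF x] bc F.smult_closed in auto)
  also have "(\<Oplus>\<^bsub>?F\<^esub>j\<in>{..<n}. i x j \<odot>\<^bsub>?F\<^esub> b j) = i x" using expand[OF ix] by simp
  finally show ?thesis using pi x by simp
 qed
 then show ?thesis using gm by blast
qed

lemma projective_resolutionD:
 assumes "projective_resolution R M Q"
 shows "fg_projective R (res_obj Q n)" "left_module R (res_obj Q n)"
  "res_diff Q n \<in> lin_hom R (res_obj Q (Suc n)) (res_obj Q n)"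
  "res_aug Q \<in> lin_hom R (res_obj Q 0) M"
  "res_aug Q ` carrier (res_obj Q 0) = carrier M"
  "{x \<in> carrier (res_obj Q 0). res_aug Q x = \<zero>\<^bsub>M\<^esub>} = res_diff Q 0 ` carrier (res_obj Q 1)"
  "{x \<in> carrier (res_obj Q (Suc n)). res_diff Q n x = \<zero>\<^bsub>res_obj Q n\<^esub>} =
   res_diff Q (Suc n) ` carrier (res_obj Q (Suc (Suc n)))"
  "!!x. x \<in> carrier (res_obj Q (Suc (Suc n))) ==> res_diff Q n (res_diff Q (Suc n) x) = \<zero>\<^bsub>res_obj Q n\<^esub>"
  "!!x. x \<in> carrier (res_obj Q 1) ==> res_aug Q (res_diff Q 0 x) = \<zero>\<^bsub>M\<^esub>"
 using assms unfolding projective_resolution_def fg_projective_def by blast+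

section \<open>Comparison of projective resolutions\<close>

definition resolution_map ::
  "'r ring => ('r, 'q, 'm) resolution => ('r, 'u, 'm) resolution => (nat => 'q => 'u) => bool" where
 "resolution_map R P Q f \<longleftrightarrow> (ALL n. f n \<in> lin_hom R (res_obj P n) (res_obj Q n)) &
   (\<forall>x\<in>carrier (res_obj P 0). res_aug Q (f 0 x) = res_aug P x) &
   (ALL n. \<forall>x\<in>carrier (res_obj P (Suc n)). res_diff Q n (f (Suc n) x) = f n (res_diff P n x))"

lemma resolution_map_exists:
 fixes P :: "('r, 'q, 'm) resolution" and Q :: "('r, 'u, 'm) resolution"
 assumes M: "left_module R M" and P: "projective_resolution R M P" and Q: "projective_resolution R M Q"
 shows "EX f. resolution_map R P Q f"
proof -
 note Pd = projective_resolutionD[OF P] and Qd = projective_resolutionD[OF Q]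
 \<comment> \<open>The invariant carries the lifting condition for the next degree, so that every
   step is one application of \<open>projective_lift\<close>. Compatibility with the augmentations
   concerns only \<open>n = 0\<close>.\<close>
 let ?A = "%n f. f \<in> lin_hom R (res_obj P n) (res_obj Q n) &
   (\<forall>x\<in>carrier (res_obj P (Suc n)). f (res_diff P n x) \<in> res_diff Q n ` carrier (res_obj Q (Suc n))) &
   (n = 0 --> (\<forall>x\<in>carrier (res_obj P 0). res_aug Q (f x) = res_aug P x))"
 let ?B = "%n f g. \<forall>x\<in>carrier (res_obj P (Suc n)). res_diff Q n (g x) = f (res_diff P n x)"
 have base: "EX f. ?A 0 f"
 proof -
  have "\<exists>g\<in>lin_hom R (res_obj P 0) (res_obj Q 0). \<forall>x\<in>carrier (res_obj P 0). res_aug Q (g x) = res_aug P x"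
   by (rule projective_lift[OF Pd(1) Qd(2) M Qd(4) Pd(4)]) (use Pd(5) Qd(5) in blast)
  then obtain g where g: "g \<in> lin_hom R (res_obj P 0) (res_obj Q 0)"
   "!!x. x \<in> carrier (res_obj P 0) ==> res_aug Q (g x) = res_aug P x" by blast
  have "g (res_diff P 0 x) \<in> res_diff Q 0 ` carrier (res_obj Q (Suc 0))" if x: "x \<in> carrier (res_obj P (Suc 0))" for x
  proof -
   have c: "res_diff P 0 x \<in> carrier (res_obj P 0)" using lin_homD(1)[OF Pd(3) x] .
   then have "res_aug Q (g (res_diff P 0 x)) = \<zero>\<^bsub>M\<^esub>" using g(2) Pd(9) x by simp
   then show ?thesis using Qd(6) lin_homD(1)[OF g(1) c] by auto
  qed
  then show ?thesis using g by blast
 qed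
 have step: "EX g. ?A (Suc n) g & ?B n f g"
  if f: "?A n f" for f n
 proof -
  have fm: "f \<in> lin_hom R (res_obj P n) (res_obj Q n)" using f by blast
  let ?h = "compose (carrier (res_obj P (Suc n))) f (res_diff P n)"
  have "\<exists>g\<in>lin_hom R (res_obj P (Suc n)) (res_obj Q (Suc n)). \<forall>x\<in>carrier (res_obj P (Suc n)). res_diff Q n (g x) = ?h x"
   by (rule projective_lift[OF Pd(1) Qd(2) Qd(2) Qd(3) lin_hom_compose[OF Pd(3) fm Pd(2)]])
    (use f in \<open>auto simp: compose_def\<close>)
  then obtain g where g: "g \<in> lin_hom R (res_obj P (Suc n)) (res_obj Q (Suc n))"
   "!!x. x \<in> carrier (res_obj P (Suc n)) ==> res_diff Q n (g x) = f (res_diff P n x)" by (auto simp: compose_def)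
  have "g (res_diff P (Suc n) x) \<in> res_diff Q (Suc n) ` carrier (res_obj Q (Suc (Suc n)))"
   if x: "x \<in> carrier (res_obj P (Suc (Suc n)))" for x
  proof -
   have c: "res_diff P (Suc n) x \<in> carrier (res_obj P (Suc n))" using lin_homD(1)[OF Pd(3) x] .
   then have "res_diff Q n (g (res_diff P (Suc n) x)) = \<zero>\<^bsub>res_obj Q n\<^esub>"
    using g(2) Pd(8)[OF x] lin_hom_zero[OF fm Pd(2) Qd(2)] by simp
   then show ?thesis using Qd(7) lin_homD(1)[OF g(1) c] by auto
  qed
  then show ?thesis using g by blast
 qed
 have "EX f. ALL n. ?A n (f n) & ?B n (f n) (f (Suc n))"
  by (rule dependent_nat_choice[of ?A ?B]) (fact base, fact step)
 then obtain f where f: "ALL n. ?A n (f n) & ?B n (f n) (f (Suc n))" ..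
 have "resolution_map R P Q f" unfolding resolution_map_def using f by simp
 then show ?thesis by blast
qed

text \<open>The difference \<open>h\<close> of the two maps is killed by the augmentation and
  commutes with the differentials, so the homotopy can be built degree by degree. The conclusion is
  written additively, without differences, so that a linear map can later be applied to it term by
  term.\<close>

lemma resolution_map_homotopy:
 fixes P :: "('r, 'q, 'm) resolution" and Q :: "('r, 'u, 'm) resolution"
 assumes M: "left_module R M" and P: "projective_resolution R M P" and Q: "projective_resolution R M Q"
  and f: "resolution_map R P Q f" and g: "resolution_map R P Q g"
 shows "EX s. (ALL n. s n \<in> lin_hom R (res_obj P n) (res_obj Q (Suc n))) &
  (\<forall>x\<in>carrier (res_obj P 0). f 0 x = g 0 x \<oplus>\<^bsub>res_obj Q 0\<^esub> res_diff Q 0 (s 0 x)) &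
  (ALL n. \<forall>x\<in>carrier (res_obj P (Suc n)). f (Suc n) x = g (Suc n) x \<oplus>\<^bsub>res_obj Q (Suc n)\<^esub>
    (res_diff Q (Suc n) (s (Suc n) x) \<oplus>\<^bsub>res_obj Q (Suc n)\<^esub> s n (res_diff P n x)))"
proof -
 note Pd = projective_resolutionD[OF P] and Qd = projective_resolutionD[OF Q]
 have fm: "f n \<in> lin_hom R (res_obj P n) (res_obj Q n)" and gm: "g n \<in> lin_hom R (res_obj P n) (res_obj Q n)" for n
  using f g unfolding resolution_map_def by auto
 have f0: "res_aug Q (f 0 x) = res_aug P x" and g0: "res_aug Q (g 0 x) = res_aug P x" if "x \<in> carrier (res_obj P 0)" for x
  using f g that unfolding resolution_map_def by auto
 have fS: "res_diff Q n (f (Suc n) x) = f n (res_diff P n x)" and gS: "res_diff Q n (g (Suc n) x) = g n (res_diff P n x)"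
  if "x \<in> carrier (res_obj P (Suc n))" for x n
  using f g that unfolding resolution_map_def by auto
 define h where "h n = (\<lambda>x\<in>carrier (res_obj P n). f n x \<ominus>\<^bsub>res_obj Q n\<^esub> g n x)" for n
 have diff_hom: "(\<lambda>x\<in>carrier P'. u x \<ominus>\<^bsub>Q'\<^esub> v x) \<in> lin_hom R P' Q'"
  if u: "u \<in> lin_hom R P' Q'" and v: "v \<in> lin_hom R P' Q'" and P': "left_module R P'" and Q': "left_module R Q'"
  for u v and P' :: "('r, 'q) module" and Q' :: "('r, 'u) module"
 proof (rule lin_homI)
  interpret P': left_module R P' by fact
  interpret Q': left_module R Q' by fact
  note uD = lin_homD[OF u] and vD = lin_homD[OF v]
  fix x assume x: "x \<in> carrier P'"
  show "(\<lambda>x\<in>carrier P'. u x \<ominus>\<^bsub>Q'\<^esub> v x) x \<in> carrier Q'" using x uD(1) vD(1) by simp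
  {
   fix y assume y: "y \<in> carrier P'"
   show "(\<lambda>x\<in>carrier P'. u x \<ominus>\<^bsub>Q'\<^esub> v x) (x \<oplus>\<^bsub>P'\<^esub> y) = (\<lambda>x\<in>carrier P'. u x \<ominus>\<^bsub>Q'\<^esub> v x) x \<oplus>\<^bsub>Q'\<^esub> (\<lambda>x\<in>carrier P'. u x \<ominus>\<^bsub>Q'\<^esub> v x) y"
    using x y uD(1,3) vD(1,3) by (simp add: Q'.M.minus_eq Q'.M.minus_add Q'.M.a_ac)
  }
  fix r assume r: "r \<in> carrier R"
  have "r \<odot>\<^bsub>Q'\<^esub> (\<ominus>\<^bsub>Q'\<^esub> v x) = \<ominus>\<^bsub>Q'\<^esub> (r \<odot>\<^bsub>Q'\<^esub> v x)"
   using Q'.smult_r_distr[OF r, of "v x" "\<ominus>\<^bsub>Q'\<^esub> v x"] vD(1)[OF x] Q'.smult_closed r Q'.smult_zero_right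
   by (metis Q'.M.a_inv_closed Q'.M.minus_equality Q'.M.r_neg Q'.M.a_comm)
  then show "(\<lambda>x\<in>carrier P'. u x \<ominus>\<^bsub>Q'\<^esub> v x) (r \<odot>\<^bsub>P'\<^esub> x) = r \<odot>\<^bsub>Q'\<^esub> (\<lambda>x\<in>carrier P'. u x \<ominus>\<^bsub>Q'\<^esub> v x) x"
   using x r uD(1,4) vD(1,4) P'.smult_closed Q'.smult_r_distr by (simp add: Q'.M.minus_eq)
 qed simp
 have hm: "h n \<in> lin_hom R (res_obj P n) (res_obj Q n)" for n
  unfolding h_def by (rule diff_hom[OF fm gm Pd(2) Qd(2)])
 have diff_minus: "u (a \<ominus>\<^bsub>P'\<^esub> b) = u a \<ominus>\<^bsub>Q'\<^esub> u b"
  if u: "u \<in> lin_hom R P' Q'" and P': "left_module R P'" and Q': "left_module R Q'"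
   and ab: "a \<in> carrier P'" "b \<in> carrier P'"
  for u and P' :: "('r, 'u) module" and Q' :: "('r, 'w) module" and a b
 proof -
  interpret P': left_module R P' by fact
  interpret Q': left_module R Q' by fact
  show ?thesis using lin_homD(3)[OF u ab(1), of "\<ominus>\<^bsub>P'\<^esub> b"] lin_hom_minus[OF u P' Q' ab(2)] ab
   by (simp add: P'.M.minus_eq Q'.M.minus_eq)
 qed
 interpret MM: left_module R M by fact
 have h0: "res_aug Q (h 0 x) = \<zero>\<^bsub>M\<^esub>" if x: "x \<in> carrier (res_obj P 0)" for x
  using x f0[OF x] g0[OF x] lin_homD(1)[OF fm x] lin_homD(1)[OF gm x] lin_homD(1)[OF Pd(4) x]
  unfolding h_def by (simp add: diff_minus[OF Qd(4) Qd(2) M] MM.M.minus_eq MM.M.r_neg)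
 have hS: "res_diff Q n (h (Suc n) x) = h n (res_diff P n x)" if x: "x \<in> carrier (res_obj P (Suc n))" for x n
  using x fS[OF x] gS[OF x] lin_homD(1)[OF fm x] lin_homD(1)[OF gm x] lin_homD(1)[OF Pd(3) x]
  unfolding h_def by (simp add: diff_minus[OF Qd(3) Qd(2) Qd(2)])
 \<comment> \<open>In degree \<open>n\<close> the map \<open>s\<close> comes with the fact that the
   remaining error in degree \<open>Suc n\<close> is a boundary; its lift is the next component of
   the homotopy.\<close>
 let ?A = "%n s. s \<in> lin_hom R (res_obj P n) (res_obj Q (Suc n)) &
   (\<forall>x\<in>carrier (res_obj P (Suc n)). h (Suc n) x \<ominus>\<^bsub>res_obj Q (Suc n)\<^esub> s (res_diff P n x)
    \<in> res_diff Q (Suc n) ` carrier (res_obj Q (Suc (Suc n)))) &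
   (n = 0 --> (\<forall>x\<in>carrier (res_obj P 0). res_diff Q 0 (s x) = h 0 x))"
 let ?B = "%n s t. \<forall>x\<in>carrier (res_obj P (Suc n)). res_diff Q (Suc n) (t x) = h (Suc n) x \<ominus>\<^bsub>res_obj Q (Suc n)\<^esub> s (res_diff P n x)"
 \<comment> \<open>The error is a cycle, since the differential of \<open>s (d x)\<close> is
   \<open>h (d x)\<close> by the previous step; exactness of \<open>Q\<close> makes it a
   boundary.\<close>
 have next_im: "h (Suc n) x \<ominus>\<^bsub>res_obj Q (Suc n)\<^esub> s (res_diff P n x) \<in> res_diff Q (Suc n) ` carrier (res_obj Q (Suc (Suc n)))"
  if s: "s \<in> lin_hom R (res_obj P n) (res_obj Q (Suc n))" and x: "x \<in> carrier (res_obj P (Suc n))"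
   and e: "res_diff Q n (s (res_diff P n x)) = h n (res_diff P n x)" for n s x
 proof -
  interpret Qn: left_module R "res_obj Q n" using Qd(2) .
  interpret QS: left_module R "res_obj Q (Suc n)" using Qd(2) .
  have c: "h (Suc n) x \<in> carrier (res_obj Q (Suc n))" "s (res_diff P n x) \<in> carrier (res_obj Q (Suc n))"
   using lin_homD(1)[OF hm x] lin_homD(1)[OF s lin_homD(1)[OF Pd(3) x]] by auto
  have "res_diff Q n (h (Suc n) x \<ominus>\<^bsub>res_obj Q (Suc n)\<^esub> s (res_diff P n x)) = \<zero>\<^bsub>res_obj Q n\<^esub>"
   using diff_minus[OF Qd(3) Qd(2) Qd(2) c] hS[OF x] e lin_homD(1)[OF hm lin_homD(1)[OF Pd(3) x]]
   by (simp add: Qn.M.minus_eq Qn.M.r_neg)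
  then show ?thesis using Qd(7) c by auto
 qed
 have base: "EX s. ?A 0 s"
 proof -
  have "\<exists>s\<in>lin_hom R (res_obj P 0) (res_obj Q (Suc 0)). \<forall>x\<in>carrier (res_obj P 0). res_diff Q 0 (s x) = h 0 x"
   by (rule projective_lift[OF Pd(1) Qd(2) Qd(2) Qd(3) hm]) (use Qd(6) h0 lin_homD(1)[OF hm] in auto)
  then obtain s where s: "s \<in> lin_hom R (res_obj P 0) (res_obj Q (Suc 0))"
   "!!x. x \<in> carrier (res_obj P 0) ==> res_diff Q 0 (s x) = h 0 x" by blast
  then show ?thesis using next_im[OF s(1)] lin_homD(1)[OF Pd(3)] by blast
 qed
 have step: "EX t. ?A (Suc n) t & ?B n s t" if s: "?A n s" for s n
 proof -
  have sm: "s \<in> lin_hom R (res_obj P n) (res_obj Q (Suc n))" using s by blast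
  let ?k = "\<lambda>x\<in>carrier (res_obj P (Suc n)). h (Suc n) x \<ominus>\<^bsub>res_obj Q (Suc n)\<^esub>
   compose (carrier (res_obj P (Suc n))) s (res_diff P n) x"
  have km: "?k \<in> lin_hom R (res_obj P (Suc n)) (res_obj Q (Suc n))"
   by (rule diff_hom[OF hm lin_hom_compose[OF Pd(3) sm Pd(2)] Pd(2) Qd(2)])
  have "\<exists>t\<in>lin_hom R (res_obj P (Suc n)) (res_obj Q (Suc (Suc n))). \<forall>x\<in>carrier (res_obj P (Suc n)). res_diff Q (Suc n) (t x) = ?k x"
   by (rule projective_lift[OF Pd(1) Qd(2) Qd(2) Qd(3) km]) (use s in \<open>auto simp: compose_def\<close>)
  then obtain t where t: "t \<in> lin_hom R (res_obj P (Suc n)) (res_obj Q (Suc (Suc n)))" and tk: "?B n s t"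
   by (auto simp: compose_def)
  have "res_diff Q (Suc n) (t (res_diff P (Suc n) x)) = h (Suc n) (res_diff P (Suc n) x)"
   if x: "x \<in> carrier (res_obj P (Suc (Suc n)))" for x
  proof -
   interpret QS: left_module R "res_obj Q (Suc n)" using Qd(2) .
   have c: "res_diff P (Suc n) x \<in> carrier (res_obj P (Suc n))" using lin_homD(1)[OF Pd(3) x] .
   have "s (res_diff P n (res_diff P (Suc n) x)) = \<zero>\<^bsub>res_obj Q (Suc n)\<^esub>"
    using Pd(8)[OF x] lin_hom_zero[OF sm Pd(2) Qd(2)] by simp
   then show ?thesis using tk c lin_homD(1)[OF hm c] by (simp add: QS.M.minus_eq)
  qed
  then have "?A (Suc n) t" using t next_im[OF t] by auto
  then show ?thesis using tk by blast
 qed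
 have "EX s. ALL n. ?A n (s n) & ?B n (s n) (s (Suc n))"
  by (rule dependent_nat_choice[of ?A ?B]) (fact base, fact step)
 then obtain s where s': "ALL n. ?A n (s n) & ?B n (s n) (s (Suc n))" ..
 have s: "?A n (s n)" "?B n (s n) (s (Suc n))" for n using s' by simp_all
 have add_cancel: "a = b \<oplus>\<^bsub>Q'\<^esub> c"
  if "a \<ominus>\<^bsub>Q'\<^esub> b = c" "left_module R Q'" "a \<in> carrier Q'" "b \<in> carrier Q'" for a b c and Q' :: "('r, 'u) module"
 proof -
  interpret Q': left_module R Q' by fact
  show ?thesis using that by (auto simp: Q'.M.minus_eq Q'.M.a_ac Q'.M.r_neg)
 qed
 show ?thesis
 proof (intro exI[of _ s] conjI allI ballI)
  fix n show "s n \<in> lin_hom R (res_obj P n) (res_obj Q (Suc n))" using s(1) by blast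
  fix x assume x: "x \<in> carrier (res_obj P (Suc n))"
  have c: "f (Suc n) x \<in> carrier (res_obj Q (Suc n))" "g (Suc n) x \<in> carrier (res_obj Q (Suc n))"
   "h (Suc n) x \<in> carrier (res_obj Q (Suc n))" "s n (res_diff P n x) \<in> carrier (res_obj Q (Suc n))"
   using lin_homD(1)[OF fm x] lin_homD(1)[OF gm x] lin_homD(1)[OF hm x] s(1)[of n] lin_homD(1)[OF _ lin_homD(1)[OF Pd(3) x]] by auto
  interpret QS: left_module R "res_obj Q (Suc n)" using Qd(2) .
  have c': "res_diff Q (Suc n) (s (Suc n) x) \<in> carrier (res_obj Q (Suc n))"
   using s(1)[of "Suc n"] lin_homD(1)[OF _ x] lin_homD(1)[OF Qd(3)] by blast
  have "h (Suc n) x = s n (res_diff P n x) \<oplus>\<^bsub>res_obj Q (Suc n)\<^esub> res_diff Q (Suc n) (s (Suc n) x)"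
   by (rule add_cancel) (use s(2)[of n] x Qd(2) c in auto)
  then have "h (Suc n) x = res_diff Q (Suc n) (s (Suc n) x) \<oplus>\<^bsub>res_obj Q (Suc n)\<^esub> s n (res_diff P n x)"
   using c c' by (simp add: QS.M.a_comm)
  then show "f (Suc n) x = g (Suc n) x \<oplus>\<^bsub>res_obj Q (Suc n)\<^esub>
    (res_diff Q (Suc n) (s (Suc n) x) \<oplus>\<^bsub>res_obj Q (Suc n)\<^esub> s n (res_diff P n x))"
   using add_cancel[OF _ Qd(2) c(1,2)] x unfolding h_def by simp
 next
  fix x assume x: "x \<in> carrier (res_obj P 0)"
  show "f 0 x = g 0 x \<oplus>\<^bsub>res_obj Q 0\<^esub> res_diff Q 0 (s 0 x)"
   by (rule add_cancel) (use s(1)[of 0] x Qd(2) lin_homD(1)[OF fm x] lin_homD(1)[OF gm x] in \<open>auto simp: h_def\<close>)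
 qed
qed

lemma resolution_map_id:
 assumes "projective_resolution R M P" shows "resolution_map R P P (%n. \<lambda>x\<in>carrier (res_obj P n). x)"
proof -
 note Pd = projective_resolutionD[OF assms]
 have "(\<lambda>x\<in>carrier (res_obj P n). x) \<in> lin_hom R (res_obj P n) (res_obj P n)" for n
 proof -
  interpret left_module R "res_obj P n" using Pd(2) .
  show ?thesis by (rule lin_homI) (auto simp: smult_closed)
 qed
 then show ?thesis unfolding resolution_map_def using lin_homD(1)[OF Pd(3)] by auto
qed

lemma resolution_map_compose:
 assumes P: "projective_resolution R M P" and f: "resolution_map R P Q f" and g: "resolution_map R Q L g"
 shows "resolution_map R P L (%n. compose (carrier (res_obj P n)) (g n) (f n))"
proof -
 note Pd = projective_resolutionD[OF P]
 have fm: "f n \<in> lin_hom R (res_obj P n) (res_obj Q n)" and gm: "g n \<in> lin_hom R (res_obj Q n) (res_obj L n)" for n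
  using f g unfolding resolution_map_def by auto
 then show ?thesis using f g lin_hom_compose[OF fm gm Pd(2)] lin_homD(1)[OF Pd(3)] lin_homD(1)[OF fm]
  unfolding resolution_map_def by (auto simp: compose_def)
qed

section \<open>Hom complexes\<close>

definition central_map :: "('k::field => 'r) => 'r ring => bool" where
 "central_map io R \<longleftrightarrow> (ALL a. io a \<in> carrier R) & (ALL a b. io (a + b) = io a \<oplus>\<^bsub>R\<^esub> io b) &
   (ALL a b. io (a * b) = io a \<otimes>\<^bsub>R\<^esub> io b) & io 1 = \<one>\<^bsub>R\<^esub> &
   (ALL a. \<forall>r\<in>carrier R. io a \<otimes>\<^bsub>R\<^esub> r = r \<otimes>\<^bsub>R\<^esub> io a)"

lemma central_mapD:
 assumes "central_map io R"
 shows "io a \<in> carrier R" "io (a + b) = io a \<oplus>\<^bsub>R\<^esub> io b" "io (a * b) = io a \<otimes>\<^bsub>R\<^esub> io b" "io 1 = \<one>\<^bsub>R\<^esub>"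
  "r \<in> carrier R ==> io a \<otimes>\<^bsub>R\<^esub> r = r \<otimes>\<^bsub>R\<^esub> io a"
 using assms unfolding central_map_def by blast+

definition restrict_scalars :: "('k::field => 'r) => ('r, 'n) module => ('k, 'n) module" where
 "restrict_scalars io N = \<lparr>carrier = carrier N, monoid.mult = undefined, one = undefined,
   zero = \<zero>\<^bsub>N\<^esub>, add = add N, module.smult = (%a x. io a \<odot>\<^bsub>N\<^esub> x)\<rparr>"

lemma restrict_scalars_simps:
 "carrier (restrict_scalars io N) = carrier N" "\<zero>\<^bsub>restrict_scalars io N\<^esub> = \<zero>\<^bsub>N\<^esub>"
 "x \<oplus>\<^bsub>restrict_scalars io N\<^esub> y = x \<oplus>\<^bsub>N\<^esub> y" "a \<odot>\<^bsub>restrict_scalars io N\<^esub> x = io a \<odot>\<^bsub>N\<^esub> x"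
 unfolding restrict_scalars_def by simp_all

lemma left_module_restrict_scalars:
 assumes io: "central_map io R" and N: "left_module R N" shows "left_module kk (restrict_scalars io N)"
proof -
 interpret N: left_module R N by fact
 note ios = central_mapD[OF io]
 show ?thesis
 proof (intro left_module.intro ring_kk abelian_groupI left_module_axioms.intro)
  fix x assume "x \<in> carrier (restrict_scalars io N)"
  then have x: "x \<in> carrier N" by (simp add: restrict_scalars_simps)
  then have "\<ominus>\<^bsub>N\<^esub> x \<oplus>\<^bsub>N\<^esub> x = \<zero>\<^bsub>N\<^esub>" by (rule N.M.l_neg)
  then show "\<exists>y\<in>carrier (restrict_scalars io N). y \<oplus>\<^bsub>restrict_scalars io N\<^esub> x = \<zero>\<^bsub>restrict_scalars io N\<^esub>"
   unfolding restrict_scalars_simps using N.M.a_inv_closed[OF x] by blast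
 qed (simp_all add: restrict_scalars_simps ios(1-4) N.M.a_ac N.smult_closed
   N.smult_l_distr N.smult_r_distr N.smult_assoc N.smult_one)
qed

text \<open>Linear maps form a subset of the functions from \<open>carrier M\<close> to
  \<open>N\<close>. Since \<open>direct_sum\<close> is defined by a full product, it models this
  function space even for an infinite index set, and the module axioms are inherited from
  it.\<close>

lemma left_module_hom_space:
 assumes io: "central_map io R" and M: "left_module R M" and N: "left_module R N"
 shows "left_module kk (hom_space io R M N)"
proof -
 interpret M: left_module R M by fact
 interpret N: left_module R N by fact
 let ?D = "direct_sum (carrier M) (%_. restrict_scalars io N)" and ?H = "hom_space io R M N"
 have D: "left_module kk ?D"
  by (rule left_module_direct_sum[OF ring_kk left_module_restrict_scalars[OF io N]])
 have carr: "carrier ?H = lin_hom R M N" unfolding hom_space_def by simp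
 show ?thesis
 proof (rule left_module_inj[OF D, where l = "%x. x"])
  show "!!f. f \<in> carrier ?H ==> f \<in> carrier ?D"
   unfolding carr lin_hom_def direct_sum_def restrict_scalars_def by auto
  show "\<zero>\<^bsub>?H\<^esub> = \<zero>\<^bsub>?D\<^esub>" unfolding hom_space_def direct_sum_def restrict_scalars_def by simp
  show "\<zero>\<^bsub>?H\<^esub> \<in> carrier ?H" unfolding carr
   by (rule lin_homI) (auto simp: hom_space_def N.smult_zero_right M.smult_closed)
  show "f \<oplus>\<^bsub>?H\<^esub> g \<in> carrier ?H" if "f \<in> carrier ?H" "g \<in> carrier ?H" for f g
   unfolding carr using lin_homD[of f R M N] lin_homD[of g R M N] that[unfolded carr]
   by (intro lin_homI) (auto simp: hom_space_def N.smult_r_distr M.smult_closed N.M.a_ac)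
  show "f \<oplus>\<^bsub>?H\<^esub> g = f \<oplus>\<^bsub>?D\<^esub> g" for f g unfolding hom_space_def direct_sum_def restrict_scalars_def by simp
  \<comment> \<open>Centrality makes multiplication by a field scalar commute with the action of
    \<open>R\<close>, so a scalar multiple of an \<open>R\<close>-linear map is again
    \<open>R\<close>-linear.\<close>
  have com: "io a \<odot>\<^bsub>N\<^esub> (r \<odot>\<^bsub>N\<^esub> x) = r \<odot>\<^bsub>N\<^esub> (io a \<odot>\<^bsub>N\<^esub> x)" if "r \<in> carrier R" "x \<in> carrier N" for a r x
   using N.smult_assoc[OF central_mapD(1)[OF io] that] N.smult_assoc[OF that(1) central_mapD(1)[OF io] that(2)]
    central_mapD(5)[OF io that(1)] by metis
  have ioc: "io a \<in> carrier R" for a using io unfolding central_map_def by blast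
  show "r \<odot>\<^bsub>?H\<^esub> f \<in> carrier ?H" if "r \<in> carrier kk" "f \<in> carrier ?H" for r f
   unfolding carr using lin_homD[of f R M N] that[unfolded carr] ioc
   by (intro lin_homI) (auto simp: hom_space_def N.smult_r_distr M.smult_closed N.smult_closed com)
  show "r \<odot>\<^bsub>?H\<^esub> f = r \<odot>\<^bsub>?D\<^esub> f" for r f unfolding hom_space_def direct_sum_def restrict_scalars_def by simp
 qed simp
qed

lemma left_module_zero_part:
 assumes "left_module kk H" shows "left_module kk (zero_part H)"
proof -
 interpret left_module kk H by fact
 show ?thesis
  by (rule left_module_inj[OF assms, where l = "%x. x"]) (use smult_zero_right in \<open>auto simp: zero_part_def\<close>)
qed

lemma carrier_hom_space [simp]: "carrier (hom_space io R M N) = lin_hom R M N"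
 and zero_hom_space: "\<zero>\<^bsub>hom_space io R M N\<^esub> = (\<lambda>x\<in>carrier M. \<zero>\<^bsub>N\<^esub>)"
 and add_hom_space: "f \<oplus>\<^bsub>hom_space io R M N\<^esub> g = (\<lambda>x\<in>carrier M. f x \<oplus>\<^bsub>N\<^esub> g x)"
 and smult_hom_space: "a \<odot>\<^bsub>hom_space io R M N\<^esub> f = (\<lambda>x\<in>carrier M. io a \<odot>\<^bsub>N\<^esub> f x)"
 unfolding hom_space_def by auto

lemma obj_hom_cochain_nonneg [simp]: "obj (hom_cochain io R Q N) (int n) = hom_space io R (res_obj Q n) N"
 and obj_hom_cochain_neg: "p < 0 ==> obj (hom_cochain io R Q N) p = zero_part (hom_space io R (res_obj Q 0) N)"
 unfolding hom_cochain_def hom_cochain_obj_def by auto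

lemma obj_hom_cochain_Suc [simp]: "obj (hom_cochain io R Q N) (int n + 1) = hom_space io R (res_obj Q (Suc n)) N"
 using obj_hom_cochain_nonneg[of io R Q N "Suc n"] by (simp add: add.commute)

lemma diff_hom_cochain_nonneg: "f \<in> lin_hom R (res_obj Q n) N ==>
  diff (hom_cochain io R Q N) (int n) f = compose (carrier (res_obj Q (Suc n))) f (res_diff Q n)"
 and diff_hom_cochain_neg: "p < 0 ==> f \<in> carrier (obj (hom_cochain io R Q N) p) ==>
  diff (hom_cochain io R Q N) p f = \<zero>\<^bsub>obj (hom_cochain io R Q N) (p + 1)\<^esub>"
 unfolding hom_cochain_def hom_cochain_obj_def by auto

lemma diff_hom_cochain_extensional:
 "f \<notin> carrier (obj (hom_cochain io R Q N) p) ==> diff (hom_cochain io R Q N) p f = undefined"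
 unfolding hom_cochain_def by auto

lemma zero_obj_hom_cochain_neg:
 "p < 0 ==> carrier (obj (hom_cochain io R Q N) p) = {\<zero>\<^bsub>obj (hom_cochain io R Q N) p\<^esub>}"
 by (simp add: obj_hom_cochain_neg zero_part_def)

lemma int_cases_nonneg: obtains "p < 0" | n where "p = int n"
 by (metis nonneg_int_cases not_le_imp_less)

lemma cochain_complex_hom_cochain:
 assumes io: "central_map io R" and Q: "projective_resolution R M Q" and N: "left_module R N"
 shows "cochain_complex (hom_cochain io R Q N)"
proof -
 note Qd = projective_resolutionD[OF Q]
 interpret N: left_module R N by fact
 let ?H = "hom_cochain io R Q N"
 have lm: "left_module kk (obj ?H p)" for p
  by (cases rule: int_cases_nonneg[of p])
   (use left_module_hom_space[OF io Qd(2) N] left_module_zero_part in \<open>auto simp: obj_hom_cochain_neg\<close>)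
 have zc: "\<zero>\<^bsub>obj ?H p\<^esub> \<in> carrier (obj ?H p)" for p
 proof -
  interpret left_module kk "obj ?H p" using lm .
  show ?thesis by simp
 qed
 have dm: "diff ?H p \<in> lin_hom kk (obj ?H p) (obj ?H (p + 1))" for p
 proof (cases rule: int_cases_nonneg[of p])
  case 1
  interpret O: left_module kk "obj ?H p" using lm .
  interpret O1: left_module kk "obj ?H (p + 1)" using lm .
  show ?thesis
   by (rule lin_homI) (use diff_hom_cochain_extensional[of _ io R Q N p] in \<open>auto simp: diff_hom_cochain_neg[OF 1] O.smult_closed O1.smult_zero_right\<close>)
 next
  case (2 n)
  interpret O: left_module kk "obj ?H p" using lm .
  have Oc: "carrier (obj ?H p) = lin_hom R (res_obj Q n) N" unfolding 2 by simp
  show ?thesis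
  proof (rule lin_homI)
   fix f assume f: "f \<in> carrier (obj ?H p)"
   then have fm: "f \<in> lin_hom R (res_obj Q n) N" unfolding Oc .
   show "diff ?H p f \<in> carrier (obj ?H (p + 1))"
    unfolding 2 diff_hom_cochain_nonneg[OF fm] using lin_hom_compose[OF Qd(3) fm Qd(2)] by simp
   {
    fix g assume g: "g \<in> carrier (obj ?H p)"
    then have gm: "g \<in> lin_hom R (res_obj Q n) N" unfolding Oc .
    have fg: "f \<oplus>\<^bsub>obj ?H p\<^esub> g \<in> lin_hom R (res_obj Q n) N" using O.M.a_closed[OF f g] unfolding Oc .
    show "diff ?H p (f \<oplus>\<^bsub>obj ?H p\<^esub> g) = diff ?H p f \<oplus>\<^bsub>obj ?H (p + 1)\<^esub> diff ?H p g"
     unfolding 2 diff_hom_cochain_nonneg[OF fg[unfolded 2]] diff_hom_cochain_nonneg[OF fm] diff_hom_cochain_nonneg[OF gm]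
     using lin_homD(1)[OF Qd(3)] by (auto simp: add_hom_space compose_def fun_eq_iff)
   }
   fix r assume r: "r \<in> carrier (kk :: 'a ring)"
   have rf: "r \<odot>\<^bsub>obj ?H p\<^esub> f \<in> lin_hom R (res_obj Q n) N" using O.smult_closed[OF r f] unfolding Oc .
   show "diff ?H p (r \<odot>\<^bsub>obj ?H p\<^esub> f) = r \<odot>\<^bsub>obj ?H (p + 1)\<^esub> diff ?H p f"
    unfolding 2 diff_hom_cochain_nonneg[OF rf[unfolded 2]] diff_hom_cochain_nonneg[OF fm]
    using lin_homD(1)[OF Qd(3)] by (auto simp: smult_hom_space compose_def fun_eq_iff)
  qed (rule diff_hom_cochain_extensional)
 qed
 have "diff ?H (p + 1) (diff ?H p f) = \<zero>\<^bsub>obj ?H (p + 1 + 1)\<^esub>" if f: "f \<in> carrier (obj ?H p)" for p f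
 proof (cases rule: int_cases_nonneg[of p])
  case 1
  then show ?thesis
   using diff_hom_cochain_neg[OF 1 f] lin_hom_zero[OF dm[of "p + 1"] lm lm] by simp
 next
  case (2 n)
  have fm: "f \<in> lin_hom R (res_obj Q n) N" using f 2 by simp
  note dfm = lin_hom_compose[OF Qd(3) fm Qd(2)]
  have e: "int n + 1 = int (Suc n)" by simp
  have "compose (carrier (res_obj Q (Suc (Suc n)))) (compose (carrier (res_obj Q (Suc n))) f (res_diff Q n)) (res_diff Q (Suc n))
   = (\<lambda>x\<in>carrier (res_obj Q (Suc (Suc n))). \<zero>\<^bsub>N\<^esub>)"
   using lin_homD(1)[OF Qd(3)] Qd(8) lin_hom_zero[OF fm Qd(2) N] by (auto simp: compose_def fun_eq_iff)
  then show ?thesis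
   unfolding 2 diff_hom_cochain_nonneg[OF fm] e diff_hom_cochain_nonneg[OF dfm] obj_hom_cochain_Suc zero_hom_space .
 qed
 then show ?thesis unfolding cochain_complex_def using lm dm by blast
qed

lemma cocycles_hom_cochain:
 "cocycles (hom_cochain io R Q N) (int n) =
  {f \<in> lin_hom R (res_obj Q n) N. \<forall>x\<in>carrier (res_obj Q (Suc n)). f (res_diff Q n x) = \<zero>\<^bsub>N\<^esub>}"
 unfolding cocycles_def
 by (auto simp: diff_hom_cochain_nonneg zero_hom_space compose_def fun_eq_iff restrict_def split: if_splits)

lemma coboundaries_hom_cochain_0: "coboundaries (hom_cochain io R Q N) 0 = {\<lambda>x\<in>carrier (res_obj Q 0). \<zero>\<^bsub>N\<^esub>}"
 unfolding coboundaries_def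
 using zero_obj_hom_cochain_neg[of "-1" io R Q N] diff_hom_cochain_neg[of "-1" _ io R Q N] obj_hom_cochain_nonneg[of io R Q N 0]
 by (simp add: zero_hom_space)

lemma coboundaries_hom_cochain_Suc: "coboundaries (hom_cochain io R Q N) (int (Suc n)) =
  (%f. compose (carrier (res_obj Q (Suc n))) f (res_diff Q n)) ` lin_hom R (res_obj Q n) N"
 unfolding coboundaries_def by (auto simp: diff_hom_cochain_nonneg image_iff)

text \<open>In negative degrees the target complex is zero, and its zero element is the only
  possible value.\<close>

definition hom_pullback :: "('k::field => 'r) => 'r ring => ('r, 'q, 'm) resolution => ('r, 'u, 'm) resolution =>
  ('r, 'n) module => (nat => 'q => 'u) => int => ('u => 'n) => ('q => 'n)" where
 "hom_pullback io R P Q N \<phi> p = (\<lambda>f\<in>carrier (obj (hom_cochain io R Q N) p).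
   if 0 \<le> p then compose (carrier (res_obj P (nat p))) f (\<phi> (nat p)) else \<zero>\<^bsub>obj (hom_cochain io R P N) p\<^esub>)"

lemma hom_pullback_nonneg:
 "f \<in> lin_hom R (res_obj Q n) N ==> hom_pullback io R P Q N \<phi> (int n) f = compose (carrier (res_obj P n)) f (\<phi> n)"
 unfolding hom_pullback_def by simp

lemma chain_map_hom_pullback:
 fixes P :: "('r, 'q, 'm) resolution" and Q :: "('r, 'u, 'm) resolution" and io :: "'k::field => 'r"
 assumes io: "central_map io R" and N: "left_module R N"
  and P: "projective_resolution R M P" and Q: "projective_resolution R M Q" and \<phi>: "resolution_map R P Q \<phi>"
 shows "chain_map (hom_cochain io R Q N) (hom_cochain io R P N) (hom_pullback io R P Q N \<phi>)"
 unfolding chain_map_def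
proof (intro allI conjI ballI)
 note Pd = projective_resolutionD[OF P] and Qd = projective_resolutionD[OF Q]
 note cP = cochain_complex_hom_cochain[OF io P N] and cQ = cochain_complex_hom_cochain[OF io Q N]
 let ?A = "hom_cochain io R Q N" and ?B = "hom_cochain io R P N" and ?h = "hom_pullback io R P Q N \<phi>"
 have \<phi>m: "\<phi> n \<in> lin_hom R (res_obj P n) (res_obj Q n)"
  and \<phi>S: "x \<in> carrier (res_obj P (Suc n)) ==> res_diff Q n (\<phi> (Suc n) x) = \<phi> n (res_diff P n x)" for n x
  using \<phi> unfolding resolution_map_def by auto
 fix p
 interpret B: left_module kk "obj ?B p" using cochain_complexD(1)[OF cP] .
 interpret A: left_module kk "obj ?A p" using cochain_complexD(1)[OF cQ] .
 show hm: "?h p \<in> lin_hom kk (obj ?A p) (obj ?B p)"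
 proof (cases rule: int_cases_nonneg[of p])
  case 1
  then have hz: "?h p f = \<zero>\<^bsub>obj ?B p\<^esub>" if "f \<in> carrier (obj ?A p)" for f
   using that unfolding hom_pullback_def by simp
  show ?thesis
   by (rule lin_homI) (simp_all add: hz A.smult_closed B.smult_zero_right, simp add: hom_pullback_def)
 next
  case (2 n)
  have Ac: "carrier (obj ?A p) = lin_hom R (res_obj Q n) N" unfolding 2 by simp
  show ?thesis
  proof (rule lin_homI)
   show "f \<notin> carrier (obj ?A p) ==> ?h p f = undefined" for f unfolding hom_pullback_def by simp
   fix f assume f: "f \<in> carrier (obj ?A p)"
   then have fm: "f \<in> lin_hom R (res_obj Q n) N" unfolding Ac .
   show "?h p f \<in> carrier (obj ?B p)" unfolding 2 hom_pullback_nonneg[OF fm]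
    using lin_hom_compose[OF \<phi>m fm Pd(2)] by simp
   {
    fix g assume g: "g \<in> carrier (obj ?A p)"
    then have gm: "g \<in> lin_hom R (res_obj Q n) N" unfolding Ac .
    have fg: "f \<oplus>\<^bsub>obj ?A p\<^esub> g \<in> lin_hom R (res_obj Q n) N" using A.M.a_closed[OF f g] unfolding Ac .
    show "?h p (f \<oplus>\<^bsub>obj ?A p\<^esub> g) = ?h p f \<oplus>\<^bsub>obj ?B p\<^esub> ?h p g"
     unfolding 2 hom_pullback_nonneg[OF fg[unfolded 2]] hom_pullback_nonneg[OF fm] hom_pullback_nonneg[OF gm]
     using lin_homD(1)[OF \<phi>m] by (auto simp: add_hom_space compose_def fun_eq_iff)
   }
   fix r assume r: "r \<in> carrier (kk :: 'k ring)"
   have rf: "r \<odot>\<^bsub>obj ?A p\<^esub> f \<in> lin_hom R (res_obj Q n) N" using A.smult_closed[OF r f] unfolding Ac .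
   show "?h p (r \<odot>\<^bsub>obj ?A p\<^esub> f) = r \<odot>\<^bsub>obj ?B p\<^esub> ?h p f"
    unfolding 2 hom_pullback_nonneg[OF rf[unfolded 2]] hom_pullback_nonneg[OF fm]
    using lin_homD(1)[OF \<phi>m] by (auto simp: smult_hom_space compose_def fun_eq_iff)
  qed
 qed
 fix f assume f: "f \<in> carrier (obj ?A p)"
 have dz: "diff ?B p \<zero>\<^bsub>obj ?B p\<^esub> = \<zero>\<^bsub>obj ?B (p + 1)\<^esub>"
  by (rule lin_hom_zero[OF cochain_complexD(2)[OF cP] cochain_complexD(1)[OF cP] cochain_complexD(1)[OF cP]])
 show "?h (p + 1) (diff ?A p f) = diff ?B p (?h p f)"
 proof (cases rule: int_cases_nonneg[of p])
  case 1
  then have hz: "?h p f = \<zero>\<^bsub>obj ?B p\<^esub>" using f unfolding hom_pullback_def by simp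
  interpret B1: left_module kk "obj ?B (p + 1)" using cochain_complexD(1)[OF cP] .
  interpret A1: left_module kk "obj ?A (p + 1)" using cochain_complexD(1)[OF cQ] .
  \<comment> \<open>The passage from degree -1 to degree 0 is a separate case, because the formula
    for \<open>hom_pullback\<close> changes there.\<close>
  have "?h (p + 1) \<zero>\<^bsub>obj ?A (p + 1)\<^esub> = \<zero>\<^bsub>obj ?B (p + 1)\<^esub>"
  proof (cases "p + 1 = 0")
   case False
   then show ?thesis using 1 A1.M.zero_closed unfolding hom_pullback_def by simp
  next
   case True
   have "(\<lambda>x\<in>carrier (res_obj Q 0). \<zero>\<^bsub>N\<^esub>) \<in> lin_hom R (res_obj Q 0) N"
    using A1.M.zero_closed obj_hom_cochain_nonneg[of io R Q N 0] unfolding True by (simp add: zero_hom_space)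
   from hom_pullback_nonneg[OF this, of io P \<phi>] show ?thesis
    using obj_hom_cochain_nonneg[of io R Q N 0] obj_hom_cochain_nonneg[of io R P N 0] lin_homD(1)[OF \<phi>m[of 0]]
    unfolding True by (auto simp: zero_hom_space compose_def fun_eq_iff)
  qed
  then show ?thesis using diff_hom_cochain_neg[OF 1 f] hz dz by simp
 next
  case (2 n)
  have fm: "f \<in> lin_hom R (res_obj Q n) N" using f 2 by simp
  have e: "int n + 1 = int (Suc n)" by simp
  have "compose (carrier (res_obj P (Suc n))) (compose (carrier (res_obj Q (Suc n))) f (res_diff Q n)) (\<phi> (Suc n)) =
   compose (carrier (res_obj P (Suc n))) (compose (carrier (res_obj P n)) f (\<phi> n)) (res_diff P n)"
   using \<phi>S lin_homD(1)[OF \<phi>m] lin_homD(1)[OF Pd(3)] by (auto simp: compose_def fun_eq_iff)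
  then show ?thesis
   unfolding 2 hom_pullback_nonneg[OF fm] diff_hom_cochain_nonneg[OF fm] e
    hom_pullback_nonneg[OF lin_hom_compose[OF Qd(3) fm Qd(2)]]
    diff_hom_cochain_nonneg[OF lin_hom_compose[OF \<phi>m fm Pd(2)]] .
 qed
qed

text \<open>Apply a cocycle \<open>f\<close> on \<open>Q\<close> to the homotopy identity
  \<open>1 = \<phi> \<psi> + d t + t d\<close>. The middle term dies, so
  \<open>f = f \<phi> \<psi> + (f t) d\<close>; if \<open>f \<phi> = u d\<close>, this makes
  \<open>f\<close> the coboundary of \<open>u \<psi> + f t\<close>. In the same way a cocycle
  \<open>f\<close> on \<open>P\<close> is the pullback of \<open>f \<psi>\<close> plus the
  coboundary of \<open>f s\<close>.\<close>

lemma qiso_hom_cochain: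
 fixes P :: "('r, 'q, 'm) resolution" and Q :: "('r, 'u, 'm) resolution" and io :: "'k::field => 'r"
 assumes io: "central_map io R" and M: "left_module R M" and N: "left_module R N"
  and P: "projective_resolution R M P" and Q: "projective_resolution R M Q"
 shows "EX g. qiso (hom_cochain io R Q N) (hom_cochain io R P N) g"
proof -
 note Pd = projective_resolutionD[OF P] and Qd = projective_resolutionD[OF Q]
 note cP = cochain_complex_hom_cochain[OF io P N] and cQ = cochain_complex_hom_cochain[OF io Q N]
 let ?A = "hom_cochain io R Q N" and ?B = "hom_cochain io R P N"
 obtain \<phi> where \<phi>: "resolution_map R P Q \<phi>" using resolution_map_exists[OF M P Q] by blast
 obtain \<psi> where \<psi>: "resolution_map R Q P \<psi>" using resolution_map_exists[OF M Q P] by blast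
 let ?h = "hom_pullback io R P Q N \<phi>"
 interpret N: left_module R N by fact
 have \<phi>m: "\<phi> n \<in> lin_hom R (res_obj P n) (res_obj Q n)" and \<psi>m: "\<psi> n \<in> lin_hom R (res_obj Q n) (res_obj P n)"
  and \<phi>S: "x \<in> carrier (res_obj P (Suc n)) ==> res_diff Q n (\<phi> (Suc n) x) = \<phi> n (res_diff P n x)"
  and \<psi>S: "y \<in> carrier (res_obj Q (Suc n)) ==> res_diff P n (\<psi> (Suc n) y) = \<psi> n (res_diff Q n y)" for n x y
  using \<phi> \<psi> unfolding resolution_map_def by auto
 \<comment> \<open>\<open>s\<close> compares the identity of \<open>P\<close> with the round trip
   through \<open>Q\<close>; \<open>t\<close> below does the same starting from
   \<open>Q\<close>.\<close>
 obtain s where s: "!!n. s n \<in> lin_hom R (res_obj P n) (res_obj P (Suc n))"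
  and s0: "!!x. x \<in> carrier (res_obj P 0) ==> x = \<psi> 0 (\<phi> 0 x) \<oplus>\<^bsub>res_obj P 0\<^esub> res_diff P 0 (s 0 x)"
  and sS: "!!n x. x \<in> carrier (res_obj P (Suc n)) ==> x = \<psi> (Suc n) (\<phi> (Suc n) x) \<oplus>\<^bsub>res_obj P (Suc n)\<^esub>
    (res_diff P (Suc n) (s (Suc n) x) \<oplus>\<^bsub>res_obj P (Suc n)\<^esub> s n (res_diff P n x))"
  using resolution_map_homotopy[OF M P P resolution_map_id[OF P] resolution_map_compose[OF P \<phi> \<psi>]]
  by (auto simp: compose_def) blast
 obtain t where t: "!!n. t n \<in> lin_hom R (res_obj Q n) (res_obj Q (Suc n))"
  and t0: "!!x. x \<in> carrier (res_obj Q 0) ==> x = \<phi> 0 (\<psi> 0 x) \<oplus>\<^bsub>res_obj Q 0\<^esub> res_diff Q 0 (t 0 x)"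
  and tS: "!!n x. x \<in> carrier (res_obj Q (Suc n)) ==> x = \<phi> (Suc n) (\<psi> (Suc n) x) \<oplus>\<^bsub>res_obj Q (Suc n)\<^esub>
    (res_diff Q (Suc n) (t (Suc n) x) \<oplus>\<^bsub>res_obj Q (Suc n)\<^esub> t n (res_diff Q n x))"
  using resolution_map_homotopy[OF M Q Q resolution_map_id[OF Q] resolution_map_compose[OF Q \<psi> \<phi>]]
  by (auto simp: compose_def) blast
 have inj: "f \<in> coboundaries ?A p" if f: "f \<in> cocycles ?A p" and hf: "?h p f \<in> coboundaries ?B p" for p f
 proof (cases rule: int_cases_nonneg[of p])
  case 1
  interpret A: left_module kk "obj ?A p" using cochain_complexD(1)[OF cQ] .
  have "f = \<zero>\<^bsub>obj ?A p\<^esub>" using f zero_obj_hom_cochain_neg[OF 1] unfolding cocycles_def by blast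
  then show ?thesis using A.submoduleD(2)[OF submodule_coboundaries[OF cQ]] by simp
 next
  case (2 n)
  have fm: "f \<in> lin_hom R (res_obj Q n) N" and fz: "!!x. x \<in> carrier (res_obj Q (Suc n)) ==> f (res_diff Q n x) = \<zero>\<^bsub>N\<^esub>"
   using f unfolding 2 cocycles_hom_cochain by auto
  note fD = lin_homD[OF fm]
  have hf': "compose (carrier (res_obj P n)) f (\<phi> n) \<in> coboundaries ?B (int n)"
   using hf unfolding 2 hom_pullback_nonneg[OF fm] .
  show ?thesis
  proof (cases n)
   case 0
   have h0: "f (\<phi> 0 x) = \<zero>\<^bsub>N\<^esub>" if "x \<in> carrier (res_obj P 0)" for x
   proof -
    have "compose (carrier (res_obj P 0)) f (\<phi> 0) = (\<lambda>x\<in>carrier (res_obj P 0). \<zero>\<^bsub>N\<^esub>)"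
     using hf' unfolding 0 by (simp add: coboundaries_hom_cochain_0)
    from fun_cong[OF this, of x] show ?thesis using that by (simp add: compose_def)
   qed
   have "f x = \<zero>\<^bsub>N\<^esub>" if x: "x \<in> carrier (res_obj Q 0)" for x
   proof -
    have c: "\<phi> 0 (\<psi> 0 x) \<in> carrier (res_obj Q 0)" "res_diff Q 0 (t 0 x) \<in> carrier (res_obj Q 0)"
     "t 0 x \<in> carrier (res_obj Q (Suc 0))" "\<psi> 0 x \<in> carrier (res_obj P 0)"
     using lin_homD(1)[OF \<phi>m lin_homD(1)[OF \<psi>m x]] lin_homD(1)[OF Qd(3) lin_homD(1)[OF t x]]
      lin_homD(1)[OF t x] lin_homD(1)[OF \<psi>m x] by auto
    have "f x = f (\<phi> 0 (\<psi> 0 x)) \<oplus>\<^bsub>N\<^esub> f (res_diff Q 0 (t 0 x))"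
     using arg_cong[OF t0[OF x], of f] fD(3) c unfolding 0 by simp
    then show ?thesis using h0[OF c(4)] fz c(3) unfolding 0 by simp
   qed
   then have "f = (\<lambda>x\<in>carrier (res_obj Q 0). \<zero>\<^bsub>N\<^esub>)" using fD(2) unfolding 0 by (auto simp: fun_eq_iff)
   then show ?thesis unfolding 2 0 by (simp add: coboundaries_hom_cochain_0)
  next
   case (Suc m)
   obtain u where u: "u \<in> lin_hom R (res_obj P m) N"
    and ue: "compose (carrier (res_obj P (Suc m))) f (\<phi> (Suc m)) = compose (carrier (res_obj P (Suc m))) u (res_diff P m)"
    using hf' unfolding Suc coboundaries_hom_cochain_Suc by blast
   have ux: "f (\<phi> (Suc m) x) = u (res_diff P m x)" if "x \<in> carrier (res_obj P (Suc m))" for x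
    using fun_cong[OF ue, of x] that by (simp add: compose_def)
   let ?w1 = "compose (carrier (res_obj Q m)) u (\<psi> m)" and ?w2 = "compose (carrier (res_obj Q m)) f (t m)"
   have w1: "?w1 \<in> lin_hom R (res_obj Q m) N" using lin_hom_compose[OF \<psi>m u Qd(2)] .
   have w2: "?w2 \<in> lin_hom R (res_obj Q m) N" using lin_hom_compose[OF t fm[unfolded Suc] Qd(2)] .
   interpret H: left_module kk "hom_space io R (res_obj Q m) N" using left_module_hom_space[OF io Qd(2) N] .
   let ?w = "?w1 \<oplus>\<^bsub>hom_space io R (res_obj Q m) N\<^esub> ?w2"
   have w: "?w \<in> lin_hom R (res_obj Q m) N" using H.M.a_closed[of ?w1 ?w2] w1 w2 by simp
   have "f x = compose (carrier (res_obj Q (Suc m))) ?w (res_diff Q m) x" for x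
   proof (cases "x \<in> carrier (res_obj Q (Suc m))")
    case False then show ?thesis using fD(2) unfolding Suc compose_def by simp
   next
    case x: True
    have c: "\<psi> (Suc m) x \<in> carrier (res_obj P (Suc m))" "\<phi> (Suc m) (\<psi> (Suc m) x) \<in> carrier (res_obj Q (Suc m))"
     "t (Suc m) x \<in> carrier (res_obj Q (Suc (Suc m)))" "res_diff Q (Suc m) (t (Suc m) x) \<in> carrier (res_obj Q (Suc m))"
     "res_diff Q m x \<in> carrier (res_obj Q m)" "t m (res_diff Q m x) \<in> carrier (res_obj Q (Suc m))"
     using lin_homD(1)[OF \<psi>m x] lin_homD(1)[OF \<phi>m lin_homD(1)[OF \<psi>m x]] lin_homD(1)[OF t x]
      lin_homD(1)[OF Qd(3) lin_homD(1)[OF t x]] lin_homD(1)[OF Qd(3) x] lin_homD(1)[OF t lin_homD(1)[OF Qd(3) x]] by auto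
    interpret QS: left_module R "res_obj Q (Suc m)" using Qd(2) .
    have "f x = f (\<phi> (Suc m) (\<psi> (Suc m) x)) \<oplus>\<^bsub>N\<^esub> (f (res_diff Q (Suc m) (t (Suc m) x)) \<oplus>\<^bsub>N\<^esub> f (t m (res_diff Q m x)))"
     using arg_cong[OF tS[OF x], of f] fD(3) c unfolding Suc by simp
    also have "\<dots> = u (\<psi> m (res_diff Q m x)) \<oplus>\<^bsub>N\<^esub> f (t m (res_diff Q m x))"
     using ux[OF c(1)] \<psi>S[OF x] fz[unfolded Suc, OF c(3)] fD(1)[unfolded Suc, OF c(6)] by simp
    finally show ?thesis using x c(5) by (simp add: compose_def add_hom_space)
   qed
   then have "f = compose (carrier (res_obj Q (Suc m))) ?w (res_diff Q m)" by blast
   then show ?thesis unfolding 2 Suc coboundaries_hom_cochain_Suc using w by blast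
  qed
 qed
 have surj: "\<exists>g\<in>cocycles ?A p. \<exists>b\<in>coboundaries ?B p. f = ?h p g \<oplus>\<^bsub>obj ?B p\<^esub> b" if f: "f \<in> cocycles ?B p" for p f
 proof (cases rule: int_cases_nonneg[of p])
  case 1
  interpret A: left_module kk "obj ?A p" using cochain_complexD(1)[OF cQ] .
  interpret B: left_module kk "obj ?B p" using cochain_complexD(1)[OF cP] .
  have "\<zero>\<^bsub>obj ?A p\<^esub> \<in> cocycles ?A p" using A.submoduleD(2)[OF submodule_cocycles[OF cQ]] .
  moreover have "\<zero>\<^bsub>obj ?B p\<^esub> \<in> coboundaries ?B p" using B.submoduleD(2)[OF submodule_coboundaries[OF cP]] .
  moreover have "f = \<zero>\<^bsub>obj ?B p\<^esub>" using f zero_obj_hom_cochain_neg[OF 1] unfolding cocycles_def by blast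
  moreover have "?h p \<zero>\<^bsub>obj ?A p\<^esub> = \<zero>\<^bsub>obj ?B p\<^esub>"
   by (rule lin_hom_zero[OF chain_mapD(1)[OF chain_map_hom_pullback[OF io N P Q \<phi>]]]) unfold_locales
  ultimately show ?thesis using B.M.l_zero[of "\<zero>\<^bsub>obj ?B p\<^esub>"] by (metis B.M.zero_closed)
 next
  case (2 n)
  have fm: "f \<in> lin_hom R (res_obj P n) N" and fz: "!!x. x \<in> carrier (res_obj P (Suc n)) ==> f (res_diff P n x) = \<zero>\<^bsub>N\<^esub>"
   using f unfolding 2 cocycles_hom_cochain by auto
  note fD = lin_homD[OF fm]
  let ?g = "compose (carrier (res_obj Q n)) f (\<psi> n)"
  have gm: "?g \<in> lin_hom R (res_obj Q n) N" using lin_hom_compose[OF \<psi>m fm Qd(2)] .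
  have "?g (res_diff Q n x) = \<zero>\<^bsub>N\<^esub>" if x: "x \<in> carrier (res_obj Q (Suc n))" for x
   using fz[OF lin_homD(1)[OF \<psi>m x]] \<psi>S[OF x] lin_homD(1)[OF Qd(3) x] by (simp add: compose_def)
  then have g: "?g \<in> cocycles ?A p" unfolding 2 cocycles_hom_cochain using gm by simp
  have hg: "?h p ?g = compose (carrier (res_obj P n)) ?g (\<phi> n)" unfolding 2 hom_pullback_nonneg[OF gm] ..
  show ?thesis
  proof (cases n)
   case 0
   have "f x = (?h p ?g \<oplus>\<^bsub>obj ?B p\<^esub> (\<lambda>x\<in>carrier (res_obj P 0). \<zero>\<^bsub>N\<^esub>)) x" for x
   proof (cases "x \<in> carrier (res_obj P 0)")
    case False
    then show ?thesis using fD(2) obj_hom_cochain_nonneg[of io R P N n] unfolding 2 0 by (simp add: add_hom_space)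
   next
    case x: True
    have c: "\<phi> 0 x \<in> carrier (res_obj Q 0)" "\<psi> 0 (\<phi> 0 x) \<in> carrier (res_obj P 0)" "s 0 x \<in> carrier (res_obj P (Suc 0))"
     "res_diff P 0 (s 0 x) \<in> carrier (res_obj P 0)"
     using lin_homD(1)[OF \<phi>m x] lin_homD(1)[OF \<psi>m lin_homD(1)[OF \<phi>m x]] lin_homD(1)[OF s x]
      lin_homD(1)[OF Pd(3) lin_homD(1)[OF s x]] by auto
    have "f x = f (\<psi> 0 (\<phi> 0 x)) \<oplus>\<^bsub>N\<^esub> f (res_diff P 0 (s 0 x))"
     using arg_cong[OF s0[OF x], of f] fD(3) c unfolding 0 by simp
    also have "f (res_diff P 0 (s 0 x)) = \<zero>\<^bsub>N\<^esub>" using fz c(3) unfolding 0 by simp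
    finally show ?thesis using x c fD(1) hg obj_hom_cochain_nonneg[of io R P N n] unfolding 2 0
     by (simp add: add_hom_space compose_def)
   qed
   then have "f = ?h p ?g \<oplus>\<^bsub>obj ?B p\<^esub> (\<lambda>x\<in>carrier (res_obj P 0). \<zero>\<^bsub>N\<^esub>)" by blast
   moreover have "(\<lambda>x\<in>carrier (res_obj P 0). \<zero>\<^bsub>N\<^esub>) \<in> coboundaries ?B p" unfolding 2 0 by (simp add: coboundaries_hom_cochain_0)
   ultimately show ?thesis using g by blast
  next
   case (Suc m)
   let ?w = "compose (carrier (res_obj P m)) f (s m)"
   have w: "?w \<in> lin_hom R (res_obj P m) N" using lin_hom_compose[OF s fm[unfolded Suc] Pd(2)] .
   let ?b = "compose (carrier (res_obj P (Suc m))) ?w (res_diff P m)"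
   have "f x = (?h p ?g \<oplus>\<^bsub>obj ?B p\<^esub> ?b) x" for x
   proof (cases "x \<in> carrier (res_obj P (Suc m))")
    case False
    then show ?thesis using fD(2) obj_hom_cochain_nonneg[of io R P N n] unfolding 2 Suc by (simp add: add_hom_space)
   next
    case x: True
    have c: "\<phi> (Suc m) x \<in> carrier (res_obj Q (Suc m))" "\<psi> (Suc m) (\<phi> (Suc m) x) \<in> carrier (res_obj P (Suc m))"
     "s (Suc m) x \<in> carrier (res_obj P (Suc (Suc m)))" "res_diff P (Suc m) (s (Suc m) x) \<in> carrier (res_obj P (Suc m))"
     "res_diff P m x \<in> carrier (res_obj P m)" "s m (res_diff P m x) \<in> carrier (res_obj P (Suc m))"
     using lin_homD(1)[OF \<phi>m x] lin_homD(1)[OF \<psi>m lin_homD(1)[OF \<phi>m x]] lin_homD(1)[OF s x]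
      lin_homD(1)[OF Pd(3) lin_homD(1)[OF s x]] lin_homD(1)[OF Pd(3) x] lin_homD(1)[OF s lin_homD(1)[OF Pd(3) x]] by auto
    interpret PS: left_module R "res_obj P (Suc m)" using Pd(2) .
    have "f x = f (\<psi> (Suc m) (\<phi> (Suc m) x)) \<oplus>\<^bsub>N\<^esub> (f (res_diff P (Suc m) (s (Suc m) x)) \<oplus>\<^bsub>N\<^esub> f (s m (res_diff P m x)))"
     using arg_cong[OF sS[OF x], of f] fD(3) c unfolding Suc by simp
    also have "\<dots> = f (\<psi> (Suc m) (\<phi> (Suc m) x)) \<oplus>\<^bsub>N\<^esub> f (s m (res_diff P m x))"
     using fz[unfolded Suc, OF c(3)] fD(1)[unfolded Suc, OF c(6)] by simp
    finally show ?thesis using x c hg obj_hom_cochain_nonneg[of io R P N n] unfolding 2 Suc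
     by (simp add: add_hom_space compose_def)
   qed
   then have "f = ?h p ?g \<oplus>\<^bsub>obj ?B p\<^esub> ?b" by blast
   moreover have "?b \<in> coboundaries ?B p" unfolding 2 Suc coboundaries_hom_cochain_Suc using w by blast
   ultimately show ?thesis using g by blast
  qed
 qed
 have "qiso ?A ?B ?h" unfolding qiso_def using cP cQ chain_map_hom_pullback[OF io N P Q \<phi>] inj surj by blast
 then show ?thesis by blast
qed

text \<open>A finitely generated projective module is isomorphic to its image in a free module.\<close>

lemma projective_resolution_transport:
 fixes Q :: "('r, 'q, 'm) resolution"
 assumes M: "left_module R M" and Q: "projective_resolution R M Q"
 shows "EX Q' :: ('r, nat => 'r, 'm) resolution. projective_resolution R M Q'"
proof -
 note Qd = projective_resolutionD[OF Q]
 let ?F = "%m :: nat. direct_sum {..<m} (%_. regular_module R)"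
 have "ALL n. EX m i p. i \<in> lin_hom R (res_obj Q n) (?F m) & p \<in> lin_hom R (?F m) (res_obj Q n) &
   (\<forall>x\<in>carrier (res_obj Q n). p (i x) = x)"
  using Qd(1) unfolding fg_projective_def by blast
 then obtain m i p where im: "!!n. i n \<in> lin_hom R (res_obj Q n) (?F (m n))"
  and pm: "!!n. p n \<in> lin_hom R (?F (m n)) (res_obj Q n)"
  and pi: "!!n x. x \<in> carrier (res_obj Q n) ==> p n (i n x) = x" by metis
 interpret M: left_module R M by fact
 have Fm: "left_module R (?F k)" for k
  by (rule left_module_direct_sum[OF M.R.ring_axioms]) (rule left_module_regular(1)[OF M.R.ring_axioms])
 define O' where "O' n = (?F (m n))\<lparr>carrier := i n ` carrier (res_obj Q n)\<rparr>" for n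
 have Osimps: "carrier (O' n) = i n ` carrier (res_obj Q n)" "\<zero>\<^bsub>O' n\<^esub> = \<zero>\<^bsub>?F (m n)\<^esub>"
  "x \<oplus>\<^bsub>O' n\<^esub> y = x \<oplus>\<^bsub>?F (m n)\<^esub> y" "r \<odot>\<^bsub>O' n\<^esub> x = r \<odot>\<^bsub>?F (m n)\<^esub> x" for n x y r
  unfolding O'_def by auto
 have sub: "submodule (i n ` carrier (res_obj Q n)) R (?F (m n))" for n
  by (rule submodule_image[OF im Qd(2) Fm])
 have OF: "carrier (O' n) \<subseteq> carrier (?F (m n))" for n
  unfolding Osimps using left_module.submoduleD(1)[OF Fm sub] .
 have Om: "left_module R (O' n)" for n
  by (rule left_module_inj[OF Fm, where l = "%x. x"])
   (use OF[of n] left_module.submoduleD[OF Fm sub[of n]] in \<open>auto simp: Osimps\<close>)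
 have iO: "i n \<in> lin_hom R (res_obj Q n) (O' n)" for n
  by (rule lin_homI) (use lin_homD[OF im] in \<open>auto simp: Osimps\<close>)
 have pO: "restrict (p n) (carrier (O' n)) \<in> lin_hom R (O' n) (res_obj Q n)" for n
 proof (rule lin_homI)
  interpret O': left_module R "O' n" using Om .
  fix x assume x: "x \<in> carrier (O' n)"
  have xF: "x \<in> carrier (?F (m n))" using x OF by blast
  show "restrict (p n) (carrier (O' n)) x \<in> carrier (res_obj Q n)" using lin_homD(1)[OF pm xF] x by simp
  {
   fix y assume y: "y \<in> carrier (O' n)"
   then have yF: "y \<in> carrier (?F (m n))" using OF by blast
   show "restrict (p n) (carrier (O' n)) (x \<oplus>\<^bsub>O' n\<^esub> y) =
     restrict (p n) (carrier (O' n)) x \<oplus>\<^bsub>res_obj Q n\<^esub> restrict (p n) (carrier (O' n)) y"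
    using lin_homD(3)[OF pm xF yF] x y O'.M.a_closed[OF x y] by (simp add: Osimps)
  }
  fix r assume r: "r \<in> carrier R"
  show "restrict (p n) (carrier (O' n)) (r \<odot>\<^bsub>O' n\<^esub> x) = r \<odot>\<^bsub>res_obj Q n\<^esub> restrict (p n) (carrier (O' n)) x"
   using lin_homD(4)[OF pm r xF] x O'.smult_closed[OF r x] by (simp add: Osimps)
 qed simp
 define p' where "p' n = restrict (p n) (carrier (O' n))" for n
 have p'm: "p' n \<in> lin_hom R (O' n) (res_obj Q n)" for n unfolding p'_def by (rule pO)
 have p'i: "p' n (i n x) = x" if "x \<in> carrier (res_obj Q n)" for n x
  unfolding p'_def using pi that by (simp add: Osimps)
 have ip': "i n (p' n y) = y" if "y \<in> carrier (O' n)" for n y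
  using that p'i unfolding Osimps by auto
 have Oproj: "fg_projective R (O' n)" for n
 proof -
  have inc: "(\<lambda>x\<in>carrier (O' n). x) \<in> lin_hom R (O' n) (?F (m n))"
  proof (rule lin_homI)
   interpret O': left_module R "O' n" using Om .
   fix x assume x: "x \<in> carrier (O' n)"
   show "(\<lambda>x\<in>carrier (O' n). x) x \<in> carrier (?F (m n))" using x OF by auto
   fix y assume y: "y \<in> carrier (O' n)"
   show "(\<lambda>x\<in>carrier (O' n). x) (x \<oplus>\<^bsub>O' n\<^esub> y) = (\<lambda>x\<in>carrier (O' n). x) x \<oplus>\<^bsub>?F (m n)\<^esub> (\<lambda>x\<in>carrier (O' n). x) y"
    using O'.M.a_closed[OF x y] x y Osimps by simp
  next
   interpret O': left_module R "O' n" using Om .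
   fix r x assume r: "r \<in> carrier R" and x: "x \<in> carrier (O' n)"
   show "(\<lambda>x\<in>carrier (O' n). x) (r \<odot>\<^bsub>O' n\<^esub> x) = r \<odot>\<^bsub>?F (m n)\<^esub> (\<lambda>x\<in>carrier (O' n). x) x"
    using O'.smult_closed[OF r x] x Osimps by simp
  qed simp
  have ret: "compose (carrier (?F (m n))) (i n) (p n) \<in> lin_hom R (?F (m n)) (O' n)"
   by (rule lin_hom_compose[OF pm iO Fm])
  have "compose (carrier (?F (m n))) (i n) (p n) ((\<lambda>x\<in>carrier (O' n). x) x) = x" if x: "x \<in> carrier (O' n)" for x
   using ip'[OF x] x OF by (auto simp: p'_def compose_def)
  then show ?thesis unfolding fg_projective_def using Om inc ret by blast
 qed
 define d' where "d' n = compose (carrier (O' (Suc n))) (i n) (compose (carrier (O' (Suc n))) (res_diff Q n) (p' (Suc n)))" for n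
 define a' where "a' = compose (carrier (O' 0)) (res_aug Q) (p' 0)"
 have d'm: "d' n \<in> lin_hom R (O' (Suc n)) (O' n)" for n
  unfolding d'_def by (rule lin_hom_compose[OF lin_hom_compose[OF p'm Qd(3) Om] iO Om])
 have a'm: "a' \<in> lin_hom R (O' 0) M" unfolding a'_def by (rule lin_hom_compose[OF p'm Qd(4) Om])
 have d'i: "d' n (i (Suc n) x) = i n (res_diff Q n x)" if "x \<in> carrier (res_obj Q (Suc n))" for n x
  using that p'i unfolding d'_def by (simp add: compose_def Osimps)
 have a'i: "a' (i 0 x) = res_aug Q x" if "x \<in> carrier (res_obj Q 0)" for x
  using that p'i unfolding a'_def by (simp add: compose_def Osimps)
 have iz: "i n x = \<zero>\<^bsub>O' n\<^esub> \<longleftrightarrow> x = \<zero>\<^bsub>res_obj Q n\<^esub>" if "x \<in> carrier (res_obj Q n)" for n x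
  using lin_hom_zero[OF iO Qd(2) Om, of n] p'i[OF that] lin_hom_zero[OF p'm Om Qd(2), of n] by metis
 have dQ: "res_diff Q n x \<in> carrier (res_obj Q n)" if "x \<in> carrier (res_obj Q (Suc n))" for n x
  using lin_homD(1)[OF Qd(3) that] .
 have im_d': "d' n ` carrier (O' (Suc n)) = i n ` res_diff Q n ` carrier (res_obj Q (Suc n))" for n
  unfolding Osimps image_image using d'i by (auto simp: image_iff)
 let ?Q = "\<lparr>res_obj = O', res_diff = d', res_aug = a'\<rparr>"
 have "projective_resolution R M ?Q"
  unfolding projective_resolution_def resolution.simps
 proof (intro conjI allI)
  show "a' ` carrier (O' 0) = carrier M" using a'i Qd(5) unfolding Osimps image_image by simp
  have "{x \<in> carrier (O' 0). a' x = \<zero>\<^bsub>M\<^esub>} = i 0 ` {x \<in> carrier (res_obj Q 0). res_aug Q x = \<zero>\<^bsub>M\<^esub>}"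
   unfolding Osimps using a'i by auto
  then show "{x \<in> carrier (O' 0). a' x = \<zero>\<^bsub>M\<^esub>} = d' 0 ` carrier (O' 1)" using im_d'[of 0] Qd(6) by simp
  fix n
  have "{x \<in> carrier (O' (Suc n)). d' n x = \<zero>\<^bsub>O' n\<^esub>} = i (Suc n) ` {x \<in> carrier (res_obj Q (Suc n)). res_diff Q n x = \<zero>\<^bsub>res_obj Q n\<^esub>}"
   unfolding Osimps(1) using d'i iz dQ left_module.axioms(2)[OF Qd(2), of n, THEN abelian_group.axioms(1), THEN abelian_monoid.zero_closed]
   by auto
  then show "{x \<in> carrier (O' (Suc n)). d' n x = \<zero>\<^bsub>O' n\<^esub>} = d' (Suc n) ` carrier (O' (Suc (Suc n)))"
   using im_d'[of "Suc n"] Qd(7) by simp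
 qed (use Oproj d'm a'm in auto)
 then show ?thesis by blast
qed

text \<open>Nothing is known about the resolution selected by \<open>SOME\<close> in
  \<open>RHom\<close> beyond its being one. The given resolution, moved to the element type
  \<open>nat => 'r\<close>, shows that such a choice exists; the comparison theorem then identifies
  the two Hom complexes.\<close>

lemma qiso_RHom:
 fixes Q :: "('r, 'q, 'm) resolution" and io :: "'k::field => 'r"
 assumes io: "central_map io R" and M: "left_module R M" and N: "left_module R N" and Q: "projective_resolution R M Q"
 shows "EX g. qiso (hom_cochain io R Q N) (RHom io R M N) g"
proof -
 have "projective_resolution R M (SOME Q :: ('r, nat => 'r, 'm) resolution. projective_resolution R M Q)"
  using projective_resolution_transport[OF M Q] by (rule someI_ex)
 then show ?thesis unfolding RHom_def using qiso_hom_cochain[OF io M N _ Q] by blast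
qed

section \<open>Subcomplexes of a cube\<close>

text \<open>The exterior algebra sign: wedging \<open>w\<close> in front of the ordered monomial of
  \<open>F\<close> and sorting moves it past the elements of \<open>F\<close> that precede
  it.\<close>

definition esign :: "('a => nat) => 'a => 'a set => 'k::field" where
 "esign e w F = (-1) ^ card {u \<in> F. e u < e w}"

lemma esign_square [simp]: "esign e w F * esign e w F = 1"
 unfolding esign_def by (simp flip: power_mult_distrib)

lemma esign_square_left [simp]: "esign e w F * (esign e w F * c) = c"
 by (simp flip: mult.assoc)

lemma esign_insert:
 fixes e :: "'a::finite => nat"
 assumes "w \<notin> F" shows "esign e v (insert w F) = (if e w < e v then - esign e v F else esign e v F)"
proof (cases "e w < e v")
 case True
 then have "{u \<in> insert w F. e u < e v} = insert w {u \<in> F. e u < e v}" by auto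
 then have "card {u \<in> insert w F. e u < e v} = Suc (card {u \<in> F. e u < e v})" using assms by simp
 then show ?thesis using True unfolding esign_def by simp
next
 case False
 then have "{u \<in> insert w F. e u < e v} = {u \<in> F. e u < e v}" by auto
 then show ?thesis using False unfolding esign_def by simp
qed

text \<open>Of two distinct elements exactly one precedes the other, so exactly one of the two signs
  changes when the other element is inserted first.\<close>

lemma esign_swap:
 fixes e :: "'a::finite => nat"
 assumes "inj e" "w ~= v" "w \<notin> F" "v \<notin> F"
 shows "esign e w F * esign e v (insert w F) = - (esign e v F * esign e w (insert v F) :: 'k::field)"
proof -
 have "e w < e v & \<not> e v < e w \<or> e v < e w & \<not> e w < e v" using assms(1,2) by (metis injD linorder_neqE_nat order.asym)
 then show ?thesis using assms by (auto simp: esign_insert)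
qed

lemma esign_swap':
 fixes e :: "'a::finite => nat"
 assumes "inj e" "w ~= v" "w \<notin> F" "v \<notin> F"
 shows "esign e w (insert v F) * esign e v (insert w F) = - (esign e w F * esign e v F :: 'k::field)"
proof -
 have "e w < e v & \<not> e v < e w \<or> e v < e w & \<not> e w < e v" using assms(1,2) by (metis injD linorder_neqE_nat order.asym)
 then show ?thesis using assms by (auto simp: esign_insert)
qed

text \<open>Toggling \<open>v\<close> contracts the cube, in the variant where the differential removes elements.\<close>

lemma toggle_contraction:
 fixes e :: "'a::finite => nat" and g :: "'a set => 'k::field"
 assumes e: "inj e" and v: "v \<in> V"
  and cyc: "v \<in> B ==> (\<Sum>b\<in>V - (B - {v}). esign e b (B - {v}) * g (insert b (B - {v}))) = 0"
 shows "(\<Sum>b\<in>V - B. esign e b B * (if v \<in> insert b B then esign e v (insert b B - {v}) * g (insert b B - {v}) else 0)) = g B"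
proof (cases "v \<in> B")
 case False
 have "(\<Sum>b\<in>V - B. esign e b B * (if v \<in> insert b B then esign e v (insert b B - {v}) * g (insert b B - {v}) else 0))
  = (\<Sum>b\<in>V - B. if b = v then g B else 0)"
  by (rule sum.cong) (use False in auto)
 also have "\<dots> = g B" using v False by simp
 finally show ?thesis .
next
 case True
 let ?B = "B - {v}"
 have ins: "insert v ?B = B" using True by auto
 have tm: "esign e b B * (esign e v (insert b B - {v}) * g (insert b B - {v})) =
   - (esign e v ?B * (esign e b ?B * g (insert b ?B)))" if "b \<in> V - B" for b
 proof -
  have b: "b ~= v" "b \<notin> ?B" "v \<notin> ?B" "insert b B - {v} = insert b ?B" using that True by auto
  have s: "esign e b B * esign e v (insert b ?B) = - (esign e b ?B * esign e v ?B :: 'k)"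
   using esign_swap'[OF e b(1,2,3), where 'k = 'k] unfolding ins .
  have "esign e b B * (esign e v (insert b B - {v}) * g (insert b B - {v}))
   = (esign e b B * esign e v (insert b ?B)) * g (insert b ?B)" unfolding b(4) by (simp add: mult.assoc)
  also have "\<dots> = - (esign e v ?B * (esign e b ?B * g (insert b ?B)))" unfolding s by (simp add: mult_ac)
  finally show ?thesis .
 qed
 have "V - ?B = insert v (V - B)" using v True by auto
 then have "(\<Sum>b\<in>V - ?B. esign e b ?B * g (insert b ?B)) = esign e v ?B * g B + (\<Sum>b\<in>V - B. esign e b ?B * g (insert b ?B))"
  using True ins by simp
 \<comment> \<open>The cycle condition at \<open>B - {v}\<close>, solved for the term that involves
   \<open>g B\<close>.\<close>
 then have *: "(\<Sum>b\<in>V - B. esign e b ?B * g (insert b ?B)) = - (esign e v ?B * g B)"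
  using cyc[OF True] by (simp add: eq_neg_iff_add_eq_0 add.commute)
 have "(\<Sum>b\<in>V - B. esign e b B * (if v \<in> insert b B then esign e v (insert b B - {v}) * g (insert b B - {v}) else 0))
  = (\<Sum>b\<in>V - B. - (esign e v ?B * (esign e b ?B * g (insert b ?B))))"
  by (rule sum.cong) (use True tm in auto)
 also have "\<dots> = - (esign e v ?B * (\<Sum>b\<in>V - B. esign e b ?B * g (insert b ?B)))"
  by (simp add: sum_negf sum_distrib_left)
 also have "\<dots> = g B" unfolding * by simp
 finally show ?thesis .
qed

text \<open>The pairs cancel two by two, which is organised as an induction on \<open>F\<close>.
  Comparing the sum with its negative would prove nothing in characteristic 2.\<close>

lemma antisymmetric_sum:
 fixes a :: "'a => 'a => 'k::field"
 assumes "finite F" and "!!w v. w \<in> F ==> v \<in> F ==> w ~= v ==> a w v = - a v w"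
 shows "(\<Sum>w\<in>F. \<Sum>v\<in>F - {w}. a w v) = 0"
 using assms
proof (induction F)
 case (insert z F)
 have "(\<Sum>w\<in>F. \<Sum>v\<in>insert z F - {w}. a w v) = (\<Sum>w\<in>F. a w z + (\<Sum>v\<in>F - {w}. a w v))"
 proof (rule sum.cong)
  fix w assume "w \<in> F"
  then have "insert z F - {w} = insert z (F - {w})" "z \<notin> F - {w}" using insert(2) by auto
  then show "(\<Sum>v\<in>insert z F - {w}. a w v) = a w z + (\<Sum>v\<in>F - {w}. a w v)" using insert(1) by simp
 qed simp
 also have "\<dots> = (\<Sum>w\<in>F. a w z)"
 proof -
  have "(\<Sum>w\<in>F. \<Sum>v\<in>F - {w}. a w v) = 0" using insert.IH insert.prems by blast
  then show ?thesis by (simp add: sum.distrib)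
 qed
 also have "\<dots> = - (\<Sum>w\<in>F. a z w)" unfolding sum_negf[symmetric]
  by (intro sum.cong refl insert.prems) (use insert(2) in auto)
 finally show ?case using insert(1,2) by simp
qed simp

section \<open>Cochain complexes on families of subsets\<close>

definition cdiff :: "('a => nat) => ('a set => 'k::field) => 'a set => 'k" where
 "cdiff e x F = (\<Sum>w\<in>F. esign e w (F - {w}) * x (F - {w}))"

text \<open>Cochains are functions on all subsets, supported in \<open>Fs\<close> and in a single
  cardinality. Passing from one family to another is then truncation or plain inclusion of
  functions.\<close>

definition cube_cochain :: "('a => nat) => 'a set set => ('k::field, 'a set => 'k) cochain" where
 "cube_cochain e Fs = \<lparr>obj = (%p. \<lparr>carrier = {x. ALL F. x F ~= 0 --> F \<in> Fs & int (card F) = p},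
   monoid.mult = undefined, one = undefined, zero = (%_. 0), add = (%x y F. x F + y F), module.smult = (%a x F. a * x F)\<rparr>),
   diff = (%p. \<lambda>x\<in>{x. ALL F. x F ~= 0 --> F \<in> Fs & int (card F) = p}. %F. if F \<in> Fs then cdiff e x F else 0)\<rparr>"

lemma obj_cube_cochain [simp]:
 "x \<in> carrier (obj (cube_cochain e Fs) p) \<longleftrightarrow> (ALL F. x F ~= 0 --> F \<in> Fs & int (card F) = p)"
 "\<zero>\<^bsub>obj (cube_cochain e Fs) p\<^esub> = (%_. 0)" "x \<oplus>\<^bsub>obj (cube_cochain e Fs) p\<^esub> y = (%F. x F + y F)"
 "a \<odot>\<^bsub>obj (cube_cochain e Fs) p\<^esub> x = (%F. a * x F)"
 unfolding cube_cochain_def by auto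

lemma diff_cube_cochain:
 "x \<in> carrier (obj (cube_cochain e Fs) p) ==> diff (cube_cochain e Fs) p x = (%F. if F \<in> Fs then cdiff e x F else 0)"
 "x \<notin> carrier (obj (cube_cochain e Fs) p) ==> diff (cube_cochain e Fs) p x = undefined"
 unfolding cube_cochain_def by auto

lemma cdiff_cdiff:
 fixes e :: "'a::finite => nat" assumes "inj e" shows "cdiff e (cdiff e x) F = (0 :: 'k::field)"
proof -
 let ?a = "%w v. esign e w (F - {w}) * (esign e v (F - {w} - {v}) * x (F - {w} - {v}))"
 have "cdiff e (cdiff e x) F = (\<Sum>w\<in>F. \<Sum>v\<in>F - {w}. ?a w v)"
  unfolding cdiff_def by (simp add: sum_distrib_left)
 also have "\<dots> = 0"
 proof (rule antisymmetric_sum)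
  fix w v assume wv: "w \<in> F" "v \<in> F" "w ~= v"
  let ?G = "F - {w} - {v}"
  have G: "F - {w} = insert v ?G" "F - {v} = insert w ?G" "F - {v} - {w} = ?G" "w \<notin> ?G" "v \<notin> ?G" using wv by auto
  have "esign e w (F - {w}) * esign e v ?G = - (esign e v (F - {v}) * esign e w ?G :: 'k)"
   using esign_swap[OF assms wv(3) G(4,5), where 'k = 'k] unfolding G(1)[symmetric] G(2)[symmetric] by (simp add: mult.commute)
  then show "?a w v = - ?a v w" unfolding G(3) by (simp flip: mult.assoc)
 qed simp
 finally show ?thesis .
qed

lemma cdiff_add: "cdiff e (%F. x F + y F) F = cdiff e x F + cdiff e y F"
 and cdiff_scale: "cdiff e (%F. a * x F) F = a * cdiff e x F"
 and cdiff_minus: "cdiff e (%F. x F - y F) F = cdiff e x F - cdiff e y F"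
 and cdiff_zero: "cdiff e (%F. 0) F = 0"
 unfolding cdiff_def by (simp_all add: sum.distrib sum_distrib_left algebra_simps sum_subtractf)

lemma card_cdiff:
 fixes e :: "'a::finite => nat"
 assumes "!!F. x F ~= 0 ==> int (card F) = p" "cdiff e x F ~= 0" shows "int (card F) = p + 1"
proof -
 obtain w where "w \<in> F" "esign e w (F - {w}) * x (F - {w}) ~= 0"
  using assms(2) unfolding cdiff_def by (rule sum.not_neutral_contains_not_neutral)
 then have "w \<in> F" "x (F - {w}) ~= 0" by auto
 then have "int (card (F - {w})) = p" "card F = Suc (card (F - {w}))" using assms(1) by (blast, metis card_Suc_Diff1 finite)
 then show ?thesis by simp
qed

definition order_convex :: "'a set set => bool" where
 "order_convex Fs \<longleftrightarrow> (\<forall>F\<in>Fs. \<forall>G\<in>Fs. ALL H. F \<subseteq> H & H \<subseteq> G --> H \<in> Fs)"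

text \<open>This is where order convexity enters. If \<open>F - {w}\<close> has left the family, no
  smaller set can be in it again, because \<open>F\<close> is a member. Truncating the intermediate
  cochain therefore loses nothing, and the truncated differential squares to zero.\<close>

lemma cdiff_supported:
 assumes "order_convex Fs" "!!F. x F ~= 0 ==> F \<in> Fs" "F \<in> Fs"
 shows "cdiff e (%F. if F \<in> Fs then cdiff e x F else 0) F = cdiff e (cdiff e x) F"
proof -
 have "cdiff e x (F - {w}) = 0" if "F - {w} \<notin> Fs" for w
 proof -
  have "x (F - {w} - {v}) = 0" for v
   using assms that unfolding order_convex_def by (metis Diff_subset)
  then show ?thesis unfolding cdiff_def by simp
 qed
 then show ?thesis unfolding cdiff_def[of e _ F] by (intro sum.cong) auto
qed

lemma left_module_cube_cochain:
 fixes e :: "'a => nat" shows "left_module kk (obj (cube_cochain e Fs :: ('k::field, 'a set => 'k) cochain) p)"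
proof (intro left_module.intro ring_kk abelian_groupI left_module_axioms.intro)
 fix x assume "x \<in> carrier (obj (cube_cochain e Fs) p)"
 then show "\<exists>y\<in>carrier (obj (cube_cochain e Fs) p). y \<oplus>\<^bsub>obj (cube_cochain e Fs) p\<^esub> x = \<zero>\<^bsub>obj (cube_cochain e Fs) p\<^esub>"
  by (intro bexI[of _ "%F. - x F"]) auto
next
 fix x y :: "'a set => 'k"
 assume x: "x \<in> carrier (obj (cube_cochain e Fs) p)" and y: "y \<in> carrier (obj (cube_cochain e Fs) p)"
 have "F \<in> Fs & int (card F) = p" if "x F + y F ~= 0" for F
 proof -
  have "x F ~= 0 \<or> y F ~= 0" using that by auto
  then show ?thesis using x y by auto
 qed
 then show "x \<oplus>\<^bsub>obj (cube_cochain e Fs) p\<^esub> y \<in> carrier (obj (cube_cochain e Fs) p)" by simp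
qed (simp_all add: algebra_simps)

lemma cochain_complex_cube_cochain:
 fixes e :: "'a::finite => nat"
 assumes e: "inj e" and Fs: "order_convex Fs" shows "cochain_complex (cube_cochain e Fs :: ('k::field, 'a set => 'k) cochain)"
 unfolding cochain_complex_def
proof (intro allI conjI ballI)
 let ?A = "cube_cochain e Fs :: ('k, 'a set => 'k) cochain"
 fix p
 interpret M: left_module kk "obj ?A p" by (rule left_module_cube_cochain)
 show "left_module kk (obj ?A p)" by (rule left_module_cube_cochain)
 have dc: "diff ?A p x \<in> carrier (obj ?A (p + 1))" if "x \<in> carrier (obj ?A p)" for x
  unfolding diff_cube_cochain(1)[OF that] using that card_cdiff[of x p e] by auto
 show "diff ?A p \<in> lin_hom kk (obj ?A p) (obj ?A (p + 1))"
 proof (rule lin_homI)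
  fix x y assume xy: "x \<in> carrier (obj ?A p)" "y \<in> carrier (obj ?A p)"
  show "diff ?A p (x \<oplus>\<^bsub>obj ?A p\<^esub> y) = diff ?A p x \<oplus>\<^bsub>obj ?A (p + 1)\<^esub> diff ?A p y"
   unfolding diff_cube_cochain(1)[OF M.M.a_closed[OF xy]] diff_cube_cochain(1)[OF xy(1)] diff_cube_cochain(1)[OF xy(2)]
   by (auto simp: cdiff_add)
 next
  fix r x assume rx: "r \<in> carrier (kk :: 'k ring)" "x \<in> carrier (obj ?A p)"
  show "diff ?A p (r \<odot>\<^bsub>obj ?A p\<^esub> x) = r \<odot>\<^bsub>obj ?A (p + 1)\<^esub> diff ?A p x"
   unfolding diff_cube_cochain(1)[OF M.smult_closed[OF rx]] diff_cube_cochain(1)[OF rx(2)]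
   by (auto simp: cdiff_scale)
 qed (fact dc, fact diff_cube_cochain(2))
 fix x assume x: "x \<in> carrier (obj ?A p)"
 show "diff ?A (p + 1) (diff ?A p x) = \<zero>\<^bsub>obj ?A (p + 1 + 1)\<^esub>"
  unfolding diff_cube_cochain(1)[OF dc[OF x]] unfolding diff_cube_cochain(1)[OF x]
  using cdiff_supported[OF Fs, of x] x cdiff_cdiff[OF e, of x] by auto
qed

text \<open>The cocycle and coboundary conditions are stated directly for functions on subsets. The
  type argument fixes the field, which the family and the ranking do not determine.\<close>

definition acyclic_cube :: "'k::field itself => ('a => nat) => 'a set set => bool" where
 "acyclic_cube TYPE('k) e Fs \<longleftrightarrow> (ALL p. ALL x :: 'a set => 'k. (ALL F. x F ~= 0 --> F \<in> Fs & int (card F) = p) -->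
   (\<forall>F\<in>Fs. cdiff e x F = 0) -->
   (EX w. (ALL F. w F ~= 0 --> F \<in> Fs & int (card F) = p - 1) & (\<forall>F\<in>Fs. cdiff e w F = x F)))"

text \<open>A family of toggles which is only constant along the levels of a filtration.\<close>

lemma acyclic_cube_filtered:
 fixes e :: "'a::finite => nat" and \<phi> :: "'a set => nat"
 assumes e: "inj e" and cv: "order_convex Fs"
  and tin: "!!F. F \<in> Fs ==> insert (t F) F \<in> Fs" and tout: "!!F. F \<in> Fs ==> F - {t F} \<in> Fs"
  and \<phi>t: "!!F. F \<in> Fs ==> \<phi> (insert (t F) F) = \<phi> F"
  and \<phi>out: "!!F. F \<in> Fs ==> \<phi> (F - {t F}) = \<phi> F"
  and \<phi>mono: "!!F G. F \<subseteq> G ==> \<phi> F \<le> \<phi> G"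
  and tconst: "!!F G. F \<in> Fs ==> G \<in> Fs ==> F \<subseteq> G ==> \<phi> F = \<phi> G ==> t F = t G"
 shows "acyclic_cube TYPE('k::field) e Fs"
 unfolding acyclic_cube_def
proof (intro allI impI)
 fix p and x :: "'a set => 'k"
 obtain m where m: "!!F. \<phi> F < m"
  using \<phi>mono[OF subset_UNIV] le_imp_less_Suc by blast
 assume hyps: "ALL F. x F ~= 0 --> F \<in> Fs & int (card F) = p" "\<forall>F\<in>Fs. cdiff e x F = 0"
 \<comment> \<open>Induction on the number \<open>k\<close> of top levels on which the cocycle may
   live. Each round clears the lowest of them, on which the toggle behaves as a constant element,
   and pushes the remainder upwards.\<close>
 have claim: "EX w. (ALL F. w F ~= 0 --> F \<in> Fs & int (card F) = p - 1) & (\<forall>F\<in>Fs. cdiff e w F = x F)"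
  if "ALL F. x F ~= 0 --> F \<in> Fs & int (card F) = p" "\<forall>F\<in>Fs. cdiff e x F = 0" "ALL F. x F ~= 0 --> m - k \<le> \<phi> F" "k \<le> m"
  for k and x :: "'a set => 'k"
  using that
 proof (induction k arbitrary: x)
  case 0
  then have "x F = 0" for F using m[of F] by (metis diff_zero leD)
  then show ?case by (intro exI[of _ "%_. 0"]) (auto simp: cdiff_zero fun_eq_iff)
 next
  case (Suc k)
  define n where "n = m - Suc k"
  have xs: "F \<in> Fs" "int (card F) = p" "n \<le> \<phi> F" if "x F ~= 0" for F using Suc.prems that unfolding n_def by auto
  have xz: "cdiff e x F = 0" if "F \<in> Fs" for F using Suc.prems that by blast
  \<comment> \<open>The usual contraction of a cube by one element, carried out on level
    \<open>n\<close> only.\<close>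
  define w where "w F = (if F \<in> Fs & \<phi> F = n & t F \<notin> F then esign e (t F) F * x (insert (t F) F) else 0)" for F
  have w1: "F \<in> Fs & int (card F) = p - 1" if "w F ~= 0" for F
  proof -
   have "F \<in> Fs" "t F \<notin> F" "x (insert (t F) F) ~= 0" using that unfolding w_def by (auto split: if_splits)
   then show ?thesis using xs(2)[of "insert (t F) F"] by simp
  qed
  have dw: "cdiff e w F = x F" if F: "F \<in> Fs" and \<phi>F: "\<phi> F = n" for F
  proof (cases "t F \<in> F")
   case True
   have "esign e v (F - {v}) * w (F - {v}) = (if v = t F then x F else 0)" if v: "v \<in> F" for v
   proof (cases "F - {v} \<in> Fs & \<phi> (F - {v}) = n")
    case c: True
    then have "t (F - {v}) = t F" using tconst[of "F - {v}" F] F \<phi>F by auto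
    then show ?thesis using c True v unfolding w_def by (auto simp: insert_absorb)
   next
    case c: False
    have "v ~= t F"
    proof
     assume vt: "v = t F"
     have a: "F - {t F} \<in> Fs" using tout[OF F] .
     then show False using c vt \<phi>out[OF F] \<phi>F by simp
    qed
    then show ?thesis using c unfolding w_def by auto
   qed
   then have "cdiff e w F = (\<Sum>v\<in>F. if v = t F then x F else 0)" unfolding cdiff_def by (intro sum.cong) auto
   also have "\<dots> = x F" using True by simp
   finally show ?thesis .
  next
   case tF: False
   let ?t = "t F"
   have iF: "insert ?t F \<in> Fs" "\<phi> (insert ?t F) = n" using tin[OF F] \<phi>t[OF F] \<phi>F by auto
   have tm: "w (F - {v}) = esign e ?t (F - {v}) * x (insert ?t (F - {v}))" if v: "v \<in> F" for v
   proof (cases "F - {v} \<in> Fs & \<phi> (F - {v}) = n")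
    case True
    then have "t (F - {v}) = ?t" using tconst[of "F - {v}" F] F \<phi>F by auto
    then show ?thesis using True tF unfolding w_def by auto
   next
    case False
    \<comment> \<open>Otherwise this set belongs to the family, on level \<open>n\<close>, and has
      the same toggle as \<open>F\<close>; toggling it out would bring \<open>F - {v}\<close> back
      to level \<open>n\<close>.\<close>
    have "x (insert ?t (F - {v})) = 0"
    proof (rule ccontr)
     assume nz: "x (insert ?t (F - {v})) ~= 0"
     let ?H = "insert ?t (F - {v})"
     have H: "?H \<in> Fs" "n \<le> \<phi> ?H" using xs[OF nz] by auto
     have "?H \<subseteq> insert ?t F" by auto
     then have "\<phi> ?H = \<phi> (insert ?t F)" using \<phi>mono[of ?H "insert ?t F"] H iF by simp
     then have "t ?H = t (insert ?t F)" using tconst[OF H(1) iF(1)] \<open>?H \<subseteq> insert ?t F\<close> by blast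
     moreover have "t F = t (insert ?t F)" using tconst[OF F iF(1)] iF(2) \<phi>F by blast
     ultimately have tH: "t ?H = ?t" by simp
     have HF: "?H - {t ?H} = F - {v}" unfolding tH using tF by auto
     have "F - {v} \<in> Fs" using tout[OF H(1)] unfolding HF .
     moreover have "\<phi> (F - {v}) = n"
      using \<phi>out[OF H(1)] \<open>\<phi> ?H = \<phi> (insert ?t F)\<close> iF(2) unfolding HF by simp
     ultimately show False using False by blast
    qed
    then show ?thesis using False unfolding w_def by auto
   qed
   have "insert ?t F - {?t} = F" using tF by auto
   then have "cdiff e x (insert ?t F) = esign e ?t F * x F + (\<Sum>v\<in>F. esign e v (insert ?t F - {v}) * x (insert ?t F - {v}))"
    unfolding cdiff_def using tF by simp
   then have sum: "(\<Sum>v\<in>F. esign e v (insert ?t F - {v}) * x (insert ?t F - {v})) = - (esign e ?t F * x F)"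
    using xz[OF iF(1)] by (simp add: eq_neg_iff_add_eq_0 add.commute)
   have "esign e v (F - {v}) * w (F - {v}) = - (esign e ?t F * (esign e v (insert ?t F - {v}) * x (insert ?t F - {v})))"
    if v: "v \<in> F" for v
   proof -
    let ?G = "F - {v}"
    have G: "v ~= ?t" "v \<notin> ?G" "?t \<notin> ?G" "insert ?t F - {v} = insert ?t ?G" "insert v ?G = F" using v tF by auto
    have "esign e v ?G * esign e ?t ?G = - (esign e ?t F * esign e v (insert ?t ?G) :: 'k)"
     using esign_swap'[OF e G(1,2,3), where 'k = 'k] unfolding G(5) by (simp add: mult.commute)
    then show ?thesis unfolding tm[OF v] G(4) by (simp flip: mult.assoc)
   qed
   then have "cdiff e w F = (\<Sum>v\<in>F. - (esign e ?t F * (esign e v (insert ?t F - {v}) * x (insert ?t F - {v}))))"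
    unfolding cdiff_def by (intro sum.cong) auto
   also have "\<dots> = - (esign e ?t F * (\<Sum>v\<in>F. esign e v (insert ?t F - {v}) * x (insert ?t F - {v})))"
    by (simp add: sum_negf sum_distrib_left)
   also have "\<dots> = x F" unfolding sum by simp
   finally show ?thesis .
  qed
  define y where "y F = x F - (if F \<in> Fs then cdiff e w F else 0)" for F
  \<comment> \<open>Subsets of \<open>F\<close> never have a higher level, so subtracting the
    coboundary of \<open>w\<close> does not disturb the levels that are already clear.\<close>
  have dwlow: "cdiff e w F = 0" if "\<phi> F < n" for F
  proof -
   have "\<phi> (F - {v}) < n" for v using \<phi>mono[of "F - {v}" F] that by auto
   then have "w (F - {v}) = 0" for v unfolding w_def by (metis nat_neq_iff)
   then show ?thesis unfolding cdiff_def by simp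
  qed
  have "EX u. (ALL F. u F ~= 0 --> F \<in> Fs & int (card F) = p - 1) & (\<forall>F\<in>Fs. cdiff e u F = y F)"
  proof (rule Suc.IH)
   show "ALL F. y F ~= 0 --> F \<in> Fs & int (card F) = p"
   proof (intro allI impI)
    fix F assume "y F ~= 0"
    then have "x F ~= 0 \<or> F \<in> Fs & cdiff e w F ~= 0" unfolding y_def by (auto split: if_splits)
    then show "F \<in> Fs & int (card F) = p" using xs card_cdiff[of w "p - 1" e F] w1 by auto
   qed
   show "\<forall>F\<in>Fs. cdiff e y F = 0"
    unfolding y_def cdiff_minus using cdiff_supported[OF cv, of w] w1 cdiff_cdiff[OF e, of w] xz by simp
   show "ALL F. y F ~= 0 --> m - k \<le> \<phi> F"
   proof (intro allI impI, rule ccontr)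
    fix F assume y: "y F ~= 0" and "\<not> m - k \<le> \<phi> F"
    then have "\<phi> F < n \<or> \<phi> F = n" unfolding n_def using Suc.prems(4) by auto
    then show False
    proof
     assume "\<phi> F < n"
     then show False using y dwlow[of F] xs(3)[of F] unfolding y_def by (auto split: if_splits)
    next
     assume "\<phi> F = n"
     then show False using y dw[of F] xs(1)[of F] unfolding y_def by (auto split: if_splits)
    qed
   qed
   show "k \<le> m" using Suc.prems by simp
  qed
  then obtain u where u: "!!F. u F ~= 0 ==> F \<in> Fs & int (card F) = p - 1" "!!F. F \<in> Fs ==> cdiff e u F = y F" by blast
  show ?case
  proof (intro exI[of _ "%F. u F + w F"] conjI allI impI ballI)
   fix F
   show "F \<in> Fs ==> cdiff e (%F. u F + w F) F = x F" unfolding cdiff_add using u(2) unfolding y_def by simp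
   assume "u F + w F ~= 0"
   then have "u F ~= 0 \<or> w F ~= 0" by auto
   then show "F \<in> Fs" "int (card F) = p - 1" using u(1) w1 by auto
  qed
 qed
 show "EX w. (ALL F. w F ~= 0 --> F \<in> Fs & int (card F) = p - 1) & (\<forall>F\<in>Fs. cdiff e w F = x F)"
  by (rule claim[of x m, OF hyps]) simp_all
qed

lemma cocycles_cube_cochain:
 "x \<in> cocycles (cube_cochain e Fs) p \<longleftrightarrow> (ALL F. x F ~= 0 --> F \<in> Fs & int (card F) = p) & (\<forall>F\<in>Fs. cdiff e x F = 0)"
proof -
 have "(%F. if F \<in> Fs then cdiff e x F else 0) = (%_. 0) \<longleftrightarrow> (\<forall>F\<in>Fs. cdiff e x F = 0)" by (auto simp: fun_eq_iff)
 then show ?thesis unfolding cocycles_def using diff_cube_cochain(1)[of x e Fs p] by auto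
qed

lemma coboundaries_cube_cochain:
 "x \<in> coboundaries (cube_cochain e Fs) p \<longleftrightarrow>
  (EX w. (ALL F. w F ~= 0 --> F \<in> Fs & int (card F) = p - 1) & x = (%F. if F \<in> Fs then cdiff e w F else 0))"
 unfolding coboundaries_def image_iff by (simp add: Bex_def diff_cube_cochain(1) cong: conj_cong)

section \<open>Nested families and quasi-isomorphisms\<close>

lemma order_convex_upclosed:
 assumes "order_convex Fs" "Fs' \<subseteq> Fs" "!!F G. F \<in> Fs' ==> G \<in> Fs ==> F \<subseteq> G ==> G \<in> Fs'"
 shows "order_convex Fs'" "order_convex (Fs - Fs')"
proof -
 show "order_convex Fs'"
  unfolding order_convex_def
 proof (intro ballI allI impI)
  fix F G H assume F: "F \<in> Fs'" "G \<in> Fs'" "F \<subseteq> H & H \<subseteq> G"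
  then have "H \<in> Fs" using assms(1,2) unfolding order_convex_def by blast
  then show "H \<in> Fs'" using assms(3) F by blast
 qed
 show "order_convex (Fs - Fs')"
  unfolding order_convex_def
 proof (intro ballI allI impI)
  fix F G H assume F: "F \<in> Fs - Fs'" "G \<in> Fs - Fs'" "F \<subseteq> H & H \<subseteq> G"
  then have "H \<in> Fs" using assms(1) unfolding order_convex_def by blast
  then show "H \<in> Fs - Fs'" using assms(3)[of H G] F by blast
 qed
qed

text \<open>The functions supported on the upper set \<open>Fs'\<close> form a subcomplex, and
  truncation to \<open>Fs - Fs'\<close> is the quotient map. Since the kernel is acyclic, this map
  is a quasi-isomorphism; the proof carries out the relevant part of the long exact sequence on
  elements.\<close>

lemma qiso_cube_restrict:
 fixes e :: "'a::finite => nat"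
 assumes e: "inj e" and Fs: "order_convex Fs" and sub: "Fs' \<subseteq> Fs"
  and up: "!!F G. F \<in> Fs' ==> G \<in> Fs ==> F \<subseteq> G ==> G \<in> Fs'" and ac: "acyclic_cube TYPE('k::field) e Fs'"
 shows "EX f. qiso (cube_cochain e Fs :: ('k, 'a set => 'k) cochain) (cube_cochain e (Fs - Fs') :: ('k, 'a set => 'k) cochain) f"
proof -
 let ?A = "cube_cochain e Fs :: ('k, 'a set => 'k) cochain" and ?B = "cube_cochain e (Fs - Fs') :: ('k, 'a set => 'k) cochain"
 have cv: "order_convex Fs'" "order_convex (Fs - Fs')" using order_convex_upclosed[OF Fs sub] up by blast+
 note A = cochain_complex_cube_cochain[OF e Fs, where 'k = 'k] and B = cochain_complex_cube_cochain[OF e cv(2), where 'k = 'k]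
 define r where "r x F = (if F \<in> Fs' then 0 else x F)" for x :: "'a set => 'k" and F
 have cr: "cdiff e (r x) F = cdiff e x F" if "F \<in> Fs - Fs'" for x F
  unfolding cdiff_def r_def
 proof (rule sum.cong)
  fix w assume "w \<in> F"
  have "F - {w} \<notin> Fs'" using up[of "F - {w}" F] that by auto
  then show "esign e w (F - {w}) * (if F - {w} \<in> Fs' then 0 else x (F - {w})) = esign e w (F - {w}) * x (F - {w})" by simp
 qed simp
 let ?f = "%p. \<lambda>x\<in>carrier (obj ?A p). r x"
 have fm: "?f p \<in> lin_hom kk (obj ?A p) (obj ?B p)" for p
 proof (rule lin_homI)
  interpret M: left_module kk "obj ?A p" by (rule left_module_cube_cochain)
  fix x assume x: "x \<in> carrier (obj ?A p)"
  then show "?f p x \<in> carrier (obj ?B p)" by (simp add: r_def)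
  fix y assume y: "y \<in> carrier (obj ?A p)"
  show "?f p (x \<oplus>\<^bsub>obj ?A p\<^esub> y) = ?f p x \<oplus>\<^bsub>obj ?B p\<^esub> ?f p y"
   using x y M.M.a_closed[OF x y] by (auto simp: r_def fun_eq_iff)
 next
  interpret M: left_module kk "obj ?A p" by (rule left_module_cube_cochain)
  fix a x assume a: "a \<in> carrier (kk :: 'k ring)" and x: "x \<in> carrier (obj ?A p)"
  show "?f p (a \<odot>\<^bsub>obj ?A p\<^esub> x) = a \<odot>\<^bsub>obj ?B p\<^esub> ?f p x"
   using x M.smult_closed[OF a x] by (auto simp: r_def fun_eq_iff)
 qed (simp del: obj_cube_cochain)
 have cm: "chain_map ?A ?B ?f"
  unfolding chain_map_def
 proof (intro allI conjI ballI fm)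
  fix p x assume x: "x \<in> carrier (obj ?A p)"
  have dx: "diff ?A p x \<in> carrier (obj ?A (p + 1))" using lin_homD(1)[OF cochain_complexD(2)[OF A] x] .
  have rx: "r x \<in> carrier (obj ?B p)" using x by (simp add: r_def)
  have "r (%F. if F \<in> Fs then cdiff e x F else 0) F = (if F \<in> Fs - Fs' then cdiff e (r x) F else 0)" for F
   using cr[of F x] sub unfolding r_def[of "%F. if F \<in> Fs then cdiff e x F else 0"] by auto
  then have "r (diff ?A p x) = diff ?B p (r x)"
   unfolding diff_cube_cochain(1)[OF x] diff_cube_cochain(1)[OF rx] by blast
  then show "?f (p + 1) (diff ?A p x) = diff ?B p (?f p x)" using x dx by (simp del: obj_cube_cochain)
 qed
 have acw: "EX w. (ALL F. w F ~= 0 --> F \<in> Fs' & int (card F) = p - 1) & (\<forall>F\<in>Fs'. cdiff e w F = x F)"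
  if "!!F. x F ~= 0 ==> F \<in> Fs' & int (card F) = p" "!!F. F \<in> Fs' ==> cdiff e x F = 0" for x :: "'a set => 'k" and p
  using ac that unfolding acyclic_cube_def by blast
 have low: "cdiff e w F = 0" if "!!F. w F ~= 0 ==> F \<in> Fs'" "F \<in> Fs - Fs'" for w :: "'a set => 'k" and F
 proof -
  have "w (F - {v}) = 0" for v using that up[of "F - {v}" F] by (metis DiffD1 DiffD2 Diff_subset)
  then show ?thesis unfolding cdiff_def by simp
 qed
 have inj: "x \<in> coboundaries ?A p" if x: "x \<in> cocycles ?A p" and fx: "?f p x \<in> coboundaries ?B p" for p x
 proof -
  have xs: "x F ~= 0 ==> F \<in> Fs & int (card F) = p" and xz: "F \<in> Fs ==> cdiff e x F = 0" for F
   using x unfolding cocycles_cube_cochain by auto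
  have "x \<in> carrier (obj ?A p)" using xs by simp
  then obtain y where y: "!!F. y F ~= 0 ==> F \<in> Fs - Fs' & int (card F) = p - 1"
   and xy: "r x = (%F. if F \<in> Fs - Fs' then cdiff e y F else 0)"
   using fx unfolding coboundaries_cube_cochain by auto
  \<comment> \<open>Subtracting the coboundary of \<open>y\<close>, taken in the large family,
    leaves a cocycle supported on \<open>Fs'\<close>. It is the coboundary of some \<open>w\<close>,
    and \<open>x\<close> is that of \<open>y + w\<close>.\<close>
  define z where "z F = x F - (if F \<in> Fs then cdiff e y F else 0)" for F
  have zs: "F \<in> Fs' & int (card F) = p" if "z F ~= 0" for F
  proof -
   have "F \<in> Fs'" using that fun_cong[OF xy, of F] xs[of F] unfolding z_def r_def by (auto split: if_splits)
   moreover have "x F ~= 0 \<or> cdiff e y F ~= 0" using that unfolding z_def by (auto split: if_splits)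
   ultimately show ?thesis using xs card_cdiff[of y "p - 1" e F] y by auto
  qed
  have zz: "cdiff e z F = 0" if "F \<in> Fs" for F
   unfolding z_def cdiff_minus using xz[OF that] cdiff_supported[OF Fs _ that, of y] y cdiff_cdiff[OF e, of y] by simp
  obtain w where w: "!!F. w F ~= 0 ==> F \<in> Fs' & int (card F) = p - 1" "!!F. F \<in> Fs' ==> cdiff e w F = z F"
   using acw[OF zs] zz sub by blast
  have "x F = (if F \<in> Fs then cdiff e (%F. y F + w F) F else 0)" for F
  proof (cases "F \<in> Fs'")
   case True then show ?thesis using w(2)[OF True] sub unfolding z_def cdiff_add by auto
  next
   case False
   then have "x F = (if F \<in> Fs then cdiff e y F else 0)" using zs[of F] unfolding z_def by (metis eq_iff_diff_eq_0)
   then show ?thesis using low[of w F] w(1) False unfolding cdiff_add by auto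
  qed
  moreover have "y F + w F ~= 0 --> F \<in> Fs & int (card F) = p - 1" for F
  proof
   assume "y F + w F ~= 0"
   then have "y F ~= 0 \<or> w F ~= 0" by auto
   then show "F \<in> Fs & int (card F) = p - 1" using y[of F] w(1)[of F] sub by blast
  qed
  ultimately show ?thesis unfolding coboundaries_cube_cochain by (intro exI[of _ "%F. y F + w F"] conjI allI ext)
 qed
 have surj: "\<exists>x\<in>cocycles ?A p. \<exists>b\<in>coboundaries ?B p. y = ?f p x \<oplus>\<^bsub>obj ?B p\<^esub> b" if y: "y \<in> cocycles ?B p" for p y
 proof -
  have ys: "y F ~= 0 ==> F \<in> Fs - Fs' & int (card F) = p" and yz: "F \<in> Fs - Fs' ==> cdiff e y F = 0" for F
   using y unfolding cocycles_cube_cochain by auto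
  \<comment> \<open>The obstruction to extending \<open>y\<close> by zero: its coboundary lives on
    \<open>Fs'\<close> in degree \<open>p + 1\<close>. A primitive \<open>w\<close> there corrects
    \<open>y\<close> without changing its truncation.\<close>
  define z where "z F = (if F \<in> Fs then cdiff e y F else 0)" for F
  have zs: "F \<in> Fs' & int (card F) = p + 1" if "z F ~= 0" for F
   using that yz[of F] card_cdiff[of y p e F] ys unfolding z_def by (auto split: if_splits)
  have zz: "cdiff e z F = 0" if "F \<in> Fs" for F
   unfolding z_def using cdiff_supported[OF Fs _ that, of y] ys cdiff_cdiff[OF e, of y] by simp
  obtain w where w: "!!F. w F ~= 0 ==> F \<in> Fs' & int (card F) = p" "!!F. F \<in> Fs' ==> cdiff e w F = z F"
  proof -
   have "EX w. (ALL F. w F ~= 0 --> F \<in> Fs' & int (card F) = p + 1 - 1) & (\<forall>F\<in>Fs'. cdiff e w F = z F)"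
    by (rule acw) (use zs zz sub in blast)+
   then show ?thesis using that by (metis add_diff_cancel_right')
  qed
  let ?x = "%F. y F - w F"
  have xs: "F \<in> Fs & int (card F) = p" if "?x F ~= 0" for F
  proof -
   have "y F ~= 0 \<or> w F ~= 0" using that by auto
   then show ?thesis using ys[of F] w(1)[of F] sub by blast
  qed
  have "cdiff e ?x F = 0" if "F \<in> Fs" for F
   unfolding cdiff_minus using that w(2)[of F] low[of w F] w(1) yz[of F] unfolding z_def by (cases "F \<in> Fs'") auto
  then have x: "?x \<in> cocycles ?A p" unfolding cocycles_cube_cochain using xs by blast
  have xc: "?x \<in> carrier (obj ?A p)" using xs by simp
  have yr: "r ?x F = y F" for F
  proof (cases "F \<in> Fs'")
   case True
   then have "y F = 0" using ys[of F] by blast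
   then show ?thesis using True unfolding r_def by simp
  next
   case False
   then have "w F = 0" using w(1)[of F] by blast
   then show ?thesis using False unfolding r_def by simp
  qed
  have "?f p ?x = r ?x" using xc by (simp only: restrict_apply if_True)
  also have "r ?x = y" using yr by (rule ext)
  finally have "y = ?f p ?x \<oplus>\<^bsub>obj ?B p\<^esub> (%_. 0)" unfolding obj_cube_cochain by simp
  moreover have "(%_. 0) \<in> coboundaries ?B p"
   unfolding coboundaries_cube_cochain by (intro exI[of _ "%_. 0"]) (auto simp: cdiff_zero fun_eq_iff)
  ultimately show ?thesis using x by blast
 qed
 have "qiso ?A ?B ?f" unfolding qiso_def using A B cm inj surj by blast
 then show ?thesis by blast
qed

text \<open>Here the quotient on \<open>Fs - Fs'\<close> is the acyclic piece, so the subcomplex on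
  the upper set already carries the whole cohomology.\<close>

lemma qiso_cube_include:
 fixes e :: "'a::finite => nat"
 assumes e: "inj e" and Fs: "order_convex Fs" and sub: "Fs' \<subseteq> Fs"
  and up: "!!F G. F \<in> Fs' ==> G \<in> Fs ==> F \<subseteq> G ==> G \<in> Fs'" and ac: "acyclic_cube TYPE('k::field) e (Fs - Fs')"
 shows "EX f. qiso (cube_cochain e Fs' :: ('k, 'a set => 'k) cochain) (cube_cochain e Fs :: ('k, 'a set => 'k) cochain) f"
proof -
 let ?A = "cube_cochain e Fs' :: ('k, 'a set => 'k) cochain" and ?B = "cube_cochain e Fs :: ('k, 'a set => 'k) cochain"
 have cv: "order_convex Fs'" "order_convex (Fs - Fs')" using order_convex_upclosed[OF Fs sub] up by blast+
 note A = cochain_complex_cube_cochain[OF e cv(1), where 'k = 'k] and B = cochain_complex_cube_cochain[OF e Fs, where 'k = 'k]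
 have low: "cdiff e w F = 0" if "!!F. w F ~= 0 ==> F \<in> Fs'" "F \<in> Fs - Fs'" for w :: "'a set => 'k" and F
 proof -
  have "w (F - {v}) = 0" for v using that up[of "F - {v}" F] by (metis DiffD1 DiffD2 Diff_subset)
  then show ?thesis unfolding cdiff_def by simp
 qed
 let ?f = "%p. \<lambda>x\<in>carrier (obj ?A p). x"
 have AB: "x \<in> carrier (obj ?A p) ==> x \<in> carrier (obj ?B p)" for x p using sub by auto
 have fm: "?f p \<in> lin_hom kk (obj ?A p) (obj ?B p)" for p
 proof (rule lin_homI)
  interpret M: left_module kk "obj ?A p" by (rule left_module_cube_cochain)
  fix x assume x: "x \<in> carrier (obj ?A p)"
  then show "?f p x \<in> carrier (obj ?B p)" using AB[OF x] by simp
  fix y assume y: "y \<in> carrier (obj ?A p)"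
  show "?f p (x \<oplus>\<^bsub>obj ?A p\<^esub> y) = ?f p x \<oplus>\<^bsub>obj ?B p\<^esub> ?f p y"
   using x y M.M.a_closed[OF x y] by (auto simp: fun_eq_iff)
 next
  interpret M: left_module kk "obj ?A p" by (rule left_module_cube_cochain)
  fix a x assume a: "a \<in> carrier (kk :: 'k ring)" and x: "x \<in> carrier (obj ?A p)"
  show "?f p (a \<odot>\<^bsub>obj ?A p\<^esub> x) = a \<odot>\<^bsub>obj ?B p\<^esub> ?f p x"
   using x M.smult_closed[OF a x] by (auto simp: fun_eq_iff)
 qed (simp del: obj_cube_cochain)
 have cm: "chain_map ?A ?B ?f"
  unfolding chain_map_def
 proof (intro allI conjI ballI fm)
  fix p x assume x: "x \<in> carrier (obj ?A p)"
  have dx: "diff ?A p x \<in> carrier (obj ?A (p + 1))" using lin_homD(1)[OF cochain_complexD(2)[OF A] x] .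
  have xs: "x F ~= 0 ==> F \<in> Fs'" for F using x by simp
  have "(if F \<in> Fs' then cdiff e x F else 0) = (if F \<in> Fs then cdiff e x F else 0)" for F
   using low[of x F] xs sub by auto
  then have "diff ?A p x = diff ?B p x"
   unfolding diff_cube_cochain(1)[OF x] diff_cube_cochain(1)[OF AB[OF x]] by blast
  then show "?f (p + 1) (diff ?A p x) = diff ?B p (?f p x)" using x dx by (simp del: obj_cube_cochain)
 qed
 have acw: "EX w. (ALL F. w F ~= 0 --> F \<in> Fs - Fs' & int (card F) = p - 1) & (\<forall>F\<in>Fs - Fs'. cdiff e w F = x F)"
  if "!!F. x F ~= 0 ==> F \<in> Fs - Fs' & int (card F) = p" "!!F. F \<in> Fs - Fs' ==> cdiff e x F = 0" for x :: "'a set => 'k" and p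
  using ac that unfolding acyclic_cube_def by blast
 \<comment> \<open>The correction that serves both halves: a cochain that is closed on
   \<open>Fs - Fs'\<close> is moved by a coboundary to one supported on \<open>Fs'\<close>. For
   injectivity it is applied to a primitive, for surjectivity to a cocycle.\<close>
 have cut: "EX w. (ALL F. w F ~= 0 --> F \<in> Fs - Fs' & int (card F) = p - 1) &
   (ALL F. y F - (if F \<in> Fs then cdiff e w F else 0) ~= 0 --> F \<in> Fs' & int (card F) = p)"
  if ys: "!!F. y F ~= 0 ==> F \<in> Fs & int (card F) = p" and yz: "!!F. F \<in> Fs - Fs' ==> cdiff e y F = 0" for y :: "'a set => 'k" and p
 proof -
  define r where "r F = (if F \<in> Fs' then 0 else y F)" for F
  have "cdiff e r F = cdiff e y F" if "F \<in> Fs - Fs'" for F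
   unfolding cdiff_def r_def
  proof (rule sum.cong)
   fix w assume "w \<in> F"
   have "F - {w} \<notin> Fs'" using up[of "F - {w}" F] that by auto
   then show "esign e w (F - {w}) * (if F - {w} \<in> Fs' then 0 else y (F - {w})) = esign e w (F - {w}) * y (F - {w})" by simp
  qed simp
  then have "!!F. F \<in> Fs - Fs' ==> cdiff e r F = 0" using yz by simp
  moreover have "F \<in> Fs - Fs' & int (card F) = p" if "r F ~= 0" for F using that ys[of F] unfolding r_def by (auto split: if_splits)
  ultimately obtain w where w: "!!F. w F ~= 0 ==> F \<in> Fs - Fs' & int (card F) = p - 1" "!!F. F \<in> Fs - Fs' ==> cdiff e w F = r F"
   using acw[of r p] by blast
  have "F \<in> Fs' & int (card F) = p" if nz: "y F - (if F \<in> Fs then cdiff e w F else 0) ~= 0" for F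
  proof -
   have "F \<in> Fs'" using nz w(2)[of F] ys[of F] unfolding r_def by (auto split: if_splits)
   moreover have "y F ~= 0 \<or> cdiff e w F ~= 0" using nz by (auto split: if_splits)
   ultimately show ?thesis using ys card_cdiff[of w "p - 1" e F] w(1) by auto
  qed
  then show ?thesis using w(1) by blast
 qed
 have inj: "x \<in> coboundaries ?A p" if x: "x \<in> cocycles ?A p" and fx: "?f p x \<in> coboundaries ?B p" for p x
 proof -
  have xs: "x F ~= 0 ==> F \<in> Fs' & int (card F) = p" for F
   using x unfolding cocycles_cube_cochain by auto
  have "x \<in> carrier (obj ?A p)" using xs by simp
  then obtain y where y: "!!F. y F ~= 0 ==> F \<in> Fs & int (card F) = p - 1"
   and xy: "x = (%F. if F \<in> Fs then cdiff e y F else 0)"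
   using fx unfolding coboundaries_cube_cochain by auto
  have "cdiff e y F = 0" if "F \<in> Fs - Fs'" for F using xs[of F] that fun_cong[OF xy, of F] by auto
  then obtain w where w: "!!F. w F ~= 0 ==> F \<in> Fs - Fs' & int (card F) = p - 1 - 1"
   "!!F. y F - (if F \<in> Fs then cdiff e w F else 0) ~= 0 ==> F \<in> Fs' & int (card F) = p - 1"
   using cut[of y "p - 1"] y by blast
  have "x F = (if F \<in> Fs' then cdiff e (%F. y F - (if F \<in> Fs then cdiff e w F else 0)) F else 0)" for F
  proof (cases "F \<in> Fs'")
   case True
   then have "cdiff e (%F. if F \<in> Fs then cdiff e w F else 0) F = 0"
    using cdiff_supported[OF Fs, of w F] w(1) sub cdiff_cdiff[OF e, of w F] by auto
   then show ?thesis using True sub fun_cong[OF xy, of F] unfolding cdiff_minus by auto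
  next
   case False then show ?thesis using xs[of F] by auto
  qed
  then have "x = (%F. if F \<in> Fs' then cdiff e (%F. y F - (if F \<in> Fs then cdiff e w F else 0)) F else 0)" by blast
  moreover have "ALL F. y F - (if F \<in> Fs then cdiff e w F else 0) ~= 0 --> F \<in> Fs' & int (card F) = p - 1" using w(2) by blast
  ultimately show ?thesis unfolding coboundaries_cube_cochain by (intro exI conjI)
 qed
 have surj: "\<exists>x\<in>cocycles ?A p. \<exists>b\<in>coboundaries ?B p. y = ?f p x \<oplus>\<^bsub>obj ?B p\<^esub> b" if y: "y \<in> cocycles ?B p" for p y
 proof -
  have ys: "y F ~= 0 ==> F \<in> Fs & int (card F) = p" and yz: "F \<in> Fs ==> cdiff e y F = 0" for F
   using y unfolding cocycles_cube_cochain by auto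
  obtain w where w: "!!F. w F ~= 0 ==> F \<in> Fs - Fs' & int (card F) = p - 1"
   "!!F. y F - (if F \<in> Fs then cdiff e w F else 0) ~= 0 ==> F \<in> Fs' & int (card F) = p"
   using cut[of y p] ys yz by blast
  let ?b = "%F. if F \<in> Fs then cdiff e w F else 0"
  let ?x = "%F. y F - ?b F"
  have "cdiff e ?x F = 0" if "F \<in> Fs'" for F
   using cdiff_supported[OF Fs, of w F] w(1) sub that cdiff_cdiff[OF e, of w F] yz[of F] unfolding cdiff_minus by auto
  then have x: "?x \<in> cocycles ?A p" unfolding cocycles_cube_cochain using w(2) by blast
  have xc: "?x \<in> carrier (obj ?A p)" using w(2) by simp
  have "y = ?f p ?x \<oplus>\<^bsub>obj ?B p\<^esub> ?b" using xc by (simp add: fun_eq_iff)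
  moreover have "?b \<in> coboundaries ?B p" unfolding coboundaries_cube_cochain using w(1) by blast
  ultimately show ?thesis using x by blast
 qed
 have "qiso ?A ?B ?f" unfolding qiso_def using A B cm inj surj by blast
 then show ?thesis by blast
qed

section \<open>Linear orders on the poset and on the cube\<close>

definition vrank :: "'p::finite => nat" where
 "vrank = (SOME f. bij_betw f UNIV {0..<card (UNIV :: 'p set)})"

lemma bij_vrank: "bij_betw (vrank :: 'p::finite => nat) UNIV {0..<card (UNIV :: 'p set)}"
proof -
 have "EX f. bij_betw f (UNIV :: 'p set) {0..<card (UNIV :: 'p set)}" by (rule ex_bij_betw_finite_nat) simp
 then show ?thesis unfolding vrank_def by (rule someI_ex)
qed

lemma inj_vrank: "inj (vrank :: 'p::finite => nat)"
 using bij_vrank bij_betw_imp_inj_on by blast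

lemma vrank_less: fixes x :: "'p::finite" shows "vrank x < card (UNIV :: 'p set)"
proof -
 have "vrank x \<in> {0..<card (UNIV :: 'p set)}"
  unfolding bij_betw_imp_surj_on[OF bij_vrank, symmetric] by (rule rangeI)
 then show ?thesis unfolding atLeastLessThan_iff by (rule conjunct2)
qed

text \<open>All left elements come before all right ones. A right element then has to pass the whole
  left part, which yields the factor \<open>(-1) ^ card (upper_boundary T S)\<close> of
  \<open>K_component\<close>.\<close>

definition erank :: "'p::finite + 'p => nat" where
 "erank w = (case w of Inl a => vrank a | Inr b => card (UNIV :: 'p set) + vrank b)"

lemma inj_erank: "inj (erank :: 'p::finite + 'p => nat)"
proof (rule injI)
 fix v w :: "'p + 'p" assume eq: "erank v = erank w"
 have less: "vrank x ~= card (UNIV :: 'p set) + vrank y" for x y :: 'p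
  using vrank_less[of x] by linarith
 show "v = w"
 proof (cases v)
  case (Inl a)
  then show ?thesis using eq less injD[OF inj_vrank, of a] unfolding erank_def by (cases w) auto
 next
  case (Inr b)
  then show ?thesis using eq less[symmetric] injD[OF inj_vrank, of b] unfolding erank_def by (cases w) auto
 qed
qed

lemma lefts_insert [simp]: "lefts (insert (Inr b) F) = lefts F" "rights (insert (Inr b) F) = insert b (rights F)"
  "lefts (insert (Inl a) F) = insert a (lefts F)" "rights (insert (Inl a) F) = rights F"
 and lefts_minus [simp]: "lefts (F - {Inr b}) = lefts F" "rights (F - {Inr b}) = rights F - {b}"
  "lefts (F - {Inl a}) = lefts F - {a}" "rights (F - {Inl a}) = rights F"
 unfolding lefts_def rights_def by auto

text \<open>Frontier elements lie below \<open>C\<close>, and the smaller stage, which contains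
  \<open>C\<close>, is a downset of the larger one. The relevant part of the frontier is therefore
  constant along inclusions of members of \<open>phi\<close> or \<open>psi\<close>.\<close>

lemma down_frontier_stage:
 fixes S :: "'p::{finite,order} set"
 assumes S: "poset_convex S" and A: "A \<subseteq> A'" "A' \<subseteq> up_frontier S" and C: "C \<subseteq> stage S A"
 shows "down_frontier C \<inter> stage S A' = down_frontier C \<inter> stage S A"
proof
 show "down_frontier C \<inter> stage S A \<subseteq> down_frontier C \<inter> stage S A'" using stage_mono[OF A(1)] by blast
 show "down_frontier C \<inter> stage S A' \<subseteq> down_frontier C \<inter> stage S A"
 proof
  fix b assume b: "b \<in> down_frontier C \<inter> stage S A'"
  then obtain c where c: "c \<in> C" "b < c" using down_frontier_below by blast
  have "b \<in> stage S A"
   by (rule stage_downset[OF S A(2,1) _ _ less_imp_le[OF c(2)]]) (use b c C in auto)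
  then show "b \<in> down_frontier C \<inter> stage S A" using b by blast
 qed
qed

lemma rel_upset_between:
 fixes S :: "'p::order set"
 assumes "rel_upset C (stage S A)" "rel_upset C (stage S A')" "A \<subseteq> H" "H \<subseteq> A'"
 shows "rel_upset C (stage S H)"
proof -
 have "stage S A \<subseteq> stage S H" "stage S H \<subseteq> stage S A'" using stage_mono assms by blast+
 then show ?thesis using assms(1,2) unfolding rel_upset_def by (meson subsetD subset_trans)
qed

text \<open>In \<open>psi - phi\<close> some element of \<open>?N F - ?B\<close> can be put into
  \<open>F\<close> or taken out freely; in \<open>phi - psi\<close> the same holds for an element of
  \<open>?B - ?N F\<close>. Toggling makes both differences acyclic and leaves the common part,
  where \<open>?N F = rights F = ?B\<close>. The upper set is \<open>psi - phi\<close> inside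
  \<open>psi\<close> but \<open>phi \<inter> psi\<close> inside \<open>phi\<close>, hence a
  truncation followed by an inclusion.\<close>

lemma qiso_psi_phi:
 fixes S C :: "'p::{finite,order} set"
 assumes S: "poset_convex S"
 shows "EX f. qiso (cube_cochain erank (psi S C) :: ('k::field, ('p + 'p) set => 'k) cochain)
  (cube_cochain erank (phi S C) :: ('k, ('p + 'p) set => 'k) cochain) f"
proof -
 let ?N = "%F. down_frontier C \<inter> stage S (lefts F)" and ?B = "min_elems S - C"
 have phiD: "lefts F \<subseteq> up_frontier S" "rel_upset C (stage S (lefts F))" "?N F \<subseteq> rights F" "rights F \<subseteq> ?B"
  if "F \<in> phi S C" for F using that unfolding phi_def by auto
 have psiD: "lefts F \<subseteq> up_frontier S" "rel_upset C (stage S (lefts F))" "?B \<subseteq> rights F" "rights F \<subseteq> ?N F"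
  if "F \<in> psi S C" for F using that unfolding psi_def by auto
 have phiI: "F \<in> phi S C" if "lefts F \<subseteq> up_frontier S" "rel_upset C (stage S (lefts F))" "?N F \<subseteq> rights F" "rights F \<subseteq> ?B" for F
  using that unfolding phi_def by auto
 have psiI: "F \<in> psi S C" if "lefts F \<subseteq> up_frontier S" "rel_upset C (stage S (lefts F))" "?B \<subseteq> rights F" "rights F \<subseteq> ?N F" for F
  using that unfolding psi_def by auto
 have N: "?N G = ?N F" if "F \<subseteq> G" "lefts G \<subseteq> up_frontier S" "rel_upset C (stage S (lefts F))" for F G
 proof -
  have "C \<subseteq> stage S (lefts F)" using that(3) unfolding rel_upset_def by blast
  moreover have "lefts F \<subseteq> lefts G" using lefts_rights_mono[OF that(1)] by blast
  ultimately show ?thesis using down_frontier_stage[OF S _ that(2)] by blast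
 qed
 have cpsi: "order_convex (psi S C)"
  unfolding order_convex_def
 proof (intro ballI allI impI)
  fix F G H assume F: "F \<in> psi S C" and G: "G \<in> psi S C" and H: "F \<subseteq> H & H \<subseteq> G"
  note m = lefts_rights_mono[of F H] lefts_rights_mono[of H G]
  have l: "lefts H \<subseteq> up_frontier S" using psiD(1)[OF G] m H by blast
  have u: "rel_upset C (stage S (lefts H))"
   using rel_upset_between[OF psiD(2)[OF F] psiD(2)[OF G]] m H by blast
  have "?N G = ?N F" "?N H = ?N F" using N[OF _ psiD(1)[OF G] psiD(2)[OF F]] N[OF _ l psiD(2)[OF F]] H by auto
  then show "H \<in> psi S C" using psiI[OF l u] psiD(3)[OF F] psiD(4)[OF G] m H by blast
 qed
 have cphi: "order_convex (phi S C)"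
  unfolding order_convex_def
 proof (intro ballI allI impI)
  fix F G H assume F: "F \<in> phi S C" and G: "G \<in> phi S C" and H: "F \<subseteq> H & H \<subseteq> G"
  note m = lefts_rights_mono[of F H] lefts_rights_mono[of H G]
  have l: "lefts H \<subseteq> up_frontier S" using phiD(1)[OF G] m H by blast
  have u: "rel_upset C (stage S (lefts H))"
   using rel_upset_between[OF phiD(2)[OF F] phiD(2)[OF G]] m H by blast
  have "?N H = ?N F" using N[OF _ l phiD(2)[OF F]] H by auto
  then show "H \<in> phi S C" using phiI[OF l u] phiD(3)[OF F] phiD(4)[OF G] m H by blast
 qed
 have lcard: "lefts F = lefts G" if "F \<subseteq> G" "card (lefts F) = card (lefts G)" for F G :: "('p + 'p) set"
  using card_subset_eq[of "lefts G" "lefts F"] lefts_rights_mono[OF that(1)] that(2) by auto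
 have lmono: "card (lefts F) \<le> card (lefts G)" if "F \<subseteq> G" for F G :: "('p + 'p) set"
  using card_mono[of "lefts G" "lefts F"] lefts_rights_mono[OF that] by auto
 \<comment> \<open>The choice depends on \<open>F\<close> only through \<open>lefts F\<close>. For
   \<open>F \<subseteq> G\<close> with equally many left elements it is therefore the same, as
   \<open>acyclic_cube_filtered\<close> requires with \<open>card (lefts F)\<close> as the
   level.\<close>
 define u where "u F = (SOME u. u \<in> ?N F - ?B)" for F :: "('p + 'p) set"
 have u: "u F \<in> ?N F - ?B" if F: "F \<in> psi S C - phi S C" for F
 proof -
  have F': "F \<in> psi S C" "F \<notin> phi S C" using F by auto
  have "\<not> ?N F \<subseteq> ?B"
  proof
   assume "?N F \<subseteq> ?B"
   then have "?N F \<subseteq> rights F" "rights F \<subseteq> ?B"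
    using psiD(3,4)[OF F'(1)] by (meson subset_trans)+
   then show False using phiI[OF psiD(1,2)[OF F'(1)]] F'(2) by blast
  qed
  then have "EX u. u \<in> ?N F - ?B" by blast
  then show ?thesis unfolding u_def by (rule someI_ex)
 qed
 have ac1: "acyclic_cube TYPE('k) (erank :: 'p + 'p => nat) (psi S C - phi S C)"
 proof (rule acyclic_cube_filtered[where t = "%F. Inr (u F)" and \<phi> = "%F. card (lefts F)"])
  show "inj (erank :: 'p + 'p => nat)" by (rule inj_erank)
  show "order_convex (psi S C - phi S C)"
   unfolding order_convex_def
  proof (intro ballI allI impI)
   fix F G H assume F: "F \<in> psi S C - phi S C" and G: "G \<in> psi S C - phi S C" and H: "F \<subseteq> H & H \<subseteq> G"
   then have Hp: "H \<in> psi S C" using cpsi unfolding order_convex_def by blast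
   have "?N H = ?N F" using N[OF _ psiD(1)[OF Hp] psiD(2)] F H by blast
   then have "H \<notin> phi S C" using u[OF F] phiD(3,4)[of H] by blast
   then show "H \<in> psi S C - phi S C" using Hp by blast
  qed
  fix F assume F: "F \<in> psi S C - phi S C"
  then have Fp: "F \<in> psi S C" by blast
  note uF = u[OF F]
  have "insert (Inr (u F)) F \<in> psi S C" by (rule psiI) (use psiD[OF Fp] uF in auto)
  moreover have "insert (Inr (u F)) F \<notin> phi S C" using phiD(3,4)[of "insert (Inr (u F)) F"] uF by auto
  ultimately show "insert (Inr (u F)) F \<in> psi S C - phi S C" by blast
  have "F - {Inr (u F)} \<in> psi S C" by (rule psiI) (use psiD[OF Fp] uF in auto)
  moreover have "F - {Inr (u F)} \<notin> phi S C" using phiD(3,4)[of "F - {Inr (u F)}"] uF by auto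
  ultimately show "F - {Inr (u F)} \<in> psi S C - phi S C" by blast
 next
  fix F G assume "F \<in> psi S C - phi S C" "G \<in> psi S C - phi S C" "F \<subseteq> G" "card (lefts F) = card (lefts G)"
  then have "lefts F = lefts G" using lcard by blast
  then show "(Inr (u F) :: 'p + 'p) = Inr (u G)" unfolding u_def by simp
 qed (simp_all add: lmono)
 define v where "v F = (SOME v. v \<in> ?B - ?N F)" for F :: "('p + 'p) set"
 have v: "v F \<in> ?B - ?N F" if F: "F \<in> phi S C - psi S C" for F
 proof -
  have F': "F \<in> phi S C" "F \<notin> psi S C" using F by auto
  have "\<not> ?B \<subseteq> ?N F"
  proof
   assume "?B \<subseteq> ?N F"
   then have "?B \<subseteq> rights F" "rights F \<subseteq> ?N F"
    using phiD(3,4)[OF F'(1)] by (meson subset_trans)+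
   then show False using psiI[OF phiD(1,2)[OF F'(1)]] F'(2) by blast
  qed
  then have "EX v. v \<in> ?B - ?N F" by blast
  then show ?thesis unfolding v_def by (rule someI_ex)
 qed
 have ac2: "acyclic_cube TYPE('k) (erank :: 'p + 'p => nat) (phi S C - psi S C)"
 proof (rule acyclic_cube_filtered[where t = "%F. Inr (v F)" and \<phi> = "%F. card (lefts F)"])
  show "inj (erank :: 'p + 'p => nat)" by (rule inj_erank)
  show "order_convex (phi S C - psi S C)"
   unfolding order_convex_def
  proof (intro ballI allI impI)
   fix F G H assume F: "F \<in> phi S C - psi S C" and G: "G \<in> phi S C - psi S C" and H: "F \<subseteq> H & H \<subseteq> G"
   then have Hp: "H \<in> phi S C" using cphi unfolding order_convex_def by blast
   have "?N H = ?N F" using N[OF _ phiD(1)[OF Hp] phiD(2)] F H by blast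
   then have "H \<notin> psi S C" using v[OF F] psiD(3,4)[of H] by blast
   then show "H \<in> phi S C - psi S C" using Hp by blast
  qed
  fix F assume F: "F \<in> phi S C - psi S C"
  then have Fp: "F \<in> phi S C" by blast
  note vF = v[OF F]
  have "insert (Inr (v F)) F \<in> phi S C" by (rule phiI) (use phiD[OF Fp] vF in auto)
  moreover have "insert (Inr (v F)) F \<notin> psi S C" using psiD(3,4)[of "insert (Inr (v F)) F"] vF by auto
  ultimately show "insert (Inr (v F)) F \<in> phi S C - psi S C" by blast
  have "F - {Inr (v F)} \<in> phi S C" by (rule phiI) (use phiD[OF Fp] vF in auto)
  moreover have "F - {Inr (v F)} \<notin> psi S C" using psiD(3,4)[of "F - {Inr (v F)}"] vF by auto
  ultimately show "F - {Inr (v F)} \<in> phi S C - psi S C" by blast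
 next
  fix F G assume "F \<in> phi S C - psi S C" "G \<in> phi S C - psi S C" "F \<subseteq> G" "card (lefts F) = card (lefts G)"
  then have "lefts F = lefts G" using lcard by blast
  then show "(Inr (v F) :: 'p + 'p) = Inr (v G)" unfolding v_def by simp
 qed (simp_all add: lmono)
 \<comment> \<open>\<open>?N\<close> is the same at \<open>F\<close> and at \<open>G\<close>, and a
   non-empty \<open>?N - ?B\<close> by itself excludes membership in \<open>phi\<close>.\<close>
 have up1: "G \<in> psi S C - phi S C" if F: "F \<in> psi S C - phi S C" and G: "G \<in> psi S C" and FG: "F \<subseteq> G" for F G
 proof -
  have "?N G = ?N F" using N[OF FG psiD(1)[OF G] psiD(2)] F by blast
  then show ?thesis using u[OF F] phiD(3,4)[of G] G by blast
 qed
 have up2: "G \<in> phi S C \<inter> psi S C" if F: "F \<in> phi S C \<inter> psi S C" and G: "G \<in> phi S C" and FG: "F \<subseteq> G" for F G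
 proof -
  have Fp: "F \<in> phi S C" "F \<in> psi S C" using F by auto
  have "?N G = ?N F" using N[OF FG phiD(1)[OF G] phiD(2)[OF Fp(1)]] .
  then have "G \<in> psi S C" using psiI[OF phiD(1,2)[OF G]] phiD(3,4)[OF G] phiD(3,4)[OF Fp(1)] psiD(3,4)[OF Fp(2)] lefts_rights_mono[OF FG]
   by blast
  then show ?thesis using G by blast
 qed
 have e1: "psi S C - (psi S C - phi S C) = phi S C \<inter> psi S C" by blast
 have "EX f. qiso (cube_cochain erank (psi S C) :: ('k, ('p + 'p) set => 'k) cochain)
   (cube_cochain erank (psi S C - (psi S C - phi S C)) :: ('k, ('p + 'p) set => 'k) cochain) f"
  by (rule qiso_cube_restrict[OF inj_erank cpsi _ _ ac1]) (blast, rule up1)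
 then obtain f where f: "qiso (cube_cochain erank (psi S C) :: ('k, ('p + 'p) set => 'k) cochain)
   (cube_cochain erank (phi S C \<inter> psi S C) :: ('k, ('p + 'p) set => 'k) cochain) f"
  unfolding e1 by blast
 have e2: "phi S C - phi S C \<inter> psi S C = phi S C - psi S C" by blast
 have "EX g. qiso (cube_cochain erank (phi S C \<inter> psi S C) :: ('k, ('p + 'p) set => 'k) cochain)
   (cube_cochain erank (phi S C) :: ('k, ('p + 'p) set => 'k) cochain) g"
  by (rule qiso_cube_include[OF inj_erank cphi]) (blast, rule up2, assumption+, unfold e2, rule ac2)
 then show ?thesis using qiso_compose[OF f] by blast
qed

section \<open>Exactness of the cubical resolution\<close>

text \<open>The homological differential, evaluated at one interval.\<close>

definition bdiff :: "'p::{finite,order} set => (('p + 'p) set => 'p => 'k::field) => ('p + 'p) set => 'p => 'k" where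
 "bdiff S z F x = (if F \<subseteq> cube S & x \<in> cell S F then \<Sum>w\<in>cube S - F. esign erank w F * z (insert w F) x else 0)"

text \<open>\<open>z F\<close> is a morphism from the representation of \<open>R\<close> to that of
  \<open>cell S F\<close>. Such families are the \<open>e_R\<close>-component of the degree
  \<open>n\<close> term of the resolution, on which exactness can be tested for one \<open>R\<close>
  at a time.\<close>

definition rchain :: "'p::{finite,order} set => 'p set => nat => (('p + 'p) set => 'p => 'k::field) => bool" where
 "rchain S R n z \<longleftrightarrow> (ALL F x. z F x ~= 0 --> F \<subseteq> cube S & card F = n) & (ALL F. F \<subseteq> cube S --> ivl_hom R (cell S F) (z F))"

lemma rchainD:
 assumes "rchain S R n z"
 shows "z F x ~= 0 ==> F \<subseteq> cube S" "z F x ~= 0 ==> card F = n" "F \<subseteq> cube S ==> ivl_hom R (cell S F) (z F)"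
  "z F x ~= 0 ==> x \<in> R" "z F x ~= 0 ==> x \<in> cell S F"
proof -
 have a: "F \<subseteq> cube S" "card F = n" if "z F x ~= 0" for F x using assms that unfolding rchain_def by auto
 have b: "ivl_hom R (cell S F) (z F)" if "F \<subseteq> cube S" for F using assms that unfolding rchain_def by auto
 show "z F x ~= 0 ==> F \<subseteq> cube S" "z F x ~= 0 ==> card F = n" "F \<subseteq> cube S ==> ivl_hom R (cell S F) (z F)"
  by (fact a b)+
 show "z F x ~= 0 ==> x \<in> R" "z F x ~= 0 ==> x \<in> cell S F" using ivl_hom_support[OF b[OF a(1)]] by blast+
qed

lemma cell_between:
 assumes "x \<in> cell S F" "x \<in> cell S G" "F \<subseteq> H" "H \<subseteq> G" shows "x \<in> cell S H"
 using assms lefts_rights_mono[OF assms(3)] lefts_rights_mono[OF assms(4)] stage_mono[of "lefts F" "lefts H" S]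
 unfolding cell_def by blast

text \<open>Composition with the structure map of the cube, which on coefficients is truncation to
  the smaller index set's cell.\<close>

lemma ivl_hom_restrict_cell:
 fixes c :: "'p::{finite,order} => 'k::field"
 assumes S: "poset_convex S" and F: "F \<subseteq> cube S" "F' \<subseteq> F" and c: "ivl_hom R (cell S F) c"
 shows "ivl_hom R (cell S F') (%x. if x \<in> cell S F' then c x else 0)"
proof -
 have "ivl_hom (cell S F) (cell S F') (%x. if x \<in> cell S F & x \<in> cell S F' then 1 else 0 :: 'k)"
  by (rule ivl_hom_indicator) (rule cell_restrict[OF S F])
 from ivl_hom_mult[OF c this]
 have "ivl_hom R (cell S F') (%x. c x * (if x \<in> cell S F & x \<in> cell S F' then 1 else 0))" .
 moreover have "(%x. c x * (if x \<in> cell S F & x \<in> cell S F' then 1 else 0)) = (%x. if x \<in> cell S F' then c x else 0)"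
  using ivl_hom_support[OF c] by (auto simp: fun_eq_iff)
 ultimately show ?thesis by simp
qed

lemma rchain_bdiff:
 assumes S: "poset_convex S" and z: "rchain S R (Suc n) z" shows "rchain S R n (bdiff S z)"
 unfolding rchain_def
proof (intro conjI allI impI)
 fix F x assume nz: "bdiff S z F x ~= 0"
 then have F: "F \<subseteq> cube S" and "(\<Sum>w\<in>cube S - F. esign erank w F * z (insert w F) x) ~= 0"
  unfolding bdiff_def by (auto split: if_splits)
 then obtain w where "w \<in> cube S - F" "esign erank w F * z (insert w F) x ~= 0"
  using sum.not_neutral_contains_not_neutral by blast
 then have "w \<notin> F" "card (insert w F) = Suc n" using rchainD(2)[OF z, of "insert w F" x] by auto
 then show "F \<subseteq> cube S" "card F = n" using F by auto
next
 fix F assume F: "F \<subseteq> cube S"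
 have "ivl_hom R (cell S F) (%x. \<Sum>w\<in>cube S - F. esign erank w F * (if x \<in> cell S F then z (insert w F) x else 0))"
 proof (intro ivl_hom_sum ivl_hom_scale)
  fix w assume "w \<in> cube S - F"
  then have "insert w F \<subseteq> cube S" using F by blast
  then show "ivl_hom R (cell S F) (%x. if x \<in> cell S F then z (insert w F) x else 0)"
   using ivl_hom_restrict_cell[OF S _ _ rchainD(3)[OF z]] by blast
 qed
 moreover have "bdiff S z F = (%x. \<Sum>w\<in>cube S - F. esign erank w F * (if x \<in> cell S F then z (insert w F) x else 0))"
  using F unfolding bdiff_def by (auto simp: fun_eq_iff)
 ultimately show "ivl_hom R (cell S F) (bdiff S z F)" by simp
qed

lemma bdiff_bdiff:
 assumes z: "rchain S R n z" shows "bdiff S (bdiff S z) F x = 0"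
proof (cases "F \<subseteq> cube S & x \<in> cell S F")
 case True
 let ?a = "%w v. esign erank w F * (esign erank v (insert w F) * z (insert v (insert w F)) x)"
 have "bdiff S (bdiff S z) F x = (\<Sum>w\<in>cube S - F. esign erank w F * bdiff S z (insert w F) x)"
  using True unfolding bdiff_def[of S "bdiff S z"] by simp
 also have "\<dots> = (\<Sum>w\<in>cube S - F. \<Sum>v\<in>cube S - F - {w}. ?a w v)"
 proof (rule sum.cong)
  fix w assume w: "w \<in> cube S - F"
  have e: "cube S - insert w F = cube S - F - {w}" by blast
  have sub: "insert w F \<subseteq> cube S" using w True by blast
  show "esign erank w F * bdiff S z (insert w F) x = (\<Sum>v\<in>cube S - F - {w}. ?a w v)"
  proof (cases "x \<in> cell S (insert w F)")
   case x: True
   then show ?thesis using sub unfolding bdiff_def by (simp add: e sum_distrib_left)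
  next
   case False
   \<comment> \<open>A point that is missing from the middle cell but lies in
     \<open>cell S F\<close> cannot come back in the cell of the largest set, so the whole row
     vanishes in the expanded sum as well.\<close>
   have "z (insert v (insert w F)) x = 0" for v
   proof (rule ccontr)
    assume "z (insert v (insert w F)) x ~= 0"
    then have "x \<in> cell S (insert v (insert w F))" using rchainD(5)[OF z] by blast
    then show False using cell_between[of x S F "insert v (insert w F)" "insert w F"] True False by blast
   qed
   then show ?thesis using False unfolding bdiff_def by simp
  qed
 qed simp
 also have "\<dots> = 0"
 proof (rule antisymmetric_sum)
  fix w v assume wv: "w \<in> cube S - F" "v \<in> cube S - F" "w ~= v"
  have "esign erank w F * esign erank v (insert w F) = - (esign erank v F * esign erank w (insert v F) :: 'b)"
   by (rule esign_swap[OF inj_erank]) (use wv in auto)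
  then show "?a w v = - ?a v w" by (simp flip: mult.assoc add: insert_commute)
 qed simp
 finally show ?thesis .
qed (auto simp: bdiff_def)

lemma bdiff_diff: "bdiff S (%F x. y F x - z F x) F x = bdiff S y F x - bdiff S z F x"
 and bdiff_add: "bdiff S (%F x. y F x + z F x) F x = bdiff S y F x + bdiff S z F x"
 and bdiff_zero: "bdiff S (%F x. 0) F x = 0"
 unfolding bdiff_def by (auto simp: right_diff_distrib distrib_left sum_subtractf sum.distrib)

lemma rchain_diff:
 assumes "rchain S R n y" "rchain S R n z" shows "rchain S R n (%F x. y F x - z F x)"
 unfolding rchain_def
proof (intro conjI allI impI)
 fix F x assume "y F x - z F x ~= 0"
 then have "y F x ~= 0 \<or> z F x ~= 0" by auto
 then show "F \<subseteq> cube S" "card F = n" using rchainD(1,2)[OF assms(1)] rchainD(1,2)[OF assms(2)] by metis+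
next
 fix F assume F: "F \<subseteq> cube S"
 from ivl_hom_add[OF rchainD(3)[OF assms(1) F] ivl_hom_scale[OF rchainD(3)[OF assms(2) F], of "-1"]]
 show "ivl_hom R (cell S F) (%x. y F x - z F x)" by simp
qed

lemma rchain_add:
 assumes "rchain S R n y" "rchain S R n z" shows "rchain S R n (%F x. y F x + z F x)"
 unfolding rchain_def
proof (intro conjI allI impI)
 fix F x assume "y F x + z F x ~= 0"
 then have "y F x ~= 0 \<or> z F x ~= 0" by auto
 then show "F \<subseteq> cube S" "card F = n" using rchainD(1,2)[OF assms(1)] rchainD(1,2)[OF assms(2)] by metis+
next
 fix F assume F: "F \<subseteq> cube S"
 show "ivl_hom R (cell S F) (%x. y F x + z F x)"
  by (rule ivl_hom_add[OF rchainD(3)[OF assms(1) F] rchainD(3)[OF assms(2) F]])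
qed

text \<open>Non-vanishing travels along all comparabilities of \<open>R \<inter> stage S A\<close>,
  although \<open>B\<close> has been deleted from the target. A step down is covered by naturality;
  a step up cannot end in \<open>B\<close>, because elements of \<open>B\<close> are minimal in the
  stage.\<close>

lemma ivl_hom_stage_const:
 assumes S: "poset_convex S" and A: "A \<subseteq> up_frontier S" and B: "B \<subseteq> min_elems S"
  and c: "ivl_hom R (stage S A - B) c" and x: "c x ~= 0" and y: "y \<in> component_of (R \<inter> stage S A) x"
 shows "c y = c x"
proof -
 have "(x, y) \<in> (comparability (R \<inter> stage S A))\<^sup>*" using y unfolding component_of_def by simp
 then show ?thesis
 proof (induction rule: rtrancl_induct)
  case (step y w)
  have st: "y \<in> R" "w \<in> R" "w \<in> stage S A" "y \<le> w \<or> w \<le> y" using step(2) unfolding comparability_def by auto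
  have yT: "y \<in> stage S A - B" using ivl_hom_support[OF c] step(3) x by auto
  from st(4) have "c w = c y"
  proof
   assume yw: "y \<le> w"
   have "w \<notin> B"
   proof
    assume "w \<in> B"
    then have "y = w" using min_elems_stage[OF S A, of w y] B yT yw by blast
    then show False using yT \<open>w \<in> B\<close> by blast
   qed
   then show ?thesis using ivl_hom_eq[OF c st(1) _ yw] st(3) by simp
  next
   assume "w \<le> y"
   then show ?thesis using ivl_hom_eq[OF c st(2) yT] by blast
  qed
  then show ?case using step(3) by simp
 qed simp
qed

text \<open>Since the component of \<open>x\<close> reaches every minimal element of
  \<open>S\<close>, \<open>c\<close> is non-zero there; so none of them was deleted and all lie in
  \<open>R\<close>. Going up from them, non-vanishing spreads over \<open>S\<close> and on to
  \<open>A\<close>, and \<open>c\<close> becomes one scalar on the whole overlap.\<close>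

lemma ivl_hom_full_support:
 fixes S :: "'p::{finite,order} set"
 assumes S: "S \<in> intervals" and R: "poset_convex R" and A: "A \<subseteq> up_frontier S" and B: "B \<subseteq> min_elems S"
  and c: "ivl_hom R (stage S A - B) c" and x: "c x ~= 0" and full: "min_elems S \<subseteq> component_of (R \<inter> stage S A) x"
 shows "B = {}" and "S \<subseteq> R" and "A \<subseteq> R" and "!!r s. r \<in> R ==> s \<in> S ==> r \<le> s ==> r \<in> S"
  and "!!y. y \<in> R \<inter> stage S A ==> c y = c x"
  and "!!A' y. A' \<subseteq> A ==> y \<in> R \<inter> stage S A' ==> min_elems S \<subseteq> component_of (R \<inter> stage S A') y"
proof -
 note Sc = intervalsD(3)[OF S]
 have SA: "S \<subseteq> stage S A" "A \<subseteq> stage S A" unfolding stage_def by auto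
 have cv: "c v = c x" if "v \<in> min_elems S" for v
  using ivl_hom_stage_const[OF Sc A B c x] full that by blast
 show B0: "B = {}"
 proof (rule ccontr)
  assume "B ~= {}"
  then obtain b where "b \<in> B" by blast
  then show False using cv[of b] x B ivl_hom_support[OF c, of b] by auto
 qed
 have vR: "v \<in> R" if "v \<in> min_elems S" for v using cv[OF that] x ivl_hom_support[OF c, of v] by auto
 have cs: "c s = c x" if s: "s \<in> S" for s
 proof -
  obtain v where v: "v \<in> min_elems S" "v \<le> s" using min_elems_below[OF s] by blast
  then show ?thesis using ivl_hom_eq[OF c vR[OF v(1)] _ v(2)] s SA B0 cv[OF v(1)] by auto
 qed
 show SR: "S \<subseteq> R"
 proof
  fix s assume "s \<in> S" then show "s \<in> R" using cs[of s] x ivl_hom_support[OF c, of s] by auto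
 qed
 have ca: "c a = c x" if a: "a \<in> A" for a
 proof -
  obtain s where s: "s \<in> S" "s < a" using up_frontier_above a A by blast
  then show ?thesis using ivl_hom_eq[OF c _ _ less_imp_le[OF s(2)]] SR SA a B0 cs[OF s(1)] by (metis Diff_empty subsetD)
 qed
 show AR: "A \<subseteq> R"
 proof
  fix a assume "a \<in> A" then show "a \<in> R" using ca[of a] x ivl_hom_support[OF c, of a] by auto
 qed
 show "!!r s. r \<in> R ==> s \<in> S ==> r \<le> s ==> r \<in> S"
 proof -
  fix r s assume r: "r \<in> R" "s \<in> S" "r \<le> s"
  then have "c r = c s" using ivl_hom_eq[OF c r(1) _ r(3)] SA B0 by auto
  then have "r \<in> stage S A" using cs[OF r(2)] x ivl_hom_support[OF c, of r] by auto
  then show "r \<in> S" using stage_not_below[OF Sc A _ _ r(2)] r(3) by blast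
 qed
 show "!!y. y \<in> R \<inter> stage S A ==> c y = c x"
 proof -
  fix y assume y: "y \<in> R \<inter> stage S A"
  show "c y = c x"
  proof (cases "y \<in> S")
   case True then show ?thesis using cs by blast
  next
   case False
   then obtain a where a: "a \<in> A" "y \<le> a" using stage_below[OF Sc] y by blast
   then show ?thesis using ivl_hom_eq[OF c _ _ a(2)] y SA B0 ca[OF a(1)] by auto
  qed
 qed
 \<comment> \<open>For any smaller left part the overlap with \<open>R\<close> still hangs together
   through the connected set \<open>S\<close>. This lets fullness descend from \<open>A\<close> to
   \<open>A'\<close>.\<close>
 show "!!A' y. A' \<subseteq> A ==> y \<in> R \<inter> stage S A' ==> min_elems S \<subseteq> component_of (R \<inter> stage S A') y"
 proof -
  fix A' y assume A': "A' \<subseteq> A" and y: "y \<in> R \<inter> stage S A'"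
  let ?T = "R \<inter> stage S A'"
  have ST: "S \<subseteq> ?T" "A' \<subseteq> ?T" using SR AR A' unfolding stage_def by auto
  obtain s where s: "s \<in> S" "s \<in> component_of ?T y"
  proof (cases "y \<in> S")
   case True then show ?thesis using that component_of_self by blast
  next
   case False
   then obtain a where a: "a \<in> A'" "y \<le> a" using stage_below[OF Sc] y by blast
   have aT: "a \<in> ?T" using a ST by blast
   have ac: "a \<in> component_of ?T y" using component_of_closed[OF y component_of_self aT] a(2) by blast
   obtain s where s: "s \<in> S" "s < a" using up_frontier_above a A A' by blast
   have "s \<in> ?T" using s ST by blast
   then have "s \<in> component_of ?T y" using component_of_closed[OF y ac, of s] s(2) by (simp add: less_imp_le)
   then show ?thesis using that s by blast
  qed
  have "S \<subseteq> component_of ?T y"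
   by (rule poset_connected_subset_closed[OF intervalsD(2)[OF S] s])
    (use component_of_closed[OF y] ST in blast)
  then show "min_elems S \<subseteq> component_of ?T y" using min_elems_sub by blast
 qed
qed

text \<open>Call \<open>(A, x)\<close> deficient, \<open>def A x\<close>, if the component of
  \<open>x\<close> in \<open>R \<inter> stage S A\<close> misses a minimal element of
  \<open>S\<close>. Toggling a missed element clears the deficient part of the cycle, from large
  left parts to small ones. At the places that remain, \<open>ivl_hom_full_support\<close> shows
  that \<open>R\<close> contains \<open>S\<close> as a downset; then an element of
  \<open>up_frontier S\<close> in \<open>R\<close> can be toggled, unless \<open>R = S\<close>, the
  case governed by \<open>aug\<close>.\<close>

lemma bdiff_exact:
 fixes S :: "'p::{finite,order} set" and z :: "('p + 'p) set => 'p => 'k::field"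
 assumes S: "S \<in> intervals" and R: "R \<in> intervals" and z: "rchain S R n z"
  and cyc: "0 < n ==> (!!F x. bdiff S z F x = 0)" and aug: "n = 0 ==> R = S ==> (!!F x. z F x = 0)"
 shows "EX y. rchain S R (Suc n) y & bdiff S y = z"
proof (cases "n = 0 & R = S")
 case True
 then have "z = (%F x. 0)" using aug by blast
 then show ?thesis by (intro exI[of _ "%F x. 0"]) (auto simp: rchain_def bdiff_zero fun_eq_iff)
next
 case excl: False
 note Sc = intervalsD(3)[OF S] and Rc = intervalsD(3)[OF R]
 \<comment> \<open>The toggled element \<open>v A x\<close> depends on \<open>x\<close> only through
   its component. Comparable points of the overlap receive the same element, which is what makes the
   homotopy a family of morphisms.\<close>
 define comp where "comp A x = component_of (R \<inter> stage S A) x" for A x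
 define def where "def A x \<longleftrightarrow> \<not> min_elems S \<subseteq> comp A x" for A x
 define v where "v A x = (SOME v. v \<in> min_elems S - comp A x)" for A x
 have v: "v A x \<in> min_elems S" "v A x \<notin> comp A x" if "def A x" for A x
 proof -
  have "EX v. v \<in> min_elems S - comp A x" using that unfolding def_def by blast
  then have "v A x \<in> min_elems S - comp A x" unfolding v_def by (rule someI_ex)
  then show "v A x \<in> min_elems S" "v A x \<notin> comp A x" by auto
 qed
 have up: "lefts F \<subseteq> up_frontier S" "rights F \<subseteq> min_elems S" if "F \<subseteq> cube S" for F using cube_subset[OF that] by auto
 \<comment> \<open>\<open>m\<close> is a strict bound for the number of left elements at deficient
   places of the support; each round clears the places at the top.\<close>
 have step1: "EX y. rchain S R (Suc n) y & (ALL F x. z F x - bdiff S y F x ~= 0 --> \<not> def (lefts F) x)"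
  if "rchain S R n z" "0 < n ==> (!!F x. bdiff S z F x = 0)"
   "!!F x. z F x ~= 0 ==> def (lefts F) x ==> card (lefts F) < m" for m and z :: "('p + 'p) set => 'p => 'k"
  using that
 proof (induction m arbitrary: z)
  case 0
  then show ?case by (intro exI[of _ "%F x. 0"]) (auto simp: rchain_def bdiff_zero)
 next
  case (Suc m)
  note z = Suc.prems(1) and cz = Suc.prems(2) and top = Suc.prems(3)
  \<comment> \<open>The contraction belonging to a differential that removes elements: values of
    \<open>z\<close> are moved to the sets that contain the toggled element.\<close>
  define h where "h F x = (if F \<subseteq> cube S & x \<in> R \<inter> stage S (lefts F) & def (lefts F) x & Inr (v (lefts F) x) \<in> F
   then esign erank (Inr (v (lefts F) x)) (F - {Inr (v (lefts F) x)}) * z (F - {Inr (v (lefts F) x)}) x else 0)" for F x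
  have h: "rchain S R (Suc n) h"
   unfolding rchain_def
  proof (intro conjI allI impI)
   fix F x assume nz: "h F x ~= 0"
   then have F: "F \<subseteq> cube S" "Inr (v (lefts F) x) \<in> F" "z (F - {Inr (v (lefts F) x)}) x ~= 0"
    unfolding h_def by (auto split: if_splits)
   have "card (F - {Inr (v (lefts F) x)}) = n" using rchainD(2)[OF z F(3)] .
   then show "F \<subseteq> cube S" "card F = Suc n" using F card_Suc_Diff1[OF _ F(2)] by auto
  next
   fix F assume F: "F \<subseteq> cube S"
   let ?A = "lefts F"
   have zF: "ivl_hom R (stage S ?A - (rights F - {b})) (z (F - {Inr b}))" for b
    using rchainD(3)[OF z, of "F - {Inr b}"] F unfolding cell_def by auto
   show "ivl_hom R (cell S F) (h F)"
    unfolding ivl_hom_def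
   proof (intro conjI allI ballI impI)
    fix x assume x: "x \<notin> R \<or> x \<notin> cell S F"
    show "h F x = 0"
    proof (rule ccontr)
     assume nz: "h F x ~= 0"
     let ?v = "v ?A x"
     have *: "x \<in> R \<inter> stage S ?A" "def ?A x" "z (F - {Inr ?v}) x ~= 0" using nz unfolding h_def by (auto split: if_splits)
     have "x \<notin> rights F - {?v}" using ivl_hom_support[OF zF *(3)] by blast
     \<comment> \<open>Deleting \<open>?v\<close> from the cell cannot delete \<open>x\<close>,
       because \<open>x\<close> lies in its own component and \<open>?v\<close> does not.\<close>
     moreover have "x ~= ?v" using v(2)[OF *(2)] component_of_self unfolding comp_def by metis
     ultimately show False using x *(1) unfolding cell_def by blast
    qed
   next
    fix x y assume x: "x \<in> R" and y: "y \<in> cell S F" and xy: "x \<le> y"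
    have yA: "y \<in> stage S ?A - rights F" using y unfolding cell_def .
    have zeq: "z (F - {Inr b}) x = z (F - {Inr b}) y" for b
     using ivl_hom_eq[OF zF x _ xy] yA by blast
    have xA: "x \<in> stage S ?A" if "z (F - {Inr b}) x ~= 0" for b using ivl_hom_support[OF zF that] by blast
    have yR: "y \<in> R" if "z (F - {Inr b}) y ~= 0" for b using ivl_hom_support[OF zF that] by blast
    show "h F x = h F y"
    proof (cases "x \<in> stage S ?A & y \<in> R")
     case True
     then have "y \<in> comp ?A x" using component_of_closed[of x "R \<inter> stage S ?A" x y] x yA xy unfolding comp_def by auto
     then have "comp ?A y = comp ?A x" unfolding comp_def by (rule component_of_eq)
     then have "def ?A y = def ?A x" "v ?A y = v ?A x" unfolding def_def v_def by auto
     then show ?thesis using True x yA zeq unfolding h_def by auto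
    next
     case False
     have "z (F - {Inr b}) x = 0" for b using False zeq[of b] xA[of b] yR[of b] by metis
     moreover have "z (F - {Inr b}) y = 0" for b using calculation zeq by metis
     ultimately show ?thesis unfolding h_def by simp
    qed
   qed
  qed
  let ?z = "%F x. z F x - bdiff S h F x"
  have z1: "rchain S R n ?z" by (rule rchain_diff[OF z rchain_bdiff[OF Sc h]])
  have cz1: "bdiff S ?z F x = 0" if "0 < n" for F x
   unfolding bdiff_diff using cz[OF that] bdiff_bdiff[OF h] by simp
  have high: "z F x = 0" if "def (lefts F) x" "m < card (lefts F)" for F x using top that by (metis Suc_leI leD)
  have "card (lefts F) < m" if nz: "?z F x ~= 0" and d: "def (lefts F) x" for F x
  proof (rule ccontr)
   assume "\<not> card (lefts F) < m"
   then have m: "m \<le> card (lefts F)" by simp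
   have F: "F \<subseteq> cube S" and xR: "x \<in> R" and xc: "x \<in> cell S F"
    using rchainD(1,4,5)[OF z1 nz] by auto
   let ?A = "lefts F" and ?v = "v (lefts F) x"
   have xs: "x \<in> R \<inter> stage S ?A" using xR xc unfolding cell_def by blast
   \<comment> \<open>The differential of \<open>h\<close> also runs over left elements, but these
     terms vanish: by \<open>high\<close>, \<open>z\<close> is zero at deficient places with more
     than \<open>m\<close> left elements. Replacing \<open>z\<close> by its part \<open>g\<close>
     with left part exactly \<open>?A\<close> therefore turns the sum into a pure toggle.\<close>
   have hb: "h (insert w F) x = (if Inr ?v \<in> insert w F then esign erank (Inr ?v) (insert w F - {Inr ?v}) * g (insert w F - {Inr ?v}) else 0)"
    if w: "w \<in> cube S - F" and g: "g = (%G. if lefts G = ?A then z G x else 0)" for w g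
   proof (cases w)
    case (Inr b)
    then have l: "lefts (insert w F) = ?A" "insert w F \<subseteq> cube S" using w F by auto
    show ?thesis unfolding g h_def using xs d w F by (simp add: l)
   next
    case (Inl a)
    have l: "lefts (insert w F) = insert a ?A" unfolding Inl by simp
    have "a \<notin> ?A" using w unfolding Inl lefts_def by blast
    then have "insert a ?A ~= ?A" by blast
    moreover have "lefts (insert w F - {Inr ?v}) = insert a ?A" unfolding Inl by simp
    moreover have "h (insert w F) x = 0"
    proof (rule ccontr)
     let ?G = "insert w F - {Inr (v (insert a ?A) x)}"
     assume "h (insert w F) x ~= 0"
     then have "def (insert a ?A) x" "z ?G x ~= 0" unfolding h_def l by (auto split: if_splits)
     moreover have "lefts ?G = insert a ?A" unfolding Inl by simp
     moreover have "card (insert a ?A) = Suc (card ?A)" using \<open>a \<notin> ?A\<close> by simp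
     ultimately show False using high[of ?G x] m by simp
    qed
    ultimately show ?thesis unfolding g by simp
   qed
   define g where "g = (%G. if lefts G = ?A then z G x else 0)"
   have "bdiff S h F x = (\<Sum>w\<in>cube S - F. esign erank w F * (if Inr ?v \<in> insert w F then esign erank (Inr ?v) (insert w F - {Inr ?v}) * g (insert w F - {Inr ?v}) else 0))"
    unfolding bdiff_def using F xc hb[OF _ g_def] by simp
   also have "\<dots> = g F"
   proof (rule toggle_contraction[OF inj_erank])
    show "Inr ?v \<in> cube S" using v(1)[OF d] unfolding cube_def by blast
    assume vF: "Inr ?v \<in> F"
    let ?G = "F - {Inr ?v}"
    have G: "?G \<subseteq> cube S" "lefts ?G = ?A" "x \<in> cell S ?G" using F xc unfolding cell_def by auto
    have gz: "esign erank w ?G * g (insert w ?G) = esign erank w ?G * z (insert w ?G) x" if w: "w \<in> cube S - ?G" for w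
    proof (cases w)
     case (Inr b) then show ?thesis unfolding g_def by simp
    next
     case (Inl a)
     then have a: "a \<notin> ?A" "a \<in> up_frontier S" using w unfolding lefts_def cube_def by auto
     \<comment> \<open>By \<open>high\<close> a non-zero value at the enlarged left part could occur
       only at a place that is not deficient. Fullness would then descend to \<open>?A\<close>,
       against the deficiency there.\<close>
     have "z (insert w ?G) x = 0"
     proof (rule ccontr)
      assume nz: "z (insert w ?G) x ~= 0"
      let ?A' = "insert a ?A"
      have H: "insert w ?G \<subseteq> cube S" "lefts (insert w ?G) = ?A'" using w G(1) unfolding Inl by auto
      have hom: "ivl_hom R (stage S ?A' - rights (insert w ?G)) (z (insert w ?G))"
       using rchainD(3)[OF z H(1)] unfolding cell_def H(2) .
      have nd: "\<not> def ?A' x"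
       using high[of "insert w ?G" x] nz m a H(2) by auto
      have "min_elems S \<subseteq> component_of (R \<inter> stage S ?A) x"
       by (rule ivl_hom_full_support(6)[OF S Rc _ _ hom nz])
        (use nd up[OF H(1)] H(2) xs in \<open>auto simp: def_def comp_def\<close>)
      then show False using d unfolding def_def comp_def by blast
     qed
     then show ?thesis unfolding g_def by simp
    qed
    show "(\<Sum>w\<in>cube S - ?G. esign erank w ?G * g (insert w ?G)) = 0"
    proof (cases "0 < n")
     case True
     have "(\<Sum>w\<in>cube S - ?G. esign erank w ?G * g (insert w ?G)) = bdiff S z ?G x"
     proof -
      have "(\<Sum>w\<in>cube S - ?G. esign erank w ?G * g (insert w ?G)) = (\<Sum>w\<in>cube S - ?G. esign erank w ?G * z (insert w ?G) x)"
       by (rule sum.cong[OF refl gz])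
      then show ?thesis unfolding bdiff_def using G by simp
     qed
     then show ?thesis using cz[OF True] by simp
    next
     case False
     \<comment> \<open>No cycle condition is available in degree 0, but a chain of degree 0 vanishes
       on the non-empty set \<open>insert w ?G\<close>.\<close>
     have "z (insert w ?G) x = 0" for w using rchainD(2)[OF z, of "insert w ?G" x] False by auto
     then have "esign erank w ?G * g (insert w ?G) = 0" if "w \<in> cube S - ?G" for w using gz[OF that] by simp
     then show ?thesis by (rule sum.neutral[OF ballI])
    qed
   qed
   also have "g F = z F x" unfolding g_def by simp
   finally show False using nz by simp
  qed
  then obtain y where y: "rchain S R (Suc n) y" "!!F x. ?z F x - bdiff S y F x ~= 0 ==> \<not> def (lefts F) x"
   using Suc.IH[OF z1 cz1] by blast
  show ?case
  proof (intro exI[of _ "%F x. h F x + y F x"] conjI allI impI)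
   show "rchain S R (Suc n) (%F x. h F x + y F x)" by (rule rchain_add[OF h y(1)])
   fix F x assume "z F x - bdiff S (%F x. h F x + y F x) F x ~= 0"
   then show "\<not> def (lefts F) x" using y(2)[of F x] unfolding bdiff_add by (simp add: algebra_simps)
  qed
 qed
 have "card (lefts F) < Suc (card (UNIV :: 'p set))" for F :: "('p + 'p) set"
  using card_mono[of UNIV "lefts F"] by simp
 then obtain y0 where y0: "rchain S R (Suc n) y0" "!!F x. z F x - bdiff S y0 F x ~= 0 ==> \<not> def (lefts F) x"
  using step1[OF z cyc, of "Suc (card (UNIV :: 'p set))"] by blast
 define u where "u F x = z F x - bdiff S y0 F x" for F x
 have u: "rchain S R n u" unfolding u_def by (rule rchain_diff[OF z rchain_bdiff[OF Sc y0(1)]])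
 have cu: "bdiff S u F x = 0" if "0 < n" for F x
  unfolding u_def bdiff_diff using cyc[OF that] bdiff_bdiff[OF y0(1)] by simp
 have nd: "\<not> def (lefts F) x" if "u F x ~= 0" for F x using y0(2) that unfolding u_def by blast
 \<comment> \<open>Where \<open>u F\<close> is not identically zero it is one scalar on an overlap
   that contains \<open>S\<close>; the value at \<open>s0\<close> stands for that scalar.\<close>
 obtain s0 where s0: "s0 \<in> S" using intervalsD(1)[OF S] by blast
 have full: "rights F = {}" "S \<subseteq> R" "lefts F \<subseteq> R" "!!r s. r \<in> R ==> s \<in> S ==> r \<le> s ==> r \<in> S"
  "!!y. y \<in> R \<inter> stage S (lefts F) ==> u F y = u F x" if nz: "u F x ~= 0" for F x
 proof -
  have F: "F \<subseteq> cube S" using rchainD(1)[OF u nz] .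
  have hom: "ivl_hom R (stage S (lefts F) - rights F) (u F)" using rchainD(3)[OF u F] unfolding cell_def .
  have "min_elems S \<subseteq> component_of (R \<inter> stage S (lefts F)) x" using nd[OF nz] unfolding def_def comp_def by blast
  note fs = ivl_hom_full_support[OF S Rc up[OF F] hom nz this]
  show "rights F = {}" "S \<subseteq> R" "lefts F \<subseteq> R" by (fact fs)+
  show "!!r s. r \<in> R ==> s \<in> S ==> r \<le> s ==> r \<in> S" by (fact fs(4))
  show "!!y. y \<in> R \<inter> stage S (lefts F) ==> u F y = u F x" by (fact fs(5))
 qed
 have "EX y. rchain S R (Suc n) y & bdiff S y = u"
 proof (cases "up_frontier S \<inter> R = {}")
  case True
  \<comment> \<open>A non-zero value forces \<open>F = {}\<close> and thus \<open>n = 0\<close>.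
    Without frontier elements \<open>R\<close> cannot leave \<open>S\<close> upwards, and it does
    not leave it downwards by \<open>full\<close>; so connectedness gives \<open>R = S\<close>, the
    excluded case.\<close>
  have "u F x = 0" for F x
  proof (rule ccontr)
   assume nz: "u F x ~= 0"
   have F: "F \<subseteq> cube S" using rchainD(1)[OF u nz] .
   have "lefts F = {}" using full(3)[OF nz] up(1)[OF F] True by blast
   then have "F = {}" using full(1)[OF nz] Plus_lefts_rights[of F] by auto
   then have "n = 0" using rchainD(2)[OF u nz] by simp
   have "R \<subseteq> S"
   proof (rule poset_connected_subset_closed[OF intervalsD(2)[OF R] _ s0])
    show "s0 \<in> R" using full(2)[OF nz] s0 by blast
    fix a b assume ab: "a \<in> R" "b \<in> R" "a \<in> S" "a \<le> b \<or> b \<le> a"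
    from ab(4) show "b \<in> S"
    proof
     assume "a \<le> b"
     show ?thesis
     proof (rule ccontr)
      assume "b \<notin> S"
      then have "a < b" using ab(3) \<open>a \<le> b\<close> by (metis order.not_eq_order_implies_strict)
      then have "b \<in> {x. x \<notin> S & (\<exists>s\<in>S. s < x)}" using ab(3) \<open>b \<notin> S\<close> by blast
      from min_elems_below[OF this] obtain t where t: "t \<in> up_frontier S" "t \<le> b"
       unfolding up_frontier_def[symmetric] by (elim bexE)
      then obtain s where s: "s \<in> S" "s < t" using up_frontier_above by blast
      have "t \<in> R" by (rule poset_convexD[OF Rc _ ab(2) less_imp_le[OF s(2)] t(2)]) (use full(2)[OF nz] s in blast)
      then show False using t True by blast
     qed
    next
     assume "b \<le> a" then show ?thesis using full(4)[OF nz ab(2,3)] by blast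
    qed
   qed
   then have "R = S" using full(2)[OF nz] by blast
   then show False using excl \<open>n = 0\<close> by blast
  qed
  then show ?thesis by (intro exI[of _ "%F x. 0"]) (auto simp: rchain_def bdiff_zero fun_eq_iff)
 next
  case False
  then obtain a where a: "a \<in> up_frontier S" "a \<in> R" by blast
  let ?w = "Inl a :: 'p + 'p"
  \<comment> \<open>The toggle is now one fixed element, and each coefficient is a scalar: the value
    of \<open>u\<close> at \<open>s0\<close>, spread over the overlap of \<open>R\<close> with the
    larger stage.\<close>
  define y where "y F x = (if F \<subseteq> cube S & ?w \<in> F & x \<in> R \<inter> stage S (lefts F)
   then esign erank ?w (F - {?w}) * u (F - {?w}) s0 else 0)" for F x
  have y: "rchain S R (Suc n) y"
   unfolding rchain_def
  proof (intro conjI allI impI)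
   fix F x assume "y F x ~= 0"
   then have F: "F \<subseteq> cube S" "?w \<in> F" "u (F - {?w}) s0 ~= 0" unfolding y_def by (auto split: if_splits)
   then show "F \<subseteq> cube S" "card F = Suc n" using rchainD(2)[OF u F(3)] card_Suc_Diff1[OF _ F(2)] by auto
  next
   fix F assume F: "F \<subseteq> cube S"
   show "ivl_hom R (cell S F) (y F)"
   proof (cases "?w \<in> F & u (F - {?w}) s0 ~= 0")
    case False
    then have "y F = (%x. 0)" unfolding y_def by auto
    then show ?thesis by simp
   next
    case True
    then have nz: "u (F - {?w}) s0 ~= 0" by blast
    let ?A = "lefts F"
    have A: "?A \<subseteq> R" using full(3)[OF nz] a by auto
    have cF: "cell S F = stage S ?A" using full(1)[OF nz] unfolding cell_def by simp
    \<comment> \<open>Here the incomparable elements of the stage are used. An element of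
      \<open>R\<close> below some \<open>b\<close> in \<open>?A\<close> that is neither
      \<open>b\<close> nor in \<open>S\<close> is incomparable to \<open>S\<close>, and so it
      belongs to the stage.\<close>
    have "x \<in> stage S ?A & t \<in> R" if x: "x \<in> R" and t: "t \<in> stage S ?A" and xt: "x \<le> t" for x t
    proof (cases "t \<in> S")
     case True
     then show ?thesis using full(2,4)[OF nz] x xt unfolding stage_def by blast
    next
     case False
     then obtain b where b: "b \<in> ?A" "t \<le> b" using stage_below[OF Sc t] by blast
     have tR: "t \<in> R" using poset_convexD[OF Rc x _ xt b(2)] A b by blast
     moreover have "x \<in> stage S ?A"
     proof (cases "x \<in> S \<or> x = b")
      case True then show ?thesis using b unfolding stage_def by blast
     next
      case F': False
      have xb: "x < b" using xt b F' by (metis order.not_eq_order_implies_strict order_trans)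
      have "\<not> s \<le> x" if "s \<in> S" for s
       using up_frontier_min[of b S x s] xb that F' b up(1)[OF F] by blast
      moreover have "\<not> x \<le> s" if "s \<in> S" for s using full(4)[OF nz x that] F' by blast
      ultimately show ?thesis using xb b unfolding stage_def by blast
     qed
     ultimately show ?thesis by blast
    qed
    then have "ivl_hom R (stage S ?A) (%x. if x \<in> R & x \<in> stage S ?A then 1 else 0 :: 'k)" by (rule ivl_hom_indicator)
    from ivl_hom_scale[OF this, of "esign erank ?w (F - {?w}) * u (F - {?w}) s0"]
    have "ivl_hom R (stage S ?A) (%x. esign erank ?w (F - {?w}) * u (F - {?w}) s0 * (if x \<in> R & x \<in> stage S ?A then 1 else 0))" .
    moreover have "(%x. esign erank ?w (F - {?w}) * u (F - {?w}) s0 * (if x \<in> R & x \<in> stage S ?A then 1 else 0)) = y F"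
     using F True unfolding y_def by (auto simp: fun_eq_iff)
    ultimately show ?thesis unfolding cF by simp
   qed
  qed
  have "bdiff S y F x = u F x" for F x
  proof (cases "F \<subseteq> cube S & x \<in> cell S F & x \<in> R & rights F = {}")
   case False
   have "u F x = 0" using False full(1)[of F x] rchainD(1,4,5)[OF u, of F x] by blast
   moreover have "bdiff S y F x = 0"
   proof (rule ccontr)
    assume nz: "bdiff S y F x ~= 0"
    note bD = rchainD[OF rchain_bdiff[OF Sc y]]
    have F: "F \<subseteq> cube S" "x \<in> R" "x \<in> cell S F" using bD(1,4,5)[OF nz] by auto
    then have "rights F ~= {}" using False by blast
    have yz: "y (insert w F) x = 0" for w
    proof (rule ccontr)
     assume "y (insert w F) x ~= 0"
     then have "u (insert w F - {?w}) s0 ~= 0" unfolding y_def by (auto split: if_splits)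
     from full(1)[OF this] have "rights (insert w F) = {}" by simp
     then show False using \<open>rights F ~= {}\<close> unfolding rights_def by blast
    qed
    have "bdiff S y F x = 0" unfolding bdiff_def by (simp add: yz)
    then show False using nz by contradiction
   qed
   ultimately show ?thesis by simp
  next
   case True
   have xA: "x \<in> R \<inter> stage S (lefts F)" using True unfolding cell_def by blast
   have "y (insert w F) x = (if ?w \<in> insert w F then esign erank ?w (insert w F - {?w}) * u (insert w F - {?w}) s0 else 0)"
    if w: "w \<in> cube S - F" for w
   proof -
    have "x \<in> stage S (lefts (insert w F))"
     using xA stage_mono[of "lefts F" "lefts (insert w F)" S] lefts_rights_mono[of F "insert w F"] by blast
    then show ?thesis using xA w True unfolding y_def by auto
   qed
   then have "bdiff S y F x = (\<Sum>w\<in>cube S - F. esign erank w F *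
     (if ?w \<in> insert w F then esign erank ?w (insert w F - {?w}) * u (insert w F - {?w}) s0 else 0))"
    using True unfolding bdiff_def by simp
   also have "\<dots> = u F s0"
   proof (rule toggle_contraction[OF inj_erank, where g = "%G. u G s0"])
    show "?w \<in> cube S" using a unfolding cube_def by blast
    assume wF: "?w \<in> F"
    let ?G = "F - {?w}"
    have G: "?G \<subseteq> cube S" "s0 \<in> cell S ?G" using True s0 unfolding cell_def stage_def by auto
    have "(\<Sum>w\<in>cube S - ?G. esign erank w ?G * u (insert w ?G) s0) = bdiff S u ?G s0"
     using G unfolding bdiff_def by simp
    also have "\<dots> = 0"
    proof (cases "0 < n")
     case True then show ?thesis using cu by blast
    next
     case False
     have "u (insert w ?G) s0 = 0" for w using rchainD(2)[OF u, of "insert w ?G" s0] False by auto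
     then show ?thesis unfolding bdiff_def by simp
    qed
    finally show "(\<Sum>w\<in>cube S - ?G. esign erank w ?G * u (insert w ?G) s0) = 0" .
   qed
   also have "u F s0 = u F x"
   proof (cases "u F x = 0 & u F s0 = 0")
    case False
    show ?thesis
    proof (cases "u F x = 0")
     case True
     then show ?thesis using full(5)[of F s0 x] xA False by auto
    next
     case nz: False
     have "s0 \<in> R \<inter> stage S (lefts F)" using full(2)[OF nz] s0 unfolding stage_def by blast
     then show ?thesis using full(5)[OF nz] by blast
    qed
   qed simp
   finally show ?thesis .
  qed
  then show ?thesis using y by blast
 qed
 then obtain y1 where y1: "rchain S R (Suc n) y1" "bdiff S y1 = u" by blast
 show ?thesis
 proof (intro exI[of _ "%F x. y0 F x + y1 F x"] conjI ext)
  show "rchain S R (Suc n) (%F x. y0 F x + y1 F x)" by (rule rchain_add[OF y0(1) y1(1)])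
  show "bdiff S (%F x. y0 F x + y1 F x) F x = z F x" for F x
   unfolding bdiff_add y1(2) u_def by simp
 qed
qed

section \<open>The algebra as a matrix algebra\<close>

lemma finite_set_type [simp]: "finite (I :: 'p::finite set set)"
 by (rule finite_subset[of _ UNIV]) (auto simp: finite_UNIV Finite_Set.finite_set)

abbreviation gspace :: "'p => ('k::field, 'p::{finite,order} set => 'k) module" where
 "gspace x \<equiv> rep_space interval_sum x"

lemma gspace:
 "v \<in> carrier (gspace x :: ('k::field, 'p::{finite,order} set => 'k) module) \<longleftrightarrow>
  (ALL S. S \<notin> intervals --> v S = undefined) & (\<forall>S\<in>intervals. x \<notin> S --> v S = 0)"
 "\<zero>\<^bsub>gspace x\<^esub> = (\<lambda>S\<in>intervals. 0 :: 'k)"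
 "u \<oplus>\<^bsub>gspace x\<^esub> v = (\<lambda>S\<in>intervals. u S + v S :: 'k)"
 "a \<odot>\<^bsub>gspace x\<^esub> v = (\<lambda>S\<in>intervals. a * v S :: 'k)"
 unfolding interval_sum_def rep_direct_sum_def direct_sum_def interval_rep_def
 by (auto simp: PiE_def Pi_def extensional_def)

lemma rep_map_interval_sum:
 "rep_map interval_sum x y v = (\<lambda>S\<in>intervals. if x \<in> S & y \<in> S then v S else (0 :: 'k::field))"
 unfolding interval_sum_def rep_direct_sum_def interval_rep_def by simp

definition unit_vec :: "'p::{finite,order} set => 'p set => 'k::field" where
 "unit_vec R = (\<lambda>S\<in>intervals. if S = R then 1 else 0)"

text \<open>The coefficient at \<open>x\<close> of the component from the summand \<open>R\<close>
  to the summand \<open>S\<close>. For \<open>x\<close> outside \<open>R\<close> the unit vector is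
  not in \<open>gspace x\<close>, where \<open>f x\<close> is \<open>undefined\<close>; the guard
  replaces this by 0.\<close>

definition ent :: "('p::{finite,order}, 'k::field) lam => 'p set => 'p set => 'p => 'k" where
 "ent f R S x = (if R \<in> intervals & S \<in> intervals & x \<in> R then f x (unit_vec R) S else 0)"

definition of_ent :: "('p::{finite,order} set => 'p set => 'p => 'k::field) => ('p, 'k) lam" where
 "of_ent m = (%x. \<lambda>v\<in>carrier (gspace x). \<lambda>S\<in>intervals. \<Sum>R\<in>intervals. m R S x * v R)"

text \<open>The matrices of endomorphisms: \<open>ent\<close> and \<open>of_ent\<close> turn out to
  be mutually inverse bijections between \<open>Lambda\<close> and these matrices, after which
  identities in \<open>Lambda\<close> are checked on entries.\<close>

definition adm :: "('p::{finite,order} set => 'p set => 'p => 'k::field) => bool" where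
 "adm m \<longleftrightarrow> (\<forall>R\<in>intervals. \<forall>S\<in>intervals. ivl_hom R S (m R S)) & (ALL R S x. R \<notin> intervals \<or> S \<notin> intervals --> m R S x = 0)"

lemma unit_vec_gspace: "R \<in> intervals ==> x \<in> R ==> unit_vec R \<in> carrier (gspace x)"
 unfolding gspace unit_vec_def by auto

lemma Lambda_carrier:
 "f \<in> carrier (Lambda :: ('p::{finite,order}, 'k::field) lam ring) \<longleftrightarrow>
  (ALL x. f x \<in> lin_hom kk (gspace x) (gspace x)) &
  (ALL x y. x \<le> y --> (\<forall>v\<in>carrier (gspace x). f y (rep_map interval_sum x y v) = rep_map interval_sum x y (f x v)))"
 unfolding Lambda_def rep_End_op_def rep_hom_def by simp

lemma Lambda_apply:
 assumes f: "f \<in> carrier (Lambda :: ('p::{finite,order}, 'k::field) lam ring)" and v: "v \<in> carrier (gspace x)" and S: "S \<in> intervals"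
 shows "f x v S = (\<Sum>R\<in>intervals. ent f R S x * v R)"
proof -
 have fl: "f x \<in> lin_hom kk (gspace x) (gspace x)" using f unfolding Lambda_carrier by blast
 note D = lin_homD[OF fl]
 \<comment> \<open>Induction on a set \<open>J\<close> outside which \<open>u\<close> vanishes.
   Splitting off the coordinate \<open>R\<close> requires the unit vector, which exists only if
   \<open>x\<close> is in \<open>R\<close>; otherwise that coordinate is already 0.\<close>
 have "f x u S = (\<Sum>R\<in>J. ent f R S x * u R)"
  if "u \<in> carrier (gspace x)" "J \<subseteq> intervals" "!!R. R \<in> intervals - J ==> u R = 0" for J u
  using finite_set_type[of J] that
 proof (induction J arbitrary: u rule: finite_induct)
  case empty
  have "u = 0 \<odot>\<^bsub>gspace x\<^esub> u" using empty(1,3) unfolding gspace by (auto simp: fun_eq_iff restrict_def)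
  then have "f x u = 0 \<odot>\<^bsub>gspace x\<^esub> f x u" using D(4)[OF _ empty(1), of 0] by simp
  then show ?case using S by (simp add: gspace fun_eq_iff)
 next
  case (insert R J)
  have RI: "R \<in> intervals" using insert by blast
  define u' where "u' = (\<lambda>S\<in>intervals. if S = R then 0 else u S)"
  have u': "u' \<in> carrier (gspace x)" using insert(4) unfolding gspace u'_def by auto
  have IH: "f x u' S = (\<Sum>R\<in>J. ent f R S x * u' R)"
   by (rule insert.IH[OF u']) (use insert in \<open>auto simp: u'_def\<close>)
  also have "\<dots> = (\<Sum>R\<in>J. ent f R S x * u R)"
   by (rule sum.cong) (use insert in \<open>auto simp: u'_def\<close>)
  finally have fu': "f x u' S = (\<Sum>R\<in>J. ent f R S x * u R)" .
  show ?case
  proof (cases "x \<in> R")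
   case True
   have e: "unit_vec R \<in> carrier (gspace x)" using unit_vec_gspace[OF RI True] .
   have ae: "u R \<odot>\<^bsub>gspace x\<^esub> unit_vec R \<in> carrier (gspace x)" using e unfolding gspace by auto
   have "u = u' \<oplus>\<^bsub>gspace x\<^esub> (u R \<odot>\<^bsub>gspace x\<^esub> unit_vec R)"
    using insert(4) RI unfolding gspace u'_def unit_vec_def by (auto simp: fun_eq_iff)
   then have "f x u = f x u' \<oplus>\<^bsub>gspace x\<^esub> (u R \<odot>\<^bsub>gspace x\<^esub> f x (unit_vec R))"
    using D(3)[OF u' ae] D(4)[OF _ e, of "u R"] by simp
   then have "f x u S = f x u' S + u R * f x (unit_vec R) S" using S by (simp add: gspace)
   then show ?thesis using fu' insert(1,2) RI S True by (simp add: ent_def)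
  next
   case False
   then have "u R = 0" using insert(4) RI unfolding gspace by blast
   then have "u = u'" using insert(4) unfolding gspace u'_def by (auto simp: fun_eq_iff)
   then show ?thesis using fu' insert(1,2) \<open>u R = 0\<close> by simp
  qed
 qed
 from this[OF v subset_refl] show ?thesis by simp
qed

lemma adm_ent:
 assumes f: "f \<in> carrier (Lambda :: ('p::{finite,order}, 'k::field) lam ring)" shows "adm (ent f)"
 unfolding adm_def
proof (intro conjI ballI allI impI)
 fix R S :: "'p set" assume RS: "R \<in> intervals" "S \<in> intervals"
 have fl: "f x \<in> lin_hom kk (gspace x) (gspace x)" for x using f unfolding Lambda_carrier by blast
 have supp: "x \<notin> S ==> ent f R S x = 0" for x
  using lin_homD(1)[OF fl unit_vec_gspace[OF RS(1)], of x] RS unfolding ent_def gspace by auto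
 show "ivl_hom R S (ent f R S)"
  unfolding ivl_hom_def
 proof (intro conjI allI ballI impI)
  fix x assume "x \<notin> R \<or> x \<notin> S" then show "ent f R S x = 0" using supp[of x] by (cases "x \<in> R") (auto simp: ent_def)
 next
  fix x y assume xy: "x \<in> R" "y \<in> S" "x \<le> y"
  have u: "(unit_vec R :: 'p set => 'k) \<in> carrier (gspace x)" using unit_vec_gspace RS xy by blast
  have nat: "f y (rep_map interval_sum x y (unit_vec R)) S = rep_map interval_sum x y (f x (unit_vec R)) S"
   using f u xy(3) unfolding Lambda_carrier by simp
  have r: "rep_map interval_sum x y (f x (unit_vec R)) S = ent f R S x"
   using supp[of x] RS xy unfolding rep_map_interval_sum ent_def by auto
  \<comment> \<open>If \<open>y\<close> has left \<open>R\<close>, the unit vector is transported to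
    zero. This agrees with the convention that \<open>ent\<close> vanishes at such
    \<open>y\<close>.\<close>
  have "f y (rep_map interval_sum x y (unit_vec R)) S = ent f R S y"
  proof (cases "y \<in> R")
   case True
   then have "rep_map interval_sum x y (unit_vec R) = (unit_vec R :: 'p set => 'k)"
    using xy unfolding rep_map_interval_sum unit_vec_def by (auto simp: fun_eq_iff)
   then show ?thesis using True RS unfolding ent_def by simp
  next
   case False
   then have e: "rep_map interval_sum x y (unit_vec R) = (\<lambda>S\<in>intervals. 0 :: 'k)"
    unfolding rep_map_interval_sum unit_vec_def by (auto simp: fun_eq_iff)
   have "f y (\<lambda>S\<in>intervals. 0) S = 0"
    using Lambda_apply[OF f _ RS(2), of "\<lambda>S\<in>intervals. 0" y] by (simp add: gspace)
   then show ?thesis using e False unfolding ent_def by simp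
  qed
  then show "ent f R S x = ent f R S y" using nat r by simp
 qed
qed (auto simp: ent_def)

lemma admD:
 assumes "adm m" shows "R \<in> intervals ==> S \<in> intervals ==> ivl_hom R S (m R S)"
  "R \<notin> intervals \<or> S \<notin> intervals ==> m R S x = 0" "x \<notin> R \<or> x \<notin> S ==> m R S x = 0"
 using assms ivl_hom_outside unfolding adm_def by (blast, blast, metis)

lemma of_ent_carrier:
 fixes m :: "'p::{finite,order} set => 'p set => 'p => 'k::field"
 assumes m: "adm m" shows "of_ent m \<in> carrier Lambda"
 unfolding Lambda_carrier
proof (intro conjI allI impI ballI)
 note D = admD[OF m]
 have clos: "(\<lambda>S\<in>intervals. \<Sum>R\<in>intervals. m R S x * v R) \<in> carrier (gspace x)" for x v
  unfolding gspace using D(3) by auto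
 show "of_ent m x \<in> lin_hom kk (gspace x) (gspace x)" for x
 proof (rule lin_homI)
  fix u v :: "'p set => 'k" assume u: "u \<in> carrier (gspace x)" and v: "v \<in> carrier (gspace x)"
  have "u \<oplus>\<^bsub>gspace x\<^esub> v \<in> carrier (gspace x)" using u v unfolding gspace by auto
  then show "of_ent m x (u \<oplus>\<^bsub>gspace x\<^esub> v) = of_ent m x u \<oplus>\<^bsub>gspace x\<^esub> of_ent m x v"
   using u v unfolding of_ent_def by (auto simp: gspace(2-4) fun_eq_iff distrib_left sum.distrib)
 next
  fix a and v :: "'p set => 'k" assume v: "v \<in> carrier (gspace x)"
  have "a \<odot>\<^bsub>gspace x\<^esub> v \<in> carrier (gspace x)" using v unfolding gspace by auto
  then show "of_ent m x (a \<odot>\<^bsub>gspace x\<^esub> v) = a \<odot>\<^bsub>gspace x\<^esub> of_ent m x v"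
   using v unfolding of_ent_def by (auto simp: gspace(2-4) fun_eq_iff sum_distrib_left mult_ac)
 qed (use clos in \<open>simp_all add: of_ent_def\<close>)
 fix x y :: 'p and v :: "'p set => 'k" assume xy: "x \<le> y" and v: "v \<in> carrier (gspace x)"
 have rv: "rep_map interval_sum x y v \<in> carrier (gspace y)" unfolding gspace rep_map_interval_sum by auto
 have "(\<Sum>R\<in>intervals. m R S y * (if x \<in> R & y \<in> R then v R else 0)) =
   (if x \<in> S & y \<in> S then \<Sum>R\<in>intervals. m R S x * v R else 0)" if S: "S \<in> intervals" for S
 proof (cases "y \<in> S")
  case False then show ?thesis using D(3) by simp
 next
  case True
  have "m R S y * (if x \<in> R & y \<in> R then v R else 0) = (if x \<in> S then m R S x * v R else 0)" if R: "R \<in> intervals" for R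
  proof (cases "x \<in> R")
   case False then show ?thesis using v R unfolding gspace by auto
  next
   case xR: True
   have "m R S x = m R S y" using ivl_hom_eq[OF D(1)[OF R S] xR True xy] .
   then show ?thesis using xR D(3)[of y R S] D(3)[of x R S] by auto
  qed
  then have "(\<Sum>R\<in>intervals. m R S y * (if x \<in> R & y \<in> R then v R else 0)) = (\<Sum>R\<in>intervals. if x \<in> S then m R S x * v R else 0)"
   by (rule sum.cong[OF refl])
  then show ?thesis using True by simp
 qed
 then show "of_ent m y (rep_map interval_sum x y v) = rep_map interval_sum x y (of_ent m x v)"
  using v rv unfolding of_ent_def by (auto simp: rep_map_interval_sum fun_eq_iff)
qed

lemma of_ent_ent:
 assumes f: "f \<in> carrier (Lambda :: ('p::{finite,order}, 'k::field) lam ring)" shows "of_ent (ent f) = f"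
proof (intro ext)
 fix x v S
 have fl: "f x \<in> lin_hom kk (gspace x) (gspace x)" using f unfolding Lambda_carrier by blast
 show "of_ent (ent f) x v S = f x v S"
 proof (cases "v \<in> carrier (gspace x)")
  case True
  then show ?thesis
   using Lambda_apply[OF f True] lin_homD(1)[OF fl True] unfolding of_ent_def gspace(1)[of "f x v"] by auto
 next
  case False then show ?thesis using lin_homD(2)[OF fl False] unfolding of_ent_def by simp
 qed
qed

lemma ent_of_ent:
 fixes m :: "'p::{finite,order} set => 'p set => 'p => 'k::field"
 assumes m: "adm m" shows "ent (of_ent m) = m"
proof (intro ext)
 fix R S x
 show "ent (of_ent m) R S x = m R S x"
 proof (cases "R \<in> intervals & S \<in> intervals & x \<in> R")
  case True
  then have "(unit_vec R :: 'p set => 'k) \<in> carrier (gspace x)" using unit_vec_gspace by blast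
  then have "ent (of_ent m) R S x = (\<Sum>R'\<in>intervals. m R' S x * unit_vec R R')"
   using True unfolding ent_def of_ent_def by simp
  also have "\<dots> = (\<Sum>R'\<in>intervals. if R' = R then m R' S x else 0)"
   by (rule sum.cong) (auto simp: unit_vec_def)
  also have "\<dots> = m R S x" using True by simp
  finally show ?thesis .
 next
  case False then show ?thesis using admD(2,3)[OF m] unfolding ent_def by auto
 qed
qed

lemma Lambda_eqI:
 assumes "f \<in> carrier Lambda" "g \<in> carrier Lambda" "!!R S x. ent f R S x = ent g R S x" shows "f = g"
proof -
 have "ent f = ent g" using assms(3) by (intro ext)
 then show ?thesis using of_ent_ent assms(1,2) by metis
qed

lemma adm_mult:
 fixes m m' :: "'p::{finite,order} set => 'p set => 'p => 'k::field"
 assumes "adm m" "adm m'" shows "adm (%R S x. \<Sum>R'\<in>intervals. m R R' x * m' R' S x)"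
 unfolding adm_def
proof (intro conjI ballI allI impI)
 fix R S :: "'p set" assume "R \<in> intervals" "S \<in> intervals"
 then show "ivl_hom R S (%x. \<Sum>R'\<in>intervals. m R R' x * m' R' S x)"
  using admD(1)[OF assms(1)] admD(1)[OF assms(2)] by (intro ivl_hom_sum ivl_hom_mult) auto
qed (use admD(2)[OF assms(1)] admD(2)[OF assms(2)] in auto)

lemma adm_add: "adm m ==> adm m' ==> adm (%R S x. m R S x + m' R S x :: 'k::field)"
 and adm_scale: "adm m ==> adm (%R S x. a * m R S x :: 'k)"
 and adm_zero: "adm (%R S x. 0 :: 'k)"
 unfolding adm_def by (simp_all add: ivl_hom_add ivl_hom_scale)

lemma adm_diag:
 "adm (%R S x. if R = S & R \<in> I & R \<in> intervals & x \<in> R then a else 0 :: 'k::field)"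
 unfolding adm_def
proof (intro conjI ballI allI impI)
 fix R S :: "'a set" show "ivl_hom R S (%x. if R = S & R \<in> I & R \<in> intervals & x \<in> R then a else 0)"
  by (cases "R = S") (auto simp: ivl_hom_def)
qed auto

text \<open>In the opposite endomorphism ring \<open>f \<otimes> g\<close> means first
  \<open>f\<close>, then \<open>g\<close>. With rows indexed by sources, entries therefore multiply
  as matrices in the written order, separately at every point.\<close>

lemma Lambda_ops:
 fixes f g :: "('p::{finite,order}, 'k::field) lam"
 assumes f: "f \<in> carrier Lambda" and g: "g \<in> carrier Lambda"
 shows "f \<otimes>\<^bsub>Lambda\<^esub> g = of_ent (%R S x. \<Sum>R'\<in>intervals. ent f R R' x * ent g R' S x)"
  and "f \<oplus>\<^bsub>Lambda\<^esub> g = of_ent (%R S x. ent f R S x + ent g R S x)"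
proof -
 have fc: "f x v \<in> carrier (gspace x)" and gc: "g x v \<in> carrier (gspace x)" if "v \<in> carrier (gspace x)" for x v
 proof -
  have "f x \<in> lin_hom kk (gspace x) (gspace x)" "g x \<in> lin_hom kk (gspace x) (gspace x)"
   using f g unfolding Lambda_carrier by auto
  then show "f x v \<in> carrier (gspace x)" "g x v \<in> carrier (gspace x)" using lin_homD(1) that by metis+
 qed
 show "f \<otimes>\<^bsub>Lambda\<^esub> g = of_ent (%R S x. \<Sum>R'\<in>intervals. ent f R R' x * ent g R' S x)"
 proof (intro ext)
  fix x v S
  have m: "(f \<otimes>\<^bsub>Lambda\<^esub> g) x = compose (carrier (gspace x)) (g x) (f x)" unfolding Lambda_def rep_End_op_def by simp
  show "(f \<otimes>\<^bsub>Lambda\<^esub> g) x v S = of_ent (%R S x. \<Sum>R'\<in>intervals. ent f R R' x * ent g R' S x) x v S"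
  proof (cases "v \<in> carrier (gspace x) & S \<in> intervals")
   case True
   then have v: "v \<in> carrier (gspace x)" and S: "S \<in> intervals" by auto
   have "(f \<otimes>\<^bsub>Lambda\<^esub> g) x v S = (\<Sum>R'\<in>intervals. ent g R' S x * f x v R')"
    unfolding m using v Lambda_apply[OF g fc[OF v] S] by (simp add: compose_def)
   also have "\<dots> = (\<Sum>R'\<in>intervals. \<Sum>R\<in>intervals. ent f R R' x * ent g R' S x * v R)"
    by (rule sum.cong) (use Lambda_apply[OF f v] in \<open>auto simp: sum_distrib_left mult_ac\<close>)
   also have "\<dots> = (\<Sum>R\<in>intervals. (\<Sum>R'\<in>intervals. ent f R R' x * ent g R' S x) * v R)"
    by (subst sum.swap) (simp add: sum_distrib_right)
   finally show ?thesis using v S unfolding of_ent_def by simp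
  next
   case False
   then show ?thesis unfolding m using gc[OF fc] unfolding of_ent_def compose_def by (auto simp: gspace(1))
  qed
 qed
 show "f \<oplus>\<^bsub>Lambda\<^esub> g = of_ent (%R S x. ent f R S x + ent g R S x)"
 proof (intro ext)
  fix x v S
  have m: "(f \<oplus>\<^bsub>Lambda\<^esub> g) x = (\<lambda>v\<in>carrier (gspace x). f x v \<oplus>\<^bsub>gspace x\<^esub> g x v)"
   unfolding Lambda_def rep_End_op_def by simp
  show "(f \<oplus>\<^bsub>Lambda\<^esub> g) x v S = of_ent (%R S x. ent f R S x + ent g R S x) x v S"
   unfolding m of_ent_def using Lambda_apply[OF f] Lambda_apply[OF g]
   by (auto simp: gspace(3) sum.distrib distrib_right restrict_def)
 qed
qed

lemma ent_Lambda:
 fixes f g :: "('p::{finite,order}, 'k::field) lam"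
 assumes f: "f \<in> carrier Lambda" and g: "g \<in> carrier Lambda"
 shows "f \<otimes>\<^bsub>Lambda\<^esub> g \<in> carrier Lambda" "f \<oplus>\<^bsub>Lambda\<^esub> g \<in> carrier Lambda"
  "ent (f \<otimes>\<^bsub>Lambda\<^esub> g) R S x = (\<Sum>R'\<in>intervals. ent f R R' x * ent g R' S x)"
  "ent (f \<oplus>\<^bsub>Lambda\<^esub> g) R S x = ent f R S x + ent g R S x"
proof -
 note a = adm_mult[OF adm_ent[OF f] adm_ent[OF g]] adm_add[OF adm_ent[OF f] adm_ent[OF g]]
 show "f \<otimes>\<^bsub>Lambda\<^esub> g \<in> carrier Lambda" "f \<oplus>\<^bsub>Lambda\<^esub> g \<in> carrier Lambda"
  unfolding Lambda_ops[OF f g] using of_ent_carrier a by blast+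
 show "ent (f \<otimes>\<^bsub>Lambda\<^esub> g) R S x = (\<Sum>R'\<in>intervals. ent f R R' x * ent g R' S x)"
  "ent (f \<oplus>\<^bsub>Lambda\<^esub> g) R S x = ent f R S x + ent g R S x"
  unfolding Lambda_ops[OF f g] ent_of_ent[OF a(1)] ent_of_ent[OF a(2)] by auto
qed

lemma of_ent_diag:
 "of_ent (%R S x. if R = S & R \<in> I & R \<in> intervals & x \<in> R then a else 0 :: 'k::field) =
  (%x. \<lambda>v\<in>carrier (gspace x). \<lambda>S\<in>intervals. if S \<in> I then a * v S else 0)" (is "?l = ?r")
proof (intro ext)
 fix x v and S :: "'a set"
 show "?l x v S = ?r x v S"
 proof (cases "v \<in> carrier (gspace x) & S \<in> intervals")
  case True
  have "(\<Sum>R\<in>intervals. (if R = S & R \<in> I & R \<in> intervals & x \<in> R then a else 0) * v R) =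
    (\<Sum>R\<in>intervals. if R = S then (if S \<in> I then a * v S else 0) else 0)"
   by (rule sum.cong) (use True in \<open>auto simp: gspace(1)\<close>)
  then show ?thesis using True unfolding of_ent_def by simp
 qed (auto simp: of_ent_def)
qed

text \<open>One diagonal pattern covers the unit, the scalars and the idempotents; conditions such
  as \<open>R \<in> UNIV\<close> keep each of them a literal instance of
  \<open>adm_diag\<close>.\<close>

lemma Lambda_diag:
 shows "\<one>\<^bsub>Lambda\<^esub> = of_ent (%R S x. if R = S & R \<in> UNIV & R \<in> intervals & x \<in> R then 1 else 0 :: 'k::field)"
  and "\<zero>\<^bsub>Lambda\<^esub> = (of_ent (%R S x. 0) :: ('p::{finite,order}, 'k) lam)"
  and "Lambda_scalar a = of_ent (%R S x. if R = S & R \<in> UNIV & R \<in> intervals & x \<in> R then a else 0 :: 'k)"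
  and "Lambda_idem C = of_ent (%R S x. if R = S & R \<in> {C} & R \<in> intervals & x \<in> R then 1 else 0 :: 'k)"
 unfolding of_ent_diag
 by (auto simp: Lambda_def rep_End_op_def of_ent_def Lambda_scalar_def Lambda_idem_def gspace fun_eq_iff restrict_def)

lemma ent_diag:
 shows "\<one>\<^bsub>Lambda\<^esub> \<in> carrier (Lambda :: ('p::{finite,order}, 'k::field) lam ring)"
  "\<zero>\<^bsub>Lambda\<^esub> \<in> carrier (Lambda :: ('p, 'k) lam ring)" "Lambda_scalar a \<in> carrier (Lambda :: ('p, 'k) lam ring)"
  "Lambda_idem C \<in> carrier (Lambda :: ('p, 'k) lam ring)"
  "ent (\<one>\<^bsub>Lambda\<^esub> :: ('p, 'k) lam) R S x = (if R = S & R \<in> intervals & x \<in> R then 1 else 0)"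
  "ent (\<zero>\<^bsub>Lambda\<^esub> :: ('p, 'k) lam) R S x = 0"
  "ent (Lambda_scalar a :: ('p, 'k) lam) R S x = (if R = S & R \<in> intervals & x \<in> R then a else 0)"
  "ent (Lambda_idem C :: ('p, 'k) lam) R S x = (if R = S & R = C & R \<in> intervals & x \<in> R then 1 else 0)"
 unfolding Lambda_diag by (simp_all only: of_ent_carrier[OF adm_diag] of_ent_carrier[OF adm_zero] ent_of_ent[OF adm_diag]
   ent_of_ent[OF adm_zero]) auto

lemma sum_diag_left:
 fixes m :: "'p::{finite,order} set => 'p => 'k::field"
 assumes "!!R x. R \<notin> intervals \<or> x \<notin> R ==> m R x = 0"
 shows "(\<Sum>R'\<in>intervals. (if R = R' & R \<in> intervals & x \<in> R then a else 0) * m R' x) = a * m R x"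
proof -
 have "(\<Sum>R'\<in>intervals. (if R = R' & R \<in> intervals & x \<in> R then a else 0) * m R' x) =
  (\<Sum>R'\<in>intervals. if R' = R then a * m R x else 0)"
  by (rule sum.cong) (use assms[of R x] in auto)
 then show ?thesis using assms[of R x] by auto
qed

lemma sum_diag_right:
 fixes m :: "'p::{finite,order} set => 'p => 'k::field"
 assumes "!!R x. R \<notin> intervals \<or> x \<notin> R ==> m R x = 0"
 shows "(\<Sum>R'\<in>intervals. m R' x * (if R' = R & R' \<in> intervals & x \<in> R' then a else 0)) = m R x * a"
proof -
 have "(\<Sum>R'\<in>intervals. m R' x * (if R' = R & R' \<in> intervals & x \<in> R' then a else 0)) =
  (\<Sum>R'\<in>intervals. if R' = R then m R x * a else 0)"
  by (rule sum.cong) (use assms[of R x] in auto)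
 then show ?thesis using assms[of R x] by auto
qed

lemma ent_outside:
 assumes "f \<in> carrier Lambda" "R \<notin> intervals \<or> S \<notin> intervals \<or> x \<notin> R \<or> x \<notin> S" shows "ent f R S x = 0"
 using admD(2,3)[OF adm_ent[OF assms(1)]] assms(2) by blast

lemma ent_ivl_hom: "f \<in> carrier Lambda ==> R \<in> intervals ==> S \<in> intervals ==> ivl_hom R S (ent f R S)"
 using admD(1)[OF adm_ent] .

lemma sum_diag_Lambda:
 assumes f: "f \<in> carrier (Lambda :: ('p::{finite,order}, 'k::field) lam ring)"
 shows "(\<Sum>R'\<in>intervals. (if R = R' & R \<in> intervals & x \<in> R then a else 0) * ent f R' S x) = a * ent f R S x"
  and "(\<Sum>R'\<in>intervals. ent f S R' x * (if R' = R & R' \<in> intervals & x \<in> R' then a else 0)) = ent f S R x * a"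
 by (rule sum_diag_left, use ent_outside[OF f] in blast) (rule sum_diag_right, use ent_outside[OF f] in blast)

lemma ring_Lambda: "ring (Lambda :: ('p::{finite,order}, 'k::field) lam ring)"
proof (rule ringI)
 let ?L = "Lambda :: ('p, 'k) lam ring"
 note E = ent_Lambda ent_diag
 show "abelian_group ?L"
 proof (rule abelian_groupI)
  fix f assume f: "f \<in> carrier ?L"
  have n: "adm (%R S x. - 1 * ent f R S x)" by (rule adm_scale[OF adm_ent[OF f]])
  show "\<exists>g\<in>carrier ?L. g \<oplus>\<^bsub>?L\<^esub> f = \<zero>\<^bsub>?L\<^esub>"
  proof (rule bexI[OF _ of_ent_carrier[OF n]])
   show "of_ent (%R S x. - 1 * ent f R S x) \<oplus>\<^bsub>?L\<^esub> f = \<zero>\<^bsub>?L\<^esub>"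
    by (rule Lambda_eqI) (use f of_ent_carrier[OF n] ent_of_ent[OF n] in \<open>simp_all add: E\<close>)
  qed
  show "\<zero>\<^bsub>?L\<^esub> \<oplus>\<^bsub>?L\<^esub> f = f" by (rule Lambda_eqI) (use f in \<open>simp_all add: E\<close>)
  fix g assume g: "g \<in> carrier ?L"
  show "f \<oplus>\<^bsub>?L\<^esub> g = g \<oplus>\<^bsub>?L\<^esub> f" by (rule Lambda_eqI) (use f g in \<open>simp_all add: E add.commute\<close>)
  fix h assume h: "h \<in> carrier ?L"
  show "(f \<oplus>\<^bsub>?L\<^esub> g) \<oplus>\<^bsub>?L\<^esub> h = f \<oplus>\<^bsub>?L\<^esub> (g \<oplus>\<^bsub>?L\<^esub> h)"
   by (rule Lambda_eqI) (use f g h in \<open>simp_all add: E add.assoc\<close>)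
 qed (simp_all add: E)
 show "monoid ?L"
 proof (rule monoidI)
  fix f assume f: "f \<in> carrier ?L"
  show "\<one>\<^bsub>?L\<^esub> \<otimes>\<^bsub>?L\<^esub> f = f"
  proof (rule Lambda_eqI)
   fix R S x
   show "ent (\<one>\<^bsub>?L\<^esub> \<otimes>\<^bsub>?L\<^esub> f) R S x = ent f R S x"
    using sum_diag_Lambda(1)[OF f, of R x 1 S] by (simp add: E f)
  qed (simp_all add: E f)
  show "f \<otimes>\<^bsub>?L\<^esub> \<one>\<^bsub>?L\<^esub> = f"
  proof (rule Lambda_eqI)
   fix R S x
   show "ent (f \<otimes>\<^bsub>?L\<^esub> \<one>\<^bsub>?L\<^esub>) R S x = ent f R S x"
    using sum_diag_Lambda(2)[OF f, of R x S 1] by (simp add: E f)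
  qed (simp_all add: E f)
  fix g h assume g: "g \<in> carrier ?L" and h: "h \<in> carrier ?L"
  show "(f \<otimes>\<^bsub>?L\<^esub> g) \<otimes>\<^bsub>?L\<^esub> h = f \<otimes>\<^bsub>?L\<^esub> (g \<otimes>\<^bsub>?L\<^esub> h)"
  proof (rule Lambda_eqI)
   fix R S x
   have "(\<Sum>P\<in>intervals. (\<Sum>Q\<in>intervals. ent f R Q x * ent g Q P x) * ent h P S x) =
     (\<Sum>P\<in>intervals. \<Sum>Q\<in>intervals. ent f R Q x * (ent g Q P x * ent h P S x))"
    by (simp add: sum_distrib_right mult.assoc)
   also have "\<dots> = (\<Sum>Q\<in>intervals. ent f R Q x * (\<Sum>P\<in>intervals. ent g Q P x * ent h P S x))"
    by (subst sum.swap) (simp add: sum_distrib_left)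
   finally show "ent ((f \<otimes>\<^bsub>?L\<^esub> g) \<otimes>\<^bsub>?L\<^esub> h) R S x = ent (f \<otimes>\<^bsub>?L\<^esub> (g \<otimes>\<^bsub>?L\<^esub> h)) R S x" by (simp add: E f g h)
  qed (simp_all add: E f g h)
 qed (simp_all add: E)
 fix f g h assume f: "f \<in> carrier ?L" and g: "g \<in> carrier ?L" and h: "h \<in> carrier ?L"
 show "(f \<oplus>\<^bsub>?L\<^esub> g) \<otimes>\<^bsub>?L\<^esub> h = f \<otimes>\<^bsub>?L\<^esub> h \<oplus>\<^bsub>?L\<^esub> g \<otimes>\<^bsub>?L\<^esub> h"
  by (rule Lambda_eqI) (use f g h in \<open>simp_all add: E distrib_right sum.distrib\<close>)
 show "h \<otimes>\<^bsub>?L\<^esub> (f \<oplus>\<^bsub>?L\<^esub> g) = h \<otimes>\<^bsub>?L\<^esub> f \<oplus>\<^bsub>?L\<^esub> h \<otimes>\<^bsub>?L\<^esub> g"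
  by (rule Lambda_eqI) (use f g h in \<open>simp_all add: E distrib_left sum.distrib\<close>)
qed

lemma central_Lambda_scalar: "central_map Lambda_scalar (Lambda :: ('p::{finite,order}, 'k::field) lam ring)"
 unfolding central_map_def
proof (intro conjI allI ballI)
 let ?L = "Lambda :: ('p, 'k) lam ring"
 note E = ent_Lambda ent_diag
 fix a b :: 'k
 show "(Lambda_scalar a :: ('p, 'k) lam) \<in> carrier ?L" by (rule E)
 show "Lambda_scalar (a + b) = Lambda_scalar a \<oplus>\<^bsub>?L\<^esub> Lambda_scalar b" by (rule Lambda_eqI) (auto simp: E)
 show "Lambda_scalar 1 = \<one>\<^bsub>?L\<^esub>" by (rule Lambda_eqI) (simp_all add: E)
 have l: "ent (Lambda_scalar a \<otimes>\<^bsub>?L\<^esub> r) R S x = a * ent r R S x" if "r \<in> carrier ?L" for r R S x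
  using sum_diag_Lambda(1)[OF that, of R x a S] that by (simp add: E)
 have r: "ent (r \<otimes>\<^bsub>?L\<^esub> Lambda_scalar a) R S x = ent r R S x * a" if "r \<in> carrier ?L" for r R S x
  using sum_diag_Lambda(2)[OF that, of R x S a] that by (simp add: E)
 show "Lambda_scalar (a * b) = Lambda_scalar a \<otimes>\<^bsub>?L\<^esub> Lambda_scalar b"
 proof (rule Lambda_eqI)
  show "ent (Lambda_scalar (a * b)) R S x = ent (Lambda_scalar a \<otimes>\<^bsub>?L\<^esub> Lambda_scalar b) R S x" for R S x
   unfolding l[OF ent_diag(3)] by (auto simp: ent_diag)
 qed (simp_all add: E)
 fix r assume r': "r \<in> carrier ?L"
 show "Lambda_scalar a \<otimes>\<^bsub>?L\<^esub> r = r \<otimes>\<^bsub>?L\<^esub> Lambda_scalar a"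
  by (rule Lambda_eqI) (use r' in \<open>simp_all add: l r E(1-2) E(7) mult.commute\<close>)
qed

section \<open>Simple modules\<close>

definition point :: "'p set => 'p" where "point C = (SOME x. x \<in> C)"

lemma point_in: "C \<in> intervals ==> point C \<in> C"
 unfolding point_def using intervalsD(1) by (metis some_in_eq)

text \<open>By \<open>component_factor\<close> every intermediate interval other than
  \<open>C\<close> contributes zero. The same collapse yields the multiplicativity of
  \<open>char_at\<close>, the linearity of the augmentation, and the linearity of the maps into
  \<open>simple_L C\<close>.\<close>

lemma sum_component_factor:
 fixes C T :: "'p::{finite,order} set"
 assumes C: "C \<in> intervals" "C \<in> components T" and c: "!!R. R \<in> intervals ==> ivl_hom C R (c R)"
  and d: "!!R. R \<in> intervals ==> ivl_hom R T (d R)"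
 shows "(\<Sum>R\<in>intervals. c R (point C) * d R (point C)) = c C (point C) * (d C (point C) :: 'k::field)"
proof -
 have "(\<Sum>R\<in>intervals. c R (point C) * d R (point C)) = (\<Sum>R\<in>intervals. if R = C then c C (point C) * d C (point C) else 0)"
 proof (rule sum.cong)
  fix R assume R: "R \<in> (intervals :: 'p set set)"
  show "c R (point C) * d R (point C) = (if R = C then c C (point C) * d C (point C) else 0)"
   using component_factor[OF C(2) intervalsD(2)[OF R] c[OF R] d[OF R] point_in[OF C(1)]] by auto
 qed simp
 then show ?thesis using C(1) by simp
qed

text \<open>The scalar by which \<open>f\<close> acts on \<open>simple_L C\<close>. An endomorphism
  of the representation of a connected \<open>C\<close> is constant, so the choice of the point is
  immaterial.\<close>

definition char_at :: "'p::{finite,order} set => ('p, 'k::field) lam => 'k" where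
 "char_at C f = ent f C C (point C)"

lemma char_at_mult:
 assumes C: "C \<in> intervals" and f: "f \<in> carrier Lambda" and g: "g \<in> carrier Lambda"
 shows "char_at C (f \<otimes>\<^bsub>Lambda\<^esub> g) = char_at C f * char_at C g"
 unfolding char_at_def ent_Lambda(3)[OF f g]
 by (rule sum_component_factor[OF C interval_is_component[OF C]]) (use ent_ivl_hom f g C in auto)

text \<open>The elements of \<open>Lambda e_C\<close> with vanishing character form a submodule
  \<open>N\<close>, and any single element outside \<open>N\<close> generates everything. So
  \<open>N\<close> is the only maximal submodule, it is the radical, and the character becomes a
  coordinate on the top.\<close>

lemma simple_L_coordinate:
 fixes C :: "'p::{finite,order} set"
 assumes C: "C \<in> intervals"
 shows "EX l :: ('p, 'k::field) lam set => 'k. coordinate Lambda (char_at C) (simple_L C) l"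
proof -
 let ?L = "Lambda :: ('p, 'k) lam ring" and ?e = "Lambda_idem C :: ('p, 'k) lam"
 let ?P = "left_ideal_module ?L ?e"
 note E = ent_Lambda ent_diag
 interpret L: ring ?L by (rule ring_Lambda)
 have ee: "?e \<otimes>\<^bsub>?L\<^esub> ?e = ?e"
 proof (rule Lambda_eqI)
  fix R S x
  have "(\<Sum>R'\<in>intervals. ent ?e R R' x * ent ?e R' S x) = (\<Sum>R'\<in>intervals. if R' = C then ent ?e R S x else 0)"
   by (rule sum.cong) (auto simp: E)
  then show "ent (?e \<otimes>\<^bsub>?L\<^esub> ?e) R S x = ent ?e R S x" using C by (simp add: E)
 qed (simp_all add: E)
 have P: "carrier ?P = {r \<otimes>\<^bsub>?L\<^esub> ?e | r. r \<in> carrier ?L}" "\<zero>\<^bsub>?P\<^esub> = \<zero>\<^bsub>?L\<^esub>"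
  "f \<oplus>\<^bsub>?P\<^esub> g = f \<oplus>\<^bsub>?L\<^esub> g" "f \<odot>\<^bsub>?P\<^esub> g = f \<otimes>\<^bsub>?L\<^esub> g" for f g
  unfolding left_ideal_module_def by auto
 have PL: "f \<in> carrier ?L" if "f \<in> carrier ?P" for f using that unfolding P by (auto simp: E)
 have Pe: "f \<otimes>\<^bsub>?L\<^esub> ?e = f" if f: "f \<in> carrier ?P" for f
 proof -
  obtain r where r: "f = r \<otimes>\<^bsub>?L\<^esub> ?e" "r \<in> carrier ?L" using f unfolding P by blast
  then show ?thesis using L.m_assoc[OF r(2) ent_diag(4) ent_diag(4)] ee by simp
 qed
 have PI: "f \<in> carrier ?P" if "f \<in> carrier ?L" "f \<otimes>\<^bsub>?L\<^esub> ?e = f" for f using that unfolding P by force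
 have P0: "\<zero>\<^bsub>?L\<^esub> \<in> carrier ?P" by (rule PI) (simp_all add: E L.l_null)
 have Padd: "f \<oplus>\<^bsub>?L\<^esub> g \<in> carrier ?P" if "f \<in> carrier ?P" "g \<in> carrier ?P" for f g
  using L.l_distr[OF PL[OF that(1)] PL[OF that(2)] ent_diag(4)] Pe[OF that(1)] Pe[OF that(2)]
  by (intro PI[OF ent_Lambda(2)[OF PL[OF that(1)] PL[OF that(2)]]]) simp
 have Psm: "r \<otimes>\<^bsub>?L\<^esub> f \<in> carrier ?P" if "r \<in> carrier ?L" "f \<in> carrier ?P" for r f
  using L.m_assoc[OF that(1) PL[OF that(2)] ent_diag(4)] Pe[OF that(2)]
  by (intro PI[OF ent_Lambda(1)[OF that(1) PL[OF that(2)]]]) simp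
 have reg: "\<zero>\<^bsub>regular_module ?L\<^esub> = \<zero>\<^bsub>?L\<^esub>" "f \<oplus>\<^bsub>regular_module ?L\<^esub> g = f \<oplus>\<^bsub>?L\<^esub> g"
  "f \<odot>\<^bsub>regular_module ?L\<^esub> g = f \<otimes>\<^bsub>?L\<^esub> g" for f g
  by (simp_all add: regular_module_def left_ideal_module_def)
 have Pm: "left_module ?L ?P"
  by (rule left_module_inj[OF left_module_regular(1)[OF ring_Lambda], where l = "%x. x"];
   (unfold P(2-4) reg left_module_regular(2)[OF ring_Lambda])?) (use P0 Padd Psm PL in auto)
 interpret P: left_module ?L ?P by fact
 have eP: "?e \<in> carrier ?P" using PI[OF ent_diag(4)] ee by blast
 have ce: "char_at C ?e = (1 :: 'k)" unfolding char_at_def ent_diag using C point_in[OF C] by simp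
 have cs: "char_at C (Lambda_scalar a) = (a :: 'k)" for a unfolding char_at_def ent_diag using C point_in[OF C] by simp
 have cadd: "char_at C (f \<oplus>\<^bsub>?L\<^esub> g) = char_at C f + char_at C g" if "f \<in> carrier ?L" "g \<in> carrier ?L" for f g
  unfolding char_at_def using that by (simp add: E)
 define N where "N = {f \<in> carrier ?P. char_at C f = 0}"
 have Nsub: "submodule N ?L ?P"
 proof (rule P.submoduleI)
  show "\<zero>\<^bsub>?P\<^esub> \<in> N" using P0 unfolding N_def P by (simp add: char_at_def E)
  show "f \<oplus>\<^bsub>?P\<^esub> g \<in> N" if "f \<in> N" "g \<in> N" for f g
   using that Padd[of f g] cadd[OF PL PL, of f g] unfolding N_def P(3) by simp
  show "r \<odot>\<^bsub>?P\<^esub> f \<in> N" if "r \<in> carrier ?L" "f \<in> N" for r f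
   using that Psm[of r f] char_at_mult[OF C that(1) PL, of f] unfolding N_def P(4) by simp
 qed (auto simp: N_def)
 \<comment> \<open>Multiplying \<open>f\<close> by the idempotent from the left keeps only the row
   of \<open>C\<close>, while its columns are confined to \<open>C\<close> already. What remains is
   a non-zero scalar, and dividing by it gives back the generator.\<close>
 have big: "N' = carrier ?P" if N': "submodule N' ?L ?P" and f: "f \<in> N'" "char_at C f ~= 0" for N' f
 proof -
  have fP: "f \<in> carrier ?P" using P.submoduleD(1)[OF N'] f by blast
  let ?a = "Lambda_scalar (inverse (char_at C f)) :: ('p, 'k) lam"
  have fe: "ent f R S x = 0" if "S ~= C" for R S x
  proof -
   have "ent (f \<otimes>\<^bsub>?L\<^esub> ?e) R S x = 0" unfolding ent_Lambda(3)[OF PL[OF fP] ent_diag(4)]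
    by (rule sum.neutral) (use that in \<open>auto simp: ent_diag\<close>)
   then show ?thesis using Pe[OF fP] by simp
  qed
  have fc: "ent f C C x = char_at C f" if "x \<in> C" for x
   unfolding char_at_def
   by (rule ivl_hom_component_const[OF interval_is_component[OF C] ent_ivl_hom[OF PL[OF fP] C C] that point_in[OF C]])
  have ef: "ent (?e \<otimes>\<^bsub>?L\<^esub> f) R S x = (if R = C then ent f C S x else 0)" for R S x
  proof -
   have "(\<Sum>R'\<in>intervals. ent ?e R R' x * ent f R' S x) = (\<Sum>R'\<in>intervals. if R' = R then (if R = C then ent f C S x else 0) else 0)"
    by (rule sum.cong) (use ent_outside[OF PL[OF fP], of C S x] C in \<open>auto simp: E\<close>)
   also have "\<dots> = (if R = C then ent f C S x else 0)" using C by auto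
   finally show ?thesis by (simp add: E PL[OF fP])
  qed
  have "?a \<otimes>\<^bsub>?L\<^esub> (?e \<otimes>\<^bsub>?L\<^esub> f) = ?e"
  proof (rule Lambda_eqI)
   have c: "?e \<otimes>\<^bsub>?L\<^esub> f \<in> carrier ?L" using PL[OF fP] by (simp add: E)
   fix R S x
   have "ent (?a \<otimes>\<^bsub>?L\<^esub> (?e \<otimes>\<^bsub>?L\<^esub> f)) R S x = inverse (char_at C f) * ent (?e \<otimes>\<^bsub>?L\<^esub> f) R S x"
    using sum_diag_Lambda(1)[OF c, of R x "inverse (char_at C f)" S]
    by (simp add: ent_Lambda(3)[OF ent_diag(3) c] ent_diag(7))
   also have "\<dots> = ent ?e R S x"
    unfolding ef using fe[of S] fc[of x] f(2) C ent_outside[OF PL[OF fP], of C C x] by (auto simp: ent_diag)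
   finally show "ent (?a \<otimes>\<^bsub>?L\<^esub> (?e \<otimes>\<^bsub>?L\<^esub> f)) R S x = ent ?e R S x" .
  qed (use PL[OF fP] in \<open>simp_all add: E\<close>)
  moreover have "?a \<otimes>\<^bsub>?L\<^esub> (?e \<otimes>\<^bsub>?L\<^esub> f) \<in> N'" using P.submoduleD(4)[OF N'] f(1) ent_diag(3,4) unfolding P(4) by metis
  ultimately have "?e \<in> N'" by simp
  then have "carrier ?P \<subseteq> N'" using P.submoduleD(4)[OF N'] unfolding P by blast
  then show ?thesis using P.submoduleD(1)[OF N'] by blast
 qed
 have Nne: "N ~= carrier ?P"
 proof
  assume "N = carrier ?P"
  then have "?e \<in> N" using eP by simp
  then show False using ce unfolding N_def by simp
 qed
 have "maximal_submodule N ?L ?P"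
  unfolding maximal_submodule_def
 proof (intro conjI allI impI Nsub)
  show "N ~= carrier ?P" by (rule Nne)
  fix N' assume N': "submodule N' ?L ?P & N \<subseteq> N'"
  show "N' = N \<or> N' = carrier ?P"
  proof (cases "N' \<subseteq> N")
   case False
   then obtain f where "f \<in> N'" "char_at C f ~= 0" using P.submoduleD(1) N' unfolding N_def by blast
   then show ?thesis using big N' by blast
  qed (use N' in blast)
 qed
 moreover have "N' = N" if N': "maximal_submodule N' ?L ?P" for N'
 proof -
  have s: "submodule N' ?L ?P" "N' ~= carrier ?P" using N' unfolding maximal_submodule_def by auto
  have "N' \<subseteq> N" using big[OF s(1)] s(2) P.submoduleD(1)[OF s(1)] unfolding N_def by blast
  then show ?thesis using N' Nsub Nne unfolding maximal_submodule_def by blast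
 qed
 ultimately have "{N. maximal_submodule N ?L ?P} = {N}" by blast
 then have rad: "radical ?L ?P = N" unfolding radical_def N_def by auto
 have "EX l. coordinate ?L (char_at C) (quotient_module ?P N) l & (\<forall>x\<in>carrier ?P. l (N +>\<^bsub>?P\<^esub> x) = char_at C x)"
 proof (rule quotient_coordinate[OF Pm Nsub])
  show "char_at C ` carrier ?P = UNIV"
  proof -
   have "Lambda_scalar a \<otimes>\<^bsub>?L\<^esub> ?e \<in> carrier ?P" for a :: 'k using Psm[OF ent_diag(3) eP] .
   moreover have "char_at C (Lambda_scalar a \<otimes>\<^bsub>?L\<^esub> ?e) = a" for a :: 'k
    unfolding char_at_mult[OF C ent_diag(3) ent_diag(4)] ce cs by simp
   ultimately show ?thesis by (metis UNIV_eq_I image_eqI)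
  qed
  show "char_at C (r \<odot>\<^bsub>?P\<^esub> x) = char_at C r * char_at C x" if "r \<in> carrier ?L" "x \<in> carrier ?P" for r x
   unfolding P(4) by (rule char_at_mult[OF C that(1) PL[OF that(2)]])
 qed (use cadd PL in \<open>auto simp: P(3) N_def\<close>)
 then show ?thesis unfolding simple_L_def top_module_def rad by blast
qed

lemma coordinate_inv:
 assumes "coordinate R \<chi> M l"
 shows "inv_into (carrier M) l (a + b) = inv_into (carrier M) l a \<oplus>\<^bsub>M\<^esub> inv_into (carrier M) l b"
  and "r \<in> carrier R ==> inv_into (carrier M) l (\<chi> r * a) = r \<odot>\<^bsub>M\<^esub> inv_into (carrier M) l a"
  and "inv_into (carrier M) l 0 = \<zero>\<^bsub>M\<^esub>" and "x \<in> carrier M ==> inv_into (carrier M) l (l x) = x"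
proof -
 note D = coordinateD[OF assms]
 interpret M: left_module R M by (rule D)
 show "inv_into (carrier M) l (a + b) = inv_into (carrier M) l a \<oplus>\<^bsub>M\<^esub> inv_into (carrier M) l b"
  by (rule D(5)) (simp_all add: D(3,6,7))
 show "r \<in> carrier R ==> inv_into (carrier M) l (\<chi> r * a) = r \<odot>\<^bsub>M\<^esub> inv_into (carrier M) l a"
  by (rule D(5)) (simp_all add: D(4,6,7) M.smult_closed)
 show "inv_into (carrier M) l 0 = \<zero>\<^bsub>M\<^esub>" by (rule D(5)) (simp_all add: D(6,7,8))
 show "x \<in> carrier M ==> inv_into (carrier M) l (l x) = x" by (rule D(5)) (simp_all add: D(6,7))
qed

section \<open>The cubical resolution\<close>

type_synonym ('p, 'k) cub = "('p + 'p) set => 'p set => 'p => 'k"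

text \<open>\<open>q F R\<close> is the part of \<open>q\<close> in the summand at \<open>F\<close>
  that comes from the summand \<open>R\<close> of the sum of all intervals: a morphism from
  \<open>R\<close> to \<open>cell S F\<close>. The action mixes the \<open>R\<close> and leaves
  \<open>F\<close> alone.\<close>

definition cres_obj :: "'p::{finite,order} set => nat => (('p, 'k::field) lam, ('p, 'k) cub) module" where
 "cres_obj S n = \<lparr>carrier = {q. (ALL F R x. q F R x ~= 0 --> R \<in> intervals) & (\<forall>R\<in>intervals. rchain S R n (%F. q F R))},
   monoid.mult = undefined, one = undefined, zero = (%_ _ _. 0), add = (%q q' F R x. q F R x + q' F R x),
   module.smult = (%f q F R x. \<Sum>R'\<in>intervals. ent f R R' x * q F R' x)\<rparr>"

lemma cres_simps:
 "q \<in> carrier (cres_obj S n) \<longleftrightarrow> (ALL F R x. q F R x ~= 0 --> R \<in> intervals) & (\<forall>R\<in>intervals. rchain S R n (%F. q F R))"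
 "\<zero>\<^bsub>cres_obj S n\<^esub> = (%_ _ _. 0)" "q \<oplus>\<^bsub>cres_obj S n\<^esub> q' = (%F R x. q F R x + q' F R x)"
 "f \<odot>\<^bsub>cres_obj S n\<^esub> q = (%F R x. \<Sum>R'\<in>intervals. ent f R R' x * q F R' x)"
 unfolding cres_obj_def by simp_all

lemma cresD:
 assumes q: "q \<in> carrier (cres_obj S n)"
 shows "q F R x ~= 0 ==> R \<in> intervals" "R \<in> intervals ==> rchain S R n (%F. q F R)"
  "F \<subseteq> cube S ==> R \<in> intervals ==> ivl_hom R (cell S F) (q F R)"
  "q F R x ~= 0 ==> F \<subseteq> cube S" "q F R x ~= 0 ==> card F = n" "q F R x ~= 0 ==> x \<in> R" "q F R x ~= 0 ==> x \<in> cell S F"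
proof -
 show a: "q F R x ~= 0 ==> R \<in> intervals" for F R x using q unfolding cres_simps by blast
 show b: "R \<in> intervals ==> rchain S R n (%F. q F R)" for R using q unfolding cres_simps by blast
 show "F \<subseteq> cube S ==> R \<in> intervals ==> ivl_hom R (cell S F) (q F R)" using rchainD(3)[OF b] .
 assume nz: "q F R x ~= 0"
 note c = b[OF a[OF nz]]
 show "F \<subseteq> cube S" "card F = n" "x \<in> R" "x \<in> cell S F"
  using rchainD(1)[OF c, of F x] rchainD(2)[OF c, of F x] rchainD(4)[OF c, of F x] rchainD(5)[OF c, of F x] nz by auto
qed

lemma cresI:
 assumes "!!F R x. q F R x ~= 0 ==> R \<in> intervals & F \<subseteq> cube S & card F = n"
  and "!!F R. F \<subseteq> cube S ==> R \<in> intervals ==> ivl_hom R (cell S F) (q F R)"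
 shows "q \<in> carrier (cres_obj S n)"
 using assms unfolding cres_simps rchain_def by blast

lemma cres_smult_closed:
 fixes q :: "('p::{finite,order}, 'k::field) cub"
 assumes f: "f \<in> carrier Lambda" and q: "q \<in> carrier (cres_obj S n)"
 shows "f \<odot>\<^bsub>cres_obj S n\<^esub> q \<in> carrier (cres_obj S n)"
proof (rule cresI)
 fix F R x assume "(f \<odot>\<^bsub>cres_obj S n\<^esub> q) F R x ~= 0"
 then have "(\<Sum>R'\<in>intervals. ent f R R' x * q F R' x) ~= 0" unfolding cres_simps .
 then obtain R' where "ent f R R' x * q F R' x ~= 0" using sum.not_neutral_contains_not_neutral by blast
 then show "R \<in> intervals & F \<subseteq> cube S & card F = n" using cresD(4,5)[OF q, of F R' x] ent_outside[OF f, of R R' x] by auto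
next
 fix F and R :: "'p set" assume "F \<subseteq> cube S" "R \<in> intervals"
 then show "ivl_hom R (cell S F) ((f \<odot>\<^bsub>cres_obj S n\<^esub> q) F R)"
  unfolding cres_simps by (intro ivl_hom_sum ivl_hom_mult[OF ent_ivl_hom[OF f] cresD(3)[OF q]]) auto
qed

lemma left_module_cres: "left_module (Lambda :: ('p::{finite,order}, 'k::field) lam ring) (cres_obj S n)"
proof (intro left_module.intro ring_Lambda abelian_groupI left_module_axioms.intro)
 let ?L = "Lambda :: ('p, 'k) lam ring" and ?Q = "cres_obj S n :: (('p, 'k) lam, ('p, 'k) cub) module"
 show "\<zero>\<^bsub>?Q\<^esub> \<in> carrier ?Q" by (rule cresI) (auto simp: cres_simps)
 fix q assume q: "q \<in> carrier ?Q"
 have z: "q F R x = 0" if "R \<notin> intervals \<or> x \<notin> R" for F R x using cresD(1,6)[OF q, of F R x] that by blast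
 show "\<zero>\<^bsub>?Q\<^esub> \<oplus>\<^bsub>?Q\<^esub> q = q" by (simp add: cres_simps)
 have neg: "(%F R x. - q F R x) \<in> carrier ?Q"
 proof (rule cresI)
  fix F R x assume "- q F R x ~= 0"
  then show "R \<in> intervals & F \<subseteq> cube S & card F = n" using cresD(1,4,5)[OF q, of F R x] by auto
 next
  fix F and R :: "'p set" assume "F \<subseteq> cube S" "R \<in> intervals"
  from ivl_hom_scale[OF cresD(3)[OF q this], of "-1"] show "ivl_hom R (cell S F) (%x. - q F R x)" by simp
 qed
 show "\<exists>q'\<in>carrier ?Q. q' \<oplus>\<^bsub>?Q\<^esub> q = \<zero>\<^bsub>?Q\<^esub>" by (rule bexI[OF _ neg]) (simp add: cres_simps)
 show "\<one>\<^bsub>?L\<^esub> \<odot>\<^bsub>?Q\<^esub> q = q"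
 proof (intro ext)
  fix F R x
  have "(\<Sum>R'\<in>intervals. (if R = R' & R \<in> intervals & x \<in> R then 1 else 0) * q F R' x) = 1 * q F R x"
   by (rule sum_diag_left) (use z in blast)
  then show "(\<one>\<^bsub>?L\<^esub> \<odot>\<^bsub>?Q\<^esub> q) F R x = q F R x" unfolding cres_simps ent_diag by simp
 qed
 {
  fix f assume f: "f \<in> carrier ?L"
  show "f \<odot>\<^bsub>?Q\<^esub> q \<in> carrier ?Q" by (rule cres_smult_closed[OF f q])
  fix g assume g: "g \<in> carrier ?L"
  show "(f \<oplus>\<^bsub>?L\<^esub> g) \<odot>\<^bsub>?Q\<^esub> q = f \<odot>\<^bsub>?Q\<^esub> q \<oplus>\<^bsub>?Q\<^esub> g \<odot>\<^bsub>?Q\<^esub> q"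
   unfolding cres_simps ent_Lambda(4)[OF f g] by (simp add: distrib_right sum.distrib)
  show "(f \<otimes>\<^bsub>?L\<^esub> g) \<odot>\<^bsub>?Q\<^esub> q = f \<odot>\<^bsub>?Q\<^esub> (g \<odot>\<^bsub>?Q\<^esub> q)"
  proof (intro ext)
   fix F R x
   have "(\<Sum>P\<in>intervals. (\<Sum>Q\<in>intervals. ent f R Q x * ent g Q P x) * q F P x) =
     (\<Sum>P\<in>intervals. \<Sum>Q\<in>intervals. ent f R Q x * (ent g Q P x * q F P x))"
    by (simp add: sum_distrib_right mult.assoc)
   also have "\<dots> = (\<Sum>Q\<in>intervals. ent f R Q x * (\<Sum>P\<in>intervals. ent g Q P x * q F P x))"
    by (subst sum.swap) (simp add: sum_distrib_left)
   finally show "((f \<otimes>\<^bsub>?L\<^esub> g) \<odot>\<^bsub>?Q\<^esub> q) F R x = (f \<odot>\<^bsub>?Q\<^esub> (g \<odot>\<^bsub>?Q\<^esub> q)) F R x"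
    unfolding cres_simps ent_Lambda(3)[OF f g] .
  qed
 }
 fix q' assume q': "q' \<in> carrier ?Q"
 show "q \<oplus>\<^bsub>?Q\<^esub> q' = q' \<oplus>\<^bsub>?Q\<^esub> q" unfolding cres_simps by (simp add: add.commute)
 show "q \<oplus>\<^bsub>?Q\<^esub> q' \<in> carrier ?Q"
 proof (rule cresI)
  fix F R x assume "(q \<oplus>\<^bsub>?Q\<^esub> q') F R x ~= 0"
  then have "q F R x ~= 0 \<or> q' F R x ~= 0" unfolding cres_simps by auto
  then show "R \<in> intervals & F \<subseteq> cube S & card F = n" using cresD(1,4,5)[OF q] cresD(1,4,5)[OF q'] by metis
 next
  fix F and R :: "'p set" assume "F \<subseteq> cube S" "R \<in> intervals"
  then show "ivl_hom R (cell S F) ((q \<oplus>\<^bsub>?Q\<^esub> q') F R)"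
   unfolding cres_simps by (intro ivl_hom_add cresD(3)[OF q] cresD(3)[OF q'])
 qed
 {
  fix q'' assume "q'' \<in> carrier ?Q"
  show "q \<oplus>\<^bsub>?Q\<^esub> q' \<oplus>\<^bsub>?Q\<^esub> q'' = q \<oplus>\<^bsub>?Q\<^esub> (q' \<oplus>\<^bsub>?Q\<^esub> q'')" unfolding cres_simps by (simp add: add.assoc)
 }
 fix f assume "f \<in> carrier ?L"
 show "f \<odot>\<^bsub>?Q\<^esub> (q \<oplus>\<^bsub>?Q\<^esub> q') = f \<odot>\<^bsub>?Q\<^esub> q \<oplus>\<^bsub>?Q\<^esub> f \<odot>\<^bsub>?Q\<^esub> q'"
  unfolding cres_simps by (simp add: distrib_left sum.distrib)
qed

text \<open>The element of the summand at \<open>F\<close> given by the inclusions of all components; it generates the summand.\<close>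

definition cgen :: "'p::{finite,order} set => ('p + 'p) set => ('p, 'k::field) cub" where
 "cgen S F = (%G R x. if G = F & R \<in> components (cell S F) & x \<in> R then 1 else 0)"

text \<open>The algebra element that produces the part of \<open>q\<close> at \<open>F\<close> from
  the generator \<open>cgen S F\<close>: its entry from \<open>R\<close> to a component
  \<open>D\<close> is \<open>q F R\<close> cut down to \<open>D\<close>.\<close>

definition cmat :: "'p::{finite,order} set => ('p + 'p) set => ('p, 'k::field) cub => 'p set => 'p set => 'p => 'k" where
 "cmat S F q = (%R D x. if R \<in> intervals & D \<in> components (cell S F) & x \<in> D then q F R x else 0)"

text \<open>The representation of a set is the direct sum of those of its components. Composing with
  the inclusion of a summand gives this lemma, composing with the projection the next one.\<close>

lemma ivl_hom_from_component:
 assumes "D \<in> components T" "ivl_hom R D c" shows "ivl_hom R T (c :: 'p::order => 'k::field)"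
proof -
 have "ivl_hom D T (%x. if x \<in> D & x \<in> T then 1 else 0 :: 'k)"
 proof (rule ivl_hom_indicator)
  fix x y assume "x \<in> D" "y \<in> T" "x \<le> y"
  then show "x \<in> T & y \<in> D" using components_subset[OF assms(1)] components_closed[OF assms(1)] by blast
 qed
 from ivl_hom_mult[OF assms(2) this] have "ivl_hom R T (%x. c x * (if x \<in> D & x \<in> T then 1 else 0))" .
 moreover have "(%x. c x * (if x \<in> D & x \<in> T then 1 else 0)) = c"
  using ivl_hom_support[OF assms(2)] components_subset[OF assms(1)] by (auto simp: fun_eq_iff)
 ultimately show ?thesis by simp
qed

lemma ivl_hom_to_component:
 assumes "D \<in> components T" "ivl_hom R T c" shows "ivl_hom R D (%x. if x \<in> D then c x else 0 :: 'k::field)"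
proof -
 have "ivl_hom T D (%x. if x \<in> T & x \<in> D then 1 else 0 :: 'k)"
 proof (rule ivl_hom_indicator)
  fix x y assume "x \<in> T" "y \<in> D" "x \<le> y"
  then show "x \<in> D & y \<in> T" using components_subset[OF assms(1)] components_closed[OF assms(1)] by blast
 qed
 from ivl_hom_mult[OF assms(2) this] have "ivl_hom R D (%x. c x * (if x \<in> T & x \<in> D then 1 else 0))" .
 moreover have "(%x. c x * (if x \<in> T & x \<in> D then 1 else 0)) = (%x. if x \<in> D then c x else 0)"
  using components_subset[OF assms(1)] by (auto simp: fun_eq_iff)
 ultimately show ?thesis by simp
qed

lemma cell_components_intervals:
 "S \<in> intervals ==> F \<subseteq> cube S ==> components (cell S F) \<subseteq> intervals"
 using components_intervals[OF cell_convex[OF intervalsD(3)]] by blast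

lemma cgen_carrier:
 fixes S :: "'p::{finite,order} set"
 assumes S: "S \<in> intervals" and F: "F \<subseteq> cube S"
 shows "(cgen S F :: ('p, 'k::field) cub) \<in> carrier (cres_obj S (card F))"
proof (rule cresI)
 fix G R x assume "(cgen S F :: ('p, 'k) cub) G R x ~= 0"
 then have "G = F" "R \<in> components (cell S F)" unfolding cgen_def by (auto split: if_splits)
 then show "R \<in> intervals & G \<subseteq> cube S & card G = card F" using cell_components_intervals[OF S F] F by blast
next
 fix G and R :: "'p set" assume "R \<in> intervals"
 show "ivl_hom R (cell S G) ((cgen S F :: ('p, 'k) cub) G R)"
 proof (cases "G = F & R \<in> components (cell S F)")
  case True
  have "ivl_hom R R (%x. if x \<in> R & x \<in> R then 1 else 0 :: 'k)" by (rule ivl_hom_indicator) blast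
  from ivl_hom_from_component[OF _ this] show ?thesis using True unfolding cgen_def by simp
 next
  case False
  then have "(cgen S F :: ('p, 'k) cub) G R = (%x. 0)" unfolding cgen_def by auto
  then show ?thesis by simp
 qed
qed

lemma adm_cmat:
 fixes q :: "('p::{finite,order}, 'k::field) cub"
 assumes S: "S \<in> intervals" and F: "F \<subseteq> cube S" and q: "q \<in> carrier (cres_obj S n)"
 shows "adm (cmat S F q)"
 unfolding adm_def
proof (intro conjI ballI allI impI)
 fix R D :: "'p set" assume R: "R \<in> intervals" and "D \<in> intervals"
 show "ivl_hom R D (cmat S F q R D)"
 proof (cases "D \<in> components (cell S F)")
  case True
  from ivl_hom_to_component[OF True cresD(3)[OF q F R]] show ?thesis using R True unfolding cmat_def by simp
 next
  case False
  then have "cmat S F q R D = (%x. 0)" unfolding cmat_def by auto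
  then show ?thesis by simp
 qed
qed (use cell_components_intervals[OF S F] in \<open>auto simp: cmat_def\<close>)

lemma sum_components:
 fixes T :: "'p::{finite,order} set"
 shows "(\<Sum>D\<in>components T. if x \<in> D then c else 0) = (if x \<in> T then c else (0 :: 'k::field))"
proof (cases "x \<in> T")
 case True
 then obtain D where D: "D \<in> components T" "x \<in> D" using components_cover by blast
 have "(\<Sum>E\<in>components T. if x \<in> E then c else 0) = (\<Sum>E\<in>components T. if E = D then c else 0)"
  by (rule sum.cong) (use D components_disjoint in auto)
 then show ?thesis using D True by simp
next
 case False
 then show ?thesis using components_subset by (intro sum.neutral[THEN trans]) auto
qed

lemma cgen_expand:
 fixes q :: "('p::{finite,order}, 'k::field) cub"
 assumes S: "S \<in> intervals" and F: "F \<subseteq> cube S" and q: "q \<in> carrier (cres_obj S n)"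
 shows "of_ent (cmat S F q) \<odot>\<^bsub>cres_obj S n\<^esub> cgen S F = (%G R x. if G = F then q F R x else 0)"
proof (intro ext)
 fix G R x
 have "(\<Sum>D\<in>intervals. cmat S F q R D x * cgen S F G D x) =
   (\<Sum>D\<in>components (cell S F). if x \<in> D then (if G = F & R \<in> intervals then q F R x else 0) else 0)"
  by (rule sum.mono_neutral_cong_right)
   (use cell_components_intervals[OF S F] in \<open>auto simp: cmat_def cgen_def\<close>)
 also have "\<dots> = (if G = F then q F R x else 0)"
  unfolding sum_components using cresD(1,7)[OF q, of F R x] by auto
 finally show "(of_ent (cmat S F q) \<odot>\<^bsub>cres_obj S n\<^esub> cgen S F) G R x = (if G = F then q F R x else 0)"
  unfolding cres_simps ent_of_ent[OF adm_cmat[OF S F q]] .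
qed

text \<open>One copy of \<open>Lambda\<close> for each \<open>F\<close> is enough: the components of
  a cell are distinct intervals, so the sum of their projectives is a direct summand of
  \<open>Lambda\<close>. The map \<open>p\<close> adds up the columns of the components, and
  \<open>i\<close> supplies these columns by \<open>cmat\<close>.\<close>

lemma fg_projective_cres:
 fixes S :: "'p::{finite,order} set"
 assumes S: "S \<in> intervals"
 shows "fg_projective (Lambda :: ('p, 'k::field) lam ring) (cres_obj S n)"
proof -
 let ?L = "Lambda :: ('p, 'k) lam ring" and ?Q = "cres_obj S n :: (('p, 'k) lam, ('p, 'k) cub) module"
 define I where "I = {F. F \<subseteq> cube S & card F = n}"
 define m where "m = card I"
 have "finite I" unfolding I_def by (rule finite_subset[of _ "Pow (cube S)"]) auto
 then obtain b where b: "bij_betw b {..<m} I" unfolding m_def using ex_bij_betw_nat_finite lessThan_atLeast0 by metis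
 define c where "c = inv_into {..<m} b"
 have bI: "b j \<in> I" if "j < m" for j using bij_betwE[OF b] that by blast
 have bc: "c F < m & b (c F) = F" if "F \<in> I" for F
  using bij_betw_inv_into_right[OF b that] bij_betwE[OF bij_betw_inv_into[OF b]] that unfolding c_def by blast
 let ?F = "direct_sum {..<m} (%_. regular_module ?L)"
 have reg: "f \<oplus>\<^bsub>regular_module ?L\<^esub> g = f \<oplus>\<^bsub>?L\<^esub> g" "f \<odot>\<^bsub>regular_module ?L\<^esub> g = f \<otimes>\<^bsub>?L\<^esub> g" for f g
  by (simp_all add: regular_module_def left_ideal_module_def)
 have F: "f \<in> carrier ?F \<longleftrightarrow> (ALL j<m. f j \<in> carrier ?L) & (ALL j. \<not> j < m --> f j = undefined)"
  "f \<oplus>\<^bsub>?F\<^esub> g = (\<lambda>j\<in>{..<m}. f j \<oplus>\<^bsub>?L\<^esub> g j)" "r \<odot>\<^bsub>?F\<^esub> f = (\<lambda>j\<in>{..<m}. r \<otimes>\<^bsub>?L\<^esub> f j)" for f g r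
  unfolding direct_sum_def
  by (auto simp: left_module_regular(2)[OF ring_Lambda] reg PiE_def Pi_def extensional_def)
 interpret Q: left_module ?L ?Q by (rule left_module_cres)
 interpret L: ring ?L by (rule ring_Lambda)
 have bcube: "b j \<subseteq> cube S" if "j < m" for j using bI[OF that] unfolding I_def by blast
 note ad = adm_cmat[OF S bcube]
 define i where "i = (\<lambda>q\<in>carrier ?Q. \<lambda>j\<in>{..<m}. of_ent (cmat S (b j) q))"
 define p where "p = (\<lambda>f\<in>carrier ?F. %F R x. if F \<in> I then \<Sum>D\<in>components (cell S F). ent (f (c F)) R D x else 0)"
 have i: "i \<in> lin_hom ?L ?Q ?F"
 proof (rule lin_homI)
  fix q assume q: "q \<in> carrier ?Q"
  show "i q \<in> carrier ?F" unfolding F i_def using q of_ent_carrier[OF ad[OF _ q]] by simp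
  {
   fix q' assume q': "q' \<in> carrier ?Q"
   have "of_ent (cmat S (b j) (q \<oplus>\<^bsub>?Q\<^esub> q')) = of_ent (cmat S (b j) q) \<oplus>\<^bsub>?L\<^esub> of_ent (cmat S (b j) q')" if j: "j < m" for j
   proof (rule Lambda_eqI)
    note a = ad[OF j q] ad[OF j q'] ad[OF j Q.M.a_closed[OF q q']]
    show "of_ent (cmat S (b j) (q \<oplus>\<^bsub>?Q\<^esub> q')) \<in> carrier ?L" by (rule of_ent_carrier[OF a(3)])
    show "of_ent (cmat S (b j) q) \<oplus>\<^bsub>?L\<^esub> of_ent (cmat S (b j) q') \<in> carrier ?L"
     by (rule ent_Lambda(2)[OF of_ent_carrier[OF a(1)] of_ent_carrier[OF a(2)]])
    show "ent (of_ent (cmat S (b j) (q \<oplus>\<^bsub>?Q\<^esub> q'))) R D x = ent (of_ent (cmat S (b j) q) \<oplus>\<^bsub>?L\<^esub> of_ent (cmat S (b j) q')) R D x" for R D x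
     unfolding ent_Lambda(4)[OF of_ent_carrier[OF a(1)] of_ent_carrier[OF a(2)]] ent_of_ent[OF a(1)] ent_of_ent[OF a(2)] ent_of_ent[OF a(3)]
     by (simp add: cmat_def cres_simps)
   qed
   then show "i (q \<oplus>\<^bsub>?Q\<^esub> q') = i q \<oplus>\<^bsub>?F\<^esub> i q'"
    unfolding F i_def using q q' Q.M.a_closed[OF q q'] by (auto simp: fun_eq_iff)
  }
  fix r assume r: "r \<in> carrier ?L"
  have "of_ent (cmat S (b j) (r \<odot>\<^bsub>?Q\<^esub> q)) = r \<otimes>\<^bsub>?L\<^esub> of_ent (cmat S (b j) q)" if j: "j < m" for j
  proof (rule Lambda_eqI)
   note a = ad[OF j q] ad[OF j Q.smult_closed[OF r q]]
   show "of_ent (cmat S (b j) (r \<odot>\<^bsub>?Q\<^esub> q)) \<in> carrier ?L" by (rule of_ent_carrier[OF a(2)])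
   show "r \<otimes>\<^bsub>?L\<^esub> of_ent (cmat S (b j) q) \<in> carrier ?L" by (rule ent_Lambda(1)[OF r of_ent_carrier[OF a(1)]])
   show "ent (of_ent (cmat S (b j) (r \<odot>\<^bsub>?Q\<^esub> q))) R D x = ent (r \<otimes>\<^bsub>?L\<^esub> of_ent (cmat S (b j) q)) R D x" for R D x
   proof (cases "R \<in> intervals & D \<in> components (cell S (b j)) & x \<in> D")
    case True
    then show ?thesis
     unfolding ent_Lambda(3)[OF r of_ent_carrier[OF a(1)]] ent_of_ent[OF a(1)] ent_of_ent[OF a(2)]
     by (simp add: cmat_def cres_simps)
   next
    case False
    then have "ent r R R' x * cmat S (b j) q R' D x = 0" for R'
     using ent_outside[OF r, of R R' x] unfolding cmat_def by auto
    then have "(\<Sum>R'\<in>intervals. ent r R R' x * cmat S (b j) q R' D x) = 0" by (simp only: sum.neutral_const)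
    moreover have "cmat S (b j) (r \<odot>\<^bsub>?Q\<^esub> q) R D x = 0" using False unfolding cmat_def by auto
    ultimately show ?thesis
     unfolding ent_Lambda(3)[OF r of_ent_carrier[OF a(1)]] ent_of_ent[OF a(1)] ent_of_ent[OF a(2)] by simp
   qed
  qed
  then show "i (r \<odot>\<^bsub>?Q\<^esub> q) = r \<odot>\<^bsub>?F\<^esub> i q"
   unfolding F i_def using q Q.smult_closed[OF r q] by (auto simp: fun_eq_iff)
 qed (simp add: i_def)
 have Fm: "left_module ?L ?F"
  by (rule left_module_direct_sum[OF ring_Lambda]) (rule left_module_regular(1)[OF ring_Lambda])
 interpret Fm: left_module ?L ?F by fact
 have fL: "f (c G) \<in> carrier ?L" if "f \<in> carrier ?F" "G \<in> I" for f G using that bc F by blast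
 have p: "p \<in> lin_hom ?L ?F ?Q"
 proof (rule lin_homI)
  fix f assume f: "f \<in> carrier ?F"
  show "p f \<in> carrier ?Q"
  proof (rule cresI)
   fix G R x assume nz: "p f G R x ~= 0"
   then have G: "G \<in> I" and "(\<Sum>D\<in>components (cell S G). ent (f (c G)) R D x) ~= 0"
    using f unfolding p_def by (auto split: if_splits)
   then obtain D where "ent (f (c G)) R D x ~= 0" using sum.not_neutral_contains_not_neutral by blast
   then show "R \<in> intervals & G \<subseteq> cube S & card G = n"
    using ent_outside[OF fL[OF f G], of R D x] G unfolding I_def by blast
  next
   fix G and R :: "'p set" assume G: "G \<subseteq> cube S" and R: "R \<in> intervals"
   show "ivl_hom R (cell S G) (p f G R)"
   proof (cases "G \<in> I")
    case True
    have "ivl_hom R (cell S G) (%x. \<Sum>D\<in>components (cell S G). ent (f (c G)) R D x)"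
    proof (rule ivl_hom_sum)
     fix D assume D: "D \<in> components (cell S G)"
     show "ivl_hom R (cell S G) (ent (f (c G)) R D)"
      by (rule ivl_hom_from_component[OF D ent_ivl_hom[OF fL[OF f True] R]])
       (use D cell_components_intervals[OF S G] in blast)
    qed
    then show ?thesis using True f unfolding p_def by simp
   next
    case False
    then have "p f G R = (%x. 0)" using f unfolding p_def by auto
    then show ?thesis by simp
   qed
  qed
  {
   fix g assume g: "g \<in> carrier ?F"
   show "p (f \<oplus>\<^bsub>?F\<^esub> g) = p f \<oplus>\<^bsub>?Q\<^esub> p g"
   proof (intro ext)
    fix G R x
    show "p (f \<oplus>\<^bsub>?F\<^esub> g) G R x = (p f \<oplus>\<^bsub>?Q\<^esub> p g) G R x"
    proof (cases "G \<in> I")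
     case True
     have "(f \<oplus>\<^bsub>?F\<^esub> g) (c G) = f (c G) \<oplus>\<^bsub>?L\<^esub> g (c G)" using bc[OF True] unfolding F by simp
     then show ?thesis using True f g Fm.M.a_closed[OF f g] ent_Lambda(4)[OF fL[OF f True] fL[OF g True]]
      unfolding p_def cres_simps by (simp add: sum.distrib)
    next
     case False
     then show ?thesis using f g Fm.M.a_closed[OF f g] unfolding p_def cres_simps by simp
    qed
   qed
  }
  fix r assume r: "r \<in> carrier ?L"
  show "p (r \<odot>\<^bsub>?F\<^esub> f) = r \<odot>\<^bsub>?Q\<^esub> p f"
  proof (intro ext)
   fix G R x
   show "p (r \<odot>\<^bsub>?F\<^esub> f) G R x = (r \<odot>\<^bsub>?Q\<^esub> p f) G R x"
   proof (cases "G \<in> I")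
    case True
    have "(r \<odot>\<^bsub>?F\<^esub> f) (c G) = r \<otimes>\<^bsub>?L\<^esub> f (c G)" using bc[OF True] unfolding F by simp
    then have "p (r \<odot>\<^bsub>?F\<^esub> f) G R x = (\<Sum>D\<in>components (cell S G). \<Sum>R'\<in>intervals. ent r R R' x * ent (f (c G)) R' D x)"
     using True Fm.smult_closed[OF r f] ent_Lambda(3)[OF r fL[OF f True]] unfolding p_def by simp
    also have "\<dots> = (\<Sum>R'\<in>intervals. ent r R R' x * (\<Sum>D\<in>components (cell S G). ent (f (c G)) R' D x))"
     by (subst sum.swap) (simp add: sum_distrib_left)
    finally show ?thesis using True f unfolding p_def cres_simps by simp
   next
    case False
    then show ?thesis using f Fm.smult_closed[OF r f] unfolding p_def cres_simps by simp
   qed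
  qed
 qed (simp add: p_def)
 have "p (i q) = q" if q: "q \<in> carrier ?Q" for q
 proof (intro ext)
  fix G R x
  show "p (i q) G R x = q G R x"
  proof (cases "G \<in> I")
   case True
   have G: "c G < m" "b (c G) = G" "G \<subseteq> cube S" using bc[OF True] True unfolding I_def by auto
   have "p (i q) G R x = (\<Sum>D\<in>components (cell S G). ent (of_ent (cmat S G q)) R D x)"
    using lin_homD(1)[OF i q] True q G unfolding p_def i_def by simp
   also have "\<dots> = (\<Sum>D\<in>components (cell S G). if x \<in> D then (if R \<in> intervals then q G R x else 0) else 0)"
    unfolding ent_of_ent[OF adm_cmat[OF S G(3) q]] by (rule sum.cong) (auto simp: cmat_def)
   also have "\<dots> = q G R x" unfolding sum_components using cresD(1,7)[OF q, of G R x] by auto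
   finally show ?thesis .
  next
   case False
   then have "q G R x = 0" using cresD(4,5)[OF q, of G R x] unfolding I_def by blast
   then show ?thesis using False lin_homD(1)[OF i q] unfolding p_def by simp
  qed
 qed
 then have "\<forall>q\<in>carrier ?Q. p (i q) = q" by blast
 then show ?thesis unfolding fg_projective_def
  by (intro conjI left_module_cres exI[of _ m] bexI[OF _ i] bexI[OF _ p])
qed

text \<open>For \<open>F = {}\<close> the cell is \<open>S\<close>, so degree 0 is the projective of
  \<open>S\<close>. The augmentation extracts its character and turns it into an element of the
  simple top through the inverse of the coordinate \<open>l\<close>.\<close>

definition cres :: "'p::{finite,order} set => (('p, 'k::field) lam set => 'k) => (('p, 'k) lam, ('p, 'k) cub, ('p, 'k) lam set) resolution" where
 "cres S l = \<lparr>res_obj = cres_obj S,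
   res_diff = (%n. \<lambda>q\<in>carrier (cres_obj S (Suc n)). %F R. bdiff S (%G. q G R) F),
   res_aug = (\<lambda>q\<in>carrier (cres_obj S 0). inv_into (carrier (simple_L S)) l (q {} S (point S)))\<rparr>"

lemma cdiff_carrier:
 assumes S: "S \<in> intervals" and q: "q \<in> carrier (cres_obj S (Suc n))"
 shows "(%F R. bdiff S (%G. q G R) F) \<in> carrier (cres_obj S n)"
 unfolding cres_simps
proof (intro conjI allI impI ballI)
 fix R assume "R \<in> (intervals :: 'a set set)"
 then show "rchain S R n (bdiff S (%G. q G R))" by (rule rchain_bdiff[OF intervalsD(3)[OF S] cresD(2)[OF q]])
next
 fix F R x assume nz: "bdiff S (%G. q G R) F x ~= 0"
 show "R \<in> intervals"
 proof (rule ccontr)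
  assume "R \<notin> intervals"
  then have "q G R x = 0" for G using cresD(1)[OF q] by blast
  then have "bdiff S (%G. q G R) F x = 0" unfolding bdiff_def by simp
  then show False using nz by contradiction
 qed
qed

lemma projective_resolution_cres:
 fixes S :: "'p::{finite,order} set" and l :: "('p, 'k::field) lam set => 'k"
 assumes S: "S \<in> intervals" and l: "coordinate Lambda (char_at S) (simple_L S) l"
 shows "projective_resolution Lambda (simple_L S) (cres S l)"
proof -
 let ?L = "Lambda :: ('p, 'k) lam ring"
 let ?Q = "%n. cres_obj S n :: (('p, 'k) lam, ('p, 'k) cub) module"
 let ?d = "%n. \<lambda>q\<in>carrier (?Q (Suc n)). %F R. bdiff S (%G. q G R) F"
 let ?i = "inv_into (carrier (simple_L S)) l"
 let ?a = "\<lambda>q\<in>carrier (?Q 0). ?i (q {} S (point S))"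
 note ld = coordinateD[OF l] and li = coordinate_inv[OF l] and dc = cdiff_carrier[OF S]
 have dm: "?d n \<in> lin_hom ?L (?Q (Suc n)) (?Q n)" for n
 proof (rule lin_homI)
  interpret Q: left_module ?L "?Q (Suc n)" by (rule left_module_cres)
  fix q assume q: "q \<in> carrier (?Q (Suc n))"
  show "?d n q \<in> carrier (?Q n)" using q dc[OF q] by simp
  {
   fix q' assume q': "q' \<in> carrier (?Q (Suc n))"
   show "?d n (q \<oplus>\<^bsub>?Q (Suc n)\<^esub> q') = ?d n q \<oplus>\<^bsub>?Q n\<^esub> ?d n q'"
    using q q' Q.M.a_closed[OF q q'] by (simp add: cres_simps(2-4) bdiff_add fun_eq_iff)
  }
  fix r assume r: "r \<in> carrier ?L"
  have "bdiff S (%G x. \<Sum>R'\<in>intervals. ent r R R' x * q G R' x) F x = (\<Sum>R'\<in>intervals. ent r R R' x * bdiff S (%G. q G R') F x)" for F R x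
  proof (cases "F \<subseteq> cube S & x \<in> cell S F")
   case True
   have "(\<Sum>w\<in>cube S - F. esign erank w F * (\<Sum>R'\<in>intervals. ent r R R' x * q (insert w F) R' x)) =
     (\<Sum>w\<in>cube S - F. \<Sum>R'\<in>intervals. ent r R R' x * (esign erank w F * q (insert w F) R' x))"
    by (simp add: sum_distrib_left mult_ac)
   also have "\<dots> = (\<Sum>R'\<in>intervals. ent r R R' x * (\<Sum>w\<in>cube S - F. esign erank w F * q (insert w F) R' x))"
    by (subst sum.swap) (simp add: sum_distrib_left)
   finally show ?thesis using True unfolding bdiff_def by simp
  next
   case False
   then have "bdiff S z F x = 0" for z :: "('p + 'p) set => 'p => 'k" unfolding bdiff_def by auto
   then show ?thesis by simp
  qed
  then show "?d n (r \<odot>\<^bsub>?Q (Suc n)\<^esub> q) = r \<odot>\<^bsub>?Q n\<^esub> ?d n q"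
   using q Q.smult_closed[OF r q] by (simp add: cres_simps(2-4) fun_eq_iff)
 qed simp
 have am: "?a \<in> lin_hom ?L (?Q 0) (simple_L S)"
 proof (rule lin_homI)
  interpret Q: left_module ?L "?Q 0" by (rule left_module_cres)
  fix q assume q: "q \<in> carrier (?Q 0)"
  show "?a q \<in> carrier (simple_L S)" using q ld(6) by simp
  {
   fix q' assume q': "q' \<in> carrier (?Q 0)"
   show "?a (q \<oplus>\<^bsub>?Q 0\<^esub> q') = ?a q \<oplus>\<^bsub>simple_L S\<^esub> ?a q'"
    using q q' Q.M.a_closed[OF q q'] li(1) by (simp add: cres_simps(2-4))
  }
  fix r assume r: "r \<in> carrier ?L"
  have "(\<Sum>R\<in>intervals. ent r S R (point S) * q {} R (point S)) = char_at S r * q {} S (point S)"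
   unfolding char_at_def
   by (rule sum_component_factor[OF S interval_is_component[OF S]])
    (use ent_ivl_hom[OF r S] cresD(3)[OF q, of "{}"] in auto)
  then show "?a (r \<odot>\<^bsub>?Q 0\<^esub> q) = r \<odot>\<^bsub>simple_L S\<^esub> ?a q"
   using q Q.smult_closed[OF r q] li(2)[OF r] by (simp add: cres_simps(2-4))
 qed simp
 have surj: "?a ` carrier (?Q 0) = carrier (simple_L S)"
 proof
  show "?a ` carrier (?Q 0) \<subseteq> carrier (simple_L S)" using lin_homD(1)[OF am] by blast
  show "carrier (simple_L S) \<subseteq> ?a ` carrier (?Q 0)"
  proof
   fix y :: "('p, 'k) lam set" assume y: "y \<in> carrier (simple_L S)"
   interpret Q: left_module ?L "?Q 0" by (rule left_module_cres)
   let ?g = "cgen S {} :: ('p, 'k) cub"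
   have g: "?g \<in> carrier (?Q 0)" using cgen_carrier[OF S, of "{}"] by simp
   have "?g {} S (point S) = 1" using interval_is_component[OF S] point_in[OF S] unfolding cgen_def by simp
   then have "?a (Lambda_scalar (l y) \<odot>\<^bsub>?Q 0\<^esub> ?g) = Lambda_scalar (l y) \<odot>\<^bsub>simple_L S\<^esub> ?i 1"
    using lin_homD(4)[OF am ent_diag(3) g, of "l y"] g by simp
   also have "\<dots> = ?i (char_at S (Lambda_scalar (l y) :: ('p, 'k) lam) * 1)" using li(2)[OF ent_diag(3)] by metis
   also have "\<dots> = y" using li(4)[OF y] S point_in[OF S] by (simp add: char_at_def ent_diag)
   finally show "y \<in> ?a ` carrier (?Q 0)" using Q.smult_closed[OF ent_diag(3) g] by (metis (no_types, lifting) imageI)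
  qed
 qed
 \<comment> \<open>The differential does not mix different \<open>R\<close>. Preimages are therefore
   taken from \<open>bdiff_exact\<close> for each interval separately and assembled into one
   chain.\<close>
 have ex: "\<exists>q'\<in>carrier (?Q (Suc n)). ?d n q' = q"
  if q: "q \<in> carrier (?Q n)" and cyc: "0 < n ==> (!!R F x. bdiff S (%G. q G R) F x = 0)"
   and aug: "n = 0 ==> q {} S (point S) = 0" for q n
 proof -
  have "EX y. rchain S R (Suc n) y & bdiff S y = (%F. q F R)" if R: "R \<in> intervals" for R
  proof (rule bdiff_exact[OF S R cresD(2)[OF q R] cyc])
   fix F x assume n: "n = 0" and RS: "R = S"
   show "q F R x = 0"
   proof (rule ccontr)
    assume nz: "q F R x ~= 0"
    have F: "F = {}" using cresD(5)[OF q nz] n by simp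
    have "ivl_hom S S (q {} S)" using cresD(3)[OF q, of "{}" S] S by simp
    then have "q {} S x = q {} S (point S)"
     using ivl_hom_component_const[OF interval_is_component[OF S]] cresD(6)[OF q nz] point_in[OF S] RS by blast
    then show False using aug[OF n] nz F RS by simp
   qed
  qed
  then obtain y where y: "!!R. R \<in> intervals ==> rchain S R (Suc n) (y R) & bdiff S (y R) = (%F. q F R)" by metis
  let ?q = "%F R x. if R \<in> intervals then y R F x else 0"
  have "rchain S R (Suc n) (%F. ?q F R)" if "R \<in> intervals" for R using y[OF that] that by simp
  then have q': "?q \<in> carrier (?Q (Suc n))" unfolding cres_simps by (metis (no_types, lifting))
  have "bdiff S (%G. ?q G R) F x = q F R x" for F R x
  proof (cases "R \<in> intervals")
   case True then show ?thesis using fun_cong[OF fun_cong[OF conjunct2[OF y[OF True]]], of F x] by simp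
  next
   case False
   then have "q F R x = 0" using cresD(1)[OF q, of F R x] by blast
   then show ?thesis using False by (simp add: bdiff_def)
  qed
  then have "?d n ?q = q" using q' by (simp add: fun_eq_iff)
  then show ?thesis using q' by blast
 qed
 have aug0: "q {} S (point S) = 0 \<longleftrightarrow> ?a q = \<zero>\<^bsub>simple_L S\<^esub>" if "q \<in> carrier (?Q 0)" for q
 proof
  assume "?a q = \<zero>\<^bsub>simple_L S\<^esub>"
  then have "?i (q {} S (point S)) = \<zero>\<^bsub>simple_L S\<^esub>" using that by simp
  then show "q {} S (point S) = 0" using ld(7)[of "q {} S (point S)"] ld(8) by metis
 qed (use that li(3) in simp)
 \<comment> \<open>A morphism from \<open>S\<close> to \<open>cell S {w}\<close> that is non-zero at
   \<open>point S\<close> has full support, since \<open>S\<close> is a single component. Then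
   nothing was deleted and every added frontier element lies in \<open>S\<close>; neither kind of
   \<open>w\<close> allows this.\<close>
 have ker0: "?a (?d 0 q) = \<zero>\<^bsub>simple_L S\<^esub>" if q: "q \<in> carrier (?Q (Suc 0))" for q
 proof -
  have "q {w} S (point S) = 0" if w: "w \<in> cube S" for w
  proof (rule ccontr)
   assume nz: "q {w} S (point S) ~= 0"
   have up: "lefts {w} \<subseteq> up_frontier S" "rights {w} \<subseteq> min_elems S" using cube_subset[of "{w}" S] w by auto
   have hom: "ivl_hom S (stage S (lefts {w}) - rights {w}) (q {w} S)"
    using cresD(3)[OF q _ S, of "{w}"] w unfolding cell_def by simp
   have e: "S \<inter> stage S (lefts {w}) = S" unfolding stage_def by blast
   have "component_of S (point S) \<in> components S" using point_in[OF S] unfolding components_def by blast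
   then have "component_of S (point S) = S"
    using components_disjoint[OF _ interval_is_component[OF S] component_of_self point_in[OF S]] by blast
   then have full: "min_elems S \<subseteq> component_of (S \<inter> stage S (lefts {w})) (point S)"
    using min_elems_sub unfolding e by blast
   note fs = ivl_hom_full_support(1,3)[OF S intervalsD(3)[OF S] up hom nz full]
   have "lefts {w} = {}" using fs(2) up(1) up_frontier_above by blast
   with fs(1) show False by (cases w) (auto simp: lefts_def rights_def)
  qed
  then have "bdiff S (%G. q G S) {} (point S) = 0" unfolding bdiff_def by simp
  then show ?thesis using aug0[OF dc[OF q]] q by simp
 qed
 have kerS: "?d n (?d (Suc n) q) = \<zero>\<^bsub>?Q n\<^esub>" if q: "q \<in> carrier (?Q (Suc (Suc n)))" for q n
 proof -
  have "bdiff S (bdiff S (%G. q G R)) F x = 0" for F R x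
  proof (cases "R \<in> intervals")
   case True then show ?thesis by (rule bdiff_bdiff[OF cresD(2)[OF q]])
  next
   case False
   then have "(%G. q G R) = (%G x. 0)" using cresD(1)[OF q] by blast
   moreover have "bdiff S (%G x. 0 :: 'k) = (%F x. 0)" by (intro ext bdiff_zero)
   ultimately show ?thesis by (simp only: bdiff_zero)
  qed
  then show ?thesis using q dc[OF q] by (simp add: cres_simps(2) fun_eq_iff)
 qed
 show ?thesis
  unfolding projective_resolution_def cres_def resolution.simps
 proof (intro conjI allI)
  show "{q \<in> carrier (?Q 0). ?a q = \<zero>\<^bsub>simple_L S\<^esub>} = ?d 0 ` carrier (?Q 1)"
  proof
   show "{q \<in> carrier (?Q 0). ?a q = \<zero>\<^bsub>simple_L S\<^esub>} \<subseteq> ?d 0 ` carrier (?Q 1)"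
   proof
    fix q assume q: "q \<in> {q \<in> carrier (?Q 0). ?a q = \<zero>\<^bsub>simple_L S\<^esub>}"
    then have "q {} S (point S) = 0" using aug0 by blast
    then have "\<exists>q'\<in>carrier (?Q (Suc 0)). ?d 0 q' = q" using q by (intro ex) simp_all
    then show "q \<in> ?d 0 ` carrier (?Q 1)" by (elim bexE) (rule image_eqI, rule sym, simp_all)
   qed
   show "?d 0 ` carrier (?Q 1) \<subseteq> {q \<in> carrier (?Q 0). ?a q = \<zero>\<^bsub>simple_L S\<^esub>}"
    using ker0 lin_homD(1)[OF dm[of 0]] by auto
  qed
  fix n
  show "{q \<in> carrier (?Q (Suc n)). ?d n q = \<zero>\<^bsub>?Q n\<^esub>} = ?d (Suc n) ` carrier (?Q (Suc (Suc n)))"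
  proof
   show "{q \<in> carrier (?Q (Suc n)). ?d n q = \<zero>\<^bsub>?Q n\<^esub>} \<subseteq> ?d (Suc n) ` carrier (?Q (Suc (Suc n)))"
   proof
    fix q assume q: "q \<in> {q \<in> carrier (?Q (Suc n)). ?d n q = \<zero>\<^bsub>?Q n\<^esub>}"
    note qc = CollectD[OF q, THEN conjunct1] and CollectD[OF q, THEN conjunct2]
    with qc have "(%F R. bdiff S (%G. q G R) F) = (%_ _ _. 0)" by (simp add: cres_simps(2))
    from fun_cong[OF fun_cong[OF fun_cong[OF this]]] have "bdiff S (%G. q G R) F x = 0" for F R x .
    then have "\<exists>q'\<in>carrier (?Q (Suc (Suc n))). ?d (Suc n) q' = q" by (intro ex qc) simp_all
    then show "q \<in> ?d (Suc n) ` carrier (?Q (Suc (Suc n)))" by (elim bexE) (rule image_eqI, rule sym)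
   qed
   show "?d (Suc n) ` carrier (?Q (Suc (Suc n))) \<subseteq> {q \<in> carrier (?Q (Suc n)). ?d n q = \<zero>\<^bsub>?Q n\<^esub>}"
    using kerS[of _ n] lin_homD(1)[OF dm[of "Suc n"]] by blast
  qed
 qed (use fg_projective_cres[OF S] dm am surj in auto)
qed

text \<open>Non-vanishing at one point spreads over \<open>C\<close>, which is a component of
  \<open>cell S F\<close>, so all of \<open>C\<close> survives in \<open>cell S G\<close>. It
  remains closed there: downwards by comparison with \<open>cell S F\<close>, upwards by naturality
  of \<open>c\<close>. In \<open>pairing_bdiff\<close> this disposes of the sets outside
  \<open>phi\<close>.\<close>

lemma phi_up:
 fixes S C :: "'p::{finite,order} set" and c :: "'p => 'k::field"
 assumes S: "S \<in> intervals" and C: "C \<in> intervals" and F: "F \<in> phi S C" and G: "F \<subseteq> G" "G \<subseteq> cube S"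
  and c: "ivl_hom C (cell S G) c" and nz: "c (point C) ~= 0"
 shows "G \<in> phi S C"
proof -
 note Sc = intervalsD(3)[OF S]
 have Cc: "C \<in> components (cell S F)" using F phi_components[OF S C] by blast
 have nzC: "c x ~= 0" if x: "x \<in> C" for x
 proof -
  have cF: "x \<in> cell S F" "point C \<in> cell S F" using components_subset[OF Cc] x point_in[OF C] by blast+
  have "(if x \<in> cell S F then c x else 0) = (if point C \<in> cell S F then c (point C) else 0)"
   using ivl_hom_component_const[OF Cc ivl_hom_restrict_cell[OF Sc G(2,1) c] x point_in[OF C]] .
  then show ?thesis using nz cF by simp
 qed
 have "C \<in> components (cell S G)"
 proof (rule componentsI[OF _ intervalsD(1,2)[OF C]])
  show "C \<subseteq> cell S G" using nzC ivl_hom_support[OF c] by blast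
  fix x y assume x: "x \<in> C" and y: "y \<in> cell S G" and xy: "y \<le> x \<or> x \<le> y"
  from xy show "y \<in> C"
  proof
   assume "y \<le> x"
   moreover have "x \<in> cell S F" using components_subset[OF Cc] x by blast
   ultimately have "y \<in> cell S F" using cell_restrict[OF Sc G(2,1) y] by blast
   then show ?thesis using components_closed[OF Cc x] \<open>y \<le> x\<close> by blast
  next
   assume "x \<le> y"
   then have "c y ~= 0" using ivl_hom_eq[OF c x y] nzC[OF x] by simp
   then show ?thesis using ivl_hom_support[OF c] by blast
  qed
 qed
 then show ?thesis using phi_components[OF S C] G by blast
qed

text \<open>The coordinate form of a map from the resolution to \<open>simple_L C\<close>:
  \<open>x\<close> lists its values on the generators, and \<open>q F C (point C)\<close> is the
  part of \<open>q\<close> at \<open>F\<close> that the character of \<open>C\<close> can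
  detect.\<close>

definition pairing :: "'p::{finite,order} set => 'p set => (('p + 'p) set => 'k::field) => ('p, 'k) cub => 'k" where
 "pairing S C x q = (\<Sum>F\<in>phi S C. x F * q F C (point C))"

lemma pairing_smult:
 fixes q :: "('p::{finite,order}, 'k::field) cub"
 assumes S: "S \<in> intervals" and C: "C \<in> intervals" and r: "r \<in> carrier Lambda" and q: "q \<in> carrier (cres_obj S n)"
 shows "pairing S C x (r \<odot>\<^bsub>cres_obj S n\<^esub> q) = char_at C r * pairing S C x q"
proof -
 have "(\<Sum>R\<in>intervals. ent r C R (point C) * q F R (point C)) = char_at C r * q F C (point C)" if F: "F \<in> phi S C" for F
 proof -
  have F: "F \<subseteq> cube S" and c: "C \<in> components (cell S F)" using F phi_components[OF S C] by blast+
  show ?thesis unfolding char_at_def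
   by (rule sum_component_factor[OF C c]) (auto intro: ent_ivl_hom[OF r C] cresD(3)[OF q F])
 qed
 then show ?thesis unfolding pairing_def cres_simps by (simp add: sum_distrib_left mult_ac)
qed

text \<open>Adjointness of the two differentials of the cube: a pair \<open>(F, w)\<close> with
  \<open>w\<close> outside \<open>F\<close> is the same as the pair \<open>(insert w F, w)\<close>
  with \<open>w\<close> inside. No further sign appears, because both sides use the sign of adding
  \<open>w\<close> to the smaller set.\<close>

lemma pairing_bdiff:
 fixes q :: "('p::{finite,order}, 'k::field) cub"
 assumes S: "S \<in> intervals" and C: "C \<in> intervals" and q: "q \<in> carrier (cres_obj S (Suc n))"
  and x: "!!F. x F ~= 0 ==> F \<in> phi S C"
 shows "pairing S C x (%F R. bdiff S (%G. q G R) F) = pairing S C (%F. if F \<in> phi S C then cdiff erank x F else 0) q"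
proof -
 let ?p = "point C"
 note ph = phi_components[OF S C]
 have sub: "phi S C \<subseteq> Pow (cube S)" using ph by blast
 have "pairing S C x (%F R. bdiff S (%G. q G R) F) =
   (\<Sum>F\<in>phi S C. \<Sum>w\<in>cube S - F. x F * (esign erank w F * q (insert w F) C ?p))"
  unfolding pairing_def
 proof (rule sum.cong[OF refl])
  fix F assume "F \<in> phi S C"
  then have "F \<subseteq> cube S" "?p \<in> cell S F" using ph[of F] components_subset[of C "cell S F"] point_in[OF C] by blast+
  then show "x F * bdiff S (%G. q G C) F ?p = (\<Sum>w\<in>cube S - F. x F * (esign erank w F * q (insert w F) C ?p))"
   unfolding bdiff_def by (simp add: sum_distrib_left)
 qed
 also have "\<dots> = (\<Sum>F\<in>Pow (cube S). \<Sum>w\<in>cube S - F. x F * (esign erank w F * q (insert w F) C ?p))"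
  by (rule sum.mono_neutral_left) (use sub x in \<open>auto intro!: sum.neutral\<close>)
 also have "\<dots> = (\<Sum>(F, w)\<in>(SIGMA F:Pow (cube S). cube S - F). x F * (esign erank w F * q (insert w F) C ?p))"
  by (simp add: sum.Sigma)
 also have "\<dots> = (\<Sum>(G, w)\<in>(SIGMA G:Pow (cube S). G). x (G - {w}) * (esign erank w (G - {w}) * q G C ?p))"
  by (rule sum.reindex_bij_witness[where i = "%(G, w). (G - {w}, w)" and j = "%(F, w). (insert w F, w)"])
   (auto simp: insert_absorb)
 also have "\<dots> = (\<Sum>G\<in>Pow (cube S). \<Sum>w\<in>G. x (G - {w}) * (esign erank w (G - {w}) * q G C ?p))"
  by (simp add: sum.Sigma)
 \<comment> \<open>A set \<open>G\<close> outside \<open>phi\<close> contributes nothing: with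
   \<open>G - {w}\<close> in \<open>phi\<close>, a non-zero value of \<open>q\<close> at
   \<open>G\<close> would put \<open>G\<close> into \<open>phi\<close> as well.\<close>
 also have "\<dots> = (\<Sum>G\<in>phi S C. \<Sum>w\<in>G. x (G - {w}) * (esign erank w (G - {w}) * q G C ?p))"
 proof (rule sum.mono_neutral_right)
  show "\<forall>G\<in>Pow (cube S) - phi S C. (\<Sum>w\<in>G. x (G - {w}) * (esign erank w (G - {w}) * q G C ?p)) = 0"
  proof (intro ballI sum.neutral)
   fix G w assume G: "G \<in> Pow (cube S) - phi S C" and w: "w \<in> G"
   have "x (G - {w}) = 0 \<or> q G C ?p = 0"
   proof (rule ccontr)
    assume "\<not> (x (G - {w}) = 0 \<or> q G C ?p = 0)"
    then have "G - {w} \<in> phi S C" "q G C ?p ~= 0" using x by auto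
    then have "G \<in> phi S C" using phi_up[OF S C, of "G - {w}" G "q G C"] cresD(3)[OF q _ C, of G] G by blast
    then show False using G by blast
   qed
   then show "x (G - {w}) * (esign erank w (G - {w}) * q G C ?p) = 0" by auto
  qed
 qed (use sub in auto)
 also have "\<dots> = pairing S C (%F. if F \<in> phi S C then cdiff erank x F else 0) q"
  unfolding pairing_def cdiff_def by (simp add: sum_distrib_left sum_distrib_right mult_ac)
 finally show ?thesis .
qed

lemma pairing_cgen:
 fixes S C :: "'p::{finite,order} set"
 assumes S: "S \<in> intervals" and C: "C \<in> intervals"
 shows "pairing S C x (cgen S F) = (if F \<in> phi S C then x F else (0 :: 'k::field))"
proof -
 have "pairing S C x (cgen S F) = (\<Sum>G\<in>phi S C. if G = F then x G else 0)"
  unfolding pairing_def using phi_components[OF S C] point_in[OF C] by (intro sum.cong) (auto simp: cgen_def)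
 then show ?thesis by simp
qed

text \<open>Maps from the \<open>n\<close>-th term to \<open>L(C)\<close> are determined by the images of the generators, and the
 generators at sets outside \<open>phi S C\<close> are killed.\<close>

lemma cres_hom_eqI:
 fixes S C :: "'p::{finite,order} set"
 assumes S: "S \<in> intervals" and C: "C \<in> intervals" and l: "coordinate Lambda (char_at C) N l"
  and f: "f \<in> lin_hom (Lambda :: ('p, 'k::field) lam ring) (cres_obj S n) N" and g: "g \<in> lin_hom Lambda (cres_obj S n) N"
  and eq: "!!F. F \<in> phi S C ==> card F = n ==> l (f (cgen S F)) = l (g (cgen S F))"
 shows "f = g"
proof (rule lin_hom_eqI[OF f g])
 let ?Q = "cres_obj S n :: (('p, 'k) lam, ('p, 'k) cub) module"
 note D = coordinateD[OF l]
 have L: "left_module (Lambda :: ('p, 'k) lam ring) ?Q" by (rule left_module_cres)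
 have single: "h (%G R x. if G = F then q F R x else 0) = r \<odot>\<^bsub>N\<^esub> h (cgen S F)"
  if h: "h \<in> lin_hom Lambda ?Q N" and q: "q \<in> carrier ?Q" and F: "F \<subseteq> cube S" "card F = n" and r: "r = of_ent (cmat S F q)" for h q F r
 proof -
  have "cgen S F \<in> carrier ?Q" using cgen_carrier[OF S F(1)] F(2) by simp
  from lin_homD(4)[OF h of_ent_carrier[OF adm_cmat[OF S F(1) q]] this] show ?thesis unfolding cgen_expand[OF S F(1) q] r .
 qed
 have "f q = g q" if "finite A" "q \<in> carrier ?Q" "!!G R x. q G R x ~= 0 ==> G \<in> A" for A q
  using that
 proof (induction A arbitrary: q)
  case empty
  have "q = (%_ _ _. 0)" using empty.prems(2) by (intro ext) blast
  then have "q = \<zero>\<^bsub>?Q\<^esub>" unfolding cres_simps .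
  then show ?case using lin_hom_zero[OF f L D(1)] lin_hom_zero[OF g L D(1)] by simp
 next
  case (insert F A)
  note q = insert.prems(1)
  let ?a = "%G R x. if G = F then q F R x else 0" and ?b = "%G R x. if G = F then 0 else q G R x"
  have b: "?b \<in> carrier ?Q"
  proof (rule cresI)
   fix G R x assume "?b G R x ~= 0"
   then have "q G R x ~= 0" by (auto split: if_splits)
   then show "R \<in> intervals & G \<subseteq> cube S & card G = n" using cresD(1,4,5)[OF q] by metis
  next
   fix G and R :: "'p set" assume "G \<subseteq> cube S" "R \<in> intervals"
   then show "ivl_hom R (cell S G) (?b G R)" using cresD(3)[OF q] by (cases "G = F") simp_all
  qed
  have fb: "f ?b = g ?b"
  proof (rule insert.IH[OF b])
   fix G R x assume "?b G R x ~= 0"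
   then have "q G R x ~= 0" "G ~= F" by (auto split: if_splits)
   then show "G \<in> A" using insert.prems(2)[of G R x] by simp
  qed
  show ?case
  proof (cases "F \<subseteq> cube S & card F = n")
   case False
   then have "q F R x = 0" for R x using cresD(4,5)[OF q, of F R x] by blast
   then have "?b = q" by (auto simp: fun_eq_iff)
   then show ?thesis using fb by simp
  next
   case True
   then have F: "F \<subseteq> cube S" "card F = n" by auto
   define r where "r = of_ent (cmat S F q)"
   have r: "r \<in> carrier Lambda" unfolding r_def by (rule of_ent_carrier[OF adm_cmat[OF S F(1) q]])
   have gen: "cgen S F \<in> carrier ?Q" using cgen_carrier[OF S F(1)] F(2) by simp
   interpret Q: left_module Lambda ?Q by (rule L)
   have a: "?a \<in> carrier ?Q" using Q.smult_closed[OF r gen] cgen_expand[OF S F(1) q] unfolding r_def by simp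
   \<comment> \<open>If \<open>C\<close> is not a component of the cell, the coefficient acts on the
     target by zero, so the image of the generator is irrelevant.\<close>
   have cr: "char_at C r = (if C \<in> components (cell S F) then q F C (point C) else 0)"
    unfolding char_at_def r_def ent_of_ent[OF adm_cmat[OF S F(1) q]] using C point_in[OF C] by (simp add: cmat_def)
   have "f ?a = g ?a"
   proof (rule D(5))
    show "f ?a \<in> carrier N" "g ?a \<in> carrier N" using lin_homD(1)[OF f a] lin_homD(1)[OF g a] by simp_all
    show "l (f ?a) = l (g ?a)"
     unfolding single[OF f q F r_def] single[OF g q F r_def]
      D(4)[OF r lin_homD(1)[OF f gen]] D(4)[OF r lin_homD(1)[OF g gen]]
     using eq[of F] F phi_components[OF S C, of F] cr by auto
   qed
   moreover have "q = ?a \<oplus>\<^bsub>?Q\<^esub> ?b" unfolding cres_simps by (auto simp: fun_eq_iff)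
   ultimately show ?thesis using lin_homD(3)[OF f a b] lin_homD(3)[OF g a b] fb by simp
  qed
 qed
 from this[of "Pow (cube S)"] show "f q = g q" if q: "q \<in> carrier ?Q" for q
  using q cresD(4)[OF q] by (meson PowI finite)
qed

definition hmap ::
  "'p::{finite,order} set => 'p set => (('p, 'k::field) lam set => 'k) => nat => (('p + 'p) set => 'k) =>
   ('p, 'k) cub => ('p, 'k) lam set" where
 "hmap S C l n x = (\<lambda>q\<in>carrier (cres_obj S n). inv_into (carrier (simple_L C)) l (pairing S C x q))"

lemma hmap_lin_hom:
 fixes S C :: "'p::{finite,order} set" and l :: "('p, 'k::field) lam set => 'k"
 assumes S: "S \<in> intervals" and C: "C \<in> intervals" and l: "coordinate Lambda (char_at C) (simple_L C) l"
 shows "hmap S C l n x \<in> lin_hom Lambda (cres_obj S n) (simple_L C)"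
proof (rule lin_homI)
 let ?Q = "cres_obj S n :: (('p, 'k) lam, ('p, 'k) cub) module"
 note D = coordinateD[OF l] and i = coordinate_inv[OF l]
 interpret Q: left_module "Lambda :: ('p, 'k) lam ring" ?Q by (rule left_module_cres)
 fix q assume q: "q \<in> carrier ?Q"
 show "hmap S C l n x q \<in> carrier (simple_L C)" using q D(6) unfolding hmap_def by simp
 {
  fix q' assume q': "q' \<in> carrier ?Q"
  have "pairing S C x (q \<oplus>\<^bsub>?Q\<^esub> q') = pairing S C x q + pairing S C x q'"
   unfolding pairing_def cres_simps by (simp add: distrib_left sum.distrib)
  then show "hmap S C l n x (q \<oplus>\<^bsub>?Q\<^esub> q') = hmap S C l n x q \<oplus>\<^bsub>simple_L C\<^esub> hmap S C l n x q'"
   using q q' Q.M.a_closed[OF q q'] i(1) unfolding hmap_def by simp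
 }
 fix r assume r: "r \<in> carrier (Lambda :: ('p, 'k) lam ring)"
 show "hmap S C l n x (r \<odot>\<^bsub>?Q\<^esub> q) = r \<odot>\<^bsub>simple_L C\<^esub> hmap S C l n x q"
  using q Q.smult_closed[OF r q] i(2)[OF r] pairing_smult[OF S C r q] unfolding hmap_def by simp
qed (simp add: hmap_def)

text \<open>The values on the generators \<open>cgen S F\<close> with \<open>F \<in> phi S C\<close>
  are coordinates on both sides, so the map is bijective in every degree. That it commutes with the
  differentials is \<open>pairing_bdiff\<close>.\<close>

lemma qiso_phi_hom:
 fixes S C :: "'p::{finite,order} set" and l l' :: "('p, 'k::field) lam set => 'k"
 assumes S: "S \<in> intervals" and C: "C \<in> intervals" and l: "coordinate Lambda (char_at S) (simple_L S) l"
  and l': "coordinate Lambda (char_at C) (simple_L C) l'"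
  and A: "cochain_complex (cube_cochain erank (phi S C) :: ('k, ('p + 'p) set => 'k) cochain)"
 shows "EX f. qiso (cube_cochain erank (phi S C) :: ('k, ('p + 'p) set => 'k) cochain)
  (hom_cochain Lambda_scalar Lambda (cres S l) (simple_L C)) f"
proof -
 let ?A = "cube_cochain erank (phi S C) :: ('k, ('p + 'p) set => 'k) cochain"
 let ?H = "hom_cochain Lambda_scalar (Lambda :: ('p, 'k) lam ring) (cres S l) (simple_L C)"
 let ?Q = "%n. cres_obj S n :: (('p, 'k) lam, ('p, 'k) cub) module"
 let ?i = "inv_into (carrier (simple_L C)) l'" and ?h = "hmap S C l'"
 note D = coordinateD[OF l'] and i = coordinate_inv[OF l']
 have H: "cochain_complex ?H"
  by (rule cochain_complex_hom_cochain[OF central_Lambda_scalar projective_resolution_cres[OF S l] D(1)])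
 have res: "res_obj (cres S l) = ?Q" "res_diff (cres S l) n = (\<lambda>q\<in>carrier (?Q (Suc n)). %F R. bdiff S (%G. q G R) F)" for n
  unfolding cres_def by simp_all
 have hm: "?h n x \<in> lin_hom Lambda (res_obj (cres S l) n) (simple_L C)" for n x
  unfolding res by (rule hmap_lin_hom[OF S C l'])
 define J where "J = (%p. \<lambda>x\<in>carrier (obj ?A p). if 0 \<le> p then ?h (nat p) x else \<zero>\<^bsub>obj ?H p\<^esub>)"
 have Jn: "J (int n) x = ?h n x" if "x \<in> carrier (obj ?A (int n))" for n x using that unfolding J_def by (simp del: obj_cube_cochain)
 have Jz: "J p x = \<zero>\<^bsub>obj ?H p\<^esub>" if "x \<in> carrier (obj ?A p)" "p < 0" for p x
  using that unfolding J_def by (simp del: obj_cube_cochain)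
 have Az: "x = \<zero>\<^bsub>obj ?A p\<^esub>" if "x \<in> carrier (obj ?A p)" "p < 0" for p x using that by (auto simp: fun_eq_iff)
 have Jm: "J p \<in> lin_hom kk (obj ?A p) (obj ?H p)" for p
 proof -
  interpret A: left_module kk "obj ?A p" by (rule cochain_complexD[OF A])
  interpret H: left_module kk "obj ?H p" by (rule cochain_complexD[OF H])
  have ext: "x \<notin> carrier (obj ?A p) ==> J p x = undefined" for x unfolding J_def by (simp del: obj_cube_cochain)
  show ?thesis
  proof (cases rule: int_cases_nonneg[of p])
   case 1
   note z = Jz[OF _ 1]
   show ?thesis
    by (rule lin_homI) (simp_all add: z A.smult_closed H.smult_zero_right ext del: obj_cube_cochain)
  next
   case (2 n)
   show ?thesis
   proof (rule lin_homI[OF _ ext])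
    fix x assume x: "x \<in> carrier (obj ?A p)"
    then show "J p x \<in> carrier (obj ?H p)" using Jn hm unfolding 2 by (simp del: obj_cube_cochain)
    {
     fix y assume y: "y \<in> carrier (obj ?A p)"
     have "pairing S C (%F. x F + y F) q = pairing S C x q + pairing S C y q" for q
      unfolding pairing_def by (simp add: distrib_right sum.distrib)
     then have "?h n (%F. x F + y F) = (\<lambda>q\<in>carrier (?Q n). ?h n x q \<oplus>\<^bsub>simple_L C\<^esub> ?h n y q)"
      unfolding hmap_def using i(1) by (auto simp: fun_eq_iff)
     then show "J p (x \<oplus>\<^bsub>obj ?A p\<^esub> y) = J p x \<oplus>\<^bsub>obj ?H p\<^esub> J p y"
      using Jn x y A.M.a_closed[OF x y] unfolding 2 by (simp add: add_hom_space res del: obj_cube_cochain(1))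
    }
    fix r assume r: "r \<in> carrier (kk :: 'k ring)"
    have cs: "char_at C (Lambda_scalar r :: ('p, 'k) lam) = r" unfolding char_at_def ent_diag using C point_in[OF C] by simp
    have "pairing S C (%F. r * x F) q = char_at C (Lambda_scalar r :: ('p, 'k) lam) * pairing S C x q" for q
     unfolding cs pairing_def by (simp add: sum_distrib_left mult_ac)
    then have "?h n (%F. r * x F) = (\<lambda>q\<in>carrier (?Q n). Lambda_scalar r \<odot>\<^bsub>simple_L C\<^esub> ?h n x q)"
     unfolding hmap_def using i(2)[OF ent_diag(3)] by (auto simp: fun_eq_iff)
    then show "J p (r \<odot>\<^bsub>obj ?A p\<^esub> x) = r \<odot>\<^bsub>obj ?H p\<^esub> J p x"
     using Jn x A.smult_closed[OF r x] unfolding 2 by (simp add: smult_hom_space res del: obj_cube_cochain(1))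
   qed
  qed
 qed
 have "chain_map ?A ?H J"
  unfolding chain_map_def
 proof (intro allI conjI Jm ballI)
  fix p x assume x: "x \<in> carrier (obj ?A p)"
  note lm = cochain_complexD(1)[OF A] cochain_complexD(1)[OF H]
  show "J (p + 1) (diff ?A p x) = diff ?H p (J p x)"
  proof (cases rule: int_cases_nonneg[of p])
   case 1
   show ?thesis unfolding Az[OF x 1] lin_hom_zero[OF cochain_complexD(2)[OF A] lm(1,1)]
     lin_hom_zero[OF Jm lm] lin_hom_zero[OF cochain_complexD(2)[OF H] lm(2,2)] ..
  next
   case (2 n)
   have e: "int n + 1 = int (Suc n)" by simp
   have dx: "diff ?A (int n) x \<in> carrier (obj ?A (int (Suc n)))"
    using lin_homD(1)[OF cochain_complexD(2)[OF A] x] unfolding 2 e .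
   have "?h (Suc n) (%F. if F \<in> phi S C then cdiff erank x F else 0) =
     compose (carrier (?Q (Suc n))) (?h n x) (\<lambda>q\<in>carrier (?Q (Suc n)). %F R. bdiff S (%G. q G R) F)"
   proof
    fix q
    show "?h (Suc n) (%F. if F \<in> phi S C then cdiff erank x F else 0) q =
      compose (carrier (?Q (Suc n))) (?h n x) (\<lambda>q\<in>carrier (?Q (Suc n)). %F R. bdiff S (%G. q G R) F) q"
    proof (cases "q \<in> carrier (?Q (Suc n))")
     case True
     have "pairing S C x (%F R. bdiff S (%G. q G R) F) = pairing S C (%F. if F \<in> phi S C then cdiff erank x F else 0) q"
      by (rule pairing_bdiff[OF S C True]) (use x in auto)
     then show ?thesis using True cdiff_carrier[OF S True] unfolding hmap_def compose_def by simp
    qed (simp add: hmap_def compose_def)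
   qed
   moreover have "J (int (Suc n)) (diff ?A (int n) x) = ?h (Suc n) (%F. if F \<in> phi S C then cdiff erank x F else 0)"
    using Jn[OF dx] unfolding diff_cube_cochain(1)[OF x[unfolded 2]] .
   ultimately show ?thesis unfolding 2 e Jn[OF x[unfolded 2]] diff_hom_cochain_nonneg[OF hm] res by (rule trans[rotated])
  qed
 qed
 moreover have "bij_betw (J p) (carrier (obj ?A p)) (carrier (obj ?H p))" for p
 proof (cases rule: int_cases_nonneg[of p])
  case 1
  interpret A: left_module kk "obj ?A p" by (rule cochain_complexD[OF A])
  have c: "carrier (obj ?A p) = {\<zero>\<^bsub>obj ?A p\<^esub>}" using Az[OF _ 1] A.M.zero_closed by blast
  show ?thesis unfolding c zero_obj_hom_cochain_neg[OF 1] bij_betw_def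
   using lin_hom_zero[OF Jm cochain_complexD(1)[OF A] cochain_complexD(1)[OF H]] by simp
 next
  case (2 n)
  have gen: "cgen S F \<in> carrier (?Q n)" if "F \<in> phi S C" "card F = n" for F
   using cgen_carrier[OF S, of F] phi_components[OF S C] that by blast
  have at: "l' (?h n x (cgen S F)) = x F" if "F \<in> phi S C" "card F = n" for F and x :: "('p + 'p) set => 'k"
   using gen[OF that] that D(7) unfolding hmap_def by (simp add: pairing_cgen[OF S C])
  show ?thesis
   unfolding bij_betw_def
  proof
   show "inj_on (J p) (carrier (obj ?A p))"
   proof (rule inj_onI)
    fix x y assume x: "x \<in> carrier (obj ?A p)" and y: "y \<in> carrier (obj ?A p)" and "J p x = J p y"
    then have h: "?h n x = ?h n y" using Jn unfolding 2 by simp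
    show "x = y"
    proof
     fix F
     show "x F = y F"
     proof (cases "F \<in> phi S C & card F = n")
      case True
      then have F: "F \<in> phi S C" "card F = n" by auto
      then show ?thesis using at[OF F, of x] at[OF F, of y] h by simp
     next
      case False
      then have "x F = 0" "y F = 0" using x y unfolding 2 by auto
      then show ?thesis by simp
     qed
    qed
   qed
   show "J p ` carrier (obj ?A p) = carrier (obj ?H p)"
   proof
    show "J p ` carrier (obj ?A p) \<subseteq> carrier (obj ?H p)" using lin_homD(1)[OF Jm] by blast
    show "carrier (obj ?H p) \<subseteq> J p ` carrier (obj ?A p)"
    proof
     fix g assume "g \<in> carrier (obj ?H p)"
     then have g: "g \<in> lin_hom Lambda (?Q n) (simple_L C)" unfolding 2 by (simp add: res)
     \<comment> \<open>The values of \<open>g\<close> on the generators; by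
       \<open>cres_hom_eqI\<close> they determine \<open>g\<close>.\<close>
     define x where "x = (%F. if F \<in> phi S C & card F = n then l' (g (cgen S F)) else 0)"
     have x: "x \<in> carrier (obj ?A p)" unfolding 2 x_def by auto
     have "?h n x = g"
     proof (rule cres_hom_eqI[OF S C l' hmap_lin_hom[OF S C l'] g])
      fix F assume F: "F \<in> phi S C" "card F = n"
      show "l' (?h n x (cgen S F)) = l' (g (cgen S F))" unfolding at[OF F] using F by (simp add: x_def)
     qed
     then show "g \<in> J p ` carrier (obj ?A p)" using Jn x unfolding 2 by (metis imageI)
    qed
   qed
  qed
 qed
 ultimately show ?thesis using qisoI_bij[OF A H] by blast
qed

section \<open>Presentations of one-dimensional spaces\<close>

text \<open>A basis of \<open>N\<close> stays independent when \<open>f\<close> is added to it, so a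
  linear functional may be prescribed to be 1 at \<open>f\<close> and 0 on the basis.\<close>

lemma separating_functional:
 fixes N :: "('w => 'k::field) set"
 assumes "(%w. 0) \<in> N" "!!f g. f \<in> N ==> g \<in> N ==> (%w. f w + g w) \<in> N" "!!a f. f \<in> N ==> (%w. a * f w) \<in> N" and f: "f \<notin> N"
 shows "\<exists>\<theta>. (ALL g h. \<theta> (%w. g w + h w) = \<theta> g + \<theta> h) & (ALL a g. \<theta> (%w. a * g w) = a * \<theta> g) & (\<forall>g\<in>N. \<theta> g = 0) & \<theta> f = (1 :: 'k)"
proof -
 let ?s = "%(a :: 'k) (f :: 'w => 'k) w. a * f w"
 interpret V: vector_space_pair ?s "(*) :: 'k => 'k => 'k"
  by unfold_locales (auto simp: fun_eq_iff algebra_simps)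
 have N: "V.vs1.subspace N"
  by (rule V.vs1.subspaceI) (use assms(1-3) in \<open>auto simp: zero_fun_def plus_fun_def\<close>)
 obtain B where B: "B \<subseteq> N" "V.vs1.independent B" "N \<subseteq> V.vs1.span B" by (rule V.vs1.maximal_independent_subset)
 have "V.vs1.span B \<subseteq> N" by (rule V.vs1.span_minimal[OF B(1) N])
 then have "V.vs1.independent (insert f B)" using V.vs1.independent_insertI[OF _ B(2)] f by blast
 then obtain \<theta> where \<theta>: "Vector_Spaces.linear ?s (*) \<theta>" and v: "\<forall>x\<in>insert f B. \<theta> x = (if x = f then 1 else 0)"
  using V.linear_independent_extend[of "insert f B" "%x. if x = f then 1 else 0"] by blast
 have "\<theta> g = 0" if "g \<in> N" for g
  by (rule V.linear_eq_0_on_span[OF \<theta>, of B]) (use v f B that in auto)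
 moreover have "\<theta> (%w. g w + h w) = \<theta> g + \<theta> h" for g h
  using V.linear_add[OF \<theta>, of g h] by (simp add: plus_fun_def)
 ultimately show ?thesis using V.linear_scale[OF \<theta>] v by auto
qed

definition extend_lin :: "('w => 'k::field) => ('w => 'k) => 'k" where
 "extend_lin t f = (\<Sum>w | f w ~= 0. f w * t w)"

lemma extend_lin_eq:
 assumes "finite B" "!!w. f w ~= 0 ==> w \<in> B" shows "extend_lin t f = (\<Sum>w\<in>B. f w * t w)"
 unfolding extend_lin_def by (rule sum.mono_neutral_left) (use assms in auto)

lemma finite_support:
 "finite {w. basis_vec x w ~= (0 :: 'k::field)}"
 "finite {w. f w ~= 0} ==> finite {w. a * f w ~= (0 :: 'k)}"
 "finite {w. f w ~= 0} ==> finite {w. g w ~= 0} ==> finite {w. f w + g w ~= (0 :: 'k)}"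
 "finite {w. f w ~= 0} ==> finite {w. g w ~= 0} ==> finite {w. f w - g w ~= (0 :: 'k)}"
proof -
 show "finite {w. basis_vec x w ~= (0 :: 'k)}" by (rule finite_subset[of _ "{x}"]) (auto simp: basis_vec_def)
 show "finite {w. f w ~= 0} ==> finite {w. a * f w ~= (0 :: 'k)}" by (rule finite_subset[of _ "{w. f w ~= 0}"]) auto
 assume "finite {w. f w ~= 0}" "finite {w. g w ~= 0}"
 then have "finite ({w. f w ~= 0} \<union> {w. g w ~= 0})" by simp
 then show "finite {w. f w + g w ~= 0}" "finite {w. f w - g w ~= 0}" by (rule finite_subset[rotated], force)+
qed

lemma extend_lin_linear:
 fixes f g :: "'w => 'k::field"
 shows "extend_lin t (basis_vec x) = t x"
  and "finite {w. f w ~= 0} ==> extend_lin t (%w. a * f w) = a * extend_lin t f"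
  and "finite {w. f w ~= 0} ==> finite {w. g w ~= 0} ==> extend_lin t (%w. f w + g w) = extend_lin t f + extend_lin t g"
  and "finite {w. f w ~= 0} ==> finite {w. g w ~= 0} ==> extend_lin t (%w. f w - g w) = extend_lin t f - extend_lin t g"
proof -
 have "extend_lin t (basis_vec x) = (\<Sum>w\<in>{x}. basis_vec x w * t w)"
  by (rule extend_lin_eq) (auto simp: basis_vec_def split: if_splits)
 then show "extend_lin t (basis_vec x) = t x" by (simp add: basis_vec_def)
 show "finite {w. f w ~= 0} ==> extend_lin t (%w. a * f w) = a * extend_lin t f"
  by (subst extend_lin_eq[of "{w. f w ~= 0}"]) (auto simp: extend_lin_def sum_distrib_left mult.assoc)
 assume "finite {w. f w ~= 0}" "finite {w. g w ~= 0}"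
 then have B: "finite ({w. f w ~= 0} \<union> {w. g w ~= 0})" by simp
 note e = extend_lin_eq[OF B, of _ t]
 show "extend_lin t (%w. f w + g w) = extend_lin t f + extend_lin t g" "extend_lin t (%w. f w - g w) = extend_lin t f - extend_lin t g"
  by (subst (1 2 3) e; auto simp: algebra_simps sum.distrib sum_subtractf)+
qed

lemma free_space_simps [simp]:
 "f \<in> carrier (free_space Y) \<longleftrightarrow> finite {x. f x ~= 0} & (ALL x. x \<notin> Y --> f x = 0)"
 "\<zero>\<^bsub>free_space Y\<^esub> = (%_. 0)" "f \<oplus>\<^bsub>free_space Y\<^esub> g = (%x. f x + g x)" "a \<odot>\<^bsub>free_space Y\<^esub> f = (%x. a * f x)"
 unfolding free_space_def by auto

lemma left_module_free_space: "left_module (kk :: 'k::field ring) (free_space Y)"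
proof (intro left_module.intro ring_kk abelian_groupI left_module_axioms.intro)
 let ?F = "free_space Y :: ('k, _) module"
 fix f assume f: "f \<in> carrier ?F"
 show "\<exists>g\<in>carrier ?F. g \<oplus>\<^bsub>?F\<^esub> f = \<zero>\<^bsub>?F\<^esub>" by (rule bexI[of _ "%x. - f x"]) (use f in auto)
qed (auto simp: finite_support algebra_simps)

text \<open>A space presented by generators and relations is one-dimensional as soon as all functionals that
 respect the relations are multiples of a single one; over a field this is enough, because functionals
 separate vectors from subspaces.\<close>

lemma presentation_coordinate:
 fixes D :: "'w => 'k::field"
 assumes Rel: "Rel \<subseteq> carrier (free_space Y)" and D: "!!f. f \<in> Rel ==> extend_lin D f = 0" and w0: "w0 \<in> Y" "D w0 = 1"
  and uniq: "!!t. (!!f. f \<in> Rel ==> extend_lin t f = 0) ==> EX c. \<forall>w\<in>Y. t w = c * D w"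
 defines "N \<equiv> generated_submodule kk (free_space Y) Rel"
 shows "EX l. coordinate kk (%r. r) (quotient_module (free_space Y) N) l & (\<forall>w\<in>Y. l (N +>\<^bsub>free_space Y\<^esub> basis_vec w) = D w)"
proof -
 let ?F = "free_space Y :: ('k, 'w => 'k) module"
 interpret F: left_module kk ?F by (rule left_module_free_space)
 note gN = generated_submodule[OF left_module_free_space Rel, folded N_def]
 note Nd = F.submoduleD[OF gN(1)]
 have bc: "basis_vec w \<in> carrier ?F" if "w \<in> Y" for w using that finite_support(1) by (auto simp: basis_vec_def)
 have "submodule {f \<in> carrier ?F. extend_lin D f = 0} kk ?F"
  by (rule F.submoduleI) (auto simp: extend_lin_linear finite_support extend_lin_def[of _ "%_. 0"])
 then have NK: "N \<subseteq> {f \<in> carrier ?F. extend_lin D f = 0}" by (rule gN(3)) (use Rel D in auto)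
 \<comment> \<open>If \<open>f\<close> were outside the span of the relations, some functional would
   kill all relations and take the value 1 at \<open>f\<close>. On generators it is a multiple of
   \<open>D\<close> by \<open>uniq\<close>, so it vanishes at \<open>f\<close>, a
   contradiction.\<close>
 have KN: "f \<in> N" if f: "f \<in> carrier ?F" and z: "extend_lin D f = 0" for f
 proof (rule ccontr)
  assume "f \<notin> N"
  then have "\<exists>\<theta>. (ALL g h. \<theta> (%w. g w + h w) = \<theta> g + \<theta> h) & (ALL a g. \<theta> (%w. a * g w) = a * \<theta> g) & (\<forall>g\<in>N. \<theta> g = 0) & \<theta> f = (1 :: 'k)"
   by (intro separating_functional) (use Nd in auto)
  then obtain \<theta> where \<theta>: "!!g h. \<theta> (%w. g w + h w) = \<theta> g + \<theta> h" "!!a g. \<theta> (%w. a * g w) = a * \<theta> g"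
   "!!g. g \<in> N ==> \<theta> g = 0" "\<theta> f = 1" by blast
  define t where "t w = \<theta> (basis_vec w)" for w
  have z0: "\<theta> (%w. 0) = 0" using \<theta>(2)[of 0 "%w. 0"] by simp
  have "\<theta> (%w. if w \<in> A then g w else 0) = (\<Sum>w\<in>A. g w * t w)" if "finite A" for A g
   using that
  proof (induction A)
   case (insert a A)
   have "(%w. if w \<in> insert a A then g w else 0) = (%w. g a * basis_vec a w + (if w \<in> A then g w else 0))"
    using insert.hyps by (auto simp: basis_vec_def)
   then show ?case using insert \<theta>(1)[of "%w. g a * basis_vec a w"] \<theta>(2)[of "g a" "basis_vec a"] by (simp add: t_def)
  qed (simp add: z0)
  note this[of "{w. g w ~= 0}" g for g]
  moreover have "(%w. if w \<in> {w. g w ~= 0} then g w else 0) = g" for g :: "'w => 'k" by auto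
  ultimately have ex: "\<theta> g = extend_lin t g" if "g \<in> carrier ?F" for g using that by (simp add: extend_lin_def)
  obtain c where c: "!!w. w \<in> Y ==> t w = c * D w"
   using uniq[of t] ex \<theta>(3) gN(2) Rel by (metis subsetD)
  have "extend_lin t f = c * extend_lin D f" unfolding extend_lin_def sum_distrib_left
   by (rule sum.cong) (use c f in auto)
  then show False using z ex[OF f] \<theta>(4) by simp
 qed
 have "EX l. coordinate kk (%r. r) (quotient_module ?F N) l & (\<forall>f\<in>carrier ?F. l (N +>\<^bsub>?F\<^esub> f) = extend_lin D f)"
 proof (rule quotient_coordinate[OF left_module_free_space gN(1)])
  have "c \<in> extend_lin D ` carrier ?F" for c
   by (rule image_eqI[of _ _ "%w. c * basis_vec w0 w"])
    (use bc[OF w0(1)] w0(2) finite_support(1,2) in \<open>auto simp: extend_lin_linear\<close>)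
  then show "extend_lin D ` carrier ?F = UNIV" by blast
  show "extend_lin D f = 0 \<longleftrightarrow> f \<in> N" if "f \<in> carrier ?F" for f using NK KN[OF that] by blast
 qed (auto simp: extend_lin_linear)
 then show ?thesis using bc extend_lin_linear(1) by metis
qed

section \<open>Exterior powers\<close>

text \<open>Determinants by Laplace expansion along the first vector, with respect to the order of \<open>A\<close> given by \<open>vrank\<close>.\<close>

primrec laplace :: "('p::finite => 'k::field) list => 'p set => 'k" where
 "laplace [] A = 1"
| "laplace (x # xs) A = (\<Sum>a\<in>A. esign vrank a (A - {a}) * x a * laplace xs (A - {a}))"

lemma laplace_add: "laplace (us @ (%z. x z + y z) # vs) A = laplace (us @ x # vs) A + laplace (us @ y # vs) A"
 by (induction us arbitrary: A) (simp_all add: algebra_simps sum.distrib)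

lemma laplace_scale: "laplace (us @ (%z. c * x z) # vs) A = c * laplace (us @ x # vs) A"
 by (induction us arbitrary: A) (simp_all add: algebra_simps sum_distrib_left)

lemma laplace_adjacent:
 fixes x :: "'p::finite => 'k::field" shows "laplace (us @ x # x # vs) A = 0"
proof (induction us arbitrary: A)
 case Nil
 let ?a = "%a b. esign vrank a (A - {a}) * x a * (esign vrank b (A - {a} - {b}) * x b * laplace vs (A - {a} - {b}))"
 have "laplace (x # x # vs) A = (\<Sum>a\<in>A. \<Sum>b\<in>A - {a}. ?a a b)" by (simp add: sum_distrib_left)
 also have "\<dots> = 0"
 proof (rule antisymmetric_sum)
  fix a b assume ab: "a \<in> A" "b \<in> A" "a ~= b"
  let ?G = "A - {a} - {b}"
  have G: "A - {a} = insert b ?G" "A - {b} = insert a ?G" "A - {b} - {a} = ?G" "a \<notin> ?G" "b \<notin> ?G" using ab by auto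
  have "esign vrank a (A - {a}) * esign vrank b ?G = - (esign vrank b (A - {b}) * esign vrank a ?G :: 'k)"
   using esign_swap[OF inj_vrank ab(3) G(4,5), where 'k = 'k] unfolding G(1)[symmetric] G(2)[symmetric] by (simp add: mult.commute)
  then have "esign vrank a (A - {a}) * esign vrank b ?G * (x a * x b * laplace vs ?G) =
    - (esign vrank b (A - {b}) * esign vrank a ?G * (x a * x b * laplace vs ?G))" by simp
  then show "?a a b = - ?a b a" unfolding G(3) by (simp add: mult_ac)
 qed simp
 finally show ?case by simp
qed simp

text \<open>Polarisation: expand the vanishing value at the repeated vector \<open>?s\<close> by
  additivity in both places.\<close>

lemma laplace_swap: "laplace (us @ x # y # vs) A = - laplace (us @ y # x # vs) A"
proof -
 let ?s = "%z. x z + y z"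
 have "laplace (us @ ?s # ?s # vs) A = laplace (us @ x # ?s # vs) A + laplace (us @ y # ?s # vs) A" by (rule laplace_add)
 then show ?thesis
  using laplace_add[of "us @ [x]" x y vs A] laplace_add[of "us @ [y]" x y vs A]
   laplace_adjacent[of us ?s vs A] laplace_adjacent[of us x vs A] laplace_adjacent[of us y vs A] by (simp add: eq_neg_iff_add_eq_0)
qed

text \<open>Swaps bring two equal vectors next to each other, and for adjacent equal vectors the
  vanishing is read off from the expansion. Antisymmetry alone would not give it in characteristic
  2.\<close>

lemma laplace_not_distinct:
 assumes "\<not> distinct xs" shows "laplace xs A = 0"
proof -
 have "laplace (us @ x # ys @ x # vs) A = 0" for us x ys vs
 proof (induction ys arbitrary: us)
  case (Cons y ys)
  then show ?case using laplace_swap[of us x y "ys @ x # vs" A] Cons[of "us @ [y]"] by simp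
 qed (simp add: laplace_adjacent)
 then show ?thesis using not_distinct_decomp[OF assms] by force
qed

lemma laplace_restrict: "a \<notin> A ==> laplace (map (%x z. if z = a then 0 else x z) xs) A = laplace xs A"
proof (induction xs arbitrary: A)
 case (Cons x xs)
 have "(\<Sum>b\<in>A. esign vrank b (A - {b}) * (if b = a then 0 else x b) * laplace (map (%x z. if z = a then 0 else x z) xs) (A - {b})) =
   (\<Sum>b\<in>A. esign vrank b (A - {b}) * x b * laplace xs (A - {b}))"
  by (rule sum.cong[OF refl]) (use Cons in auto)
 then show ?case by simp
qed simp

lemma laplace_basis_vec: "a \<in> A ==> laplace (basis_vec a # xs) A = esign vrank a (A - {a}) * laplace xs (A - {a})"
proof -
 assume a: "a \<in> A"
 have "laplace (basis_vec a # xs) A = (\<Sum>b\<in>A. if b = a then esign vrank a (A - {a}) * laplace xs (A - {a}) else 0)"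
  unfolding laplace.simps by (rule sum.cong) (auto simp: basis_vec_def)
 then show ?thesis using a by simp
qed

lemma words_free_space:
 fixes A :: "'p::finite set"
 shows "(xs :: ('p => 'k::field) list) \<in> words n (free_space A) \<longleftrightarrow> length xs = n & (\<forall>x\<in>set xs. ALL z. z \<notin> A --> x z = 0)"
 unfolding words_def by (auto simp: subset_iff)

text \<open>The leading basis vector is scaled by its own sign, so that the expansion along it
  returns the determinant of the minor unchanged.\<close>

lemma laplace_one:
 fixes A :: "'p::finite set"
 shows "EX xs :: ('p => 'k::field) list. xs \<in> words (card A) (free_space A) & laplace xs A = 1"
proof (induction "card A" arbitrary: A)
 case 0
 then show ?case by (intro exI[of _ "[]"]) (simp add: words_free_space)
next
 case (Suc n)
 then obtain a where a: "a \<in> A" by fastforce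
 then have n: "n = card (A - {a})" using Suc.hyps(2) by simp
 from Suc.hyps(1)[OF this] obtain xs :: "('p => 'k) list" where xs: "xs \<in> words n (free_space (A - {a}))" "laplace xs (A - {a}) = 1"
  unfolding n by blast
 let ?x = "%z. esign vrank a (A - {a}) * basis_vec a z :: 'k"
 have "laplace (?x # xs) A = 1" using xs(2) by (simp add: laplace_scale[of "[]", simplified append_Nil] laplace_basis_vec[OF a] del: laplace.simps)
 moreover have "?x # xs \<in> words (card A) (free_space A)"
  using xs(1) a Suc.hyps(2) by (auto simp: words_free_space basis_vec_def)
 ultimately show ?case by blast
qed

text \<open>The values of an alternating form are expanded along the first vector, as for \<open>laplace\<close>;
 antisymmetry in the first two arguments makes the constants of the minors agree.\<close>

lemma alternating_unique:
 fixes A :: "'p::finite set" and t :: "('p => 'k::field) list => 'k"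
 assumes "!!us x y vs. us @ x # vs \<in> words (card A) (free_space A) ==> y \<in> carrier (free_space A) ==>
   t (us @ (%z. x z + y z) # vs) = t (us @ x # vs) + t (us @ y # vs)"
  and "!!us a x vs. us @ x # vs \<in> words (card A) (free_space A) ==> t (us @ (%z. a * x z) # vs) = a * t (us @ x # vs)"
  and "!!xs. xs \<in> words (card A) (free_space A) ==> \<not> distinct xs ==> t xs = 0"
 shows "EX c. \<forall>xs\<in>words (card A) (free_space A). t xs = c * laplace xs A"
 using assms
proof (induction "card A" arbitrary: A t)
 case 0
 then show ?case by (intro exI[of _ "t []"]) (auto simp: words_free_space)
next
 case (Suc n)
 let ?W = "words (Suc n) (free_space A) :: ('p => 'k) list set"
 let ?s = "%a. esign vrank a (A - {a}) :: 'k"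
 note add = Suc.prems(1)[folded Suc.hyps(2)] and scale = Suc.prems(2)[folded Suc.hyps(2)] and alt = Suc.prems(3)[folded Suc.hyps(2)]
 have cn: "n = card (A - {a})" if "a \<in> A" for a using Suc.hyps(2) that by simp
 have W: "xs \<in> ?W \<longleftrightarrow> length xs = Suc n & (\<forall>x\<in>set xs. ALL z. z \<notin> A --> x z = 0)" for xs by (rule words_free_space)
 \<comment> \<open>Fixing the first vector leaves an alternating form in the other coordinates, so
   the induction hypothesis provides one constant for every \<open>a\<close>.\<close>
 have "EX c. \<forall>xs\<in>words n (free_space (A - {a})). t (basis_vec a # xs) = c * laplace xs (A - {a})" if a: "a \<in> A" for a
 proof -
  have sub: "basis_vec a # xs \<in> ?W" if "xs \<in> words n (free_space (A - {a}))" for xs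
   using that a unfolding W words_free_space basis_vec_def by auto
  show ?thesis unfolding cn[OF a]
  proof (rule Suc.hyps(1)[OF cn[OF a]]; unfold cn[OF a, symmetric])
   fix us vs and x y :: "'p => 'k" and r :: 'k
   assume xs: "us @ x # vs \<in> words n (free_space (A - {a}))"
   show "t (basis_vec a # us @ (%z. r * x z) # vs) = r * t (basis_vec a # us @ x # vs)"
    using scale[of "basis_vec a # us" x vs r] sub[OF xs] by simp
   assume "y \<in> carrier (free_space (A - {a}))"
   then show "t (basis_vec a # us @ (%z. x z + y z) # vs) = t (basis_vec a # us @ x # vs) + t (basis_vec a # us @ y # vs)"
    using add[of "basis_vec a # us" x vs y] sub[OF xs] by simp
  next
   fix xs :: "('p => 'k) list" assume "xs \<in> words n (free_space (A - {a}))" "\<not> distinct xs"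
   then show "t (basis_vec a # xs) = 0" using alt[of "basis_vec a # xs"] sub by simp
  qed
 qed
 then obtain y where y: "!!a xs. a \<in> A ==> xs \<in> words n (free_space (A - {a})) ==> t (basis_vec a # xs) = y a * laplace xs (A - {a})"
  by metis
 have eq: "?s a * y a = ?s b * y b" if ab: "a \<in> A" "b \<in> A" "a ~= b" for a b
 proof -
  let ?G = "A - {a} - {b}"
  have G: "A - {a} = insert b ?G" "A - {b} = insert a ?G" "A - {b} - {a} = ?G" "a \<notin> ?G" "b \<notin> ?G" using ab by auto
  obtain zs :: "('p => 'k) list" where zs: "zs \<in> words (card ?G) (free_space ?G)" "laplace zs ?G = 1" using laplace_one by blast
  have "Suc (card ?G) = card (A - {a})" by (rule card_Suc_Diff1) (use ab in auto)
  then have n: "n = Suc (card ?G)" unfolding cn[OF ab(1)] by (rule sym)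
  have xw: "x # y # zs \<in> ?W" if "ALL z. z \<notin> A --> x z = 0" "ALL z. z \<notin> A --> y z = 0" for x y
   using zs(1) that unfolding W words_free_space n by auto
  let ?a = "basis_vec a :: 'p => 'k" and ?b = "basis_vec b :: 'p => 'k"
  \<comment> \<open>Polarisation in the first two places exchanges \<open>a\<close> and
    \<open>b\<close>. The remaining vectors \<open>zs\<close> have determinant 1, so this becomes an
    equation between the constants \<open>y a\<close> and \<open>y b\<close>.\<close>
  let ?c = "%z. ?a z + ?b z"
  have v: "ALL z. z \<notin> A --> ?a z = 0" "ALL z. z \<notin> A --> ?b z = 0" "ALL z. z \<notin> A --> ?c z = 0"
   using ab by (auto simp: basis_vec_def)
  have "t (?c # ?c # zs) = 0" "t (?a # ?a # zs) = 0" "t (?b # ?b # zs) = 0" by (rule alt[OF xw], use v in auto)+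
  moreover have "t (?c # ?c # zs) = t (?a # ?c # zs) + t (?b # ?c # zs)" using add[of "[]" ?a "?c # zs" ?b] xw[OF v(1,3)] v(2) by simp
  moreover have "t (?a # ?c # zs) = t (?a # ?a # zs) + t (?a # ?b # zs)" using add[of "[?a]" ?a zs ?b] xw[OF v(1,1)] v(2) by simp
  moreover have "t (?b # ?c # zs) = t (?b # ?a # zs) + t (?b # ?b # zs)" using add[of "[?b]" ?a zs ?b] xw[OF v(2,1)] v(2) by simp
  ultimately have "t (?a # ?b # zs) = - t (?b # ?a # zs)" by (simp add: eq_neg_iff_add_eq_0)
  moreover have "?b # zs \<in> words n (free_space (A - {a}))" "?a # zs \<in> words n (free_space (A - {b}))"
   using zs(1) ab unfolding words_free_space n by (auto simp: basis_vec_def)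
  ultimately have "y a * laplace (?b # zs) (A - {a}) = - (y b * laplace (?a # zs) (A - {b}))"
   using y[OF ab(1)] y[OF ab(2)] by simp
  then have 1: "y a * esign vrank b ?G = - (y b * esign vrank a ?G)"
   using ab zs(2) G(3) laplace_basis_vec[of b "A - {a}" zs] laplace_basis_vec[of a "A - {b}" zs] by simp
  have "esign vrank a ?G * ?s b = - (esign vrank b ?G * ?s a)"
   using esign_swap[OF inj_vrank ab(3) G(4,5), where 'k = 'k] unfolding G(1)[symmetric] G(2)[symmetric] .
  then have 2: "?s b = - (esign vrank a ?G * (esign vrank b ?G * ?s a))"
   using esign_square_left[of vrank a ?G "?s b"] by simp
  have "y a = - (esign vrank b ?G * (y b * esign vrank a ?G))"
   using arg_cong[OF 1, of "%z. esign vrank b ?G * z"] esign_square_left[of vrank b ?G "y a"] by (simp add: mult_ac)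
  then show ?thesis unfolding 2 by (simp add: mult_ac)
 qed
 obtain a0 where a0: "a0 \<in> A" using Suc.hyps(2) by fastforce
 \<comment> \<open>By \<open>eq\<close> the constants agree once the signs of the expansion are
   removed; any \<open>a0\<close> yields the common value.\<close>
 define c where "c = ?s a0 * y a0"
 have c: "y a = ?s a * c" if "a \<in> A" for a
 proof -
  have "c = ?s a * y a" using eq[OF that a0] unfolding c_def by (cases "a = a0") auto
  then show ?thesis by simp
 qed
 have "t xs = c * laplace xs A" if xs: "xs \<in> ?W" for xs
 proof -
  obtain x ws where x: "xs = x # ws" using xs unfolding W by (cases xs) auto
  have ws: "length ws = n" "!!u z. u \<in> set ws ==> z \<notin> A ==> u z = 0" and xA: "!!z. z \<notin> A ==> x z = 0" using xs unfolding W x by auto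
  have cons: "u # ws \<in> ?W" if "!!z. z \<notin> A ==> u z = 0" for u using ws that unfolding W by auto
  have term_a: "t (basis_vec a # ws) = ?s a * c * laplace ws (A - {a})" if a: "a \<in> A" for a
  proof -
   let ?a = "basis_vec a :: 'p => 'k" and ?r = "%(u :: 'p => 'k) z. if z = a then 0 else u z"
   have aA: "z \<notin> A ==> ?a z = 0" for z using a by (auto simp: basis_vec_def)
   \<comment> \<open>Subtracting multiples of the leading vector from later ones does not change an
     alternating form. Their \<open>a\<close>-coordinates may thus be cleared, and the tail becomes
     a word over \<open>A - {a}\<close>.\<close>
   have "t (?a # us @ vs) = t (?a # us @ map ?r vs)" if "?a # us @ vs \<in> ?W" for us vs
    using that
   proof (induction vs arbitrary: us)
    case (Cons u vs)
    have m: "?a # us @ ?r u # vs \<in> ?W" "?a # us @ ?a # vs \<in> ?W" using Cons.prems aA unfolding W by auto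
    have u: "(%z. ?r u z + u a * ?a z) = u" by (auto simp: basis_vec_def)
    have "t (?a # us @ (%z. ?r u z + u a * ?a z) # vs) = t (?a # us @ ?r u # vs) + t (?a # us @ (%z. u a * ?a z) # vs)"
     using add[of "?a # us" "?r u" vs "%z. u a * ?a z"] m(1) aA by simp
    also have "t (?a # us @ (%z. u a * ?a z) # vs) = u a * t (?a # us @ ?a # vs)" using scale[of "?a # us" ?a vs] m(2) by simp
    also have "t (?a # us @ ?a # vs) = 0" by (rule alt[OF m(2)]) simp
    finally show ?case using Cons.IH[of "us @ [?r u]"] m(1) unfolding u by simp
   qed simp
   from this[of "[]" ws] have "t (?a # ws) = t (?a # map ?r ws)" using cons[of ?a] aA by simp
   also have "\<dots> = y a * laplace (map ?r ws) (A - {a})" by (rule y[OF a]) (use ws in \<open>auto simp: words_free_space\<close>)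
   finally show ?thesis using c[OF a] laplace_restrict[of a "A - {a}" ws] by simp
  qed
  have ex: "t ((%z. if z \<in> B then x z else 0) # ws) = (\<Sum>a\<in>B. x a * t (basis_vec a # ws))" if "B \<subseteq> A" for B
   using finite[of B] that
  proof (induction B)
   case empty
   show ?case using scale[of "[]" "%z. 0" ws 0] cons[of "%z. 0"] by simp
  next
   case (insert a B)
   let ?u = "%z. if z \<in> B then x z else 0" and ?a = "basis_vec a :: 'p => 'k"
   have aA: "z \<notin> A ==> ?a z = 0" for z using insert.prems by (auto simp: basis_vec_def)
   have u: "(%z. if z \<in> insert a B then x z else 0) = (%z. x a * ?a z + ?u z)" using insert.hyps by (auto simp: basis_vec_def)
   have "t ((%z. x a * ?a z + ?u z) # ws) = t ((%z. x a * ?a z) # ws) + t (?u # ws)"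
    using add[of "[]" "%z. x a * ?a z" ws ?u] cons[of "%z. x a * ?a z"] aA xA by simp
   also have "t ((%z. x a * ?a z) # ws) = x a * t (?a # ws)" using scale[of "[]" ?a ws] cons[of ?a] aA by simp
   finally show ?case unfolding u using insert by simp
  qed
  have "(%z. if z \<in> A then x z else 0) = x" using xA by auto
  then have "t (x # ws) = (\<Sum>a\<in>A. x a * t (basis_vec a # ws))" using ex[OF order_refl] by simp
  then show ?thesis unfolding x using term_a by (simp add: sum_distrib_left mult_ac)
 qed
 then show ?case unfolding Suc.hyps(2) by blast
qed

lemma ball_Collect_image:
 "(\<forall>u\<in>{F x | x. P x}. Q u) \<longleftrightarrow> (ALL x. P x --> Q (F x))"
 "(\<forall>u\<in>{G x y z | x y z. P' x y z}. Q u) \<longleftrightarrow> (ALL x y z. P' x y z --> Q (G x y z))"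
 "(\<forall>u\<in>{H v x y z | v x y z. P'' v x y z}. Q u) \<longleftrightarrow> (ALL v x y z. P'' v x y z --> Q (H v x y z))"
 by blast+

lemma free_space_closed:
 "x \<in> Y ==> basis_vec x \<in> carrier (free_space Y :: ('k::field, 'w => 'k) module)"
 "(f :: 'w => 'k) \<in> carrier (free_space Y) ==> (%w. a * f w) \<in> carrier (free_space Y)"
 "(f :: 'w => 'k) \<in> carrier (free_space Y) ==> g \<in> carrier (free_space Y) ==> (%w. f w - g w) \<in> carrier (free_space Y)"
 using finite_support(1)[of x, where 'k = 'k] finite_support(2)[of f a] finite_support(4)[of f g] by (auto simp: basis_vec_def)

text \<open>A functional on words respects the relations exactly if it is multilinear and
  alternating. By \<open>alternating_unique\<close> such functionals are the multiples of
  \<open>laplace\<close>, and \<open>presentation_coordinate\<close> turns this into a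
  coordinate.\<close>

lemma ext_power_coordinate:
 fixes A :: "'p::finite set"
 shows "EX l. coordinate (kk :: 'k::field ring) (%r. r) (det_space A) l &
  (\<forall>xs\<in>words (card A) (free_space A). l (wedge_word (card A) (free_space A) xs) = laplace xs A)"
proof -
 let ?V = "free_space A :: ('k, 'p => 'k) module" and ?n = "card A"
 let ?W = "words ?n ?V" and ?b = "basis_vec :: ('p => 'k) list => ('p => 'k) list => 'k"
 obtain w0 where w0: "w0 \<in> ?W" "laplace w0 A = 1" using laplace_one by blast
 have W: "us @ (%z. x z + y z) # vs \<in> ?W" "us @ y # vs \<in> ?W" "us @ (%z. a * x z) # vs \<in> ?W"
  if "us @ x # vs \<in> ?W" "y \<in> carrier ?V" for us x y vs a
  using that by (auto simp: words_free_space)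
 have z: "(%z. 0) \<in> carrier ?V" by simp
 note fin = finite_support
 have rel: "Ball (ext_relations ?n ?V) Q \<longleftrightarrow>
   (ALL us x y vs. us @ x # vs \<in> ?W --> y \<in> carrier ?V --> Q (%w. ?b (us @ (%z. x z + y z) # vs) w - ?b (us @ x # vs) w - ?b (us @ y # vs) w)) &
   (ALL us a x vs. us @ x # vs \<in> ?W --> Q (%w. ?b (us @ (%z. a * x z) # vs) w - a * ?b (us @ x # vs) w)) &
   (ALL xs. xs \<in> ?W --> \<not> distinct xs --> Q (?b xs))" for Q
  unfolding ext_relations_def ball_Un free_space_simps(3,4) ball_Collect_image conj_assoc imp_conjL ..
 have sub: "ext_relations ?n ?V \<subseteq> carrier (free_space ?W)"
  unfolding subset_eq rel
 proof (intro conjI allI impI)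
  fix us vs and x y :: "'p => 'k" and a assume h: "us @ x # vs \<in> ?W"
  show "(%w. ?b (us @ (%z. a * x z) # vs) w - a * ?b (us @ x # vs) w) \<in> carrier (free_space ?W)"
   by (intro free_space_closed W(3)[OF h z] h)
  assume y: "y \<in> carrier ?V"
  show "(%w. ?b (us @ (%z. x z + y z) # vs) w - ?b (us @ x # vs) w - ?b (us @ y # vs) w) \<in> carrier (free_space ?W)"
   by (intro free_space_closed W(1,2)[OF h y] h)
 qed (rule free_space_closed)
 have ext: "(\<forall>f\<in>ext_relations ?n ?V. extend_lin t f = 0) \<longleftrightarrow>
   (ALL us x y vs. us @ x # vs \<in> ?W --> y \<in> carrier ?V --> t (us @ (%z. x z + y z) # vs) - t (us @ x # vs) - t (us @ y # vs) = 0) &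
   (ALL us a x vs. us @ x # vs \<in> ?W --> t (us @ (%z. a * x z) # vs) - a * t (us @ x # vs) = 0) &
   (ALL xs. xs \<in> ?W --> \<not> distinct xs --> t xs = 0)" for t
  unfolding rel by (simp only: extend_lin_linear fin)
 show ?thesis
  unfolding det_space_def ext_power_def wedge_word_def ext_kernel_def
 proof (rule presentation_coordinate[where D = "%xs. laplace xs A" and ?w0.0 = w0, OF sub _ w0])
  have "\<forall>f\<in>ext_relations ?n ?V. extend_lin (%xs. laplace xs A) f = 0"
   unfolding ext by (simp add: laplace_add laplace_scale laplace_not_distinct)
  then show "f \<in> ext_relations ?n ?V ==> extend_lin (%xs. laplace xs A) f = 0" for f by blast
  fix t assume "!!f. f \<in> ext_relations ?n ?V ==> extend_lin t f = 0"
  then have t: "\<forall>f\<in>ext_relations ?n ?V. extend_lin t f = 0" by blast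
  note t1 = t[unfolded ext, THEN conjunct1, rule_format] and t2 = t[unfolded ext, THEN conjunct2, THEN conjunct1, rule_format]
   and t3 = t[unfolded ext, THEN conjunct2, THEN conjunct2, rule_format]
  show "EX c. \<forall>xs\<in>?W. t xs = c * laplace xs A"
  proof (rule alternating_unique)
   show "us @ x # vs \<in> ?W ==> y \<in> carrier ?V ==> t (us @ (%z. x z + y z) # vs) = t (us @ x # vs) + t (us @ y # vs)" for us x y vs
    using t1[of us x vs y] by (simp only: diff_diff_eq right_minus_eq)
   show "us @ x # vs \<in> ?W ==> t (us @ (%z. a * x z) # vs) = a * t (us @ x # vs)" for us a x vs
    using t2[of us x vs a] by simp
  qed (rule t3)
 qed
qed

definition det_coord :: "'p::finite set => ('p, 'k::field) det_elt => 'k" where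
 "det_coord A = (SOME l. coordinate kk (%r. r) (det_space A) l &
  (\<forall>xs\<in>words (card A) (free_space A). l (wedge_word (card A) (free_space A) xs) = laplace xs A))"

lemma det_coord:
 shows "coordinate (kk :: 'k::field ring) (%r. r) (det_space A) (det_coord (A :: 'p::finite set))"
  and "(xs :: ('p => 'k) list) \<in> words (card A) (free_space A) ==> det_coord A (wedge_word (card A) (free_space A) xs) = laplace xs A"
 using someI_ex[OF ext_power_coordinate[of A]] unfolding det_coord_def by blast+

lemma coordinate_lin_hom:
 assumes M: "coordinate kk (%r. r) M l" and N: "coordinate kk (%r. r) N l'"
 shows "EX h. h \<in> lin_hom (kk :: 'k::field ring) M N & (\<forall>x\<in>carrier M. l' (h x) = c * l x)"
proof (intro exI conjI ballI)
 note D = coordinateD[OF M] and D' = coordinateD[OF N]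
 interpret M: left_module kk M by (rule D)
 interpret N: left_module kk N by (rule D')
 let ?h = "\<lambda>x\<in>carrier M. inv_into (carrier N) l' (c * l x)"
 show "?h \<in> lin_hom kk M N"
 proof (rule lin_homI)
  fix x assume x: "x \<in> carrier M"
  show "?h x \<in> carrier N" using x D'(6) by simp
  show "?h (x \<oplus>\<^bsub>M\<^esub> y) = ?h x \<oplus>\<^bsub>N\<^esub> ?h y" if y: "y \<in> carrier M" for y
   using x y M.M.a_closed[OF x y] D(3)[OF x y] coordinate_inv(1)[OF N] by (simp add: distrib_left)
  show "?h (r \<odot>\<^bsub>M\<^esub> x) = r \<odot>\<^bsub>N\<^esub> ?h x" if r: "r \<in> carrier kk" for r
   using x M.smult_closed[OF r x] D(4)[OF r x] coordinate_inv(2)[OF N r, of "c * l x"] by (simp add: mult_ac)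
 qed simp
 show "l' (?h x) = c * l x" if "x \<in> carrier M" for x using that D'(7) by simp
qed

lemma coordinate_lin_hom_eq:
 assumes M: "coordinate kk (%r. r) M l" and f: "f \<in> lin_hom (kk :: 'k::field ring) M N" and g: "g \<in> lin_hom kk M N"
  and x: "x \<in> carrier M" "l x = 1" "f x = g x"
 shows "f = g"
proof (rule lin_hom_eqI[OF f g])
 note D = coordinateD[OF M]
 interpret M: left_module kk M by (rule D)
 fix y assume y: "y \<in> carrier M"
 have "y = l y \<odot>\<^bsub>M\<^esub> x" by (rule D(5)) (use y x D(4)[of "l y" x] M.smult_closed[of "l y" x] in auto)
 then show "f y = g y" using lin_homD(4)[OF f _ x(1), of "l y"] lin_homD(4)[OF g _ x(1), of "l y"] x(3) by simp
qed

text \<open>Laplace expansion along a basis vector has a single term, so in coordinates wedging with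
  \<open>a\<close> is multiplication by a sign. This scaling satisfies the description of
  \<open>det_wedge\<close>; any other candidate agrees with it on a word of determinant 1 and is
  therefore equal to it.\<close>

lemma det_wedge:
 fixes A :: "'p::finite set" and \<alpha> :: "('p, 'k::field) det_elt"
 assumes a: "a \<notin> A" and \<alpha>: "\<alpha> \<in> carrier (det_space A)"
 shows "det_wedge A a \<alpha> \<in> carrier (det_space (insert a A))"
  and "det_coord (insert a A) (det_wedge A a \<alpha>) = esign vrank a A * det_coord A \<alpha>"
proof -
 let ?B = "insert a A" and ?V = "%A. free_space A :: ('k, 'p => 'k) module"
 let ?w = "%A. wedge_word (card A) (?V A)"
 note A = det_coord[where A = A and 'k = 'k] and B = det_coord[where A = ?B and 'k = 'k]
 have wc: "?w A xs \<in> carrier (det_space A)" if "xs \<in> words (card A) (?V A)" for xs and A :: "'p set"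
  unfolding det_space_def ext_power_def quotient_module_def wedge_word_def
  using that finite_support(1)[of xs, where 'k = 'k] by (auto simp: basis_vec_def)
 have ww: "basis_vec a # xs \<in> words (card ?B) (?V ?B)" if "xs \<in> words (card A) (?V A)" for xs
  using that a by (auto simp: words_free_space basis_vec_def)
 obtain h where h: "h \<in> lin_hom kk (det_space A) (det_space ?B)"
  and hl: "!!x. x \<in> carrier (det_space A) ==> det_coord ?B (h x) = (esign vrank a A * det_coord A x :: 'k)"
  using coordinate_lin_hom[OF A(1) B(1), of "esign vrank a A"] by blast
 have hw: "h (?w A xs) = ?w ?B (basis_vec a # xs)" if xs: "xs \<in> words (card A) (?V A)" for xs
 proof (rule coordinateD(5)[OF B(1) lin_homD(1)[OF h wc[OF xs]] wc[OF ww[OF xs]]])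
  have e: "?B - {a} = A" using a by blast
  show "det_coord ?B (h (?w A xs)) = det_coord ?B (?w ?B (basis_vec a # xs))"
   unfolding hl[OF wc[OF xs]] A(2)[OF xs] B(2)[OF ww[OF xs]] laplace_basis_vec[OF insertI1] e ..
 qed
 obtain w0 where w0: "w0 \<in> words (card A) (?V A)" "laplace w0 A = 1" using laplace_one by blast
 have "det_wedge A a = h"
  unfolding det_wedge_def
 proof (rule the_equality)
  fix g assume g: "g \<in> lin_hom kk (det_space A) (det_space ?B) & (\<forall>xs\<in>words (card A) (?V A). g (?w A xs) = ?w ?B (basis_vec a # xs))"
  show "g = h"
   by (rule coordinate_lin_hom_eq[OF A(1) _ h wc[OF w0(1)]]) (use g hw w0 A(2)[OF w0(1)] in auto)
 qed (use h hw in blast)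
 then show "det_wedge A a \<alpha> \<in> carrier (det_space ?B)" "det_coord ?B (det_wedge A a \<alpha>) = esign vrank a A * det_coord A \<alpha>"
  using lin_homD(1)[OF h \<alpha>] hl[OF \<alpha>] by simp_all
qed

section \<open>The complex \<open>K\<close> in coordinates\<close>

text \<open>With \<open>x0\<close> and \<open>y0\<close> of coordinate 1, a functional that respects
  the relations is determined by its value at \<open>(x0, y0)\<close>. So the product of the
  coordinates is the only one up to a scalar.\<close>

lemma tensor_coordinate:
 fixes V :: "('k::field, 'v) module" and W :: "('k, 'w) module"
 assumes V: "coordinate kk (%r. r) V l" and W: "coordinate kk (%r. r) W l'"
 shows "EX m. coordinate kk (%r. r) (tensor_space V W) m & (\<forall>x\<in>carrier V. \<forall>y\<in>carrier W. m (pure_tensor V W x y) = l x * l' y)"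
proof -
 note D = coordinateD[OF V] and D' = coordinateD[OF W]
 interpret V: left_module kk V by (rule D)
 interpret W: left_module kk W by (rule D')
 let ?Y = "carrier V \<times> carrier W" and ?b = "basis_vec :: 'v \<times> 'w => 'v \<times> 'w => 'k"
 let ?D = "%(x, y). l x * l' y"
 define x0 y0 where "x0 = inv_into (carrier V) l 1" and "y0 = inv_into (carrier W) l' 1"
 have x0: "x0 \<in> carrier V" "l x0 = 1" and y0: "y0 \<in> carrier W" "l' y0 = 1"
  unfolding x0_def y0_def using D(6,7) D'(6,7) by auto
 note fin = finite_support
 note cl = V.M.a_closed W.M.a_closed V.smult_closed W.smult_closed
 have rel: "Ball (tensor_relations V W) Q \<longleftrightarrow>
   (ALL x x' y. x \<in> carrier V --> x' \<in> carrier V --> y \<in> carrier W --> Q (%z. ?b (x \<oplus>\<^bsub>V\<^esub> x', y) z - ?b (x, y) z - ?b (x', y) z)) &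
   (ALL x y y'. x \<in> carrier V --> y \<in> carrier W --> y' \<in> carrier W --> Q (%z. ?b (x, y \<oplus>\<^bsub>W\<^esub> y') z - ?b (x, y) z - ?b (x, y') z)) &
   (ALL a x y. x \<in> carrier V --> y \<in> carrier W --> Q (%z. ?b (a \<odot>\<^bsub>V\<^esub> x, y) z - a * ?b (x, y) z)) &
   (ALL a x y. x \<in> carrier V --> y \<in> carrier W --> Q (%z. ?b (x, a \<odot>\<^bsub>W\<^esub> y) z - a * ?b (x, y) z))" for Q
  unfolding tensor_relations_def ball_Un ball_Collect_image conj_assoc imp_conjL ..
 have sub: "tensor_relations V W \<subseteq> carrier (free_space ?Y)"
  unfolding subset_eq rel by (intro conjI allI impI free_space_closed) (auto intro: cl)
 have ext: "(\<forall>f\<in>tensor_relations V W. extend_lin t f = 0) \<longleftrightarrow>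
   (ALL x x' y. x \<in> carrier V --> x' \<in> carrier V --> y \<in> carrier W --> t (x \<oplus>\<^bsub>V\<^esub> x', y) - t (x, y) - t (x', y) = 0) &
   (ALL x y y'. x \<in> carrier V --> y \<in> carrier W --> y' \<in> carrier W --> t (x, y \<oplus>\<^bsub>W\<^esub> y') - t (x, y) - t (x, y') = 0) &
   (ALL a x y. x \<in> carrier V --> y \<in> carrier W --> t (a \<odot>\<^bsub>V\<^esub> x, y) - a * t (x, y) = 0) &
   (ALL a x y. x \<in> carrier V --> y \<in> carrier W --> t (x, a \<odot>\<^bsub>W\<^esub> y) - a * t (x, y) = 0)" for t
  unfolding rel by (simp only: extend_lin_linear fin)
 have "EX m. coordinate kk (%r. r) (quotient_module (free_space ?Y) (tensor_kernel V W)) m &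
   (\<forall>z\<in>?Y. m (tensor_kernel V W +>\<^bsub>free_space ?Y\<^esub> ?b z) = ?D z)"
  unfolding tensor_kernel_def
 proof (rule presentation_coordinate[OF sub])
  have "\<forall>f\<in>tensor_relations V W. extend_lin ?D f = 0"
   unfolding ext using D(3,4) D'(3,4) by (simp add: distrib_left distrib_right mult_ac)
  then show "f \<in> tensor_relations V W ==> extend_lin ?D f = 0" for f by blast
  show "(x0, y0) \<in> ?Y" "?D (x0, y0) = 1" using x0 y0 by auto
  fix t assume "!!f. f \<in> tensor_relations V W ==> extend_lin t f = 0"
  then have "\<forall>f\<in>tensor_relations V W. extend_lin t f = 0" by blast
  then have t: "t (a \<odot>\<^bsub>V\<^esub> x, y) = a * t (x, y)" "t (x, a \<odot>\<^bsub>W\<^esub> y) = a * t (x, y)"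
   if "x \<in> carrier V" "y \<in> carrier W" for a x y unfolding ext using that by auto
  have "t (x, y) = t (x0, y0) * (l x * l' y)" if x: "x \<in> carrier V" and y: "y \<in> carrier W" for x y
  proof -
   have "x = l x \<odot>\<^bsub>V\<^esub> x0" by (rule D(5)) (use x x0 D(4)[of "l x" x0] cl(3) in auto)
   then have "t (x, y) = l x * t (x0, y)" using t(1)[OF x0(1) y] by metis
   moreover have "y = l' y \<odot>\<^bsub>W\<^esub> y0" by (rule D'(5)) (use y y0 D'(4)[of "l' y" y0] cl(4) in auto)
   then have "t (x0, y) = l' y * t (x0, y0)" using t(2)[OF x0(1) y0(1)] by metis
   ultimately show ?thesis by simp
  qed
  then show "EX c. \<forall>z\<in>?Y. t z = c * ?D z" by (intro exI[of _ "t (x0, y0)"]) auto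
 qed
 then show ?thesis unfolding tensor_space_def pure_tensor_def by auto
qed

definition K_coord :: "'p::{finite,order} set => 'p set => 'p set => ('p, 'k::field) Kterm => 'k" where
 "K_coord S C T = (SOME m. coordinate kk (%r. r) (K_summand S C T) m &
  (\<forall>\<alpha>\<in>carrier (det_space (upper_boundary T S)). \<forall>\<beta>\<in>carrier (det_space (lower_boundary T C)).
   m (K_tensor S C T \<alpha> \<beta>) = det_coord (upper_boundary T S) \<alpha> * det_coord (lower_boundary T C) \<beta>))"

lemma K_coord:
 fixes S :: "'p::{finite,order} set"
 shows "coordinate (kk :: 'k::field ring) (%r. r) (K_summand S C T) (K_coord S C T)"
  and "\<alpha> \<in> carrier (det_space (upper_boundary T S)) ==> \<beta> \<in> carrier (det_space (lower_boundary T C)) ==>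
   K_coord S C T (K_tensor S C T \<alpha> \<beta>) = det_coord (upper_boundary T S) \<alpha> * (det_coord (lower_boundary T C) \<beta> :: 'k)"
 using someI_ex[OF tensor_coordinate[OF det_coord(1)[of "upper_boundary T S", where 'k = 'k] det_coord(1)[of "lower_boundary T C"]]]
 unfolding K_coord_def K_summand_def K_tensor_def by blast+

lemma K_tensor_carrier:
 assumes "\<alpha> \<in> carrier (det_space (upper_boundary T S))" "\<beta> \<in> carrier (det_space (lower_boundary T C))"
 shows "(K_tensor S C T \<alpha> \<beta> :: ('p::{finite,order}, 'k::field) Kterm) \<in> carrier (K_summand S C T)"
 using assms finite_support(1)[of "(\<alpha>, \<beta>)", where 'k = 'k]
 unfolding K_tensor_def K_summand_def tensor_space_def pure_tensor_def quotient_module_def by (auto simp: basis_vec_def)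

text \<open>The elements that precede \<open>Inr b\<close> are all of \<open>U\<close> together with
  those of \<open>L\<close> before \<open>b\<close>, which splits the sign into the two factors seen
  in the differential of \<open>K\<close>.\<close>

lemma esign_erank:
 fixes U L :: "'p::finite set"
 shows "esign erank (Inl a) (U <+> L) = (esign vrank a U :: 'k::field)"
  and "esign erank (Inr b) (U <+> L) = ((-1) ^ card U * esign vrank b L :: 'k)"
proof -
 have "{u \<in> U <+> L. erank u < erank (Inl a)} = Inl ` {u \<in> U. vrank u < vrank a}"
  using vrank_less[of a] by (auto simp: erank_def)
 then show "esign erank (Inl a) (U <+> L) = (esign vrank a U :: 'k)" unfolding esign_def by (simp add: card_image)
 have "{u \<in> U <+> L. erank u < erank (Inr b)} = U <+> {u \<in> L. vrank u < vrank b}"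
  using trans_less_add1[OF vrank_less] by (auto simp: erank_def)
 then show "esign erank (Inr b) (U <+> L) = ((-1) ^ card U * esign vrank b L :: 'k)"
  unfolding esign_def by (simp add: card_Plus power_add)
qed

text \<open>In coordinates both clauses of the definition are multiplication by the cube sign of the
  new boundary element \<open>w\<close>. The corresponding multiple of the coordinate gives
  existence. Uniqueness holds because the clause that applies fixes the value at a tensor of
  coordinate 1.\<close>

lemma K_component:
 fixes S C :: "'p::{finite,order} set"
 assumes w: "w \<notin> boundary S C T" and R: "boundary S C R = insert w (boundary S C T)"
 shows "(K_component S C T R :: ('p, 'k::field) Kterm => _) \<in> lin_hom kk (K_summand S C T) (K_summand S C R)"
  and "(x :: ('p, 'k) Kterm) \<in> carrier (K_summand S C T) ==>
   K_coord S C R (K_component S C T R x) = esign erank w (boundary S C T) * K_coord S C T x"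
proof -
 let ?U = "upper_boundary T S" and ?L = "lower_boundary T C" and ?U' = "upper_boundary R S" and ?L' = "lower_boundary R C"
 let ?D = "%A. carrier (det_space A) :: ('p, 'k) det_elt set"
 let ?MT = "K_summand S C T :: ('k, ('p, 'k) Kterm) module" and ?MR = "K_summand S C R :: ('k, ('p, 'k) Kterm) module"
 note T = K_coord[where S = S and C = C and T = T and 'k = 'k] and Rc = K_coord[where S = S and C = C and T = R and 'k = 'k]
 interpret MR: left_module kk ?MR by (rule coordinateD(1)[OF Rc(1)])
 have ul: "?U' = lefts (insert w (boundary S C T))" "?L' = rights (insert w (boundary S C T))"
  unfolding R[symmetric] by (simp_all add: boundary_def)
 obtain h where h: "h \<in> lin_hom kk ?MT ?MR"
  and hl: "!!x. x \<in> carrier ?MT ==> K_coord S C R (h x) = esign erank w (boundary S C T) * K_coord S C T x"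
  using coordinate_lin_hom[OF T(1) Rc(1), of "esign erank w (boundary S C T)"] by blast
 define P where "P g \<longleftrightarrow> (\<forall>\<alpha>\<in>?D ?U. \<forall>\<beta>\<in>?D ?L.
   (ALL a. a \<notin> ?U & ?U' = insert a ?U & ?L' = ?L --> g (K_tensor S C T \<alpha> \<beta>) = K_tensor S C R (det_wedge ?U a \<alpha>) \<beta>) &
   (ALL b. b \<notin> ?L & ?L' = insert b ?L & ?U' = ?U -->
    g (K_tensor S C T \<alpha> \<beta>) = (-1) ^ card ?U \<odot>\<^bsub>?MR\<^esub> K_tensor S C R \<alpha> (det_wedge ?L b \<beta>)))" for g
 \<comment> \<open>\<open>det\<close> keeps from the two cases only that \<open>P\<close> prescribes
   the value at a pure tensor, so that uniqueness can be argued once for both kinds of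
   \<open>w\<close>.\<close>
 have Ph: "P h" and det: "EX v. ALL g. P g --> g (K_tensor S C T \<alpha> \<beta>) = v" if "\<alpha> \<in> ?D ?U" "\<beta> \<in> ?D ?L" for \<alpha> \<beta>
 proof -
  have "P h & (EX v. ALL g. P g --> g (K_tensor S C T \<alpha> \<beta>) = v)"
  proof (cases w)
   case (Inl a)
   then have e: "?U' = insert a ?U" "?L' = ?L" "a \<notin> ?U" using ul w unfolding boundary_def by auto
   have s: "esign erank w (boundary S C T) = (esign vrank a ?U :: 'k)" unfolding Inl boundary_def by (rule esign_erank)
   have uniq: "a' = a" if "a' \<notin> ?U" "?U' = insert a' ?U" for a' using that e by blast
   have "h (K_tensor S C T \<alpha> \<beta>) = K_tensor S C R (det_wedge ?U a \<alpha>) \<beta>" if ab: "\<alpha> \<in> ?D ?U" "\<beta> \<in> ?D ?L" for \<alpha> \<beta>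
   proof -
    have b: "\<beta> \<in> ?D ?L'" and c: "det_wedge ?U a \<alpha> \<in> ?D ?U'" using ab(2) det_wedge(1)[OF e(3) ab(1)] unfolding e by simp_all
    show ?thesis
     by (rule coordinateD(5)[OF Rc(1) lin_homD(1)[OF h K_tensor_carrier[OF ab]] K_tensor_carrier[OF c b]])
      (simp add: hl[OF K_tensor_carrier[OF ab]] T(2)[OF ab] Rc(2)[OF c b] s, simp add: e det_wedge(2)[OF e(3) ab(1)])
   qed
   then have "P h" unfolding P_def using uniq e by blast
   moreover have "ALL g. P g --> g (K_tensor S C T \<alpha> \<beta>) = K_tensor S C R (det_wedge ?U a \<alpha>) \<beta>"
    unfolding P_def using that e by blast
   ultimately show ?thesis by blast
  next
   case (Inr b)
   then have e: "?L' = insert b ?L" "?U' = ?U" "b \<notin> ?L" using ul w unfolding boundary_def by auto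
   have s: "esign erank w (boundary S C T) = ((-1) ^ card ?U * esign vrank b ?L :: 'k)" unfolding Inr boundary_def by (rule esign_erank)
   have uniq: "b' = b" if "b' \<notin> ?L" "?L' = insert b' ?L" for b' using that e by blast
   have "h (K_tensor S C T \<alpha> \<beta>) = (-1) ^ card ?U \<odot>\<^bsub>?MR\<^esub> K_tensor S C R \<alpha> (det_wedge ?L b \<beta>)" if ab: "\<alpha> \<in> ?D ?U" "\<beta> \<in> ?D ?L" for \<alpha> \<beta>
   proof -
    have a: "\<alpha> \<in> ?D ?U'" and c: "det_wedge ?L b \<beta> \<in> ?D ?L'" using ab(1) det_wedge(1)[OF e(3) ab(2)] unfolding e by simp_all
    note k = K_tensor_carrier[OF a c]
    show ?thesis
     by (rule coordinateD(5)[OF Rc(1) lin_homD(1)[OF h K_tensor_carrier[OF ab]]])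
      (simp_all add: MR.smult_closed k hl[OF K_tensor_carrier[OF ab]] T(2)[OF ab] Rc(2)[OF a c] s coordinateD(4)[OF Rc(1) _ k]
       , simp add: e det_wedge(2)[OF e(3) ab(2)])
   qed
   then have "P h" unfolding P_def using uniq e by blast
   moreover have "ALL g. P g --> g (K_tensor S C T \<alpha> \<beta>) = (-1) ^ card ?U \<odot>\<^bsub>?MR\<^esub> K_tensor S C R \<alpha> (det_wedge ?L b \<beta>)"
    unfolding P_def using that e by blast
   ultimately show ?thesis by blast
  qed
  then show "P h" "EX v. ALL g. P g --> g (K_tensor S C T \<alpha> \<beta>) = v" by blast+
 qed
 obtain \<alpha> \<beta> where ab: "\<alpha> \<in> ?D ?U" "det_coord ?U \<alpha> = 1" "\<beta> \<in> ?D ?L" "det_coord ?L \<beta> = 1"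
  using coordinateD(6,7)[OF det_coord(1)[of ?U, where 'k = 'k]] coordinateD(6,7)[OF det_coord(1)[of ?L, where 'k = 'k]] by blast
 have "K_component S C T R = h"
  unfolding K_component_def P_def[symmetric]
 proof (rule the_equality)
  fix g assume g: "g \<in> lin_hom kk ?MT ?MR & P g"
  show "g = h"
  proof (rule coordinate_lin_hom_eq[OF T(1) conjunct1[OF g] h K_tensor_carrier[OF ab(1,3)]])
   show "K_coord S C T (K_tensor S C T \<alpha> \<beta>) = (1 :: 'k)" using T(2)[OF ab(1,3)] ab by simp
   show "g (K_tensor S C T \<alpha> \<beta>) = h (K_tensor S C T \<alpha> \<beta>)" using det[OF ab(1,3)] g Ph[OF ab(1,3)] by metis
  qed
 qed (use h Ph[OF ab(1,3)] in blast)
 then show "K_component S C T R \<in> lin_hom kk ?MT ?MR"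
  "x \<in> carrier ?MT ==> K_coord S C R (K_component S C T R x) = esign erank w (boundary S C T) * K_coord S C T x"
  using h hl by simp_all
qed

lemma coordinate_finsum:
 assumes l: "coordinate R \<chi> M l" and "finite I" "!!i. i \<in> I ==> g i \<in> carrier M"
 shows "l (\<Oplus>\<^bsub>M\<^esub>i\<in>I. g i) = (\<Sum>i\<in>I. l (g i))"
 using assms(2,3)
proof (induction I)
 note D = coordinateD[OF l]
 interpret M: left_module R M by (rule D)
 case empty then show ?case by (simp add: D(8))
next
 note D = coordinateD[OF l]
 interpret M: left_module R M by (rule D)
 case (insert i I)
 have c: "g \<in> I \<rightarrow> carrier M" "g i \<in> carrier M" using insert.prems by auto
 show ?case using insert M.M.finsum_insert[OF insert.hyps c] D(3)[OF c(2) M.M.finsum_closed[OF c(1)]] by simp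
qed

text \<open>That \<open>A\<close> is a complex is a consequence rather than an assumption: linearity
  of its differential and the vanishing of its square are pulled back from \<open>B\<close> along
  the degreewise bijections. In this way no sign computation is made in \<open>K_complex\<close>
  itself.\<close>

lemma qiso_transport:
 assumes B: "cochain_complex B" and lm: "!!p. left_module kk (obj A p)"
  and \<kappa>: "!!p. \<kappa> p \<in> lin_hom kk (obj A p) (obj B p)" and bij: "!!p. bij_betw (\<kappa> p) (carrier (obj A p)) (carrier (obj B p))"
  and d: "!!p x. x \<in> carrier (obj A p) ==> diff A p x \<in> carrier (obj A (p + 1))"
  and ext: "!!p x. x \<notin> carrier (obj A p) ==> diff A p x = undefined"
  and comm: "!!p x. x \<in> carrier (obj A p) ==> \<kappa> (p + 1) (diff A p x) = diff B p (\<kappa> p x)"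
 shows "qiso A B \<kappa>"
proof -
 note Bd = cochain_complexD[OF B]
 have inj: "x = y" if "\<kappa> p x = \<kappa> p y" "x \<in> carrier (obj A p)" "y \<in> carrier (obj A p)" for p x y
  using bij[of p] that unfolding bij_betw_def inj_on_def by blast
 have dm: "diff A p \<in> lin_hom kk (obj A p) (obj A (p + 1))" for p
 proof (rule lin_homI[OF d ext])
  interpret A: left_module kk "obj A p" by (rule lm)
  interpret A': left_module kk "obj A (p + 1)" by (rule lm)
  fix x assume x: "x \<in> carrier (obj A p)"
  note kx = lin_homD(1)[OF \<kappa> x]
  {
   fix y assume y: "y \<in> carrier (obj A p)"
   note ky = lin_homD(1)[OF \<kappa> y]
   show "diff A p (x \<oplus>\<^bsub>obj A p\<^esub> y) = diff A p x \<oplus>\<^bsub>obj A (p + 1)\<^esub> diff A p y"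
    by (rule inj[OF _ d[OF A.M.a_closed[OF x y]] A'.M.a_closed[OF d[OF x] d[OF y]]])
     (simp only: comm x y A.M.a_closed lin_homD(3)[OF \<kappa> x y] lin_homD(3)[OF Bd(2) kx ky] lin_homD(3)[OF \<kappa> d[OF x] d[OF y]])
  }
  fix r assume r: "r \<in> carrier (kk :: 'a ring)"
  show "diff A p (r \<odot>\<^bsub>obj A p\<^esub> x) = r \<odot>\<^bsub>obj A (p + 1)\<^esub> diff A p x"
   by (rule inj[OF _ d[OF A.smult_closed[OF r x]] A'.smult_closed[OF r d[OF x]]])
    (simp only: comm x A.smult_closed[OF r x] lin_homD(4)[OF \<kappa> r x] lin_homD(4)[OF Bd(2) r kx] lin_homD(4)[OF \<kappa> r d[OF x]])
 qed
 have "diff A (p + 1) (diff A p x) = \<zero>\<^bsub>obj A (p + 1 + 1)\<^esub>" if x: "x \<in> carrier (obj A p)" for p x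
 proof (rule inj[OF _ d[OF d[OF x]]])
  interpret A: left_module kk "obj A (p + 1 + 1)" by (rule lm)
  show "\<zero>\<^bsub>obj A (p + 1 + 1)\<^esub> \<in> carrier (obj A (p + 1 + 1))" by (rule A.M.zero_closed)
  have "diff B (p + 1) (diff B p (\<kappa> p x)) = \<zero>\<^bsub>obj B (p + 1 + 1)\<^esub>"
   using B lin_homD(1)[OF \<kappa> x] unfolding cochain_complex_def by blast
  then show "\<kappa> (p + 1 + 1) (diff A (p + 1) (diff A p x)) = \<kappa> (p + 1 + 1) \<zero>\<^bsub>obj A (p + 1 + 1)\<^esub>"
   unfolding comm[OF d[OF x]] comm[OF x] lin_hom_zero[OF \<kappa> lm Bd(1)] .
 qed
 then have "cochain_complex A" unfolding cochain_complex_def using lm dm by blast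
 then show ?thesis by (rule qisoI_bij[OF _ B _ bij]) (use \<kappa> comm in \<open>simp add: chain_map_def\<close>)
qed

text \<open>Reading every determinant line in its coordinate turns a cochain of \<open>K\<close>
  into a function on \<open>psi S C\<close>. By \<open>covers_in_W_set\<close>, the terms of the
  differential at \<open>R\<close> correspond to deleting one element from the boundary of
  \<open>R\<close>, with the sign given by \<open>K_component\<close>.\<close>

lemma qiso_K_psi:
 fixes S C :: "'p::{finite,order} set"
 assumes S: "S \<in> intervals" and C: "C \<in> intervals"
  and B: "cochain_complex (cube_cochain erank (psi S C) :: ('k::field, ('p + 'p) set => 'k) cochain)"
 shows "EX f. qiso (K_complex S C :: ('k, 'p set => ('p, 'k) Kterm) cochain)
  (cube_cochain erank (psi S C) :: ('k, ('p + 'p) set => 'k) cochain) f"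
proof -
 let ?K = "K_complex S C :: ('k, 'p set => ('p, 'k) Kterm) cochain"
 let ?B = "cube_cochain erank (psi S C) :: ('k, ('p + 'p) set => 'k) cochain"
 let ?M = "K_summand S C :: 'p set => ('k, ('p, 'k) Kterm) module"
 let ?l = "K_coord S C :: 'p set => ('p, 'k) Kterm => 'k"
 let ?b = "boundary S C" and ?h = "%F. span_hull S C (lefts F) (rights F)"
 note bb = boundary_bij[OF S C]
 note l = K_coord(1)[where S = S and C = C and 'k = 'k]
 note lD = coordinateD[OF l]
 have obj: "obj ?K p = direct_sum (K_index S C p) ?M" for p unfolding K_complex_def K_obj_def by simp
 have D: "\<xi> \<in> carrier (obj ?K p) \<longleftrightarrow> \<xi> \<in> (\<Pi>\<^sub>E T\<in>K_index S C p. carrier (?M T))"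
  "\<xi> \<oplus>\<^bsub>obj ?K p\<^esub> \<eta> = (\<lambda>T\<in>K_index S C p. \<xi> T \<oplus>\<^bsub>?M T\<^esub> \<eta> T)"
  "r \<odot>\<^bsub>obj ?K p\<^esub> \<xi> = (\<lambda>T\<in>K_index S C p. r \<odot>\<^bsub>?M T\<^esub> \<xi> T)" for p \<xi> \<eta> r
  unfolding obj direct_sum_def by simp_all
 have at: "\<xi> T \<in> carrier (?M T)" if "\<xi> \<in> carrier (obj ?K p)" "T \<in> K_index S C p" for \<xi> p T using that unfolding D by auto
 have hK: "?h F \<in> K_index S C p" if "F \<in> psi S C" "int (card F) = p" for F p
  using bb(2)[OF that(1)] bb(3)[OF that(1)] that(2) card_boundary[of S C "?h F"] unfolding K_index_def by simp
 have Kb: "?b T \<in> psi S C" "int (card (?b T)) = p" "?h (?b T) = T" "T \<in> W_set S C" if "T \<in> K_index S C p" for T p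
  using bb(4,5)[of T] that card_boundary[of S C T] unfolding K_index_def by simp_all
 define I where "I p R = {T \<in> K_index S C p. covers_in (W_set S C) T R}" for p R
 have fin: "finite (I p R)" for p R by simp
 have cov: "EX w. w \<notin> ?b T & ?b R = insert w (?b T)" if "T \<in> I p R" for T p R
 proof -
  have c: "covers_in (W_set S C) T R" "T \<in> W_set S C" "R \<in> W_set S C" using that unfolding I_def covers_in_def by auto
  show ?thesis using covers_in_W_set[OF S C c(2,3)] c(1) by blast
 qed
 have comp: "K_component S C T R (\<xi> T) \<in> carrier (?M R)" if "\<xi> \<in> carrier (obj ?K p)" "T \<in> I p R" for \<xi> p T R
  using cov[OF that(2)] lin_homD(1)[OF K_component(1) at[OF that(1)]] that(2) unfolding I_def by blast
 have diff: "diff ?K p \<xi> = (\<lambda>R\<in>K_index S C (p + 1). \<Oplus>\<^bsub>?M R\<^esub>T\<in>I p R. K_component S C T R (\<xi> T))"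
  if "\<xi> \<in> carrier (obj ?K p)" for p \<xi>
  using that unfolding obj unfolding K_complex_def K_obj_def I_def by simp
 have ext: "diff ?K p \<xi> = undefined" if "\<xi> \<notin> carrier (obj ?K p)" for p \<xi>
  using that unfolding obj unfolding K_complex_def K_obj_def by simp
 have lm: "left_module kk (obj ?K p)" for p unfolding obj by (rule left_module_direct_sum[OF ring_kk lD(1)])
 define \<kappa> where "\<kappa> p = (\<lambda>\<xi>\<in>carrier (obj ?K p). %F. if F \<in> psi S C & int (card F) = p then ?l (?h F) (\<xi> (?h F)) else 0)" for p
 have \<kappa>_at: "\<kappa> p \<xi> F = (if F \<in> psi S C & int (card F) = p then ?l (?h F) (\<xi> (?h F)) else 0)"
  if "\<xi> \<in> carrier (obj ?K p)" for p \<xi> F using that unfolding \<kappa>_def by simp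
 have \<kappa>_boundary: "\<kappa> p \<xi> (?b T) = ?l T (\<xi> T)" if "\<xi> \<in> carrier (obj ?K p)" "T \<in> K_index S C p" for p \<xi> T
  unfolding \<kappa>_at[OF that(1)] using Kb[OF that(2)] by simp
 have \<kappa>m: "\<kappa> p \<in> lin_hom kk (obj ?K p) (obj ?B p)" for p
 proof (rule lin_homI)
  interpret K: left_module kk "obj ?K p" by (rule lm)
  fix \<xi> assume \<xi>: "\<xi> \<in> carrier (obj ?K p)"
  show "\<kappa> p \<xi> \<in> carrier (obj ?B p)" unfolding obj_cube_cochain \<kappa>_at[OF \<xi>] by simp
  {
   fix \<eta> assume \<eta>: "\<eta> \<in> carrier (obj ?K p)"
   have "?l (?h F) ((\<xi> \<oplus>\<^bsub>obj ?K p\<^esub> \<eta>) (?h F)) = ?l (?h F) (\<xi> (?h F)) + ?l (?h F) (\<eta> (?h F))" if F: "F \<in> psi S C" "int (card F) = p" for F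
    unfolding D using hK[OF F] lD(3)[OF at[OF \<xi> hK[OF F]] at[OF \<eta> hK[OF F]]] by simp
   then show "\<kappa> p (\<xi> \<oplus>\<^bsub>obj ?K p\<^esub> \<eta>) = \<kappa> p \<xi> \<oplus>\<^bsub>obj ?B p\<^esub> \<kappa> p \<eta>"
    unfolding obj_cube_cochain by (intro HOL.ext) (simp add: \<kappa>_at[OF \<xi>] \<kappa>_at[OF \<eta>] \<kappa>_at[OF K.M.a_closed[OF \<xi> \<eta>]])
  }
  fix r assume r: "r \<in> carrier (kk :: 'k ring)"
  have "?l (?h F) ((r \<odot>\<^bsub>obj ?K p\<^esub> \<xi>) (?h F)) = r * ?l (?h F) (\<xi> (?h F))" if F: "F \<in> psi S C" "int (card F) = p" for F
   unfolding D using hK[OF F] lD(4)[OF r at[OF \<xi> hK[OF F]]] by simp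
  then show "\<kappa> p (r \<odot>\<^bsub>obj ?K p\<^esub> \<xi>) = r \<odot>\<^bsub>obj ?B p\<^esub> \<kappa> p \<xi>"
   unfolding obj_cube_cochain by (intro HOL.ext) (simp add: \<kappa>_at[OF \<xi>] \<kappa>_at[OF K.smult_closed[OF r \<xi>]])
 qed (simp add: \<kappa>_def)
 have "qiso ?K ?B \<kappa>"
 proof (rule qiso_transport[OF B lm \<kappa>m _ _ ext])
  fix p
  show "bij_betw (\<kappa> p) (carrier (obj ?K p)) (carrier (obj ?B p))"
   unfolding bij_betw_def
  proof
   show "inj_on (\<kappa> p) (carrier (obj ?K p))"
   proof (rule inj_onI)
    fix \<xi> \<eta> assume \<xi>: "\<xi> \<in> carrier (obj ?K p)" and \<eta>: "\<eta> \<in> carrier (obj ?K p)" and eq: "\<kappa> p \<xi> = \<kappa> p \<eta>"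
    have "\<xi> T = \<eta> T" if T: "T \<in> K_index S C p" for T
     by (rule lD(5)[OF at[OF \<xi> T] at[OF \<eta> T]]) (use \<kappa>_boundary[OF \<xi> T] \<kappa>_boundary[OF \<eta> T] eq in simp)
    then show "\<xi> = \<eta>" using \<xi> \<eta> unfolding D by (intro PiE_ext)
   qed
   show "\<kappa> p ` carrier (obj ?K p) = carrier (obj ?B p)"
   proof
    show "\<kappa> p ` carrier (obj ?K p) \<subseteq> carrier (obj ?B p)" using lin_homD(1)[OF \<kappa>m] by blast
    show "carrier (obj ?B p) \<subseteq> \<kappa> p ` carrier (obj ?K p)"
    proof
     fix x assume x: "x \<in> carrier (obj ?B p)"
     define \<xi> where "\<xi> = (\<lambda>T\<in>K_index S C p. inv_into (carrier (?M T)) (?l T) (x (?b T)))"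
     have \<xi>: "\<xi> \<in> carrier (obj ?K p)" unfolding D \<xi>_def using lD(6) by auto
     have "\<kappa> p \<xi> F = x F" for F
     proof (cases "F \<in> psi S C & int (card F) = p")
      case True
      then show ?thesis unfolding \<kappa>_at[OF \<xi>] using hK[of F p] lD(7) bb(3)[of F] by (simp add: \<xi>_def)
     next
      case False
      then show ?thesis unfolding \<kappa>_at[OF \<xi>] using x unfolding obj_cube_cochain by auto
     qed
     then show "x \<in> \<kappa> p ` carrier (obj ?K p)" using \<xi> by (intro image_eqI[of _ _ \<xi>]) auto
    qed
   qed
  qed
  fix \<xi> assume \<xi>: "\<xi> \<in> carrier (obj ?K p)"
  have fc: "(\<Oplus>\<^bsub>?M R\<^esub>T\<in>I p R. K_component S C T R (\<xi> T)) \<in> carrier (?M R)" for R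
  proof -
   interpret M: left_module kk "?M R" by (rule lD(1))
   show ?thesis by (rule M.M.finsum_closed) (use comp[OF \<xi>] in blast)
  qed
  then show d: "diff ?K p \<xi> \<in> carrier (obj ?K (p + 1))" unfolding diff[OF \<xi>] D by simp
  note \<kappa>\<xi> = lin_homD(1)[OF \<kappa>m \<xi>]
  show "\<kappa> (p + 1) (diff ?K p \<xi>) = diff ?B p (\<kappa> p \<xi>)"
  proof
   fix F
   show "\<kappa> (p + 1) (diff ?K p \<xi>) F = diff ?B p (\<kappa> p \<xi>) F"
   proof (cases "F \<in> psi S C & int (card F) = p + 1")
    case False
    then have "diff ?B p (\<kappa> p \<xi>) F = 0"
     using lin_homD(1)[OF cochain_complexD(2)[OF B] \<kappa>\<xi>] unfolding obj_cube_cochain by blast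
    then show ?thesis unfolding \<kappa>_at[OF d] if_not_P[OF False] by (rule sym)
   next
    case True
    then have F: "F \<in> psi S C" "int (card F) = p + 1" by auto
    let ?R = "?h F" and ?J = "{w \<in> F. F - {w} \<in> psi S C}"
    have bR: "?b ?R = F" by (rule bb(3)[OF F(1)])
    have cF: "int (card (F - {w})) = p" if "w \<in> F" for w using F(2) card_Suc_Diff1[OF finite[of F] that] by linarith
    \<comment> \<open>The intervals covered by \<open>?R\<close> are those whose boundary is
      \<open>F\<close> with one element removed, as far as the result is still in
      \<open>psi\<close>; distinct elements give distinct intervals.\<close>
    have im: "I p ?R = (%w. ?h (F - {w})) ` ?J"
    proof
     show "I p ?R \<subseteq> (%w. ?h (F - {w})) ` ?J"
     proof
      fix T assume T: "T \<in> I p ?R"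
      then obtain w where w: "w \<notin> ?b T" "F = insert w (?b T)" using cov[OF T] unfolding bR by blast
      have e: "F - {w} = ?b T" using w by blast
      have "T \<in> K_index S C p" using T unfolding I_def by blast
      from Kb[OF this] show "T \<in> (%w. ?h (F - {w})) ` ?J"
       by (intro image_eqI[of _ _ w]) (use w e in auto)
     qed
     show "(%w. ?h (F - {w})) ` ?J \<subseteq> I p ?R"
     proof (rule image_subsetI)
      fix w assume w: "w \<in> ?J"
      then have "?h (F - {w}) \<in> K_index S C p" using hK cF by blast
      moreover have p: "F - {w} \<in> psi S C" using w by blast
      have "covers_in (W_set S C) (?h (F - {w})) ?R"
       unfolding covers_in_W_set[OF S C bb(2)[OF p] bb(2)[OF F(1)]] bR bb(3)[OF p]
       by (rule exI[of _ w]) (use w in blast)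
      ultimately show "?h (F - {w}) \<in> I p ?R" unfolding I_def by blast
     qed
    qed
    have inj: "inj_on (%w. ?h (F - {w})) ?J"
    proof (rule inj_onI)
     fix v w assume v: "v \<in> ?J" and w: "w \<in> ?J" and e: "?h (F - {v}) = ?h (F - {w})"
     have "F - {v} = ?b (?h (F - {v}))" by (rule bb(3)[symmetric]) (use v in blast)
     also have "\<dots> = F - {w}" unfolding e by (rule bb(3)) (use w in blast)
     finally have "F - {v} = F - {w}" .
     then show "v = w" using v w by blast
    qed
    have "\<kappa> (p + 1) (diff ?K p \<xi>) F = ?l ?R (\<Oplus>\<^bsub>?M ?R\<^esub>T\<in>I p ?R. K_component S C T ?R (\<xi> T))"
     unfolding \<kappa>_at[OF d] unfolding diff[OF \<xi>] using True hK[OF F] by simp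
    also have "\<dots> = (\<Sum>T\<in>I p ?R. ?l ?R (K_component S C T ?R (\<xi> T)))"
     by (rule coordinate_finsum[OF l fin comp[OF \<xi>]])
    also have "\<dots> = (\<Sum>w\<in>?J. esign erank w (F - {w}) * \<kappa> p \<xi> (F - {w}))"
    proof (rule sum.reindex_cong[OF inj im])
     fix w assume w: "w \<in> ?J"
     then have p: "F - {w} \<in> psi S C" and wF: "w \<in> F" by auto
     let ?T = "?h (F - {w})"
     have b: "?b ?T = F - {w}" by (rule bb(3)[OF p])
     have c: "w \<notin> ?b ?T" "?b ?R = insert w (?b ?T)" unfolding b bR using wF by auto
     show "?l ?R (K_component S C ?T ?R (\<xi> ?T)) = esign erank w (F - {w}) * \<kappa> p \<xi> (F - {w})"
      using K_component(2)[OF c at[OF \<xi> hK[OF p cF[OF wF]]]] p cF[OF wF] unfolding b \<kappa>_at[OF \<xi>] by simp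
    qed
    \<comment> \<open>The elements \<open>w\<close> for which \<open>F - {w}\<close> is outside
      \<open>psi\<close> may be added to the sum, because \<open>\<kappa> p \<xi>\<close> is zero
      there.\<close>
    also have "\<dots> = cdiff erank (\<kappa> p \<xi>) F"
     unfolding cdiff_def by (rule sum.mono_neutral_left) (auto simp: \<kappa>_at[OF \<xi>])
    finally show ?thesis unfolding diff_cube_cochain(1)[OF \<kappa>\<xi>] using F(1) by simp
   qed
  qed
 qed
 then show ?thesis by blast
qed

theorem proposition6p2:
  fixes S C :: "'p::{finite,order} set"
  assumes "poset_connected (UNIV :: 'p set)"
    and "S \<in> intervals" and "C \<in> intervals"
  shows "derived_iso
           (K_complex S C :: ('k::field, 'p set \<Rightarrow> ('p, 'k) Kterm) cochain)
           (RHom Lambda_scalar Lambda (simple_L S) (simple_L C))"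
proof -
 note S = assms(2) and C = assms(3)
 obtain l :: "('p, 'k) lam set => 'k" where l: "coordinate Lambda (char_at S) (simple_L S) l"
  using simple_L_coordinate[OF S] by blast
 obtain l' :: "('p, 'k) lam set => 'k" where l': "coordinate Lambda (char_at C) (simple_L C) l'"
  using simple_L_coordinate[OF C] by blast
 obtain f2 where f2: "qiso (cube_cochain erank (psi S C) :: ('k, ('p + 'p) set => 'k) cochain)
   (cube_cochain erank (phi S C) :: ('k, ('p + 'p) set => 'k) cochain) f2"
  using qiso_psi_phi[OF intervalsD(3)[OF S]] by blast
 \<comment> \<open>A \<open>qiso\<close> contains the fact that both of its sides are complexes;
   \<open>f2\<close> thus supplies what the comparisons with the cube complexes of
   \<open>psi\<close> and \<open>phi\<close> require.\<close>
 then obtain f1 where f1: "qiso (K_complex S C :: ('k, 'p set => ('p, 'k) Kterm) cochain)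
   (cube_cochain erank (psi S C) :: ('k, ('p + 'p) set => 'k) cochain) f1"
  using qiso_K_psi[OF S C] unfolding qiso_def by blast
 obtain f3 where f3: "qiso (cube_cochain erank (phi S C) :: ('k, ('p + 'p) set => 'k) cochain)
   (hom_cochain Lambda_scalar Lambda (cres S l) (simple_L C)) f3"
  using qiso_phi_hom[OF S C l l'] f2 unfolding qiso_def by blast
 obtain f4 where f4: "qiso (hom_cochain Lambda_scalar Lambda (cres S l) (simple_L C))
   (RHom Lambda_scalar Lambda (simple_L S) (simple_L C)) f4"
  using qiso_RHom[OF central_Lambda_scalar coordinateD(1)[OF l] coordinateD(1)[OF l'] projective_resolution_cres[OF S l]] by blast
 show ?thesis by (rule derived_iso_qiso[OF qiso_compose[OF qiso_compose[OF qiso_compose[OF f1 f2] f3] f4]])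
qed

end
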